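(* Let $\pi$ be an atomic $*$-representation of $\mathbb{F}_\theta^+$ with connected graph. Then: (i) $\pi$ is (unitarily equivalent to) the minimal $*$-dilation of a group construction representation of $\mathbb{F}_\theta^+$ on $\ell^2(G)$ for some abelian group $G$ with two designated generators. (ii) $\pi$ is irreducible if and only if its symmetry group $H_\pi$ is trivial. (iii) In general, $\pi$ decomposes as a direct sum or a direct integral of (minimal $*$-dilations of) irreducible group construction representations.
   Context: Semigroup. Fix integers $m,n\ge 1$ and a permutation $\theta$ of $\{1,\dots,m\}\times\{1,\dots,n\}$. $\mathbb{F}_\theta^+$ is the unital semigroup generated by $e_1,\dots,e_m,f_1,\dots,f_n$ subject only to the relations $e_if_j=f_{j'}e_{i'}$ whenever $\theta(i,j)=(i',j')$ (so the $e_i$ generate a free semigroup, and so do the $f_j$). For a word $u=i_k\cdots i_1$ put $e_u=e_{i_k}\cdots e_{i_1}$ and $|u|=k$; similarly $f_v$. Each $w\in\mathbb{F}_\theta^+$ factors uniquely as $w=e_uf_v$ and uniquely as $w=f_{v'}e_{u'}$; its degree is $d(w)=(|u|,|v|)$. Representations. A partially isometric representation is a unital semigroup homomorphism $\sigma:\mathbb{F}_\theta^+\to B(\mathcal H)$ whose values are partial isometries; it is isometric if the values are isometries. It is atomic if there is an orthonormal basis $\{\xi_k\}$ such that for every $w$ and $k$, $\sigma(w)\xi_k=\alpha\xi_l$ for some $l$ and some $\alpha\in\mathbb{T}\cup\{0\}$. It is defect free if $\sum_i\sigma(e_i)\sigma(e_i)^*=I=\sum_j\sigma(f_j)\sigma(f_j)^*$.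 A $*$-representation is an isometric defect free representation. Irreducible means no nontrivial reducing subspaces for $\sigma(\mathbb{F}_\theta^+)$. The graph of an atomic representation has vertices $\dot\xi_k=\mathbb{C}\xi_k$, a blue edge labelled $i$ from $\dot\xi_k$ to $\dot\xi_l$ if $\sigma(e_i)\dot\xi_k=\dot\xi_l$, and a red edge labelled $j$ if $\sigma(f_j)\dot\xi_k=\dot\xi_l$; connected means connected as an undirected graph. In the defect free case each vertex has exactly one incoming blue edge and one incoming red edge. Dilations. A dilation of $\sigma$ (on $\mathcal H$) is a representation $\pi$ on $\mathcal K\supset\mathcal H$ with $\sigma(w)=P_{\mathcal H}\pi(w)|_{\mathcal H}$ for all $w$. Every defect free $\sigma$ has a minimal isometric dilation (one with $\mathcal K=\bigvee_w\pi(w)\mathcal H$), unique up to a unitary fixing $\mathcal H$; it is a $*$-representation, called the minimal $*$-dilation. Group construction representations. Let $G$ be an abelian group with two designated generators $\mathfrak g_1,\mathfrak g_2$, and let $i:G\to\{1,\dots,m\}$, $j:G\to\{1,\dots,n\}$, $\alpha,\beta:G\to\mathbb{T}$ (written $i_g,j_g,\alpha_g,\beta_g$) satisfy $e_{i_{g+\mathfrak g_2}}f_{j_g}=f_{j_{g+\mathfrak g_1}}e_{i_g}$ and $\alpha_{g+\mathfrak g_2}\beta_g=\beta_{g+\mathfrak g_1}\alpha_g$ for all $g$. The group construction representation on $\ell^2(G)$ (standard basis $\{\xi_g\}$) is $\sigma(e_i)\xi_g=\delta_{i,i_g}\alpha_g\xi_{g+\mathfrak g_1}$, $\sigma(f_j)\xi_g=\delta_{j,j_g}\beta_g\xi_{g+\mathfrak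 g_2}$. It is defect free and atomic. Symmetry group of an atomic $*$-representation $\pi$ with connected graph. Fix a vertex $\dot\xi$. For $s,t\le 0$ let $\dot\xi_{s,t}$ be the unique vertex from which some word of degree $(|s|,|t|)$ leads to $\dot\xi$, and let $i_{s,t}$ (resp. $j_{s,t}$) be the label of the unique blue (resp. red) edge into $\dot\xi_{s,t}$. Let $K_\pi$ be the subgroup of those $(p,q)\in\mathbb{Z}^2$ for which there is $T$ with $\dot\xi_{s+p,t+q}=\dot\xi_{s,t}$ for all $s,t\le T$, and let $L_\pi\supseteq K_\pi$ be the subgroup of those $(p,q)$ for which there is $T$ with $(i_{s+p,t+q},j_{s+p,t+q})=(i_{s,t},j_{s,t})$ for all $s,t\le T$. The symmetry group is $H_\pi=L_\pi/K_\pi\le G_\pi=\mathbb{Z}^2/K_\pi$; it does not depend on the chosen vertex. *)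

theory Defs
  imports "HOL-Analysis.Analysis" "HOL-Algebra.Elementary_Groups"
begin

section \<open>Complex Hilbert spaces\<close>

text \<open>The inner product is conjugate linear in its first argument.\<close>

class chilbert_space = banach +
  fixes scaleC :: "complex \<Rightarrow> 'a \<Rightarrow> 'a" (infixr "*\<^sub>C" 75)
    and cinner :: "'a \<Rightarrow> 'a \<Rightarrow> complex"
  assumes scaleC_add_right: "c *\<^sub>C (x + y) = c *\<^sub>C x + c *\<^sub>C y"
    and scaleC_add_left: "(c + d) *\<^sub>C x = c *\<^sub>C x + d *\<^sub>C x"
    and scaleC_scaleC: "c *\<^sub>C (d *\<^sub>C x) = (c * d) *\<^sub>C x"
    and scaleR_scaleC: "scaleR r x = complex_of_real r *\<^sub>C x"
    and cinner_commute: "cinner x y = cnj (cinner y x)"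
    and cinner_add_right: "cinner x (y + z) = cinner x y + cinner x z"
    and cinner_scaleC_right: "cinner x (c *\<^sub>C y) = c * cinner x y"
    and cinner_self: "cinner x x = complex_of_real ((norm x)\<^sup>2)"

lemma scaleC_one: "1 *\<^sub>C x = x" for x :: "'a::chilbert_space"
  using scaleR_scaleC[of 1 x] by simp

global_interpretation complex_vector:
  vector_space "scaleC :: complex \<Rightarrow> 'a \<Rightarrow> 'a::chilbert_space"
  by unfold_locales
    (simp_all add: scaleC_add_right scaleC_add_left scaleC_scaleC scaleC_one)

section \<open>The Hilbert space of square summable families\<close>

definition square_summable :: "('a \<Rightarrow> complex) \<Rightarrow> bool" where
  "square_summable f \<longleftrightarrow> (\<lambda>x. (cmod (f x))\<^sup>2) summable_on UNIV"

typedef 'a ell2 = "{f :: 'a \<Rightarrow> complex. square_summable f}"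
  morphisms ell2_fun Abs_ell2
  by (rule exI[of _ "\<lambda>_. 0"]) (simp add: square_summable_def)

definition ell2_norm :: "('a \<Rightarrow> complex) \<Rightarrow> real" where
  "ell2_norm f = sqrt (\<Sum>\<^sub>\<infinity>x. (cmod (f x))\<^sup>2)"

lemma square_summable_iff_bounded:
  "square_summable f \<longleftrightarrow> (\<exists>C. \<forall>F. finite F \<longrightarrow> L2_set (\<lambda>x. cmod (f x)) F \<le> C)"
proof
  assume s: "square_summable f"
  show "\<exists>C. \<forall>F. finite F \<longrightarrow> L2_set (\<lambda>x. cmod (f x)) F \<le> C"
    using s unfolding square_summable_def L2_set_def
    by (intro exI[of _ "ell2_norm f"])
      (auto simp: ell2_norm_def intro!: real_sqrt_le_mono finite_sum_le_infsum)
next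
  assume "\<exists>C. \<forall>F. finite F \<longrightarrow> L2_set (\<lambda>x. cmod (f x)) F \<le> C"
  then obtain C where C: "\<And>F. finite F \<Longrightarrow> L2_set (\<lambda>x. cmod (f x)) F \<le> C" by blast
  have "(\<Sum>x\<in>F. (cmod (f x))\<^sup>2) \<le> C\<^sup>2" if "finite F" for F
    using power_mono[OF C[OF that] L2_set_nonneg, of 2]
    by (simp add: L2_set_def sum_nonneg)
  then show "square_summable f"
    unfolding square_summable_def
    by (intro nonneg_bdd_above_summable_on bdd_aboveI[of _ "C\<^sup>2"]) auto
qed

lemma L2_set_le_ell2_norm:
  assumes "square_summable f" "finite F"
  shows "L2_set (\<lambda>x. cmod (f x)) F \<le> ell2_norm f"
  using assms unfolding square_summable_def L2_set_def ell2_norm_def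
  by (auto intro!: real_sqrt_le_mono finite_sum_le_infsum)

lemma ell2_norm_le:
  assumes "\<And>F. finite F \<Longrightarrow> L2_set (\<lambda>x. cmod (f x)) F \<le> C"
  shows "ell2_norm f \<le> C"
proof -
  have C0: "0 \<le> C" using assms[of "{}"] by simp
  have s: "square_summable f" using assms square_summable_iff_bounded by blast
  have "(\<Sum>x\<in>F. (cmod (f x))\<^sup>2) \<le> C\<^sup>2" if "finite F" for F
    using power_mono[OF assms[OF that] L2_set_nonneg, of 2]
    by (simp add: L2_set_def sum_nonneg)
  then have "(\<Sum>\<^sub>\<infinity>x. (cmod (f x))\<^sup>2) \<le> C\<^sup>2"
    using s unfolding square_summable_def by (intro infsum_le_finite_sums) auto
  then show ?thesis unfolding ell2_norm_def using C0 real_le_lsqrt by (simp add: real_sqrt_le_iff real_le_lsqrt infsum_nonneg)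
qed

lemma ell2_norm_add_bound:
  assumes "square_summable f" "square_summable g" "finite F"
  shows "L2_set (\<lambda>x. cmod (f x + g x)) F \<le> ell2_norm f + ell2_norm g"
proof -
  have "L2_set (\<lambda>x. cmod (f x + g x)) F \<le> L2_set (\<lambda>x. cmod (f x) + cmod (g x)) F"
    by (intro L2_set_mono norm_triangle_ineq) auto
  also have "\<dots> \<le> L2_set (\<lambda>x. cmod (f x)) F + L2_set (\<lambda>x. cmod (g x)) F"
    by (rule L2_set_triangle_ineq)
  also have "\<dots> \<le> ell2_norm f + ell2_norm g"
    using assms by (intro add_mono L2_set_le_ell2_norm)
  finally show ?thesis .
qed

lemma square_summable_add:
  "square_summable f \<Longrightarrow> square_summable g \<Longrightarrow> square_summable (\<lambda>x. f x + g x)"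
  using ell2_norm_add_bound square_summable_iff_bounded by blast

lemma square_summable_cmult:
  "square_summable f \<Longrightarrow> square_summable (\<lambda>x. c * f x)"
  unfolding square_summable_def
  by (simp add: norm_mult power_mult_distrib summable_on_cmult_right)

lemma square_summable_diff:
  assumes "square_summable f" "square_summable g"
  shows "square_summable (\<lambda>x. f x - g x)"
  using square_summable_add[OF assms(1) square_summable_cmult[OF assms(2), of "-1"]] by simp

lemma square_summable_zero: "square_summable (\<lambda>_. 0)"
  by (simp add: square_summable_def)

lemma ell2_norm_cmult: "ell2_norm (\<lambda>x. c * f x) = cmod c * ell2_norm f"
  by (simp add: ell2_norm_def norm_mult power_mult_distrib infsum_cmult_right' real_sqrt_mult)

lemma square_summable_ell2_fun: "square_summable (ell2_fun f)"
  using ell2_fun by auto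

lemma ell2_cinner_summable:
  assumes "square_summable f" "square_summable g"
  shows "(\<lambda>x. cnj (f x) * g x) summable_on UNIV"
proof -
  have "(\<lambda>x. (cmod (f x))\<^sup>2 + (cmod (g x))\<^sup>2) summable_on UNIV"
    using assms unfolding square_summable_def by (rule summable_on_add)
  moreover have "cmod (f x) * cmod (g x) \<le> (cmod (f x))\<^sup>2 + (cmod (g x))\<^sup>2" for x
  proof -
    have "0 \<le> cmod (f x) * cmod (g x)" by simp
    with sum_squares_bound[of "cmod (f x)" "cmod (g x)"] show ?thesis by linarith
  qed
  ultimately have "(\<lambda>x. cmod (f x) * cmod (g x)) summable_on UNIV"
    by (rule summable_on_comparison_test) auto
  then have "(\<lambda>x. cmod (cnj (f x) * g x)) summable_on UNIV"
    by (simp add: norm_mult)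
  then show ?thesis by (rule abs_summable_summable)
qed

instantiation ell2 :: (type) real_normed_vector
begin

definition "0 = Abs_ell2 (\<lambda>_. 0)"
definition "f + g = Abs_ell2 (\<lambda>x. ell2_fun f x + ell2_fun g x)"
definition "f - g = Abs_ell2 (\<lambda>x. ell2_fun f x - ell2_fun g x)"
definition "- f = Abs_ell2 (\<lambda>x. - ell2_fun f x)" for f :: "'a ell2"
definition "scaleR r f = Abs_ell2 (\<lambda>x. complex_of_real r * ell2_fun f x)"
definition "norm f = ell2_norm (ell2_fun f)"
definition "dist f g = norm (f - g)" for f :: "'a ell2"
definition "sgn f = scaleR (inverse (norm f)) f" for f :: "'a ell2"
definition [code del]:
  "(uniformity :: ('a ell2 \<times> 'a ell2) filter) = (INF e\<in>{0<..}. principal {(x, y). dist x y < e})"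
definition [code del]:
  "open (U :: 'a ell2 set) \<longleftrightarrow> (\<forall>x\<in>U. eventually (\<lambda>(x', y). x' = x \<longrightarrow> y \<in> U) uniformity)"

lemma ell2_fun_zero: "ell2_fun (0 :: 'a ell2) = (\<lambda>_. 0)"
  unfolding zero_ell2_def by (rule Abs_ell2_inverse) (simp add: square_summable_zero)

lemma ell2_fun_add: "ell2_fun (f + g) = (\<lambda>x. ell2_fun f x + ell2_fun g x)" for f :: "'a ell2"
  unfolding plus_ell2_def
  by (rule Abs_ell2_inverse) (simp add: square_summable_add square_summable_ell2_fun)

lemma ell2_fun_diff: "ell2_fun (f - g) = (\<lambda>x. ell2_fun f x - ell2_fun g x)" for f :: "'a ell2"
  unfolding minus_ell2_def
  by (rule Abs_ell2_inverse) (simp add: square_summable_diff square_summable_ell2_fun)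

lemma ell2_fun_uminus: "ell2_fun (- f) = (\<lambda>x. - ell2_fun f x)" for f :: "'a ell2"
  unfolding uminus_ell2_def
  by (rule Abs_ell2_inverse)
    (use square_summable_cmult[OF square_summable_ell2_fun, of "-1" f] in simp)

lemma ell2_fun_scaleR:
  "ell2_fun (scaleR r f) = (\<lambda>x. complex_of_real r * ell2_fun f x)" for f :: "'a ell2"
  unfolding scaleR_ell2_def
  by (rule Abs_ell2_inverse) (simp add: square_summable_cmult square_summable_ell2_fun)

lemmas ell2_fun_simps =
  ell2_fun_zero ell2_fun_add ell2_fun_diff ell2_fun_uminus ell2_fun_scaleR

lemma ell2_eqI: "(\<And>x. ell2_fun f x = ell2_fun g x) \<Longrightarrow> f = g"
  by (metis ell2_fun_inject ext)

lemma cmod_le_ell2_norm: "cmod (ell2_fun f x) \<le> norm f"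
  using L2_set_le_ell2_norm[OF square_summable_ell2_fun[of f], of "{x}"]
  by (simp add: norm_ell2_def)

instance
proof
  fix a b :: real and x y z :: "'a ell2"
  show "x + y + z = x + (y + z)" "x + y = y + x" "0 + x = x" "- x + x = 0" "x - y = x + - y"
    "a *\<^sub>R (x + y) = a *\<^sub>R x + a *\<^sub>R y" "(a + b) *\<^sub>R x = a *\<^sub>R x + b *\<^sub>R x"
    "a *\<^sub>R b *\<^sub>R x = (a * b) *\<^sub>R x" "1 *\<^sub>R x = x"
    by (rule ell2_eqI; simp add: ell2_fun_simps algebra_simps)+
  show "dist x y = norm (x - y)" by (rule dist_ell2_def)
  show "sgn x = inverse (norm x) *\<^sub>R x" by (rule sgn_ell2_def)
  show "(uniformity :: ('a ell2 \<times> 'a ell2) filter)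
      = (INF e\<in>{0<..}. principal {(x, y). dist x y < e})" by (rule uniformity_ell2_def)
  show "open U \<longleftrightarrow> (\<forall>x\<in>U. eventually (\<lambda>(x', y). x' = x \<longrightarrow> y \<in> U) uniformity)"
    for U :: "'a ell2 set" by (rule open_ell2_def)
  show "norm x = 0 \<longleftrightarrow> x = 0"
  proof
    assume "norm x = 0"
    then have "ell2_fun x i = 0" for i using cmod_le_ell2_norm[of x i] by simp
    then show "x = 0" by (intro ell2_eqI) (simp add: ell2_fun_zero)
  qed (simp add: norm_ell2_def ell2_fun_zero ell2_norm_def)
  show "norm (x + y) \<le> norm x + norm y"
    unfolding norm_ell2_def ell2_fun_add
    by (intro ell2_norm_le ell2_norm_add_bound square_summable_ell2_fun)
  show "norm (a *\<^sub>R x) = \<bar>a\<bar> * norm x"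
    by (simp add: norm_ell2_def ell2_fun_scaleR ell2_norm_cmult)
qed

end

lemma ell2_complete:
  fixes X :: "nat \<Rightarrow> 'a ell2"
  assumes X: "\<And>e. e > 0 \<Longrightarrow> \<exists>N. \<forall>m\<ge>N. \<forall>n\<ge>N. norm (X m - X n) < e"
  shows "\<exists>L. \<forall>e>0. \<exists>N. \<forall>n\<ge>N. norm (X n - L) \<le> e"
proof -
  have "Cauchy (\<lambda>n. ell2_fun (X n) x)" for x
  proof (rule metric_CauchyI)
    fix e :: real assume "e > 0"
    then obtain N where N: "\<forall>m\<ge>N. \<forall>n\<ge>N. norm (X m - X n) < e" using X by blast
    have "dist (ell2_fun (X m) x) (ell2_fun (X n) x) < e" if "m \<ge> N" "n \<ge> N" for m n
      using cmod_le_ell2_norm[of "X m - X n" x] N that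
      by (fastforce simp: dist_norm ell2_fun_diff)
    then show "\<exists>M. \<forall>m\<ge>M. \<forall>n\<ge>M. dist (ell2_fun (X m) x) (ell2_fun (X n) x) < e" by blast
  qed
  then have "\<exists>l. (\<lambda>n. ell2_fun (X n) x) \<longlonglongrightarrow> l" for x
    using Cauchy_convergent convergent_def by blast
  then obtain l where l: "\<And>x. (\<lambda>n. ell2_fun (X n) x) \<longlonglongrightarrow> l x" by metis
  have bound: "L2_set (\<lambda>x. cmod (ell2_fun (X m) x - l x)) F \<le> e"
    if F: "finite F" and N: "\<forall>m\<ge>N. \<forall>n\<ge>N. norm (X m - X n) < e" and m: "m \<ge> N" for F N e m
  proof (rule tendsto_upperbound)
    show "(\<lambda>n. L2_set (\<lambda>x. cmod (ell2_fun (X m) x - ell2_fun (X n) x)) F)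
        \<longlonglongrightarrow> L2_set (\<lambda>x. cmod (ell2_fun (X m) x - l x)) F"
      unfolding L2_set_def by (intro tendsto_intros l)
    show "\<forall>\<^sub>F n in sequentially. L2_set (\<lambda>x. cmod (ell2_fun (X m) x - ell2_fun (X n) x)) F \<le> e"
    proof (rule eventually_sequentiallyI[of N])
      fix n assume "n \<ge> N"
      then have "norm (X m - X n) < e" using N m by blast
      then show "L2_set (\<lambda>x. cmod (ell2_fun (X m) x - ell2_fun (X n) x)) F \<le> e"
        using L2_set_le_ell2_norm[OF square_summable_ell2_fun[of "X m - X n"] F]
        by (simp add: norm_ell2_def ell2_fun_diff)
    qed
  qed simp
  obtain N1 where N1: "\<forall>m\<ge>N1. \<forall>n\<ge>N1. norm (X m - X n) < 1" using X[of 1] by auto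
  have "square_summable (\<lambda>x. ell2_fun (X N1) x - l x)"
    unfolding square_summable_iff_bounded using bound[OF _ N1] by blast
  from square_summable_diff[OF square_summable_ell2_fun[of "X N1"] this]
  have sl: "square_summable l" by simp
  define L where "L = Abs_ell2 l"
  have L: "ell2_fun L = l" unfolding L_def by (rule Abs_ell2_inverse) (simp add: sl)
  have "\<exists>N. \<forall>n\<ge>N. norm (X n - L) \<le> e" if "e > 0" for e
  proof -
    obtain N where N: "\<forall>m\<ge>N. \<forall>n\<ge>N. norm (X m - X n) < e" using X[OF \<open>e > 0\<close>] by blast
    have "norm (X n - L) \<le> e" if "n \<ge> N" for n
      unfolding norm_ell2_def ell2_fun_diff L
      by (rule ell2_norm_le) (rule bound[OF _ N that])
    then show ?thesis by blast
  qed
  then show ?thesis by blast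
qed

instance ell2 :: (type) banach
proof
  fix X :: "nat \<Rightarrow> 'a ell2"
  assume C: "Cauchy X"
  have "\<exists>N. \<forall>m\<ge>N. \<forall>n\<ge>N. norm (X m - X n) < e" if "e > 0" for e
    using C that unfolding Cauchy_def dist_ell2_def by blast
  from ell2_complete[OF this] obtain L where
    L: "\<And>e. e > 0 \<Longrightarrow> \<exists>N. \<forall>n\<ge>N. norm (X n - L) \<le> e" by blast
  have "\<exists>N. \<forall>n\<ge>N. dist (X n) L < e" if "e > 0" for e
    using L[of "e/2"] that unfolding dist_ell2_def by (smt (verit) field_sum_of_halves)
  then have "X \<longlonglongrightarrow> L" by (auto simp: lim_sequentially)
  then show "convergent X" by (auto simp: convergent_def)
qed

instantiation ell2 :: (type) chilbert_space
begin

definition "scaleC c f = Abs_ell2 (\<lambda>x. c * ell2_fun f x)"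
definition "cinner f g = (\<Sum>\<^sub>\<infinity>x. cnj (ell2_fun f x) * ell2_fun g x)"

lemma ell2_fun_scaleC: "ell2_fun (c *\<^sub>C f) = (\<lambda>x. c * ell2_fun f x)" for f :: "'a ell2"
  unfolding scaleC_ell2_def
  by (rule Abs_ell2_inverse) (simp add: square_summable_cmult square_summable_ell2_fun)

instance
proof
  fix a :: real and c d :: complex and x y z :: "'a ell2"
  show "c *\<^sub>C (x + y) = c *\<^sub>C x + c *\<^sub>C y" "(c + d) *\<^sub>C x = c *\<^sub>C x + d *\<^sub>C x"
    "c *\<^sub>C d *\<^sub>C x = (c * d) *\<^sub>C x" "a *\<^sub>R x = complex_of_real a *\<^sub>C x"
    by (rule ell2_eqI; simp add: ell2_fun_simps ell2_fun_scaleC algebra_simps)+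
  show "cinner x y = cnj (cinner y x)"
    unfolding cinner_ell2_def infsum_cnj[symmetric] by (simp add: mult.commute)
  show "cinner x (y + z) = cinner x y + cinner x z"
    unfolding cinner_ell2_def ell2_fun_add distrib_left
    by (intro infsum_add ell2_cinner_summable square_summable_ell2_fun)
  show "cinner x (c *\<^sub>C y) = c * cinner x y"
    unfolding cinner_ell2_def ell2_fun_scaleC
    by (simp add: infsum_cmult_right'[symmetric] algebra_simps)
  have "cnj u * u = complex_of_real ((cmod u)\<^sup>2)" for u
    by (metis complex_norm_square mult.commute)
  moreover have "(\<Sum>\<^sub>\<infinity>i. complex_of_real ((cmod (ell2_fun x i))\<^sup>2))
      = complex_of_real (\<Sum>\<^sub>\<infinity>i. (cmod (ell2_fun x i))\<^sup>2)"
    using square_summable_ell2_fun[of x] unfolding square_summable_def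
    by (intro infsumI iffD2[OF has_sum_of_real_iff] has_sum_infsum)
  ultimately have "cinner x x = complex_of_real (\<Sum>\<^sub>\<infinity>i. (cmod (ell2_fun x i))\<^sup>2)"
    unfolding cinner_ell2_def by (simp only:)
  moreover have "(norm x)\<^sup>2 = (\<Sum>\<^sub>\<infinity>i. (cmod (ell2_fun x i))\<^sup>2)"
    unfolding norm_ell2_def ell2_norm_def by (rule real_sqrt_pow2) (simp add: infsum_nonneg)
  ultimately show "cinner x x = complex_of_real ((norm x)\<^sup>2)" by (simp only:)
qed

end

definition ket :: "'a \<Rightarrow> 'a ell2" where
  "ket a = Abs_ell2 (\<lambda>x. if x = a then 1 else 0)"

lemma ell2_fun_ket: "ell2_fun (ket a) = (\<lambda>x. if x = a then 1 else 0)"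
proof -
  have "square_summable (\<lambda>x. if x = a then 1 else 0)"
    unfolding square_summable_def
    by (rule finite_nonzero_values_imp_summable_on) (simp add: if_distrib cong: if_cong)
  then show ?thesis unfolding ket_def by (simp add: Abs_ell2_inverse)
qed

definition ell2_on :: "'a set \<Rightarrow> 'a ell2 set" where
  "ell2_on A = {f. \<forall>x. x \<notin> A \<longrightarrow> ell2_fun f x = 0}"

section \<open>Operators on closed subspaces\<close>

text \<open>
  A closed subspace of a type of class \<^class>\<open>chilbert_space\<close> is a Hilbert space in its own right.
  An operator on it is a function on the ambient type of which only the restriction to the
  subspace matters; adjoints are taken within the subspace.
\<close>

definition hilbert_subspace :: "'h::chilbert_space set \<Rightarrow> bool" where
  "hilbert_subspace S \<longleftrightarrow> complex_vector.subspace S \<and> closed S"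

definition closed_span :: "'h::chilbert_space set \<Rightarrow> 'h set" where
  "closed_span X = closure (complex_vector.span X)"

definition linear_on_subspace ::
  "'h::chilbert_space set \<Rightarrow> ('h \<Rightarrow> 'k::chilbert_space) \<Rightarrow> bool" where
  "linear_on_subspace S T \<longleftrightarrow>
    (\<forall>x\<in>S. \<forall>y\<in>S. T (x + y) = T x + T y) \<and> (\<forall>c. \<forall>x\<in>S. T (c *\<^sub>C x) = c *\<^sub>C T x)"

definition bounded_operator_on :: "'h::chilbert_space set \<Rightarrow> ('h \<Rightarrow> 'h) \<Rightarrow> bool" where
  "bounded_operator_on S T \<longleftrightarrow>
    T ` S \<subseteq> S \<and> linear_on_subspace S T \<and> (\<exists>C. \<forall>x\<in>S. norm (T x) \<le> C * norm x)"

definition adjoint_on :: "'h::chilbert_space set \<Rightarrow> ('h \<Rightarrow> 'h) \<Rightarrow> 'h \<Rightarrow> 'h" where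
  "adjoint_on S T y = (THE z. z \<in> S \<and> (\<forall>x\<in>S. cinner (T x) y = cinner x z))"

definition orth_proj :: "'h::chilbert_space set \<Rightarrow> 'h \<Rightarrow> 'h" where
  "orth_proj S x = (THE y. y \<in> S \<and> (\<forall>z\<in>S. cinner z (x - y) = 0))"

definition isometry_on :: "'h::chilbert_space set \<Rightarrow> ('h \<Rightarrow> 'h) \<Rightarrow> bool" where
  "isometry_on S T \<longleftrightarrow> bounded_operator_on S T \<and> (\<forall>x\<in>S. norm (T x) = norm x)"

text \<open>A partial isometry is isometric on the orthogonal complement of its kernel.\<close>

definition partial_isometry_on :: "'h::chilbert_space set \<Rightarrow> ('h \<Rightarrow> 'h) \<Rightarrow> bool" where
  "partial_isometry_on S T \<longleftrightarrow> bounded_operator_on S T \<and>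
    (\<forall>x\<in>S. (\<forall>y\<in>S. T y = 0 \<longrightarrow> cinner y x = 0) \<longrightarrow> norm (T x) = norm x)"

definition orthonormal_basis :: "'h::chilbert_space set \<Rightarrow> 'h set \<Rightarrow> bool" where
  "orthonormal_basis S B \<longleftrightarrow> B \<subseteq> S \<and>
    (\<forall>x\<in>B. \<forall>y\<in>B. cinner x y = (if x = y then 1 else 0)) \<and> closed_span B = S"

section \<open>The semigroup of a single vertex rank 2 graph\<close>

text \<open>
  Words over the alphabet \<^typ>\<open>'m + 'n\<close>: the letter \<^term>\<open>Inl i\<close> stands for $e_i$ and
  \<^term>\<open>Inr j\<close> for $f_j$.  The semigroup is the quotient of the free monoid by the congruence
  generated by the commutation relations.
\<close>

inductive theta_cong :: "('m \<times> 'n \<Rightarrow> 'm \<times> 'n) \<Rightarrow> ('m + 'n) list \<Rightarrow> ('m + 'n) list \<Rightarrow> bool"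
  for \<theta> where
  commutation: "\<theta> (i, j) = (i', j') \<Longrightarrow> theta_cong \<theta> [Inl i, Inr j] [Inr j', Inl i']"
| refl: "theta_cong \<theta> u u"
| sym: "theta_cong \<theta> u v \<Longrightarrow> theta_cong \<theta> v u"
| trans: "theta_cong \<theta> u v \<Longrightarrow> theta_cong \<theta> v w \<Longrightarrow> theta_cong \<theta> u w"
| append: "theta_cong \<theta> u v \<Longrightarrow> theta_cong \<theta> u' v' \<Longrightarrow> theta_cong \<theta> (u @ u') (v @ v')"

definition word_class ::
  "('m \<times> 'n \<Rightarrow> 'm \<times> 'n) \<Rightarrow> ('m + 'n) list \<Rightarrow> ('m + 'n) list set" where
  "word_class \<theta> u = {v. theta_cong \<theta> u v}"

definition F_theta :: "('m \<times> 'n \<Rightarrow> 'm \<times> 'n) \<Rightarrow> ('m + 'n) list set monoid" where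
  "F_theta \<theta> = \<lparr>carrier = range (word_class \<theta>),
     mult = (\<lambda>a b. \<Union>u\<in>a. \<Union>v\<in>b. word_class \<theta> (u @ v)),
     one = word_class \<theta> []\<rparr>"

lemma word_class_eq_iff: "word_class \<theta> u = word_class \<theta> v \<longleftrightarrow> theta_cong \<theta> u v"
  unfolding word_class_def set_eq_iff mem_Collect_eq
  by (meson theta_cong.refl theta_cong.sym theta_cong.trans)

lemma F_theta_mult_word_class:
  "word_class \<theta> u \<otimes>\<^bsub>F_theta \<theta>\<^esub> word_class \<theta> v = word_class \<theta> (u @ v)"
proof -
  have "word_class \<theta> (u' @ v') = word_class \<theta> (u @ v)"
    if "u' \<in> word_class \<theta> u" "v' \<in> word_class \<theta> v" for u' v'
  proof -
    from that have "theta_cong \<theta> u u'" "theta_cong \<theta> v v'"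
      by (simp_all add: word_class_def)
    then have "theta_cong \<theta> (u @ v) (u' @ v')" by (rule theta_cong.append)
    then show ?thesis unfolding word_class_eq_iff by (rule theta_cong.sym)
  qed
  moreover have "u \<in> word_class \<theta> u" for u :: "('a + 'b) list"
    by (simp add: word_class_def theta_cong.refl)
  ultimately have "(\<Union>u'\<in>word_class \<theta> u. \<Union>v'\<in>word_class \<theta> v. word_class \<theta> (u' @ v'))
      = word_class \<theta> (u @ v)" by blast
  then show ?thesis by (simp add: F_theta_def)
qed

definition gen_e :: "('m \<times> 'n \<Rightarrow> 'm \<times> 'n) \<Rightarrow> 'm \<Rightarrow> ('m + 'n) list set" where
  "gen_e \<theta> i = word_class \<theta> [Inl i]"

definition gen_f :: "('m \<times> 'n \<Rightarrow> 'm \<times> 'n) \<Rightarrow> 'n \<Rightarrow> ('m + 'n) list set" where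
  "gen_f \<theta> j = word_class \<theta> [Inr j]"

text \<open>The degree of $w = e_u f_v$ is $(|u|, |v|)$.\<close>

definition has_degree ::
  "('m \<times> 'n \<Rightarrow> 'm \<times> 'n) \<Rightarrow> ('m + 'n) list set \<Rightarrow> nat \<Rightarrow> nat \<Rightarrow> bool" where
  "has_degree \<theta> w a b \<longleftrightarrow>
    (\<exists>u v. w = word_class \<theta> (map Inl u @ map Inr v) \<and> length u = a \<and> length v = b)"

section \<open>Representations\<close>

type_synonym ('m, 'n, 'h) rep = "('m + 'n) list set \<Rightarrow> 'h \<Rightarrow> 'h"

definition representation ::
  "('m \<times> 'n \<Rightarrow> 'm \<times> 'n) \<Rightarrow> 'h::chilbert_space set \<Rightarrow> ('m, 'n, 'h) rep \<Rightarrow> bool" where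
  "representation \<theta> S \<sigma> \<longleftrightarrow> hilbert_subspace S \<and>
    (\<forall>w\<in>carrier (F_theta \<theta>). partial_isometry_on S (\<sigma> w)) \<and>
    (\<forall>x\<in>S. \<sigma> \<one>\<^bsub>F_theta \<theta>\<^esub> x = x) \<and>
    (\<forall>v\<in>carrier (F_theta \<theta>). \<forall>w\<in>carrier (F_theta \<theta>). \<forall>x\<in>S.
       \<sigma> (v \<otimes>\<^bsub>F_theta \<theta>\<^esub> w) x = \<sigma> v (\<sigma> w x))"

definition isometric_representation ::
  "('m \<times> 'n \<Rightarrow> 'm \<times> 'n) \<Rightarrow> 'h::chilbert_space set \<Rightarrow> ('m, 'n, 'h) rep \<Rightarrow> bool" where
  "isometric_representation \<theta> S \<sigma> \<longleftrightarrow> representation \<theta> S \<sigma> \<and>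
    (\<forall>w\<in>carrier (F_theta \<theta>). isometry_on S (\<sigma> w))"

definition defect_free ::
  "('m::finite \<times> 'n::finite \<Rightarrow> 'm \<times> 'n) \<Rightarrow> 'h::chilbert_space set \<Rightarrow> ('m, 'n, 'h) rep \<Rightarrow> bool" where
  "defect_free \<theta> S \<sigma> \<longleftrightarrow> (\<forall>x\<in>S.
    (\<Sum>i\<in>UNIV. \<sigma> (gen_e \<theta> i) (adjoint_on S (\<sigma> (gen_e \<theta> i)) x)) = x \<and>
    (\<Sum>j\<in>UNIV. \<sigma> (gen_f \<theta> j) (adjoint_on S (\<sigma> (gen_f \<theta> j)) x)) = x)"

definition star_representation ::
  "('m::finite \<times> 'n::finite \<Rightarrow> 'm \<times> 'n) \<Rightarrow> 'h::chilbert_space set \<Rightarrow> ('m, 'n, 'h) rep \<Rightarrow> bool" where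
  "star_representation \<theta> S \<sigma> \<longleftrightarrow> isometric_representation \<theta> S \<sigma> \<and> defect_free \<theta> S \<sigma>"

definition atomic_wrt ::
  "('m \<times> 'n \<Rightarrow> 'm \<times> 'n) \<Rightarrow> 'h::chilbert_space set \<Rightarrow> 'h set \<Rightarrow> ('m, 'n, 'h) rep \<Rightarrow> bool" where
  "atomic_wrt \<theta> S B \<sigma> \<longleftrightarrow> orthonormal_basis S B \<and>
    (\<forall>w\<in>carrier (F_theta \<theta>). \<forall>\<xi>\<in>B. \<exists>\<eta>\<in>B. \<exists>\<alpha>. (cmod \<alpha> = 1 \<or> \<alpha> = 0) \<and> \<sigma> w \<xi> = \<alpha> *\<^sub>C \<eta>)"

definition reducing ::
  "('m \<times> 'n \<Rightarrow> 'm \<times> 'n) \<Rightarrow> 'h::chilbert_space set \<Rightarrow> ('m, 'n, 'h) rep \<Rightarrow> 'h set \<Rightarrow> bool" where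
  "reducing \<theta> S \<sigma> N \<longleftrightarrow> hilbert_subspace N \<and> N \<subseteq> S \<and>
    (\<forall>w\<in>carrier (F_theta \<theta>). \<sigma> w ` N \<subseteq> N \<and> adjoint_on S (\<sigma> w) ` N \<subseteq> N)"

definition irreducible_rep ::
  "('m \<times> 'n \<Rightarrow> 'm \<times> 'n) \<Rightarrow> 'h::chilbert_space set \<Rightarrow> ('m, 'n, 'h) rep \<Rightarrow> bool" where
  "irreducible_rep \<theta> S \<sigma> \<longleftrightarrow> (\<forall>N. reducing \<theta> S \<sigma> N \<longrightarrow> N = {0} \<or> N = S)"

definition unitarily_equivalent ::
  "('m \<times> 'n \<Rightarrow> 'm \<times> 'n) \<Rightarrow> 'h::chilbert_space set \<Rightarrow> ('m, 'n, 'h) rep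
    \<Rightarrow> 'k::chilbert_space set \<Rightarrow> ('m, 'n, 'k) rep \<Rightarrow> bool" where
  "unitarily_equivalent \<theta> S \<sigma> S' \<sigma>' \<longleftrightarrow> (\<exists>U. linear_on_subspace S U \<and>
    (\<forall>x\<in>S. norm (U x) = norm x) \<and> U ` S = S' \<and>
    (\<forall>w\<in>carrier (F_theta \<theta>). \<forall>x\<in>S. U (\<sigma> w x) = \<sigma>' w (U x)))"

section \<open>Dilations\<close>

definition dilation ::
  "('m \<times> 'n \<Rightarrow> 'm \<times> 'n) \<Rightarrow> 'h::chilbert_space set \<Rightarrow> ('m, 'n, 'h) rep
    \<Rightarrow> 'h set \<Rightarrow> ('m, 'n, 'h) rep \<Rightarrow> bool" where
  "dilation \<theta> H \<sigma> K \<pi> \<longleftrightarrow> representation \<theta> H \<sigma> \<and> representation \<theta> K \<pi> \<and> H \<subseteq> K \<and>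
    (\<forall>w\<in>carrier (F_theta \<theta>). \<forall>x\<in>H. \<sigma> w x = orth_proj H (\<pi> w x))"

definition minimal_star_dilation ::
  "('m::finite \<times> 'n::finite \<Rightarrow> 'm \<times> 'n) \<Rightarrow> 'h::chilbert_space set \<Rightarrow> ('m, 'n, 'h) rep
    \<Rightarrow> 'h set \<Rightarrow> ('m, 'n, 'h) rep \<Rightarrow> bool" where
  "minimal_star_dilation \<theta> H \<sigma> K \<pi> \<longleftrightarrow> dilation \<theta> H \<sigma> K \<pi> \<and> defect_free \<theta> H \<sigma> \<and>
    star_representation \<theta> K \<pi> \<and> K = closed_span (\<Union>w\<in>carrier (F_theta \<theta>). \<pi> w ` H)"

text \<open>
  Minimal $*$-dilations are only determined up to unitary equivalence, and \<open>\<sigma>\<close> may live on another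
  type than \<open>\<pi>\<close>; so the inclusion of the space of \<open>\<sigma>\<close> into that of \<open>\<pi>\<close> is realised by a unitary
  copy of \<open>\<sigma>\<close> on a subspace of \<open>K\<close>.
\<close>

definition is_minimal_star_dilation_of ::
  "('m::finite \<times> 'n::finite \<Rightarrow> 'm \<times> 'n) \<Rightarrow> 'k::chilbert_space set \<Rightarrow> ('m, 'n, 'k) rep
    \<Rightarrow> 'h::chilbert_space set \<Rightarrow> ('m, 'n, 'h) rep \<Rightarrow> bool" where
  "is_minimal_star_dilation_of \<theta> K \<pi> S \<sigma> \<longleftrightarrow>
    (\<exists>H \<sigma>'. unitarily_equivalent \<theta> S \<sigma> H \<sigma>' \<and> minimal_star_dilation \<theta> H \<sigma>' K \<pi>)"

section \<open>Group construction representations\<close>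

text \<open>The abelian group is written multiplicatively, following the conventions for \<^const>\<open>comm_group\<close>.\<close>

definition group_construction_rep ::
  "('m \<times> 'n \<Rightarrow> 'm \<times> 'n) \<Rightarrow> 'g monoid \<Rightarrow> 'g \<Rightarrow> 'g \<Rightarrow> ('g \<Rightarrow> 'm) \<Rightarrow> ('g \<Rightarrow> 'n)
    \<Rightarrow> ('g \<Rightarrow> complex) \<Rightarrow> ('g \<Rightarrow> complex) \<Rightarrow> ('m, 'n, 'g ell2) rep \<Rightarrow> bool" where
  "group_construction_rep \<theta> G g\<^sub>1 g\<^sub>2 i j \<alpha> \<beta> \<sigma> \<longleftrightarrow>
    comm_group G \<and> g\<^sub>1 \<in> carrier G \<and> g\<^sub>2 \<in> carrier G \<and> generate G {g\<^sub>1, g\<^sub>2} = carrier G \<and>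
    (\<forall>g\<in>carrier G. cmod (\<alpha> g) = 1 \<and> cmod (\<beta> g) = 1) \<and>
    (\<forall>g\<in>carrier G.
       gen_e \<theta> (i (g \<otimes>\<^bsub>G\<^esub> g\<^sub>2)) \<otimes>\<^bsub>F_theta \<theta>\<^esub> gen_f \<theta> (j g)
         = gen_f \<theta> (j (g \<otimes>\<^bsub>G\<^esub> g\<^sub>1)) \<otimes>\<^bsub>F_theta \<theta>\<^esub> gen_e \<theta> (i g) \<and>
       \<alpha> (g \<otimes>\<^bsub>G\<^esub> g\<^sub>2) * \<beta> g = \<beta> (g \<otimes>\<^bsub>G\<^esub> g\<^sub>1) * \<alpha> g) \<and>
    representation \<theta> (ell2_on (carrier G)) \<sigma> \<and>
    (\<forall>g\<in>carrier G.
       (\<forall>k. \<sigma> (gen_e \<theta> k) (ket g) = (if k = i g then \<alpha> g *\<^sub>C ket (g \<otimes>\<^bsub>G\<^esub> g\<^sub>1) else 0)) \<and>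
       (\<forall>k. \<sigma> (gen_f \<theta> k) (ket g) = (if k = j g then \<beta> g *\<^sub>C ket (g \<otimes>\<^bsub>G\<^esub> g\<^sub>2) else 0)))"

section \<open>The graph and the symmetry group\<close>

text \<open>
  A vertex of the graph is a line spanned by a basis vector; it is represented by that basis vector.
  Correspondingly, \<^term>\<open>leads_to \<sigma> w \<xi> \<eta>\<close> states an equality of lines.
\<close>

definition line :: "'h::chilbert_space \<Rightarrow> 'h set" where
  "line \<xi> = range (\<lambda>c. c *\<^sub>C \<xi>)"

definition leads_to ::
  "('m, 'n, 'h::chilbert_space) rep \<Rightarrow> ('m + 'n) list set \<Rightarrow> 'h \<Rightarrow> 'h \<Rightarrow> bool" where
  "leads_to \<sigma> w \<xi> \<eta> \<longleftrightarrow> \<sigma> w ` line \<xi> = line \<eta>"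

definition graph_edges ::
  "('m \<times> 'n \<Rightarrow> 'm \<times> 'n) \<Rightarrow> 'h::chilbert_space set \<Rightarrow> ('m, 'n, 'h) rep \<Rightarrow> ('h \<times> 'h) set" where
  "graph_edges \<theta> B \<sigma> = {(\<xi>, \<eta>). \<xi> \<in> B \<and> \<eta> \<in> B \<and>
    ((\<exists>i. leads_to \<sigma> (gen_e \<theta> i) \<xi> \<eta>) \<or> (\<exists>j. leads_to \<sigma> (gen_f \<theta> j) \<xi> \<eta>))}"

definition connected_graph ::
  "('m \<times> 'n \<Rightarrow> 'm \<times> 'n) \<Rightarrow> 'h::chilbert_space set \<Rightarrow> ('m, 'n, 'h) rep \<Rightarrow> bool" where
  "connected_graph \<theta> B \<sigma> \<longleftrightarrow> B \<noteq> {} \<and>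
    (\<forall>\<xi>\<in>B. \<forall>\<eta>\<in>B. (\<xi>, \<eta>) \<in> (graph_edges \<theta> B \<sigma> \<union> (graph_edges \<theta> B \<sigma>)\<inverse>)\<^sup>*)"

text \<open>Only meaningful for \<open>s, t \<le> 0\<close>.\<close>

definition back_vertex ::
  "('m \<times> 'n \<Rightarrow> 'm \<times> 'n) \<Rightarrow> 'h::chilbert_space set \<Rightarrow> ('m, 'n, 'h) rep
    \<Rightarrow> 'h \<Rightarrow> int \<Rightarrow> int \<Rightarrow> 'h" where
  "back_vertex \<theta> B \<pi> \<xi> s t = (THE \<eta>. \<eta> \<in> B \<and>
    (\<exists>w. has_degree \<theta> w (nat \<bar>s\<bar>) (nat \<bar>t\<bar>) \<and> leads_to \<pi> w \<eta> \<xi>))"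

definition blue_label ::
  "('m \<times> 'n \<Rightarrow> 'm \<times> 'n) \<Rightarrow> 'h::chilbert_space set \<Rightarrow> ('m, 'n, 'h) rep \<Rightarrow> 'h \<Rightarrow> 'm" where
  "blue_label \<theta> B \<pi> \<eta> = (THE i. \<exists>\<zeta>\<in>B. leads_to \<pi> (gen_e \<theta> i) \<zeta> \<eta>)"

definition red_label ::
  "('m \<times> 'n \<Rightarrow> 'm \<times> 'n) \<Rightarrow> 'h::chilbert_space set \<Rightarrow> ('m, 'n, 'h) rep \<Rightarrow> 'h \<Rightarrow> 'n" where
  "red_label \<theta> B \<pi> \<eta> = (THE j. \<exists>\<zeta>\<in>B. leads_to \<pi> (gen_f \<theta> j) \<zeta> \<eta>)"

text \<open>
  The constraints on \<open>T\<close> keep all indices in the range where the vertices are defined.  They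
  are harmless, since the condition on \<open>s, t \<le> T\<close> becomes weaker as \<open>T\<close> decreases.
\<close>

definition K_sub ::
  "('m \<times> 'n \<Rightarrow> 'm \<times> 'n) \<Rightarrow> 'h::chilbert_space set \<Rightarrow> ('m, 'n, 'h) rep
    \<Rightarrow> 'h \<Rightarrow> (int \<times> int) set" where
  "K_sub \<theta> B \<pi> \<xi> = {(p, q). \<exists>T. T \<le> 0 \<and> T + p \<le> 0 \<and> T + q \<le> 0 \<and> (\<forall>s\<le>T. \<forall>t\<le>T.
    back_vertex \<theta> B \<pi> \<xi> (s + p) (t + q) = back_vertex \<theta> B \<pi> \<xi> s t)}"

definition L_sub ::
  "('m \<times> 'n \<Rightarrow> 'm \<times> 'n) \<Rightarrow> 'h::chilbert_space set \<Rightarrow> ('m, 'n, 'h) rep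
    \<Rightarrow> 'h \<Rightarrow> (int \<times> int) set" where
  "L_sub \<theta> B \<pi> \<xi> = {(p, q). \<exists>T. T \<le> 0 \<and> T + p \<le> 0 \<and> T + q \<le> 0 \<and> (\<forall>s\<le>T. \<forall>t\<le>T.
    blue_label \<theta> B \<pi> (back_vertex \<theta> B \<pi> \<xi> (s + p) (t + q))
      = blue_label \<theta> B \<pi> (back_vertex \<theta> B \<pi> \<xi> s t) \<and>
    red_label \<theta> B \<pi> (back_vertex \<theta> B \<pi> \<xi> (s + p) (t + q))
      = red_label \<theta> B \<pi> (back_vertex \<theta> B \<pi> \<xi> s t))}"

definition symmetry_group ::
  "('m \<times> 'n \<Rightarrow> 'm \<times> 'n) \<Rightarrow> 'h::chilbert_space set \<Rightarrow> ('m, 'n, 'h) rep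
    \<Rightarrow> 'h \<Rightarrow> (int \<times> int) set monoid" where
  "symmetry_group \<theta> B \<pi> \<xi> =
    ((integer_group \<times>\<times> integer_group)\<lparr>carrier := L_sub \<theta> B \<pi> \<xi>\<rparr>) Mod K_sub \<theta> B \<pi> \<xi>"

section \<open>Direct sums and direct integrals\<close>

definition direct_sum_decomposition ::
  "('m \<times> 'n \<Rightarrow> 'm \<times> 'n) \<Rightarrow> 'h::chilbert_space set \<Rightarrow> ('m, 'n, 'h) rep \<Rightarrow> 'h set set \<Rightarrow> bool" where
  "direct_sum_decomposition \<theta> S \<pi> \<N> \<longleftrightarrow>
    (\<forall>N\<in>\<N>. reducing \<theta> S \<pi> N) \<and>
    (\<forall>N\<in>\<N>. \<forall>N'\<in>\<N>. N \<noteq> N' \<longrightarrow> (\<forall>x\<in>N. \<forall>y\<in>N'. cinner x y = 0)) \<and>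
    closed_span (\<Union>\<N>) = S"

text \<open>
  A measurable field of Hilbert spaces \<open>H x\<close> over \<open>M\<close> in the sense of Dixmier, whose measurable
  structure is given by the fundamental sequence of sections \<open>\<epsilon> n\<close>.
\<close>

definition measurable_field ::
  "'x measure \<Rightarrow> ('x \<Rightarrow> 'k::chilbert_space set) \<Rightarrow> (nat \<Rightarrow> 'x \<Rightarrow> 'k) \<Rightarrow> bool" where
  "measurable_field M H \<epsilon> \<longleftrightarrow>
    (\<forall>x\<in>space M. hilbert_subspace (H x)) \<and>
    (\<forall>x\<in>space M. closed_span (range (\<lambda>n. \<epsilon> n x)) = H x) \<and>
    (\<forall>n k. (\<lambda>x. cinner (\<epsilon> n x) (\<epsilon> k x)) \<in> borel_measurable M)"

definition measurable_section ::
  "'x measure \<Rightarrow> ('x \<Rightarrow> 'k::chilbert_space set) \<Rightarrow> (nat \<Rightarrow> 'x \<Rightarrow> 'k) \<Rightarrow> ('x \<Rightarrow> 'k) \<Rightarrow> bool" where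
  "measurable_section M H \<epsilon> f \<longleftrightarrow>
    (\<forall>x\<in>space M. f x \<in> H x) \<and> (\<forall>n. (\<lambda>x. cinner (\<epsilon> n x) (f x)) \<in> borel_measurable M)"

definition square_integrable_sections ::
  "'x measure \<Rightarrow> ('x \<Rightarrow> 'k::chilbert_space set) \<Rightarrow> (nat \<Rightarrow> 'x \<Rightarrow> 'k) \<Rightarrow> ('x \<Rightarrow> 'k) set" where
  "square_integrable_sections M H \<epsilon> =
    {f. measurable_section M H \<epsilon> f \<and> integrable M (\<lambda>x. (norm (f x))\<^sup>2)}"

text \<open>
  Unitary equivalence of \<open>\<pi>\<close> with the direct integral of the measurable field \<open>\<rho>\<close> of
  representations.  The map \<open>U\<close> is defined on square integrable sections; preserving the seminorm,
  it descends to a unitary from the Hilbert space of sections modulo equality almost everywhere.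
\<close>

definition is_direct_integral ::
  "('m \<times> 'n \<Rightarrow> 'm \<times> 'n) \<Rightarrow> 'h::chilbert_space set \<Rightarrow> ('m, 'n, 'h) rep
    \<Rightarrow> 'x measure \<Rightarrow> ('x \<Rightarrow> 'k::chilbert_space set) \<Rightarrow> (nat \<Rightarrow> 'x \<Rightarrow> 'k)
    \<Rightarrow> ('x \<Rightarrow> ('m, 'n, 'k) rep) \<Rightarrow> bool" where
  "is_direct_integral \<theta> S \<pi> M H \<epsilon> \<rho> \<longleftrightarrow>
    measurable_field M H \<epsilon> \<and>
    (\<forall>x\<in>space M. representation \<theta> (H x) (\<rho> x)) \<and>
    (\<forall>w\<in>carrier (F_theta \<theta>). \<forall>f. measurable_section M H \<epsilon> f \<longrightarrow>
       measurable_section M H \<epsilon> (\<lambda>x. \<rho> x w (f x))) \<and>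
    (\<exists>U :: ('x \<Rightarrow> 'k) \<Rightarrow> 'h.
       (\<forall>f\<in>square_integrable_sections M H \<epsilon>. \<forall>g\<in>square_integrable_sections M H \<epsilon>.
          U (\<lambda>x. f x + g x) = U f + U g) \<and>
       (\<forall>c. \<forall>f\<in>square_integrable_sections M H \<epsilon>. U (\<lambda>x. c *\<^sub>C f x) = c *\<^sub>C U f) \<and>
       (\<forall>f\<in>square_integrable_sections M H \<epsilon>. (norm (U f))\<^sup>2 = (\<integral>x. (norm (f x))\<^sup>2 \<partial>M)) \<and>
       U ` square_integrable_sections M H \<epsilon> = S \<and>
       (\<forall>w\<in>carrier (F_theta \<theta>). \<forall>f\<in>square_integrable_sections M H \<epsilon>.
          U (\<lambda>x. \<rho> x w (f x)) = \<pi> w (U f)))"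

text \<open>
  Every abelian group with two generators is a quotient of the group of pairs of integers, hence
  isomorphic to a group on a set of cosets.
\<close>

definition irreducible_group_construction_dilation ::
  "('m::finite \<times> 'n::finite \<Rightarrow> 'm \<times> 'n) \<Rightarrow> 'k::chilbert_space set \<Rightarrow> ('m, 'n, 'k) rep \<Rightarrow> bool" where
  "irreducible_group_construction_dilation \<theta> K \<rho> \<longleftrightarrow> irreducible_rep \<theta> K \<rho> \<and>
    (\<exists>(G :: (int \<times> int) set monoid) g\<^sub>1 g\<^sub>2 i j \<alpha> \<beta> \<sigma>.
       group_construction_rep \<theta> G g\<^sub>1 g\<^sub>2 i j \<alpha> \<beta> \<sigma> \<and>
       irreducible_rep \<theta> (ell2_on (carrier G)) \<sigma> \<and>
       is_minimal_star_dilation_of \<theta> K \<rho> (ell2_on (carrier G)) \<sigma>)"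

end

theory Submission
  imports Defs
begin

text \<open>
  An atomic $*$-representation with connected graph is encoded by the predecessor maps of its graph.
  Its scalars are gauged away up to two constants \<open>a\<close> and \<open>c\<close>, because a character of the group of
  periods extends to the pairs of integers; so it is unitarily equivalent to a model \<open>rho a c\<close> on the
  square summable functions on the vertices.  Extending backward paths forwards without losing
  periods, by a pigeonhole argument on the finitely many labels, yields an invariant set of vertices indexed by the
  group \<open>\<int>\<^sup>2 / K\<close>, and compressing the model to it gives the group construction representation.

  If labels separate vertices, then the ranges of the words matched by a vertex shrink to its line,
  which gives irreducibility.  In general vertices with equal label tails are identified: the
  quotient graph carries a family of irreducible models, twisted by the characters of \<open>L\<close> which are
  trivial on \<open>K\<close>.  Fourier expansion along the classes is a unitary map from the model onto the direct
  integral of this family over the Haar measure of the character group, and cutting by a set of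
  characters of intermediate measure produces a reducing subspace when the symmetry group is
  nontrivial.
\<close>

section \<open>Inner products\<close>

text \<open>A group construction has a vertex at every lattice position modulo periods, whereas a
  vertex of the graph determines only its past, a quadrant. Going forward, labels are free, and a
  careless choice separates positions whose pasts coincide. The group \<open>K\<close> of periods
  has two generators, so only two equations between vertices have to survive, and each is controlled
  by a finite window of labels. The same two generators govern the scalars: the products of scalars
  around two loops are prescribed, and unimodular roots give the constants \<open>a\<close> and
  \<open>c\<close>.

  Inside a class of vertices with equal tails, the position relative to a base vertex is a complete
  invariant modulo \<open>K\<close>, and it ranges over a coset of \<open>L\<close>. Functions on a
  class are thus functions on a copy of \<open>L / K\<close>, and the Fourier transform turns a
  backward step into multiplication by a character value; this is the source of the twists. A
  probability measure on pairs of reals stands for the dual of \<open>L / K\<close> whether that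
  group is finite or not, so the direct integral alternative of (iii) is proved in all
  cases.\<close>

lemma cinner_add_left: "cinner (x + y) z = cinner x z + cinner y z"
  for x :: "'h::chilbert_space"
  by (metis cinner_add_right cinner_commute complex_cnj_add)

lemma cinner_scaleC_left: "cinner (c *\<^sub>C x) y = cnj c * cinner x y"
  for x :: "'h::chilbert_space"
  by (metis cinner_scaleC_right cinner_commute complex_cnj_mult)

lemma scaleC_zero_left [simp]: "0 *\<^sub>C x = (0 :: 'h::chilbert_space)"
  by (rule complex_vector.scale_zero_left)

lemma cinner_zero_right [simp]: "cinner x 0 = 0"
  using cinner_scaleC_right[of x 0 x] by simp

lemma cinner_zero_left [simp]: "cinner 0 x = 0"
  using cinner_scaleC_left[of 0 x x] by simp

lemma cinner_minus_right: "cinner x (- y) = - cinner x y" for x :: "'h::chilbert_space"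
  using cinner_add_right[of x y "- y"] by (simp add: eq_neg_iff_add_eq_0 add.commute)

lemma cinner_diff_right: "cinner x (y - z) = cinner x y - cinner x z" for x :: "'h::chilbert_space"
  using cinner_add_right[of x y "- z"] by (simp add: cinner_minus_right)

lemma cinner_sum_right: "cinner x (\<Sum>i\<in>F. f i) = (\<Sum>i\<in>F. cinner x (f i))"
  for x :: "'h::chilbert_space"
  by (induction F rule: infinite_finite_induct) (auto simp: cinner_add_right)

lemma cinner_sum_left: "cinner (\<Sum>i\<in>F. f i) x = (\<Sum>i\<in>F. cinner (f i) x)"
  for x :: "'h::chilbert_space"
  by (induction F rule: infinite_finite_induct) (auto simp: cinner_add_left)

lemma cinner_self_eq_0 [simp]: "cinner x x = 0 \<longleftrightarrow> x = (0 :: 'h::chilbert_space)"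
  by (simp add: cinner_self)

lemma norm_scaleC: "norm (c *\<^sub>C x) = cmod c * norm (x :: 'h::chilbert_space)"
proof -
  have "complex_of_real ((norm (c *\<^sub>C x))\<^sup>2) = (c * cnj c) * cinner x x"
    unfolding cinner_self[of "c *\<^sub>C x", symmetric]
    by (simp only: cinner_scaleC_left cinner_scaleC_right mult_ac)
  also have "\<dots> = complex_of_real ((cmod c * norm x)\<^sup>2)"
    by (simp only: cinner_self complex_norm_square[symmetric] of_real_mult[symmetric]
        of_real_power[symmetric] power_mult_distrib)
  finally have "complex_of_real ((norm (c *\<^sub>C x))\<^sup>2) = complex_of_real ((cmod c * norm x)\<^sup>2)" .
  then have "(norm (c *\<^sub>C x))\<^sup>2 = (cmod c * norm x)\<^sup>2"
    using of_real_eq_iff by blast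
  then show ?thesis by (simp add: power2_eq_iff_nonneg)
qed

lemma norm_add_square:
  "(norm (x + y))\<^sup>2 = (norm x)\<^sup>2 + (norm y)\<^sup>2 + 2 * Re (cinner x y)"
  for x :: "'h::chilbert_space"
proof -
  have "complex_of_real ((norm (x + y))\<^sup>2)
      = (norm x)\<^sup>2 + (norm y)\<^sup>2 + (cinner x y + cnj (cinner x y))"
    unfolding cinner_self[symmetric] of_real_add
    by (simp only: cinner_add_left cinner_add_right cinner_commute[of y x] add_ac)
  then have "Re (complex_of_real ((norm (x + y))\<^sup>2)) = Re (complex_of_real ((norm x)\<^sup>2
      + (norm y)\<^sup>2) + (cinner x y + cnj (cinner x y)))" by simp
  then show ?thesis by simp
qed

lemma norm_diff_square:
  "(norm (x - y))\<^sup>2 = (norm x)\<^sup>2 + (norm y)\<^sup>2 - 2 * Re (cinner x y)"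
  for x :: "'h::chilbert_space"
  using norm_add_square[of x "- y"] by (simp add: cinner_minus_right)

lemma cinner_Cauchy_Schwarz: "cmod (cinner x y) \<le> norm x * norm (y :: 'h::chilbert_space)"
proof (cases "x = 0")
  case False
  then have n: "norm x > 0" by simp
  define c where "c = cinner x y / (norm x)\<^sup>2"
  define D where "D = (cmod (cinner x y))\<^sup>2 / (norm x)\<^sup>2"
  have "cmod c = cmod (cinner x y) / (norm x)\<^sup>2"
    by (simp add: c_def norm_divide norm_power)
  then have 1: "(cmod c * norm x)\<^sup>2 = D" using n by (simp add: D_def power2_eq_square)
  have "c * cinner y x = complex_of_real D"
    unfolding c_def D_def cinner_commute[of y x] times_divide_eq_left complex_norm_square[symmetric]
    by simp
  then have 2: "Re (c * cinner y x) = D" by simp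
  have "0 \<le> (norm (y - c *\<^sub>C x))\<^sup>2" by simp
  also have "\<dots> = (norm y)\<^sup>2 + (cmod c * norm x)\<^sup>2 - 2 * Re (c * cinner y x)"
    by (simp add: norm_diff_square norm_scaleC cinner_scaleC_right)
  finally have "(cmod (cinner x y))\<^sup>2 / (norm x)\<^sup>2 \<le> (norm y)\<^sup>2"
    unfolding 1 2 D_def by linarith
  then have "(cmod (cinner x y))\<^sup>2 \<le> (norm x * norm y)\<^sup>2"
    using n by (simp add: power_mult_distrib pos_divide_le_eq mult.commute)
  then show ?thesis by (rule power2_le_imp_le) simp
qed simp

lemma bounded_linear_cinner_right: "bounded_linear (\<lambda>x. cinner y (x :: 'h::chilbert_space))"
  by (rule bounded_linear_intro[of _ "norm y"])
    (auto simp: cinner_add_right scaleR_scaleC cinner_scaleC_right scaleR_conv_of_real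
      mult.commute[of "norm _" "norm y"] intro: cinner_Cauchy_Schwarz)

lemma bounded_linear_scaleC: "bounded_linear (\<lambda>x. c *\<^sub>C (x :: 'h::chilbert_space))"
  by (rule bounded_linear_intro[of _ "cmod c"])
    (auto simp: scaleC_add_right scaleR_scaleC scaleC_scaleC norm_scaleC mult.commute)

text \<open>Polarisation: norms of sums determine real parts, and replacing the second vector by
  \<i> times itself brings in the imaginary part.\<close>

lemma isometry_preserves_cinner:
  fixes T :: "'h::chilbert_space \<Rightarrow> 'k::chilbert_space"
  assumes "complex_vector.subspace S" "linear_on_subspace S T" "\<forall>x\<in>S. norm (T x) = norm x"
    and x: "x \<in> S" and y: "y \<in> S"
  shows "cinner (T x) (T y) = cinner x y"
proof -
  have re: "Re (cinner (T x) (T y)) = Re (cinner x y)" if "x \<in> S" "y \<in> S" for x y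
  proof -
    have "x + y \<in> S" using that assms(1) complex_vector.subspace_add by blast
    moreover have "T (x + y) = T x + T y" using assms(2) that by (simp add: linear_on_subspace_def)
    ultimately have "(norm (T x + T y))\<^sup>2 = (norm (x + y))\<^sup>2" using assms(3) by metis
    then show ?thesis using that assms(3) by (simp add: norm_add_square)
  qed
  have iy: "\<i> *\<^sub>C y \<in> S" using y assms(1) complex_vector.subspace_scale by blast
  have "T (\<i> *\<^sub>C y) = \<i> *\<^sub>C T y" using assms(2) y by (simp add: linear_on_subspace_def)
  then have "Im (cinner (T x) (T y)) = Im (cinner x y)"
    using re[OF x iy] by (simp add: cinner_scaleC_right)
  with re[OF x y] show ?thesis by (simp add: complex_eq_iff)
qed

lemma linear_on_subspace_zero:
  assumes "complex_vector.subspace S" "linear_on_subspace S T" shows "T 0 = 0"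
proof -
  have "0 \<in> S" using assms(1) complex_vector.subspace_0 by blast
  then have "T (0 *\<^sub>C 0) = 0 *\<^sub>C T 0" using assms(2) unfolding linear_on_subspace_def by blast
  then show ?thesis by simp
qed

lemma linear_on_subspace_diff:
  assumes "complex_vector.subspace S" "linear_on_subspace S T" "x \<in> S" "y \<in> S"
  shows "T (x - y) = T x - T y"
proof -
  have "(-1) *\<^sub>C y \<in> S" using assms complex_vector.subspace_scale by blast
  then have "T (x + (-1) *\<^sub>C y) = T x + (-1) *\<^sub>C T y"
    using assms unfolding linear_on_subspace_def by metis
  then show ?thesis by (simp add: complex_vector.scale_minus_left scaleC_one)
qed

lemma linear_isometry_inj_on:
  assumes "complex_vector.subspace S" "linear_on_subspace S T" "\<forall>x\<in>S. norm (T x) = norm x"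
  shows "inj_on T S"
proof (rule inj_onI)
  fix x y assume xy: "x \<in> S" "y \<in> S" "T x = T y"
  have "x - y \<in> S" using xy assms(1) complex_vector.subspace_diff by blast
  then have "norm (x - y) = norm (T (x - y))" using assms(3) by simp
  also have "T (x - y) = 0" using linear_on_subspace_diff[OF assms(1,2) xy(1,2)] xy(3) by simp
  finally show "x = y" by simp
qed

section \<open>Subspaces\<close>

lemma subspace_closure:
  assumes "complex_vector.subspace (S :: 'h::chilbert_space set)"
  shows "complex_vector.subspace (closure S)"
proof (rule complex_vector.subspaceI)
  show "0 \<in> closure S" using assms complex_vector.subspace_0 closure_subset by blast
next
  fix x y assume "x \<in> closure S" "y \<in> closure S"
  then obtain f g where "\<forall>n. f n \<in> S" "f \<longlonglongrightarrow> x" "\<forall>n. g n \<in> S" "g \<longlonglongrightarrow> y"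
    unfolding closure_sequential by blast
  then have "\<forall>n. f n + g n \<in> S" "(\<lambda>n. f n + g n) \<longlonglongrightarrow> x + y"
    using assms complex_vector.subspace_add tendsto_add by blast+
  then show "x + y \<in> closure S" unfolding closure_sequential by (intro exI conjI)
next
  fix c x assume "x \<in> closure S"
  then obtain f where "\<forall>n. f n \<in> S" "f \<longlonglongrightarrow> x" unfolding closure_sequential by blast
  then have "\<forall>n. c *\<^sub>C f n \<in> S" "(\<lambda>n. c *\<^sub>C f n) \<longlonglongrightarrow> c *\<^sub>C x"
    using assms complex_vector.subspace_scale bounded_linear.tendsto[OF bounded_linear_scaleC] by blast+
  then show "c *\<^sub>C x \<in> closure S" unfolding closure_sequential by (intro exI conjI)
qed

lemma hilbert_subspace_closed_span: "hilbert_subspace (closed_span X)"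
  by (simp add: hilbert_subspace_def closed_span_def subspace_closure complex_vector.subspace_span)

lemma closed_span_superset: "X \<subseteq> closed_span X"
  unfolding closed_span_def using complex_vector.span_superset closure_subset by blast

lemma closed_span_minimal: "hilbert_subspace S \<Longrightarrow> X \<subseteq> S \<Longrightarrow> closed_span X \<subseteq> S"
  unfolding closed_span_def hilbert_subspace_def
  by (simp add: closure_minimal complex_vector.span_minimal)

lemma closed_span_mono: "X \<subseteq> Y \<Longrightarrow> closed_span X \<subseteq> closed_span Y"
  by (meson closed_span_minimal closed_span_superset hilbert_subspace_closed_span subset_trans)

text \<open>The set of agreement is a closed subspace, so identities between inner products need
  checking on basis vectors only. Since \<open>bounded_linear\<close> expresses real linearity,
  complex homogeneity is asked for separately.\<close>

lemma cinner_eq_on_closed_span: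
  assumes "\<And>b. b \<in> X \<Longrightarrow> f b = (g b :: complex)" "bounded_linear f" "bounded_linear g"
    and c: "\<And>c x. f (c *\<^sub>C x) = c * f x" "\<And>c x. g (c *\<^sub>C x) = c * g x"
    and "x \<in> closed_span X"
  shows "f x = g (x :: 'h::chilbert_space)"
proof -
  let ?S = "{x. f x = g x}"
  interpret f: bounded_linear f by fact
  interpret g: bounded_linear g by fact
  have "complex_vector.subspace ?S"
    by (rule complex_vector.subspaceI) (auto simp: f.add g.add c f.zero g.zero)
  moreover have "closed ?S"
    by (intro closed_Collect_eq linear_continuous_on assms)
  ultimately have "closed_span X \<subseteq> ?S"
    by (intro closed_span_minimal) (auto simp: hilbert_subspace_def assms)
  then show ?thesis using assms by blast
qed

section \<open>Square summable families\<close>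

lemma ell2_fun_sum: "ell2_fun (\<Sum>i\<in>F. f i) x = (\<Sum>i\<in>F. ell2_fun (f i) x)"
  by (induction F rule: infinite_finite_induct) (auto simp: ell2_fun_simps)

lemma norm_ell2_square: "(norm f)\<^sup>2 = (\<Sum>\<^sub>\<infinity>x. (cmod (ell2_fun f x))\<^sup>2)"
  unfolding norm_ell2_def ell2_norm_def by (rule real_sqrt_pow2) (simp add: infsum_nonneg)

lemma ell2_summable: "(\<lambda>x. (cmod (ell2_fun f x))\<^sup>2) summable_on A"
  using square_summable_ell2_fun[of f] unfolding square_summable_def
  by (rule summable_on_subset_banach) simp

lemma cinner_ket: "cinner (ket a) f = ell2_fun f a"
proof -
  have "cinner (ket a) f = (\<Sum>\<^sub>\<infinity>x\<in>{a}. cnj (ell2_fun (ket a) x) * ell2_fun f x)"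
    unfolding cinner_ell2_def by (rule infsum_cong_neutral) (auto simp: ell2_fun_ket)
  then show ?thesis by (simp add: ell2_fun_ket)
qed

lemma cinner_ket_ket: "cinner (ket a) (ket b) = (if a = b then 1 else 0)"
  by (simp add: cinner_ket ell2_fun_ket)

lemma norm_ket [simp]: "norm (ket a) = 1"
proof -
  have "complex_of_real ((norm (ket a))\<^sup>2) = 1"
    by (simp add: cinner_self[symmetric] cinner_ket_ket del: of_real_power)
  then have "(norm (ket a))\<^sup>2 = 1\<^sup>2" unfolding of_real_eq_1_iff by simp
  then show ?thesis by (rule power2_eq_imp_eq) auto
qed

lemma ket_in_ell2_on: "ket a \<in> ell2_on A \<longleftrightarrow> a \<in> A"
  by (auto simp: ell2_on_def ell2_fun_ket)

lemma ell2_on_mono: "A \<subseteq> B \<Longrightarrow> ell2_on A \<subseteq> ell2_on B" by (auto simp: ell2_on_def)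

lemma hilbert_subspace_ell2_on: "hilbert_subspace (ell2_on A)"
proof -
  have "complex_vector.subspace (ell2_on A)"
    by (rule complex_vector.subspaceI) (auto simp: ell2_on_def ell2_fun_simps ell2_fun_scaleC)
  moreover have "ell2_on A = (\<Inter>a\<in>- A. {f. cinner (ket a) f = 0})"
    by (auto simp: ell2_on_def cinner_ket)
  moreover have "closed {f. cinner (ket a) f = 0}" for a :: 'a
    by (intro closed_Collect_eq linear_continuous_on bounded_linear_cinner_right continuous_on_const)
  ultimately show ?thesis by (auto simp: hilbert_subspace_def)
qed

lemma ell2_partial_sum: "ell2_fun (\<Sum>x\<in>F. ell2_fun f x *\<^sub>C ket x) y
    = (if finite F \<and> y \<in> F then ell2_fun f y else 0)"
  by (cases "finite F") (simp_all add: ell2_fun_sum ell2_fun_scaleC ell2_fun_ket if_distrib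
      sum.delta ell2_fun_zero cong: if_cong)

lemma closed_span_ket: "closed_span (ket ` A) = ell2_on A"
proof
  show "closed_span (ket ` A) \<subseteq> ell2_on A"
    by (rule closed_span_minimal) (auto simp: hilbert_subspace_ell2_on ket_in_ell2_on)
next
  show "ell2_on A \<subseteq> closed_span (ket ` A)"
  proof
    fix f :: "'a ell2" assume f: "f \<in> ell2_on A"
    show "f \<in> closed_span (ket ` A)"
      unfolding closed_span_def closure_approachable
    proof (intro allI impI)
      fix e :: real assume e: "e > 0"
      let ?g = "\<lambda>x. (cmod (ell2_fun f x))\<^sup>2"
      have "(?g has_sum (norm f)\<^sup>2) UNIV"
        unfolding norm_ell2_square by (rule has_sum_infsum[OF ell2_summable])
      then obtain F where F: "finite F" "dist (sum ?g F) ((norm f)\<^sup>2) \<le> e\<^sup>2 / 2"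
        using has_sum_finite_approximation[where f="?g" and A=UNIV and \<epsilon>="e\<^sup>2 / 2"] e by (metis half_gt_zero zero_less_power)
      define h where "h = (\<Sum>x\<in>F \<inter> A. ell2_fun f x *\<^sub>C ket x)"
      have hx: "ell2_fun h x = (if x \<in> F then ell2_fun f x else 0)" for x
        using F(1) f by (auto simp: h_def ell2_partial_sum ell2_on_def)
      have "(norm (f - h))\<^sup>2 = (\<Sum>\<^sub>\<infinity>x. if x \<in> F then 0 else ?g x)"
        unfolding norm_ell2_square ell2_fun_diff hx by (rule infsum_cong) auto
      also have "\<dots> = infsum ?g (UNIV - F)" by (rule infsum_cong_neutral) auto
      also have "\<dots> = (norm f)\<^sup>2 - sum ?g F"
        unfolding norm_ell2_square using F(1)
        by (subst infsum_Diff) (auto intro: ell2_summable)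
      also have "\<dots> < e\<^sup>2" using F(2) zero_less_power[OF e, of 2] unfolding dist_real_def by linarith
      finally have "norm (f - h) < e" using e by (meson less_imp_le power_less_imp_less_base)
      moreover have "h \<in> complex_vector.span (ket ` A)"
        unfolding h_def
        by (intro complex_vector.span_sum complex_vector.span_scale complex_vector.span_base) auto
      ultimately show "\<exists>y\<in>complex_vector.span (ket ` A). dist y f < e"
        by (metis dist_norm norm_minus_commute)
    qed
  qed
qed

lemma cinner_ell2_on_eqI:
  assumes "y \<in> S" "z \<in> S" "hilbert_subspace S" "\<forall>x\<in>S. cinner x y = cinner x z"
  shows "y = z"
proof -
  have "y - z \<in> S" using assms(1-3) complex_vector.subspace_diff unfolding hilbert_subspace_def by blast
  then have "cinner (y - z) (y - z) = 0" using assms(4) by (simp add: cinner_diff_right)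
  then show ?thesis by simp
qed

lemma adjoint_on_eqI:
  assumes "hilbert_subspace S" "z \<in> S" "\<forall>x\<in>S. cinner (T x) y = cinner x z"
  shows "adjoint_on S T y = z"
  unfolding adjoint_on_def
proof (rule the_equality)
  fix z' assume z': "z' \<in> S \<and> (\<forall>x\<in>S. cinner (T x) y = cinner x z')"
  show "z' = z"
    by (rule cinner_ell2_on_eqI[of _ S]) (use z' assms in auto)
qed (use assms in blast)

lemma orth_proj_eqI:
  assumes "hilbert_subspace S" "y \<in> S" "\<forall>z\<in>S. cinner z (x - y) = 0"
  shows "orth_proj S x = y"
  unfolding orth_proj_def
proof (rule the_equality)
  fix y' assume y': "y' \<in> S \<and> (\<forall>z\<in>S. cinner z (x - y') = 0)"
  show "y' = y"
    by (rule cinner_ell2_on_eqI[of _ S]) (use y' assms in \<open>auto simp: cinner_diff_right\<close>)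
qed (use assms in blast)

section \<open>Weighted composition operators\<close>

text \<open>The action of a word, the projection onto a set of vertices and the unitary induced by a
  bijection of vertices all have this shape, which is stable under adjoints (with the inverse of
  \<open>h\<close>). Injectivity of \<open>h\<close> on \<open>S\<close> guarantees square
  summability.\<close>

definition pullop :: "'a set \<Rightarrow> ('a \<Rightarrow> 'b) \<Rightarrow> complex \<Rightarrow> 'b ell2 \<Rightarrow> 'a ell2" where
  "pullop S h c f = Abs_ell2 (\<lambda>x. if x \<in> S then c * ell2_fun f (h x) else 0)"

lemma pullop_summable:
  assumes "inj_on h S"
  shows "(\<lambda>x. (cmod (if x \<in> S then c * ell2_fun f (h x) else 0))\<^sup>2) summable_on UNIV"
proof -
  have "(\<lambda>x. (cmod (ell2_fun f x))\<^sup>2) summable_on h ` S" by (rule ell2_summable)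
  then have "(\<lambda>x. (cmod (ell2_fun f (h x)))\<^sup>2) summable_on S"
    using assms by (simp add: summable_on_reindex o_def)
  then have "(\<lambda>x. (cmod c)\<^sup>2 * (cmod (ell2_fun f (h x)))\<^sup>2) summable_on S"
    by (rule summable_on_cmult_right)
  then show ?thesis
    by (rule summable_on_cong_neutral[THEN iffD1, rotated -1])
      (auto simp: norm_mult power_mult_distrib)
qed

lemma ell2_fun_pullop:
  assumes "inj_on h S"
  shows "ell2_fun (pullop S h c f) = (\<lambda>x. if x \<in> S then c * ell2_fun f (h x) else 0)"
  unfolding pullop_def using pullop_summable[OF assms]
  by (intro Abs_ell2_inverse) (simp add: square_summable_def)

lemma norm_pullop:
  assumes "inj_on h S"
  shows "(norm (pullop S h c f))\<^sup>2 = (cmod c)\<^sup>2 * (\<Sum>\<^sub>\<infinity>x\<in>h ` S. (cmod (ell2_fun f x))\<^sup>2)"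
proof -
  have "(norm (pullop S h c f))\<^sup>2 = (\<Sum>\<^sub>\<infinity>x\<in>S. (cmod c)\<^sup>2 * (cmod (ell2_fun f (h x)))\<^sup>2)"
    unfolding norm_ell2_square ell2_fun_pullop[OF assms]
    by (rule infsum_cong_neutral) (auto simp: norm_mult power_mult_distrib)
  also have "\<dots> = (cmod c)\<^sup>2 * (\<Sum>\<^sub>\<infinity>x\<in>S. (cmod (ell2_fun f (h x)))\<^sup>2)"
    by (rule infsum_cmult_right')
  finally show ?thesis using assms by (simp add: infsum_reindex o_def)
qed

lemma norm_pullop_le:
  assumes "inj_on h S"
  shows "norm (pullop S h c f) \<le> cmod c * norm f"
proof -
  have "(\<Sum>\<^sub>\<infinity>x\<in>h ` S. (cmod (ell2_fun f x))\<^sup>2) \<le> (norm f)\<^sup>2"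
    unfolding norm_ell2_square by (rule infsum_mono2) (auto intro: ell2_summable)
  then have "(norm (pullop S h c f))\<^sup>2 \<le> (cmod c * norm f)\<^sup>2"
    unfolding norm_pullop[OF assms] power_mult_distrib by (rule mult_left_mono) simp
  then show ?thesis by (rule power2_le_imp_le) simp
qed

lemma norm_pullop_eq:
  assumes "inj_on h S" "f \<in> ell2_on (h ` S)" "cmod c = 1"
  shows "norm (pullop S h c f) = norm f"
proof -
  have "(\<Sum>\<^sub>\<infinity>x\<in>h ` S. (cmod (ell2_fun f x))\<^sup>2) = (norm f)\<^sup>2"
    unfolding norm_ell2_square
    by (rule infsum_cong_neutral) (use assms(2) in \<open>auto simp: ell2_on_def\<close>)
  then have "(norm (pullop S h c f))\<^sup>2 = (norm f)\<^sup>2"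
    by (simp add: norm_pullop[OF assms(1)] assms(3))
  then show ?thesis by (simp add: power2_eq_iff_nonneg)
qed

lemma pullop_add: "inj_on h S \<Longrightarrow> pullop S h c (f + g) = pullop S h c f + pullop S h c g"
  by (rule ell2_eqI) (simp add: ell2_fun_pullop ell2_fun_add algebra_simps)

lemma pullop_scaleC: "inj_on h S \<Longrightarrow> pullop S h c (d *\<^sub>C f) = d *\<^sub>C pullop S h c f"
  by (rule ell2_eqI) (simp add: ell2_fun_pullop ell2_fun_scaleC)

lemma pullop_in_ell2_on: "inj_on h S \<Longrightarrow> S \<subseteq> A \<Longrightarrow> pullop S h c f \<in> ell2_on A"
  by (auto simp: ell2_on_def ell2_fun_pullop)

lemma linear_pullop: "inj_on h S \<Longrightarrow> linear_on_subspace X (pullop S h c)"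
  by (simp add: linear_on_subspace_def pullop_add pullop_scaleC)

lemma bounded_operator_pullop:
  assumes "inj_on h S" "S \<subseteq> A"
  shows "bounded_operator_on (ell2_on A) (pullop S h c)"
  unfolding bounded_operator_on_def
proof (intro conjI exI ballI)
  show "pullop S h c ` ell2_on A \<subseteq> ell2_on A"
    using assms by (intro image_subsetI pullop_in_ell2_on)
  show "linear_on_subspace (ell2_on A) (pullop S h c)" by (rule linear_pullop) fact
  show "norm (pullop S h c x) \<le> cmod c * norm x" for x by (rule norm_pullop_le) fact
qed

lemma pullop_ket:
  assumes "inj_on h S" "x \<in> S"
  shows "pullop S h c (ket (h x)) = c *\<^sub>C ket x"
  by (rule ell2_eqI) (use assms in \<open>auto simp: ell2_fun_pullop ell2_fun_scaleC ell2_fun_ket inj_on_eq_iff\<close>)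

lemma pullop_ket_0:
  assumes "inj_on h S" "y \<notin> h ` S"
  shows "pullop S h c (ket y) = 0"
  by (rule ell2_eqI) (use assms in \<open>auto simp: ell2_fun_pullop ell2_fun_zero ell2_fun_ket\<close>)

text \<open>Every \<open>ket a\<close> with \<open>a\<close> outside the image of \<open>S\<close>
  under \<open>h\<close> lies in the kernel. A vector orthogonal to the kernel is therefore
  supported on that image, where the norm is preserved.\<close>

lemma partial_isometry_pullop:
  assumes "inj_on h S" "S \<subseteq> A" "h ` S \<subseteq> A" "cmod c = 1"
  shows "partial_isometry_on (ell2_on A) (pullop S h c)"
  unfolding partial_isometry_on_def
proof (intro conjI ballI impI bounded_operator_pullop assms)
  fix x assume x: "x \<in> ell2_on A"
    and orth: "\<forall>y\<in>ell2_on A. pullop S h c y = 0 \<longrightarrow> cinner y x = 0"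
  have "ell2_fun x a = 0" if "a \<notin> h ` S" for a
  proof (cases "a \<in> A")
    case True
    then show ?thesis using orth pullop_ket_0[OF assms(1) that] ket_in_ell2_on cinner_ket by metis
  qed (use x in \<open>auto simp: ell2_on_def\<close>)
  then show "norm (pullop S h c x) = norm x"
    by (intro norm_pullop_eq assms) (simp add: ell2_on_def)
qed

lemma cinner_pullop:
  assumes "inj_on h S"
  shows "cinner (pullop S h c f) g = cinner f (pullop (h ` S) (inv_into S h) (cnj c) g)"
proof -
  have inj: "inj_on (inv_into S h) (h ` S)" by (simp add: inj_on_inv_into)
  have "cinner (pullop S h c f) g = (\<Sum>\<^sub>\<infinity>x\<in>S. cnj (ell2_fun f (h x)) * (cnj c * ell2_fun g x))"
    unfolding cinner_ell2_def ell2_fun_pullop[OF assms]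
    by (rule infsum_cong_neutral) auto
  also have "\<dots> = (\<Sum>\<^sub>\<infinity>y\<in>h ` S. cnj (ell2_fun f y) * (cnj c * ell2_fun g (inv_into S h y)))"
    using assms by (simp add: infsum_reindex o_def cong: infsum_cong)
  also have "\<dots> = cinner f (pullop (h ` S) (inv_into S h) (cnj c) g)"
    unfolding cinner_ell2_def ell2_fun_pullop[OF inj]
    by (rule infsum_cong_neutral) auto
  finally show ?thesis .
qed

lemma adjoint_pullop:
  assumes "inj_on h S" "h ` S \<subseteq> A"
  shows "adjoint_on (ell2_on A) (pullop S h c) g = pullop (h ` S) (inv_into S h) (cnj c) g"
  by (rule adjoint_on_eqI)
    (use assms in \<open>auto simp: hilbert_subspace_ell2_on cinner_pullop inj_on_inv_into intro: pullop_in_ell2_on\<close>)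

lemma orth_proj_ell2_on: "orth_proj (ell2_on A) f = pullop A (\<lambda>x. x) 1 f"
proof (rule orth_proj_eqI)
  show "pullop A (\<lambda>x. x) 1 f \<in> ell2_on A" by (rule pullop_in_ell2_on) auto
  show "\<forall>z\<in>ell2_on A. cinner z (f - pullop A (\<lambda>x. x) 1 f) = 0"
    by (auto simp: cinner_ell2_def ell2_fun_diff ell2_fun_pullop ell2_on_def intro!: infsum_0)
qed (rule hilbert_subspace_ell2_on)

lemma hilbert_subspace_scale: "hilbert_subspace S \<Longrightarrow> x \<in> S \<Longrightarrow> d *\<^sub>C x \<in> S"
  unfolding hilbert_subspace_def using complex_vector.subspace_scale by blast

lemma hilbert_subspace_unscale:
  assumes "hilbert_subspace S" "d *\<^sub>C x \<in> S" "d \<noteq> 0"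
  shows "x \<in> S"
  using hilbert_subspace_scale[OF assms(1,2), of "1 / d"] assms(3)
  by (simp add: scaleC_scaleC scaleC_one)

section \<open>Words\<close>

fun nblue :: "('m + 'n) list \<Rightarrow> nat" where
  "nblue [] = 0"
| "nblue (Inl i # u) = Suc (nblue u)"
| "nblue (Inr j # u) = nblue u"

fun nred :: "('m + 'n) list \<Rightarrow> nat" where
  "nred [] = 0"
| "nred (Inl i # u) = nred u"
| "nred (Inr j # u) = Suc (nred u)"

lemma sum_list_induct [case_names Nil Blue Red]:
  assumes "P []" "\<And>i u. P u \<Longrightarrow> P (Inl i # u)" "\<And>j u. P u \<Longrightarrow> P (Inr j # u)"
  shows "P u"
proof (induction u)
  case (Cons a u)
  then show ?case using assms by (cases a) auto
qed (rule assms)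

lemma nblue_append: "nblue (u @ v) = nblue u + nblue v"
  by (induction u rule: sum_list_induct) auto

lemma nred_append: "nred (u @ v) = nred u + nred v"
  by (induction u rule: sum_list_induct) auto

lemma nblue_map [simp]: "nblue (map Inl is) = length is" "nblue (map Inr js) = 0"
  by (induction "is", auto) (induction js, auto)

lemma nred_map [simp]: "nred (map Inl is) = 0" "nred (map Inr js) = length js"
  by (induction "is", auto) (induction js, auto)

lemma theta_cong_degree:
  assumes "theta_cong \<theta> u v" shows "nblue u = nblue v" "nred u = nred v"
  using assms by (induction rule: theta_cong.induct) (auto simp: nblue_append nred_append)

lemma carrier_F_theta: "w \<in> carrier (F_theta \<theta>) \<longleftrightarrow> (\<exists>u. w = word_class \<theta> u)"
  by (auto simp: F_theta_def)

lemma word_class_in_carrier [simp]: "word_class \<theta> u \<in> carrier (F_theta \<theta>)"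
  by (auto simp: F_theta_def)

lemma one_F_theta: "\<one>\<^bsub>F_theta \<theta>\<^esub> = word_class \<theta> []"
  by (simp add: F_theta_def)

lemma gen_in_carrier [simp]:
  "gen_e \<theta> i \<in> carrier (F_theta \<theta>)" "gen_f \<theta> j \<in> carrier (F_theta \<theta>)"
  by (auto simp: gen_e_def gen_f_def)

lemma gen_e_gen_f:
  "\<theta> (i, j) = (i', j') \<Longrightarrow> gen_e \<theta> i \<otimes>\<^bsub>F_theta \<theta>\<^esub> gen_f \<theta> j = gen_f \<theta> j' \<otimes>\<^bsub>F_theta \<theta>\<^esub> gen_e \<theta> i'"
  unfolding gen_e_def gen_f_def F_theta_mult_word_class word_class_eq_iff
  by (simp add: theta_cong.commutation)

text \<open>\<open>adjoint_on\<close> is a definite description and says nothing by itself. This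
  predicate records that adjoints exist inside the subspace; for the graph models they are given
  explicitly by \<open>cinner_pullop\<close>.\<close>

definition adjointable ::
  "('m \<times> 'n \<Rightarrow> 'm \<times> 'n) \<Rightarrow> 'h::chilbert_space set \<Rightarrow> ('m, 'n, 'h) rep \<Rightarrow> bool" where
  "adjointable \<theta> H \<sigma> \<longleftrightarrow>
    (\<forall>w\<in>carrier (F_theta \<theta>). \<forall>y\<in>H. \<exists>z\<in>H. \<forall>x\<in>H. cinner (\<sigma> w x) y = cinner x z)"

section \<open>Graphs with unique predecessors\<close>

text \<open>
  The graph of an atomic representation is encoded by its predecessor maps: \<open>b\<close> and \<open>r\<close> send a
  vertex to the source of its unique incoming blue, respectively red, edge, and \<open>I\<close> and \<open>J\<close> give
  the labels of these edges.
\<close>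

locale pred_system =
  fixes \<theta> :: "'m \<times> 'n \<Rightarrow> 'm \<times> 'n" and A :: "'w set"
    and b r :: "'w \<Rightarrow> 'w" and I :: "'w \<Rightarrow> 'm" and J :: "'w \<Rightarrow> 'n"
  assumes bij_theta: "bij \<theta>"
    and b_closed [simp]: "x \<in> A \<Longrightarrow> b x \<in> A"
    and r_closed [simp]: "x \<in> A \<Longrightarrow> r x \<in> A"
    and b_r: "x \<in> A \<Longrightarrow> b (r x) = r (b x)"
    and square: "x \<in> A \<Longrightarrow> \<theta> (I x, J (b x)) = (I (r x), J x)"
    and b_inj: "x \<in> A \<Longrightarrow> y \<in> A \<Longrightarrow> b x = b y \<Longrightarrow> I x = I y \<Longrightarrow> x = y"
    and r_inj: "x \<in> A \<Longrightarrow> y \<in> A \<Longrightarrow> r x = r y \<Longrightarrow> J x = J y \<Longrightarrow> x = y"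
begin

definition bwd :: "nat \<Rightarrow> nat \<Rightarrow> 'w \<Rightarrow> 'w" where
  "bwd k l x = (b ^^ k) ((r ^^ l) x)"

text \<open>Products act from right to left, so the head of a word is the last edge of its path, the
  one entering \<open>x\<close>. The rest of the word is compared with the path ending at the source
  of that edge.\<close>

fun matches :: "('m + 'n) list \<Rightarrow> 'w \<Rightarrow> bool" where
  "matches [] x \<longleftrightarrow> True"
| "matches (Inl i # u) x \<longleftrightarrow> I x = i \<and> matches u (b x)"
| "matches (Inr j # u) x \<longleftrightarrow> J x = j \<and> matches u (r x)"

lemma r_pow_closed [simp]: "x \<in> A \<Longrightarrow> (r ^^ l) x \<in> A"
  by (induction l) auto

lemma b_pow_closed [simp]: "x \<in> A \<Longrightarrow> (b ^^ k) x \<in> A"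
  by (induction k) auto

lemma bwd_closed [simp]: "x \<in> A \<Longrightarrow> bwd k l x \<in> A"
  by (simp add: bwd_def)

lemma bwd_0 [simp]: "bwd 0 0 x = x"
  by (simp add: bwd_def)

lemma b_pow_r: "x \<in> A \<Longrightarrow> (b ^^ k) (r x) = r ((b ^^ k) x)"
  by (induction k) (auto simp: b_r)

lemma b_pow_r_pow: "x \<in> A \<Longrightarrow> (b ^^ k) ((r ^^ l) x) = (r ^^ l) ((b ^^ k) x)"
  by (induction l) (auto simp: b_pow_r)

lemma bwd_bwd: "x \<in> A \<Longrightarrow> bwd k l (bwd k' l' x) = bwd (k + k') (l + l') x"
  by (simp add: bwd_def funpow_add b_pow_r_pow[symmetric])

lemma b_eq_bwd: "b x = bwd 1 0 x" and r_eq_bwd: "r x = bwd 0 1 x"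
  by (simp_all add: bwd_def)

lemma bwd_b: "x \<in> A \<Longrightarrow> bwd k l (b x) = bwd (Suc k) l x"
  and bwd_r: "x \<in> A \<Longrightarrow> bwd k l (r x) = bwd k (Suc l) x"
  and b_bwd: "x \<in> A \<Longrightarrow> b (bwd k l x) = bwd (Suc k) l x"
  and r_bwd: "x \<in> A \<Longrightarrow> r (bwd k l x) = bwd k (Suc l) x"
  by (simp_all add: b_eq_bwd r_eq_bwd bwd_bwd)

lemma theta_eq_iff: "\<theta> p = \<theta> q \<longleftrightarrow> p = q"
  using bij_theta by (simp add: bij_def inj_eq)

lemma matches_append:
  "x \<in> A \<Longrightarrow> matches (u @ v) x \<longleftrightarrow> matches u x \<and> matches v (bwd (nblue u) (nred u) x)"
  by (induction u arbitrary: x rule: sum_list_induct) (auto simp: bwd_b bwd_r)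

text \<open>A commutation relation is one square of the graph: \<open>square\<close> gives one
  direction, injectivity of \<open>\<theta>\<close> the other.\<close>

lemma matches_theta_cong:
  assumes "theta_cong \<theta> u v" "x \<in> A" shows "matches u x \<longleftrightarrow> matches v x"
  using assms
proof (induction arbitrary: x rule: theta_cong.induct)
  case (commutation i j i' j')
  then show ?case using square[of x] by (auto, (metis Pair_inject theta_eq_iff)+)
next
  case (append u v u' v')
  then show ?case using theta_cong_degree[OF append.hyps(1)] by (simp add: matches_append)
qed auto

text \<open>A path is determined by its source and its labels: the injectivity axioms undo the
  backward steps one at a time.\<close>

lemma matches_bwd_inj:
  assumes "matches u x" "matches u y" "x \<in> A" "y \<in> A"
    and "bwd (nblue u) (nred u) x = bwd (nblue u) (nred u) y"
  shows "x = y"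
  using assms
proof (induction u arbitrary: x y rule: sum_list_induct)
  case (Blue i u)
  then have "b x = b y" using Blue.IH[of "b x" "b y"] by (simp add: bwd_b)
  then show ?case using Blue.prems b_inj by auto
next
  case (Red j u)
  then have "r x = r y" using Red.IH[of "r x" "r y"] by (simp add: bwd_r)
  then show ?case using Red.prems r_inj by auto
qed simp

lemma inj_on_bwd: "inj_on (bwd (nblue u) (nred u)) {x \<in> A. matches u x}"
  by (rule inj_onI) (use matches_bwd_inj in auto)

lemma ex_matching_word:
  assumes "x \<in> A"
  shows "\<exists>is js. length is = k \<and> length js = l \<and> matches (map Inl is @ map Inr js) x"
proof (use assms in \<open>induction k arbitrary: x\<close>)
  case 0
  then show ?case
  proof (induction l arbitrary: x)
    case (Suc l)
    then obtain js where "length js = l" "matches (map Inr js) (r x)" using r_closed by fastforce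
    then show ?case using Suc by (intro exI[of _ "[]"] exI[of _ "J x # js"]) auto
  qed simp
next
  case (Suc k)
  then obtain "is" js where "length is = k" "length js = l" "matches (map Inl is @ map Inr js) (b x)"
    using b_closed by blast
  then show ?case using Suc by (intro exI[of _ "I x # is"] exI[of _ js]) auto
qed

lemma ex_word:
  assumes "x \<in> A" obtains u where "matches u x" "nblue u = k" "nred u = l"
  using ex_matching_word[OF assms, of k l] that by (auto simp: nblue_append nred_append)

subsection \<open>The representation with constant weights\<close>

text \<open>An element of the semigroup is a congruence class, so a word is picked from it.
  \<open>rho_word\<close> shows that the choice is immaterial, because congruent words have equal
  letter counts and match the same vertices.\<close>

definition rho :: "complex \<Rightarrow> complex \<Rightarrow> ('m, 'n, 'w ell2) rep" where
  "rho a c w = (let u = (SOME u. u \<in> w) in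
     pullop {x \<in> A. matches u x} (bwd (nblue u) (nred u)) (a ^ nblue u * c ^ nred u))"

lemma rho_word:
  "rho a c (word_class \<theta> u)
    = pullop {x \<in> A. matches u x} (bwd (nblue u) (nred u)) (a ^ nblue u * c ^ nred u)"
proof -
  define v where "v = (SOME v. v \<in> word_class \<theta> u)"
  have "u \<in> word_class \<theta> u" by (simp add: word_class_def theta_cong.refl)
  then have "v \<in> word_class \<theta> u" unfolding v_def by (rule someI)
  then have uv: "theta_cong \<theta> u v" by (simp add: word_class_def)
  then have "{x \<in> A. matches v x} = {x \<in> A. matches u x}" using matches_theta_cong by blast
  then show ?thesis using theta_cong_degree[OF uv]
    by (simp add: rho_def v_def[symmetric])
qed

lemma ell2_fun_rho_word:
  "ell2_fun (rho a c (word_class \<theta> u) f) = (\<lambda>x. if x \<in> A \<and> matches u x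
     then a ^ nblue u * c ^ nred u * ell2_fun f (bwd (nblue u) (nred u) x) else 0)"
  by (simp add: rho_word ell2_fun_pullop[OF inj_on_bwd])

lemma rho_word_ket:
  assumes "x \<in> A" "matches u x"
  shows "rho a c (word_class \<theta> u) (ket (bwd (nblue u) (nred u) x))
    = (a ^ nblue u * c ^ nred u) *\<^sub>C ket x"
  unfolding rho_word using assms by (intro pullop_ket inj_on_bwd) auto

lemma image_bwd_subset: "bwd k l ` {x \<in> A. Q x} \<subseteq> A"
  by auto

lemma adjointable_rho: "adjointable \<theta> (ell2_on A) (rho a c)"
  unfolding adjointable_def
proof (intro ballI)
  fix w y assume "w \<in> carrier (F_theta \<theta>)"
  then obtain u where w: "w = word_class \<theta> u" unfolding carrier_F_theta by blast
  let ?S = "{x \<in> A. matches u x}" and ?h = "bwd (nblue u) (nred u)"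
  have "pullop (?h ` ?S) (inv_into ?S ?h) (cnj (a ^ nblue u * c ^ nred u)) y \<in> ell2_on A"
    by (intro pullop_in_ell2_on inj_on_inv_into image_bwd_subset) simp
  then show "\<exists>z\<in>ell2_on A. \<forall>x\<in>ell2_on A. cinner (rho a c w x) y = cinner x z"
    unfolding w rho_word cinner_pullop[OF inj_on_bwd] by blast
qed

context
  fixes a c :: complex
  assumes a: "cmod a = 1" and c: "cmod c = 1"
begin

lemma representation_rho: "representation \<theta> (ell2_on A) (rho a c)"
  unfolding representation_def
proof (intro conjI ballI)
  show "partial_isometry_on (ell2_on A) (rho a c w)" if "w \<in> carrier (F_theta \<theta>)" for w
    using that unfolding carrier_F_theta
    by (elim exE) (auto simp: rho_word norm_mult norm_power a c
        intro!: partial_isometry_pullop inj_on_bwd)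
  show "rho a c \<one>\<^bsub>F_theta \<theta>\<^esub> f = f" if "f \<in> ell2_on A" for f
    unfolding one_F_theta
    by (rule ell2_eqI) (use that in \<open>auto simp: ell2_fun_rho_word ell2_on_def\<close>)
  show "rho a c (v \<otimes>\<^bsub>F_theta \<theta>\<^esub> w) f = rho a c v (rho a c w f)"
    if "v \<in> carrier (F_theta \<theta>)" "w \<in> carrier (F_theta \<theta>)" for v w f
  proof -
    from that obtain u u' where "v = word_class \<theta> u" "w = word_class \<theta> u'"
      unfolding carrier_F_theta by blast
    then show ?thesis
      by (intro ell2_eqI) (auto simp: F_theta_mult_word_class ell2_fun_rho_word matches_append
          nblue_append nred_append bwd_bwd power_add add.commute)
  qed
qed (rule hilbert_subspace_ell2_on)

lemma adjoint_rho_word: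
  "adjoint_on (ell2_on A) (rho a c (word_class \<theta> u)) f
    = pullop (bwd (nblue u) (nred u) ` {x \<in> A. matches u x})
       (inv_into {x \<in> A. matches u x} (bwd (nblue u) (nred u))) (cnj (a ^ nblue u * c ^ nred u)) f"
  unfolding rho_word by (intro adjoint_pullop inj_on_bwd image_bwd_subset)

text \<open>The range projection of a word is the restriction to the vertices it leads to; the
  weights cancel because they are unimodular. Defect freeness and irreducibility both rest on this
  formula.\<close>

lemma rho_adjoint_rho:
  "rho a c (word_class \<theta> u) (adjoint_on (ell2_on A) (rho a c (word_class \<theta> u)) f)
    = pullop {x \<in> A. matches u x} (\<lambda>x. x) 1 f"
proof (rule ell2_eqI)
  let ?S = "{x \<in> A. matches u x}" and ?h = "bwd (nblue u) (nred u)" and ?d = "a ^ nblue u * c ^ nred u"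
  have inj: "inj_on (inv_into ?S ?h) (?h ` ?S)" by (simp add: inj_on_inv_into)
  have d: "?d * cnj ?d = 1"
    unfolding complex_norm_square[symmetric] by (simp add: norm_mult norm_power a c)
  fix x
  show "ell2_fun (rho a c (word_class \<theta> u) (adjoint_on (ell2_on A) (rho a c (word_class \<theta> u)) f)) x
    = ell2_fun (pullop ?S (\<lambda>x. x) 1 f) x"
  proof (cases "x \<in> ?S")
    case True
    then have "?h x \<in> ?h ` ?S" "inv_into ?S ?h (?h x) = x"
      by (auto simp: inv_into_f_f[OF inj_on_bwd])
    then show ?thesis using True d
      unfolding adjoint_rho_word
      by (simp add: ell2_fun_rho_word ell2_fun_pullop[OF inj] ell2_fun_pullop mult.assoc[symmetric])
  qed (auto simp: ell2_fun_rho_word ell2_fun_pullop)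
qed

lemma rho_word_adjoint_ket:
  assumes "x \<in> A" "matches u x"
  shows "adjoint_on (ell2_on A) (rho a c (word_class \<theta> u)) (ket x)
    = cnj (a ^ nblue u * c ^ nred u) *\<^sub>C ket (bwd (nblue u) (nred u) x)"
proof -
  let ?S = "{x \<in> A. matches u x}" and ?h = "bwd (nblue u) (nred u)"
  have inj: "inj_on (inv_into ?S ?h) (?h ` ?S)" by (simp add: inj_on_inv_into)
  have "inv_into ?S ?h (?h x) = x" using assms by (intro inv_into_f_f inj_on_bwd) auto
  then show ?thesis
    unfolding adjoint_rho_word using pullop_ket[OF inj, of "?h x"] assms by auto
qed

end

end

text \<open>Every vertex carries exactly one label of each colour, so the range projections of the
  generators of one colour cut along a partition of \<open>A\<close>.\<close>

lemma (in pred_system) defect_free_rho: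
  fixes a c
  assumes "finite (UNIV :: 'm set)" "finite (UNIV :: 'n set)"
    and "cmod a = 1" "cmod c = 1" and f: "f \<in> ell2_on A"
  shows "(\<Sum>i\<in>UNIV. rho a c (gen_e \<theta> i) (adjoint_on (ell2_on A) (rho a c (gen_e \<theta> i)) f)) = f"
    and "(\<Sum>j\<in>UNIV. rho a c (gen_f \<theta> j) (adjoint_on (ell2_on A) (rho a c (gen_f \<theta> j)) f)) = f"
proof -
  have e: "ell2_fun (pullop {x \<in> A. matches [Inl i] x} (\<lambda>x. x) 1 f) x
      = (if i = I x then ell2_fun f x else 0)" for x i
    using f by (auto simp: ell2_fun_pullop ell2_on_def)
  have f': "ell2_fun (pullop {x \<in> A. matches [Inr j] x} (\<lambda>x. x) 1 f) x
      = (if j = J x then ell2_fun f x else 0)" for x j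
    using f by (auto simp: ell2_fun_pullop ell2_on_def)
  show "(\<Sum>i\<in>UNIV. rho a c (gen_e \<theta> i) (adjoint_on (ell2_on A) (rho a c (gen_e \<theta> i)) f)) = f"
    unfolding gen_e_def rho_adjoint_rho[OF assms(3,4)]
    by (rule ell2_eqI) (simp only: ell2_fun_sum e sum.delta assms UNIV_I if_True)
  show "(\<Sum>j\<in>UNIV. rho a c (gen_f \<theta> j) (adjoint_on (ell2_on A) (rho a c (gen_f \<theta> j)) f)) = f"
    unfolding gen_f_def rho_adjoint_rho[OF assms(3,4)]
    by (rule ell2_eqI) (simp only: ell2_fun_sum f' sum.delta assms UNIV_I if_True)
qed

text \<open>The additional axioms say that an edge of each label leaves every vertex. This turns the
  partial isometries into isometries; it fails in general for the predecessor-closed sets on which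
  group constructions live.\<close>

locale full_system = pred_system \<theta> A b r I J
  for \<theta> :: "'m \<times> 'n \<Rightarrow> 'm \<times> 'n" and A :: "'w set" and b r I J +
  assumes b_ex: "y \<in> A \<Longrightarrow> \<exists>x\<in>A. b x = y \<and> I x = i"
    and r_ex: "y \<in> A \<Longrightarrow> \<exists>x\<in>A. r x = y \<and> J x = j"
begin

lemma matches_bwd_ex: "y \<in> A \<Longrightarrow> \<exists>x\<in>A. matches u x \<and> bwd (nblue u) (nred u) x = y"
proof (induction u arbitrary: y rule: sum_list_induct)
  case (Blue i u)
  then obtain z where "z \<in> A" "matches u z" "bwd (nblue u) (nred u) z = y" by blast
  moreover obtain x where "x \<in> A" "b x = z" "I x = i" using b_ex[OF \<open>z \<in> A\<close>] by blast
  ultimately show ?case using bwd_b by fastforce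
next
  case (Red j u)
  then obtain z where "z \<in> A" "matches u z" "bwd (nblue u) (nred u) z = y" by blast
  moreover obtain x where "x \<in> A" "r x = z" "J x = j" using r_ex[OF \<open>z \<in> A\<close>] by blast
  ultimately show ?case using bwd_r by fastforce
qed auto

lemma image_bwd_eq: "bwd (nblue u) (nred u) ` {x \<in> A. matches u x} = A"
proof
  show "bwd (nblue u) (nred u) ` {x \<in> A. matches u x} \<subseteq> A" by (rule image_bwd_subset)
  show "A \<subseteq> bwd (nblue u) (nred u) ` {x \<in> A. matches u x}"
    using matches_bwd_ex[of _ u] by (auto simp: image_iff)
qed

lemma isometric_rho:
  assumes "cmod a = 1" "cmod c = 1"
  shows "isometric_representation \<theta> (ell2_on A) (rho a c)"
  unfolding isometric_representation_def isometry_on_def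
proof (intro conjI ballI representation_rho assms)
  fix w assume "w \<in> carrier (F_theta \<theta>)"
  then obtain u where w: "w = word_class \<theta> u" unfolding carrier_F_theta by blast
  show "bounded_operator_on (ell2_on A) (rho a c w)"
    unfolding w rho_word by (intro bounded_operator_pullop inj_on_bwd) auto
  show "norm (rho a c w f) = norm f" if "f \<in> ell2_on A" for f
    unfolding w rho_word using that assms
    by (intro norm_pullop_eq inj_on_bwd) (auto simp: image_bwd_eq norm_mult norm_power)
qed

end

subsection \<open>Irreducibility\<close>

lemma ell2_small_tail:
  assumes "e > 0"
  obtains F where "finite F" "(\<Sum>\<^sub>\<infinity>x\<in>- F. (cmod (ell2_fun f x))\<^sup>2) < e"
proof -
  let ?g = "\<lambda>x. (cmod (ell2_fun f x))\<^sup>2"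
  obtain F where F: "finite F" "dist (sum ?g F) (infsum ?g UNIV) \<le> e / 2"
    using infsum_finite_approximation[OF ell2_summable, where \<epsilon>="e / 2"] assms
    by (metis half_gt_zero)
  have "infsum ?g (- F) = infsum ?g UNIV - sum ?g F"
    unfolding Compl_eq_Diff_UNIV using F(1)
    by (subst infsum_Diff) (auto intro: ell2_summable)
  also have "\<dots> < e" using F(2) assms unfolding dist_real_def by linarith
  finally show ?thesis using that F(1) by blast
qed

context pred_system
begin

text \<open>Common ancestors replace undirected paths: since the predecessor maps commute, having a
  common ancestor survives passing along an edge in either direction.\<close>

definition connected :: bool where
  "connected \<longleftrightarrow> A \<noteq> {} \<and> (\<forall>x\<in>A. \<forall>y\<in>A. \<exists>k l k' l'. bwd k l x = bwd k' l' y)"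

definition same_tail :: "'w \<Rightarrow> 'w \<Rightarrow> bool" where
  "same_tail x y \<longleftrightarrow> (\<forall>k l. I (bwd k l x) = I (bwd k l y) \<and> J (bwd k l x) = J (bwd k l y))"

text \<open>A label at depth \<open>(k, l)\<close> is read off by a word of that degree followed by
  one more letter. In contrapositive form, vertices with different tails are separated by a
  word.\<close>

lemma same_tail_if_matches:
  assumes "x \<in> A" "y \<in> A" "\<And>u. matches u x \<Longrightarrow> matches u y"
  shows "same_tail x y"
  unfolding same_tail_def
proof (intro allI)
  fix k l
  obtain u where u: "matches u x" "nblue u = k" "nred u = l" using ex_word assms(1) by blast
  have "matches (u @ [Inl (I (bwd k l x))]) x" "matches (u @ [Inr (J (bwd k l x))]) x"
    using u assms by (simp_all add: matches_append)
  then have "matches (u @ [Inl (I (bwd k l x))]) y" "matches (u @ [Inr (J (bwd k l x))]) y"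
    using assms(3) by blast+
  then show "I (bwd k l x) = I (bwd k l y) \<and> J (bwd k l x) = J (bwd k l y)"
    using u assms(1,2) by (simp add: matches_append)
qed

text \<open>
  The projections \<open>\<rho>(u)\<rho>(u)\<^sup>*\<close> over the words \<open>u\<close> leading into \<open>x\<close> decrease strongly to the projection
  onto the vertices with the same label tail as \<open>x\<close>; if tails separate vertices, this is \<open>\<complex>x\<close>.
\<close>

lemma irreducible_rho:
  assumes a: "cmod a = 1" "cmod c = 1" and conn: connected
    and sep: "\<And>x y. x \<in> A \<Longrightarrow> y \<in> A \<Longrightarrow> same_tail x y \<Longrightarrow> x = y"
  shows "irreducible_rep \<theta> (ell2_on A) (rho a c)"
  unfolding irreducible_rep_def
proof (intro allI impI)
  fix N assume red: "reducing \<theta> (ell2_on A) (rho a c) N"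
  then have sub: "complex_vector.subspace N" and cl: "closed N" and NA: "N \<subseteq> ell2_on A"
    by (auto simp: reducing_def hilbert_subspace_def)
  have inv: "rho a c (word_class \<theta> u) f \<in> N"
      "adjoint_on (ell2_on A) (rho a c (word_class \<theta> u)) f \<in> N" if "f \<in> N" for u f
  proof -
    have "rho a c (word_class \<theta> u) ` N \<subseteq> N \<and> adjoint_on (ell2_on A) (rho a c (word_class \<theta> u)) ` N \<subseteq> N"
      using red word_class_in_carrier unfolding reducing_def by blast
    then show "rho a c (word_class \<theta> u) f \<in> N"
      "adjoint_on (ell2_on A) (rho a c (word_class \<theta> u)) f \<in> N" using that by blast+
  qed
  have proj: "pullop {x \<in> A. matches u x} (\<lambda>x. x) 1 f \<in> N" if "f \<in> N" for u f
    unfolding rho_adjoint_rho[OF a, symmetric] by (intro inv that)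
  have scale: "ket x \<in> N" if "d *\<^sub>C ket x \<in> N" "d \<noteq> 0" for d x
    using hilbert_subspace_unscale that red unfolding reducing_def by blast
  have d0: "a ^ k * c ^ l \<noteq> 0" for k l using a by auto
  show "N = {0} \<or> N = ell2_on A"
  proof (cases "N = {0}")
    case False
    then obtain f where f: "f \<in> N" "f \<noteq> 0" using sub complex_vector.subspace_0 by blast
    then obtain x where fx: "ell2_fun f x \<noteq> 0"
      using ell2_eqI[of f 0] by (auto simp: ell2_fun_zero)
    then have x: "x \<in> A" using f NA by (auto simp: ell2_on_def)
    \<comment> \<open>One range projection for each \<open>y\<close> in \<open>F\<close> removes
      that coordinate. The coordinate at \<open>x\<close> is kept throughout, and no coordinate ever
      grows.\<close>
    have approx: "\<exists>g\<in>N. ell2_fun g x = ell2_fun f x \<and> (\<forall>y\<in>F. ell2_fun g y = 0) \<and>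
        (\<forall>z. cmod (ell2_fun g z) \<le> cmod (ell2_fun f z))" if "finite F" "F \<subseteq> A - {x}" for F
      using that
    proof (induction F)
      case empty
      then show ?case using f(1) by auto
    next
      case (insert y F)
      then obtain g where g: "g \<in> N" "ell2_fun g x = ell2_fun f x" "\<forall>y\<in>F. ell2_fun g y = 0"
        "\<forall>z. cmod (ell2_fun g z) \<le> cmod (ell2_fun f z)" by blast
      obtain u where u: "matches u x" "\<not> matches u y"
        using same_tail_if_matches[of x y] sep[of x y] x insert.prems by blast
      let ?g = "pullop {x \<in> A. matches u x} (\<lambda>x. x) 1 g"
      have "ell2_fun ?g z = (if z \<in> A \<and> matches u z then ell2_fun g z else 0)" for z
        by (simp add: ell2_fun_pullop)
      then show ?case using g u x proj[OF g(1), of u]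
        by (intro bexI[of _ ?g]) auto
    qed
    \<comment> \<open>The error vanishes on \<open>F\<close> by the choice of \<open>g\<close>; off
      \<open>F\<close> it is dominated by the tail of \<open>f\<close>.\<close>
    have "ell2_fun f x *\<^sub>C ket x \<in> closure N"
      unfolding closure_approachable
    proof (intro allI impI)
      fix e :: real assume e: "e > 0"
      then obtain F where F: "finite F" "(\<Sum>\<^sub>\<infinity>x\<in>- F. (cmod (ell2_fun f x))\<^sup>2) < e\<^sup>2"
        using ell2_small_tail[of "e\<^sup>2" f] by auto
      obtain g where g: "g \<in> N" "ell2_fun g x = ell2_fun f x" "\<forall>y\<in>F \<inter> A - {x}. ell2_fun g y = 0"
        "\<forall>z. cmod (ell2_fun g z) \<le> cmod (ell2_fun f z)"
        using approx[of "F \<inter> A - {x}"] F(1) by blast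
      let ?d = "g - ell2_fun f x *\<^sub>C ket x"
      have gF: "ell2_fun g z = 0" if "z \<in> F" "z \<noteq> x" for z
      proof (cases "z \<in> A")
        case False
        then have "ell2_fun f z = 0" using f(1) NA by (auto simp: ell2_on_def)
        then show ?thesis using g(4)[rule_format, of z] by simp
      qed (use g(3) that in blast)
      have "(norm ?d)\<^sup>2 = (\<Sum>\<^sub>\<infinity>z\<in>- F. (cmod (ell2_fun ?d z))\<^sup>2)"
        unfolding norm_ell2_square
        by (rule infsum_cong_neutral)
          (use gF g(2) in \<open>auto simp: ell2_fun_diff ell2_fun_scaleC ell2_fun_ket\<close>)
      also have "\<dots> \<le> (\<Sum>\<^sub>\<infinity>x\<in>- F. (cmod (ell2_fun f x))\<^sup>2)"
        by (rule infsum_mono[OF ell2_summable ell2_summable])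
          (use g in \<open>auto simp: ell2_fun_diff ell2_fun_scaleC ell2_fun_ket power_mono\<close>)
      also have "\<dots> < e\<^sup>2" by (rule F)
      finally have "norm ?d < e" using e by (meson less_imp_le power_less_imp_less_base)
      then show "\<exists>y\<in>N. dist y (ell2_fun f x *\<^sub>C ket x) < e"
        using g(1) by (auto simp: dist_norm)
    qed
    then have kx: "ket x \<in> N" using scale[OF _ fx] cl by (simp add: closure_closed)
    \<comment> \<open>An adjoint moves the vector back to a common ancestor of \<open>x\<close> and
      \<open>y\<close>, and a word matched by \<open>y\<close> moves it forward again.\<close>
    have "ket y \<in> N" if y: "y \<in> A" for y
    proof -
      obtain k l k' l' where z: "bwd k l x = bwd k' l' y"
        using conn x y unfolding connected_def by blast
      obtain u where u: "matches u x" "nblue u = k" "nred u = l" using ex_word x by blast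
      obtain u' where u': "matches u' y" "nblue u' = k'" "nred u' = l'" using ex_word y by blast
      have "cnj (a ^ k * c ^ l) *\<^sub>C ket (bwd k l x) \<in> N"
        using inv(2)[OF kx, of u] rho_word_adjoint_ket[OF a x u(1)] u by simp
      then have "ket (bwd k l x) \<in> N"
        using scale d0[of k l] complex_cnj_zero_iff by blast
      then have "(a ^ k' * c ^ l') *\<^sub>C ket y \<in> N"
        using inv(1)[of "ket (bwd k l x)" u'] rho_word_ket[OF y u'(1)] u' z by simp
      then show ?thesis using scale d0[of k' l'] by blast
    qed
    then have "closed_span (ket ` A) \<subseteq> N"
      using red by (intro closed_span_minimal) (auto simp: reducing_def)
    then show ?thesis using NA by (simp add: closed_span_ket)
  qed simp
qed

end

subsection \<open>Coinvariant restrictions and isomorphic systems\<close>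

text \<open>A set closed under predecessors is coinvariant: a word leading to a vertex of
  \<open>A0\<close> starts in \<open>A0\<close>, so compressing to \<open>A0\<close> gives the
  operators of the subgraph. Minimality holds because every vertex is reached by a word from one of
  its ancestors, and by \<open>cofinal\<close> some ancestor lies in \<open>A0\<close>.\<close>

lemma minimal_star_dilation_rho:
  fixes \<theta> :: "'m::finite \<times> 'n::finite \<Rightarrow> 'm \<times> 'n"
  assumes "full_system \<theta> A b r I J" and A0: "A0 \<subseteq> A" "b ` A0 \<subseteq> A0" "r ` A0 \<subseteq> A0"
    and cofinal: "\<And>x. x \<in> A \<Longrightarrow> \<exists>k l. pred_system.bwd b r k l x \<in> A0"
    and a: "cmod a = 1" "cmod c = 1"
  shows "minimal_star_dilation \<theta> (ell2_on A0) (pred_system.rho A0 b r I J a c)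
    (ell2_on A) (pred_system.rho A b r I J a c)"
proof -
  interpret full_system \<theta> A b r I J by fact
  interpret R: pred_system \<theta> A0 b r I J
  proof
    show "bij \<theta>" by (rule bij_theta)
    fix x assume "x \<in> A0"
    then have x: "x \<in> A" using A0 by auto
    show "b x \<in> A0" "r x \<in> A0" using \<open>x \<in> A0\<close> A0 by auto
    show "b (r x) = r (b x)" "\<theta> (I x, J (b x)) = (I (r x), J x)"
      by (rule b_r[OF x], rule square[OF x])
    fix y assume "y \<in> A0"
    then have y: "y \<in> A" using A0 by auto
    show "x = y" if "b x = b y" "I x = I y" by (rule b_inj[OF x y that])
    show "x = y" if "r x = r y" "J x = J y" by (rule r_inj[OF x y that])
  qed
  have proj: "R.rho a c w f = orth_proj (ell2_on A0) (rho a c w f)"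
    if "w \<in> carrier (F_theta \<theta>)" for w f
  proof -
    from that obtain u where w: "w = word_class \<theta> u" unfolding carrier_F_theta by blast
    show ?thesis unfolding w orth_proj_ell2_on
      by (rule ell2_eqI) (auto simp: ell2_fun_pullop ell2_fun_rho_word R.ell2_fun_rho_word
          dest: subsetD[OF A0(1)])
  qed
  let ?X = "\<Union>w\<in>carrier (F_theta \<theta>). rho a c w ` ell2_on A0"
  have XA: "?X \<subseteq> ell2_on A"
  proof (intro UN_least image_subsetI)
    fix w f assume "w \<in> carrier (F_theta \<theta>)"
    then obtain u where "w = word_class \<theta> u" unfolding carrier_F_theta by blast
    then show "rho a c w f \<in> ell2_on A"
      by (auto simp: rho_word intro!: pullop_in_ell2_on inj_on_bwd)
  qed
  have "ket x \<in> closed_span ?X" if x: "x \<in> A" for x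
  proof -
    obtain k l where kl: "bwd k l x \<in> A0" using cofinal x by blast
    obtain u where u: "matches u x" "nblue u = k" "nred u = l" using ex_word x by blast
    have "rho a c (word_class \<theta> u) (ket (bwd k l x)) \<in> ?X"
      using kl by (intro UN_I[of "word_class \<theta> u"]) (auto simp: ket_in_ell2_on)
    then have "(a ^ k * c ^ l) *\<^sub>C ket x \<in> closed_span ?X"
      using rho_word_ket[OF x u(1), of a c] u closed_span_superset[of ?X] by auto
    moreover have "a ^ k * c ^ l \<noteq> 0" using a by auto
    ultimately show ?thesis by (rule hilbert_subspace_unscale[OF hilbert_subspace_closed_span])
  qed
  then have "ell2_on A \<subseteq> closed_span ?X"
    unfolding closed_span_ket[symmetric]
    by (intro closed_span_minimal hilbert_subspace_closed_span) auto
  moreover have "closed_span ?X \<subseteq> ell2_on A"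
    using XA by (rule closed_span_minimal[OF hilbert_subspace_ell2_on])
  ultimately have span: "ell2_on A = closed_span ?X" by blast
  have df: "defect_free \<theta> (ell2_on A0) (R.rho a c)" "defect_free \<theta> (ell2_on A) (rho a c)"
    unfolding defect_free_def by (simp_all add: R.defect_free_rho defect_free_rho a)
  show ?thesis
    unfolding minimal_star_dilation_def dilation_def star_representation_def
  proof (intro conjI ballI)
    show "R.rho a c w x = orth_proj (ell2_on A0) (rho a c w x)"
      if "w \<in> carrier (F_theta \<theta>)" for w x using that by (rule proj)
  qed (fact R.representation_rho[OF a] representation_rho[OF a] isometric_rho[OF a]
        ell2_on_mono[OF A0(1)] df span)+
qed

lemma unitarily_equivalent_rho:
  assumes "pred_system \<theta> A b r I J" "pred_system \<theta> A' b' r' I' J'"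
    and h: "bij_betw h A' A"
    and hb: "\<And>x. x \<in> A' \<Longrightarrow> h (b' x) = b (h x) \<and> h (r' x) = r (h x) \<and> I' x = I (h x) \<and> J' x = J (h x)"
  shows "unitarily_equivalent \<theta> (ell2_on A') (pred_system.rho A' b' r' I' J' a c)
    (ell2_on A) (pred_system.rho A b r I J a c)"
proof -
  interpret pred_system \<theta> A b r I J by fact
  interpret S: pred_system \<theta> A' b' r' I' J' by fact
  let ?i = "inv_into A' h"
  have inj: "inj_on ?i A" and injh: "inj_on h A'" and im: "h ` A' = A" "?i ` A = A'"
    using h bij_betw_inv_into[OF h] by (auto simp: bij_betw_def)
  have ih: "?i (h x) = x" if "x \<in> A'" for x using that injh by (simp add: inv_into_f_f)
  have hi: "h (?i y) = y" "?i y \<in> A'" if "y \<in> A" for y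
    using that im by (auto intro: f_inv_into_f inv_into_into)
  have rl: "h ((r' ^^ l) x) = (r ^^ l) (h x)" if "x \<in> A'" for l x
    using that hb by (induction l) auto
  have "h ((b' ^^ k) x) = (b ^^ k) (h x)" if "x \<in> A'" for k x
    using that hb by (induction k) auto
  then have bwd: "h (S.bwd k l x) = bwd k l (h x)" if "x \<in> A'" for k l x
    using that rl by (simp add: S.bwd_def bwd_def)
  have m: "S.matches u x \<longleftrightarrow> matches u (h x)" if "x \<in> A'" for u x
    using that hb by (induction u arbitrary: x rule: sum_list_induct) auto
  let ?U = "pullop A ?i 1"
  have "linear_on_subspace (ell2_on A') ?U" by (rule linear_pullop[OF inj])
  moreover have "norm (?U f) = norm f" if "f \<in> ell2_on A'" for f
    using that im by (intro norm_pullop_eq inj) auto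
  moreover have "?U ` ell2_on A' = ell2_on A"
  proof
    show "?U ` ell2_on A' \<subseteq> ell2_on A" by (auto intro: pullop_in_ell2_on[OF inj])
    show "ell2_on A \<subseteq> ?U ` ell2_on A'"
    proof
      fix g assume g: "g \<in> ell2_on A"
      have "?U (pullop A' h 1 g) = g"
        by (rule ell2_eqI)
          (use g hi in \<open>auto simp: ell2_fun_pullop[OF inj] ell2_fun_pullop[OF injh] ell2_on_def\<close>)
      then show "g \<in> ?U ` ell2_on A'"
        by (metis pullop_in_ell2_on[OF injh order_refl] image_eqI)
    qed
  qed
  moreover have "?U (S.rho a c w f) = rho a c w (?U f)" if "w \<in> carrier (F_theta \<theta>)" for w f
  proof -
    from that obtain u where w: "w = word_class \<theta> u" unfolding carrier_F_theta by blast
    have "?i (bwd k l y) = S.bwd k l (?i y)" if "y \<in> A" for y k l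
      using bwd[of "?i y" k l] ih[of "S.bwd k l (?i y)"] hi[OF that] by simp
    then show ?thesis unfolding w
      by (intro ell2_eqI) (auto simp: ell2_fun_pullop[OF inj] ell2_fun_rho_word
          S.ell2_fun_rho_word m hi)
  qed
  ultimately show ?thesis
    unfolding unitarily_equivalent_def by (intro exI[of _ ?U] conjI) auto
qed

section \<open>Subgroups of the group of pairs of integers\<close>

definition add_subgroup :: "'a::ab_group_add set \<Rightarrow> bool" where
  "add_subgroup K \<longleftrightarrow> 0 \<in> K \<and> (\<forall>x\<in>K. \<forall>y\<in>K. x - y \<in> K)"

lemma add_subgroup_0: "add_subgroup K \<Longrightarrow> 0 \<in> K"
  and add_subgroup_diff: "add_subgroup K \<Longrightarrow> x \<in> K \<Longrightarrow> y \<in> K \<Longrightarrow> x - y \<in> K"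
  by (auto simp: add_subgroup_def)

lemma add_subgroup_minus: "add_subgroup K \<Longrightarrow> x \<in> K \<Longrightarrow> - x \<in> K"
  using add_subgroup_diff[of K 0 x] add_subgroup_0[of K] by simp

lemma add_subgroup_add: "add_subgroup K \<Longrightarrow> x \<in> K \<Longrightarrow> y \<in> K \<Longrightarrow> x + y \<in> K"
  using add_subgroup_diff[of K x "- y"] add_subgroup_minus[of K y] by simp

lemma add_subgroup_scale_nat:
  fixes K :: "(int \<times> int) set"
  assumes "add_subgroup K" "(s, t) \<in> K" shows "(int n * s, int n * t) \<in> K"
proof (induction n)
  case 0
  then show ?case using add_subgroup_0[OF assms(1)] by (simp add: zero_prod_def)
next
  case (Suc n)
  then show ?case using add_subgroup_add[OF assms(1) Suc assms(2)]
    by (simp add: algebra_simps)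
qed

lemma add_subgroup_scale:
  fixes K :: "(int \<times> int) set"
  assumes "add_subgroup K" "(s, t) \<in> K" shows "(j * s, j * t) \<in> K"
proof (cases "j \<ge> 0")
  case True
  then show ?thesis using add_subgroup_scale_nat[OF assms, of "nat j"] by simp
next
  case False
  then have "(- (j * s), - (j * t)) \<in> K" using add_subgroup_scale_nat[OF assms, of "nat (- j)"] by simp
  then show ?thesis using add_subgroup_minus[OF assms(1), of "(- (j * s), - (j * t))"] by simp
qed

lemma add_subgroup_int:
  assumes S: "add_subgroup (S :: int set)"
  obtains d where "d \<ge> 0" "d \<in> S" "\<And>s. s \<in> S \<Longrightarrow> d dvd s"
proof (cases "\<exists>s\<in>S. s \<noteq> 0")
  case True
  then obtain s where "s \<in> S" "s \<noteq> 0" by blast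
  then have "\<exists>n. n > 0 \<and> int n \<in> S"
    using add_subgroup_minus[OF S, of s] by (intro exI[of _ "nat \<bar>s\<bar>"]) (auto simp: abs_if)
  define n where "n = (LEAST n. n > 0 \<and> int n \<in> S)"
  have n: "n > 0" "int n \<in> S"
    using LeastI_ex[OF \<open>\<exists>n. n > 0 \<and> int n \<in> S\<close>] unfolding n_def by blast+
  have mult: "j * int n \<in> S" for j
  proof -
    have nat: "int k * int n \<in> S" for k
    proof (induction k)
      case (Suc k)
      then show ?case using add_subgroup_add[OF S Suc n(2)] by (simp add: algebra_simps)
    qed (simp add: add_subgroup_0[OF S])
    show ?thesis
    proof (cases "j \<ge> 0")
      case True
      then show ?thesis using nat[of "nat j"] by simp
    next
      case False
      then show ?thesis using add_subgroup_minus[OF S nat[of "nat (- j)"]] by simp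
    qed
  qed
  have "int n dvd s" if "s \<in> S" for s
  proof (rule ccontr)
    assume "\<not> int n dvd s"
    then have "s mod int n \<noteq> 0" by (simp add: dvd_eq_mod_eq_0)
    then have m: "s mod int n > 0" "s mod int n < int n"
      using n(1) pos_mod_sign[of "int n" s] pos_mod_bound[of "int n" s] by linarith+
    have "s mod int n \<in> S"
      using add_subgroup_diff[OF S that mult[of "s div int n"]]
      unfolding minus_div_mult_eq_mod .
    then have "nat (s mod int n) > 0 \<and> int (nat (s mod int n)) \<in> S" using m by simp
    then have "n \<le> nat (s mod int n)" unfolding n_def by (rule Least_le)
    then show False using m by linarith
  qed
  then show ?thesis using n(2) by (intro that[of "int n"]) auto
next
  case False
  then show ?thesis using add_subgroup_0[OF S] by (intro that[of 0]) auto
qed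

text \<open>The Hermite normal form of a subgroup.\<close>

lemma add_subgroup_int_pairs:
  fixes K :: "(int \<times> int) set"
  assumes K: "add_subgroup K"
  obtains p q r where "p \<ge> 0" "r \<ge> 0" "r = 0 \<Longrightarrow> q = 0"
    and "\<And>s t. (s, t) \<in> K \<longleftrightarrow> (\<exists>i j. s = i * p + j * q \<and> t = j * r)"
proof -
  have "add_subgroup {s. (s, 0) \<in> K}"
    unfolding add_subgroup_def[of "{s. (s, 0) \<in> K}"]
    using add_subgroup_0[OF K] add_subgroup_diff[OF K, of "(_, 0)" "(_, 0)"]
    by (auto simp: zero_prod_def)
  then obtain p where p: "p \<ge> 0" "(p, 0) \<in> K" "\<And>s. (s, 0) \<in> K \<Longrightarrow> p dvd s"
    by (rule add_subgroup_int) auto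
  have "add_subgroup (snd ` K)"
    unfolding add_subgroup_def[of "snd ` K"]
  proof (intro conjI ballI)
    show "0 \<in> snd ` K" using imageI[OF add_subgroup_0[OF K], of snd] by simp
    fix x y assume "x \<in> snd ` K" "y \<in> snd ` K"
    then obtain x' y' where "x' \<in> K" "y' \<in> K" "x = snd x'" "y = snd y'" by blast
    then show "x - y \<in> snd ` K" using imageI[OF add_subgroup_diff[OF K], of x' y' snd] by simp
  qed
  then obtain r where r: "r \<ge> 0" "r \<in> snd ` K" "\<And>t. t \<in> snd ` K \<Longrightarrow> r dvd t"
    by (rule add_subgroup_int) auto
  \<comment> \<open>Taking \<open>q = 0\<close> when \<open>r = 0\<close> is a normalisation; it
    keeps the degenerate cases consistent when quotients such as \<open>q / r\<close> are formed
    later.\<close>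
  obtain q where q: "(q, r) \<in> K" "r = 0 \<Longrightarrow> q = 0"
  proof (cases "r = 0")
    case True
    then show ?thesis using that[of 0] add_subgroup_0[OF K] by (simp add: zero_prod_def)
  next
    case False
    then show ?thesis using that r(2) by auto
  qed
  have "(s, t) \<in> K \<longleftrightarrow> (\<exists>i j. s = i * p + j * q \<and> t = j * r)" for s t
  proof
    assume st: "(s, t) \<in> K"
    then have "r dvd t" by (intro r(3)) force
    then obtain j where j: "t = j * r" by (auto simp: dvd_def mult.commute)
    have "(s - j * q, t - j * r) \<in> K"
      using add_subgroup_diff[OF K st add_subgroup_scale[OF K q(1), of j]] by simp
    then have "p dvd s - j * q" using p(3) j by simp
    then obtain i where "s - j * q = p * i" by (auto simp: dvd_def)
    then show "\<exists>i j. s = i * p + j * q \<and> t = j * r"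
      using j by (intro exI[of _ i] exI[of _ j]) (auto simp: algebra_simps)
  next
    assume "\<exists>i j. s = i * p + j * q \<and> t = j * r"
    then obtain i j where "s = i * p + j * q" "t = j * r" by blast
    then show "(s, t) \<in> K"
      using add_subgroup_add[OF K add_subgroup_scale[OF K p(2), of i] add_subgroup_scale[OF K q(1), of j]]
      by simp
  qed
  then show ?thesis using that[of p r q] p r q by blast
qed

section \<open>Periods\<close>

context pred_system
begin

text \<open>This is \<open>K\<close> seen from \<open>x\<close>: \<open>bwd k l x\<close> sits at
  position (-k, -l), so the recorded pair is the shift from the second position to the first. A
  single coincidence suffices, since it propagates to all earlier positions.\<close>

definition periods :: "'w \<Rightarrow> (int \<times> int) set" where
  "periods x = {(int k' - int k, int l' - int l) | k l k' l'. bwd k l x = bwd k' l' x}"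

definition label_periods :: "'w \<Rightarrow> (int \<times> int) set" where
  "label_periods x = {(int k' - int k, int l' - int l) | k l k' l'. same_tail (bwd k l x) (bwd k' l' x)}"

lemma same_tail_refl [simp]: "same_tail x x"
  and same_tail_sym: "same_tail x y \<Longrightarrow> same_tail y x"
  and same_tail_trans: "same_tail x y \<Longrightarrow> same_tail y z \<Longrightarrow> same_tail x z"
  by (auto simp: same_tail_def)

lemma same_tail_bwd: "x \<in> A \<Longrightarrow> y \<in> A \<Longrightarrow> same_tail x y \<Longrightarrow> same_tail (bwd k l x) (bwd k l y)"
  by (simp add: same_tail_def bwd_bwd)

lemma bwd_shift: "x \<in> A \<Longrightarrow> bwd k l x = bwd k' l' y \<Longrightarrow> y \<in> A
    \<Longrightarrow> bwd (k + m) (l + n) x = bwd (k' + m) (l' + n) y"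
  by (metis bwd_bwd add.commute)

lemma same_tail_shift: "x \<in> A \<Longrightarrow> same_tail (bwd k l x) (bwd k' l' y) \<Longrightarrow> y \<in> A
    \<Longrightarrow> same_tail (bwd (k + m) (l + n) x) (bwd (k' + m) (l' + n) y)"
  using same_tail_bwd[of "bwd k l x" "bwd k' l' y" m n] by (simp add: bwd_bwd add.commute)

text \<open>A common proof for both period groups: two related pairs are shifted further back until
  they share a middle term, where transitivity applies.\<close>

lemma add_subgroup_rel:
  assumes refl: "\<And>x. R x x" and sym: "\<And>x y. R x y \<Longrightarrow> R y x"
    and trans: "\<And>x y z. R x y \<Longrightarrow> R y z \<Longrightarrow> R x z"
    and shift: "\<And>k l k' l' m n. R (bwd k l x) (bwd k' l' x)
      \<Longrightarrow> R (bwd (k + m) (l + n) x) (bwd (k' + m) (l' + n) x)"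
  shows "add_subgroup {(int k' - int k, int l' - int l) | k l k' l'. R (bwd k l x) (bwd k' l' x)}"
    (is "add_subgroup ?P")
  unfolding add_subgroup_def
proof (intro conjI ballI)
  show "0 \<in> ?P" using refl by (fastforce simp: zero_prod_def)
  fix u v assume "u \<in> ?P" "v \<in> ?P"
  then obtain k l k' l' m n m' n' where
    u: "u = (int k' - int k, int l' - int l)" "R (bwd k l x) (bwd k' l' x)" and
    v: "v = (int m' - int m, int n' - int n)" "R (bwd m n x) (bwd m' n' x)" by blast
  have "R (bwd (k + m') (l + n') x) (bwd (k' + m') (l' + n') x)" by (rule shift[OF u(2)])
  moreover have "R (bwd (k' + m') (l' + n') x) (bwd (k' + m) (l' + n) x)"
    using shift[OF sym[OF v(2)], of k' l'] by (simp add: add.commute)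
  ultimately have "R (bwd (k + m') (l + n') x) (bwd (k' + m) (l' + n) x)" by (rule trans)
  moreover have "u - v = (int (k' + m) - int (k + m'), int (l' + n) - int (l + n'))"
    by (simp add: u v)
  ultimately show "u - v \<in> ?P" by blast
qed

lemma add_subgroup_periods: "x \<in> A \<Longrightarrow> add_subgroup (periods x)"
  unfolding periods_def by (rule add_subgroup_rel) (auto intro: bwd_shift)

lemma add_subgroup_label_periods: "x \<in> A \<Longrightarrow> add_subgroup (label_periods x)"
  unfolding label_periods_def
  by (rule add_subgroup_rel) (auto intro: same_tail_shift same_tail_sym same_tail_trans)

lemma periods_subset: "periods x \<subseteq> label_periods x"
proof
  fix u assume "u \<in> periods x"
  then obtain k l k' l' where "u = (int k' - int k, int l' - int l)" "bwd k l x = bwd k' l' x"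
    unfolding periods_def by blast
  then show "u \<in> label_periods x" unfolding label_periods_def by force
qed

lemma periodsI: "bwd k l x = bwd k' l' x \<Longrightarrow> (int k' - int k, int l' - int l) \<in> periods x"
  unfolding periods_def by blast

text \<open>Beyond the coordinates of one witnessing coincidence, every pair of positions with the
  same difference is a shift of that witness; the sum of its four coordinates is a crude
  bound.\<close>

lemma periods_far:
  assumes "x \<in> A" "(p, q) \<in> periods x"
  obtains N where "\<And>k l k' l'. N \<le> k \<Longrightarrow> N \<le> l \<Longrightarrow> N \<le> k' \<Longrightarrow> N \<le> l'
    \<Longrightarrow> int k' - int k = p \<Longrightarrow> int l' - int l = q \<Longrightarrow> bwd k l x = bwd k' l' x"
proof -
  obtain k0 l0 k0' l0' where 0: "p = int k0' - int k0" "q = int l0' - int l0"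
    "bwd k0 l0 x = bwd k0' l0' x" using assms(2) unfolding periods_def by blast
  show ?thesis
  proof (rule that[of "k0 + l0 + k0' + l0'"])
    fix k l k' l' assume h: "k0 + l0 + k0' + l0' \<le> k" "k0 + l0 + k0' + l0' \<le> l"
      "k0 + l0 + k0' + l0' \<le> k'" "k0 + l0 + k0' + l0' \<le> l'" "int k' - int k = p" "int l' - int l = q"
    then have "k = k0 + (k - k0)" "l = l0 + (l - l0)" "k' = k0' + (k - k0)" "l' = l0' + (l - l0)"
      using 0 by linarith+
    then show "bwd k l x = bwd k' l' x" using bwd_shift[OF assms(1) 0(3) assms(1)] by metis
  qed
qed

lemma label_periods_far:
  assumes "x \<in> A" "(p, q) \<in> label_periods x"
  obtains N where "\<And>k l k' l'. N \<le> k \<Longrightarrow> N \<le> l \<Longrightarrow> N \<le> k' \<Longrightarrow> N \<le> l'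
    \<Longrightarrow> int k' - int k = p \<Longrightarrow> int l' - int l = q \<Longrightarrow> same_tail (bwd k l x) (bwd k' l' x)"
proof -
  obtain k0 l0 k0' l0' where 0: "p = int k0' - int k0" "q = int l0' - int l0"
    "same_tail (bwd k0 l0 x) (bwd k0' l0' x)" using assms(2) unfolding label_periods_def by blast
  show ?thesis
  proof (rule that[of "k0 + l0 + k0' + l0'"])
    fix k l k' l' assume h: "k0 + l0 + k0' + l0' \<le> k" "k0 + l0 + k0' + l0' \<le> l"
      "k0 + l0 + k0' + l0' \<le> k'" "k0 + l0 + k0' + l0' \<le> l'" "int k' - int k = p" "int l' - int l = q"
    then have "k = k0 + (k - k0)" "l = l0 + (l - l0)" "k' = k0' + (k - k0)" "l' = l0' + (l - l0)"
      using 0 by linarith+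
    then show "same_tail (bwd k l x) (bwd k' l' x)"
      using same_tail_shift[OF assms(1) 0(3) assms(1)] by metis
  qed
qed

section \<open>Finite windows of labels\<close>

definition window :: "nat \<Rightarrow> 'w \<Rightarrow> ('m \<times> 'n) list" where
  "window N x = map (\<lambda>(k, l). (I (bwd k l x), J (bwd k l x))) (List.product [0..<N] [0..<N])"

lemma window_eq_iff:
  "window N x = window N y \<longleftrightarrow>
    (\<forall>k<N. \<forall>l<N. I (bwd k l x) = I (bwd k l y) \<and> J (bwd k l x) = J (bwd k l y))"
  by (auto simp: window_def)

lemma finite_windows:
  assumes "finite (UNIV :: 'm set)" "finite (UNIV :: 'n set)"
  shows "finite (range (window N))"
proof (rule finite_subset)
  show "range (window N) \<subseteq> {xs. set xs \<subseteq> UNIV \<and> length xs = N * N}"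
    by (auto simp: window_def)
  show "finite {xs :: ('m \<times> 'n) list. set xs \<subseteq> UNIV \<and> length xs = N * N}"
    using assms by (intro finite_lists_length_eq) (simp add: finite_Prod_UNIV)
qed

lemma same_tail_iff_window: "same_tail x y \<longleftrightarrow> (\<forall>N. window N x = window N y)"
  unfolding same_tail_def window_eq_iff by (meson lessI less_max_iff_disj)

text \<open>Passing to \<open>b x\<close> loses only the positions \<open>(0, l)\<close>, and these
  are recovered from \<open>I x\<close> alone: the square at \<open>(0, l)\<close> computes the blue
  label at \<open>(0, l + 1)\<close> and the red label at \<open>(0, l)\<close> from the blue label
  at \<open>(0, l)\<close> and the known red label at \<open>(1, l)\<close>.\<close>

lemma window_b:
  assumes xy: "x \<in> A" "y \<in> A" and "window N (b x) = window N (b y)" "I x = I y"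
  shows "window N x = window N y"
proof -
  have w: "I (bwd (Suc k) l x) = I (bwd (Suc k) l y) \<and> J (bwd (Suc k) l x) = J (bwd (Suc k) l y)"
    if "k < N" "l < N" for k l
    using assms(3) that xy unfolding window_eq_iff by (simp add: bwd_b)
  have row: "I (bwd 0 l x) = I (bwd 0 l y)" if "l < N" for l
    using that
  proof (induction l)
    case 0
    then show ?case using assms(4) by simp
  next
    case (Suc l)
    have "\<theta> (I (bwd 0 l x), J (bwd 1 l x)) = (I (bwd 0 (Suc l) x), J (bwd 0 l x))"
      "\<theta> (I (bwd 0 l y), J (bwd 1 l y)) = (I (bwd 0 (Suc l) y), J (bwd 0 l y))"
      using square[of "bwd 0 l x"] square[of "bwd 0 l y"] xy by (simp_all add: b_bwd r_bwd)
    then show ?case using Suc w[of 0 l] by simp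
  qed
  have col: "J (bwd 0 l x) = J (bwd 0 l y)" if "l < N" for l
  proof -
    have "\<theta> (I (bwd 0 l x), J (bwd 1 l x)) = (I (bwd 0 (Suc l) x), J (bwd 0 l x))"
      "\<theta> (I (bwd 0 l y), J (bwd 1 l y)) = (I (bwd 0 (Suc l) y), J (bwd 0 l y))"
      using square[of "bwd 0 l x"] square[of "bwd 0 l y"] xy by (simp_all add: b_bwd r_bwd)
    then show ?thesis using row[OF that] w[of 0 l] that by simp
  qed
  show ?thesis unfolding window_eq_iff
  proof (intro allI impI)
    fix k l assume "k < N" "l < N"
    then show "I (bwd k l x) = I (bwd k l y) \<and> J (bwd k l x) = J (bwd k l y)"
      using row[of l] col[of l] w[of "k - 1" l] by (cases k) auto
  qed
qed

text \<open>The lost positions are now \<open>(k, 0)\<close>, and squares have to be read backwards: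
  the blue label at \<open>(k, 1)\<close> and the red label at \<open>(k, 0)\<close> determine the
  blue label at \<open>(k, 0)\<close> and the red label at \<open>(k + 1, 0)\<close>, by injectivity
  of \<open>\<theta>\<close>.\<close>

lemma window_r:
  assumes xy: "x \<in> A" "y \<in> A" and "window N (r x) = window N (r y)" "J x = J y"
  shows "window N x = window N y"
proof -
  have w: "I (bwd k (Suc l) x) = I (bwd k (Suc l) y) \<and> J (bwd k (Suc l) x) = J (bwd k (Suc l) y)"
    if "k < N" "l < N" for k l
    using assms(3) that xy unfolding window_eq_iff by (simp add: bwd_r)
  have sq: "(I (bwd k 0 x), J (bwd (Suc k) 0 x)) = (I (bwd k 0 y), J (bwd (Suc k) 0 y))"
    if "k < N" "J (bwd k 0 x) = J (bwd k 0 y)" for k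
  proof -
    have "\<theta> (I (bwd k 0 x), J (bwd (Suc k) 0 x)) = (I (bwd k 1 x), J (bwd k 0 x))"
      "\<theta> (I (bwd k 0 y), J (bwd (Suc k) 0 y)) = (I (bwd k 1 y), J (bwd k 0 y))"
      using square[of "bwd k 0 x"] square[of "bwd k 0 y"] xy by (simp_all add: b_bwd r_bwd)
    then show ?thesis using that w[of k 0] theta_eq_iff
      by (metis One_nat_def less_nat_zero_code neq0_conv)
  qed
  have row: "J (bwd k 0 x) = J (bwd k 0 y)" if "k < N" for k
    using that
  proof (induction k)
    case 0
    then show ?case using assms(4) by simp
  next
    case (Suc k)
    then show ?case using sq[of k] by simp
  qed
  show ?thesis unfolding window_eq_iff
  proof (intro allI impI)
    fix k l assume "k < N" "l < N"
    then show "I (bwd k l x) = I (bwd k l y) \<and> J (bwd k l x) = J (bwd k l y)"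
      using row[of k] sq[of k] w[of k "l - 1"] by (cases l) auto
  qed
qed

text \<open>The axiom \<open>b_inj\<close> for the graph of tail classes, obtained window by
  window.\<close>

lemma same_tail_b_cancel:
  "x \<in> A \<Longrightarrow> y \<in> A \<Longrightarrow> same_tail (b x) (b y) \<Longrightarrow> I x = I y \<Longrightarrow> same_tail x y"
  unfolding same_tail_iff_window using window_b by blast

lemma same_tail_r_cancel:
  "x \<in> A \<Longrightarrow> y \<in> A \<Longrightarrow> same_tail (r x) (r y) \<Longrightarrow> J x = J y \<Longrightarrow> same_tail x y"
  unfolding same_tail_iff_window using window_r by blast

end

section \<open>Bi-infinite paths\<close>

context full_system
begin

text \<open>The forward step from \<open>b (r y)\<close> to \<open>y\<close> is copied at
  \<open>z\<close>: follow the blue label of \<open>r y\<close>, then the red label of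
  \<open>y\<close>. Equal windows and the relations at \<open>z\<close> then force the relations at
  the new vertex. The margin \<open>Suc l < N\<close> leaves room for labels one red step further
  back.\<close>

lemma extend_forward:
  assumes yz: "y \<in> A" "z \<in> A" and win: "window N (b (r y)) = window N z"
    and R: "\<forall>(k, l, k', l')\<in>R. Suc k < N \<and> Suc l < N \<and> Suc k' < N \<and> Suc l' < N"
    and Ry: "\<forall>(k, l, k', l')\<in>R. bwd k l y = bwd k' l' y"
    and Rz: "\<forall>(k, l, k', l')\<in>R. bwd k l z = bwd k' l' z"
  obtains y' where "y' \<in> A" "b (r y') = z" "window N y' = window N y"
    "\<forall>(k, l, k', l')\<in>R. bwd k l y' = bwd k' l' y'"
proof -
  obtain u where u: "u \<in> A" "b u = z" "I u = I (r y)" using b_ex yz by blast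
  obtain y' where y': "y' \<in> A" "r y' = u" "J y' = J y" using r_ex u by blast
  have "window N u = window N (r y)" using window_b[OF u(1), of "r y" N] yz u win by simp
  then have w: "window N y' = window N y" using window_r[OF y'(1), of y N] yz y' by simp
  have "bwd k l y' = bwd k' l' y'" if kl: "(k, l, k', l') \<in> R" for k l k' l'
  proof -
    have N: "Suc k < N" "Suc l < N" "Suc k' < N" "Suc l' < N" using bspec[OF R kl] by auto
    have eq: "bwd k l y = bwd k' l' y" "bwd k l z = bwd k' l' z" using bspec[OF Ry kl] bspec[OF Rz kl] by auto
    have I: "I (bwd m n y') = I (bwd m n y)" "J (bwd m n y') = J (bwd m n y)" if "m < N" "n < N" for m n
      using w that by (simp_all add: window_eq_iff)
    have eq': "bwd k (Suc l) y = bwd k' (Suc l') y"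
      using arg_cong[OF eq(1), of r] yz(1) by (simp add: r_bwd)
    have "z = b (r y')" using u y' by simp
    then have z: "bwd m n z = b (bwd m (Suc n) y')" for m n
      using y'(1) by (simp add: b_bwd bwd_b bwd_r)
    \<comment> \<open>Both sides have the same blue predecessor by the relation at \<open>z\<close>,
      and the same blue label because their labels are those of \<open>y\<close>, which satisfies
      the relation. So the blue step cancels; the red step cancels afterwards in the same
      way.\<close>
    have "bwd k (Suc l) y' = bwd k' (Suc l') y'"
    proof (rule b_inj)
      show "b (bwd k (Suc l) y') = b (bwd k' (Suc l') y')" using eq(2) unfolding z .
      show "I (bwd k (Suc l) y') = I (bwd k' (Suc l') y')" using I N eq' by simp
    qed (use y'(1) in simp_all)
    then have "r (bwd k l y') = r (bwd k' l' y')" using y' by (simp add: r_bwd)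
    moreover have "J (bwd k l y') = J (bwd k' l' y')" using I N eq(1) by simp
    ultimately show ?thesis using y'(1) r_inj[of "bwd k l y'" "bwd k' l' y'"] by simp
  qed
  then have "\<forall>(k, l, k', l')\<in>R. bwd k l y' = bwd k' l' y'" by auto
  moreover have "b (r y') = z" using y' u by simp
  ultimately show ?thesis using that[of y'] y'(1) w by blast
qed

text \<open>
  Windows occurring infinitely often along the diagonal through \<open>x\<close> allow to continue the
  diagonal forwards for ever by copying its past, without destroying finitely many relations.
\<close>

lemma ex_forward_diagonal:
  assumes fin: "finite (UNIV :: 'm set)" "finite (UNIV :: 'n set)" and x: "x \<in> A"
    and finR: "finite R" and Rx: "\<forall>(k, l, k', l')\<in>R. bwd k l x = bwd k' l' x"
  obtains d n0 where "\<And>n. d n \<in> A" "\<And>n. b (r (d (Suc n))) = d n" "d 0 = bwd n0 n0 x"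
    "\<And>n. \<forall>(k, l, k', l')\<in>R. bwd k l (d n) = bwd k' l' (d n)"
proof -
  \<comment> \<open>The window exceeds every index in \<open>R\<close> by at least two, as
    \<open>extend_forward\<close> requires.\<close>
  define N where "N = Suc (Suc (Max (insert 0 ((\<lambda>(k, l, k', l'). k + l + k' + l') ` R))))"
  have N: "\<forall>(k, l, k', l')\<in>R. Suc k < N \<and> Suc l < N \<and> Suc k' < N \<and> Suc l' < N"
  proof (clarify)
    fix k l k' l' assume "(k, l, k', l') \<in> R"
    then have "k + l + k' + l' \<in> (\<lambda>(k, l, k', l'). k + l + k' + l') ` R"
      by (auto simp: image_iff intro!: bexI[of _ "(k, l, k', l')"])
    then have "k + l + k' + l' \<le> Max (insert 0 ((\<lambda>(k, l, k', l'). k + l + k' + l') ` R))"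
      using finR by (intro Max_ge) auto
    then show "Suc k < N \<and> Suc l < N \<and> Suc k' < N \<and> Suc l' < N" unfolding N_def by linarith
  qed
  define ok where "ok y \<longleftrightarrow> y \<in> A \<and> (\<forall>(k, l, k', l')\<in>R. bwd k l y = bwd k' l' y)" for y
  define s where "s n = bwd n n x" for n
  have ok_s: "ok (s n)" for n
    unfolding ok_def s_def
  proof (intro conjI ballI)
    fix t assume t: "t \<in> R"
    obtain k l k' l' where klt: "t = (k, l, k', l')" by (cases t)
    have "bwd k l x = bwd k' l' x" using bspec[OF Rx t] by (simp add: klt)
    then have "bwd (k + n) (l + n) x = bwd (k' + n) (l' + n) x" by (rule bwd_shift[OF x _ x])
    then show "case t of (k, l, k', l') \<Rightarrow> bwd k l (bwd n n x) = bwd k' l' (bwd n n x)"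
      using x by (simp add: klt bwd_bwd)
  qed (use x in simp)
  have bs: "b (r (s n)) = s (Suc n)" for n using x by (simp add: s_def r_bwd b_bwd)
  define Q where "Q = {q. infinite {n. window N (s n) = q}}"
  have fw: "finite (range (window N))" by (rule finite_windows[OF fin])
  have Q: "\<exists>n\<in>M. window N (s (f n)) \<in> Q \<and> infinite {m\<in>M. window N (s (f m)) = window N (s (f n))}"
    if M: "infinite M" and f: "inj_on f M" for M and f :: "nat \<Rightarrow> nat"
  proof -
    have "finite ((\<lambda>n. window N (s (f n))) ` M)" using fw by (rule finite_subset[rotated]) auto
    from pigeonhole_infinite[OF M this] obtain n where
      n: "n \<in> M" "infinite {m\<in>M. window N (s (f m)) = window N (s (f n))}" by blast
    have "inj_on f {m\<in>M. window N (s (f m)) = window N (s (f n))}"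
      using f by (rule inj_on_subset) auto
    then have "infinite (f ` {m\<in>M. window N (s (f m)) = window N (s (f n))})"
      using n(2) finite_imageD by blast
    moreover have "f ` {m\<in>M. window N (s (f m)) = window N (s (f n))}
        \<subseteq> {m. window N (s m) = window N (s (f n))}" by auto
    ultimately have "infinite {m. window N (s m) = window N (s (f n))}"
      using finite_subset by blast
    then show ?thesis using n by (auto simp: Q_def)
  qed
  obtain n0 where n0: "window N (s n0) \<in> Q" using Q[of UNIV id] by auto
  have step: "\<exists>z'. (ok z' \<and> window N z' \<in> Q) \<and> b (r z') = z" if z: "ok z" "window N z \<in> Q" for z
  proof -
    have inf: "infinite {n. window N (s n) = window N z}" using z(2) by (simp add: Q_def)
    let ?M = "{n. window N (s (Suc n)) = window N z}"
    \<comment> \<open>Index 0 is exceptional because \<open>s 0\<close> is the front end of the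
      diagonal: no step forward from it is available for copying.\<close>
    have "{n. window N (s n) = window N z} \<subseteq> insert 0 (Suc ` ?M)"
    proof
      fix n assume "n \<in> {n. window N (s n) = window N z}"
      then show "n \<in> insert 0 (Suc ` ?M)" by (cases n) auto
    qed
    then have "infinite ?M" using inf by (meson finite.insertI finite_imageI finite_subset)
    then obtain n where n: "n \<in> ?M" "window N (s n) \<in> Q" using Q[of ?M "\<lambda>n. n"] by auto
    obtain z' where "z' \<in> A" "b (r z') = z" "window N z' = window N (s n)"
      "\<forall>(k, l, k', l')\<in>R. bwd k l z' = bwd k' l' z'"
      using extend_forward[of "s n" z N R] ok_s[of n] z(1) N n(1) unfolding ok_def bs by auto
    then show ?thesis using n(2) by (intro exI[of _ z']) (auto simp: ok_def)
  qed
  have "\<exists>d. \<forall>n. ((ok (d n) \<and> window N (d n) \<in> Q) \<and> (n = 0 \<longrightarrow> d n = s n0)) \<and> b (r (d (Suc n))) = d n"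
  proof (rule dependent_nat_choice[where Q="\<lambda>n z z'. b (r z') = z"])
    show "\<exists>z. (ok z \<and> window N z \<in> Q) \<and> ((0::nat) = 0 \<longrightarrow> z = s n0)"
      using n0 ok_s by auto
    show "\<exists>z'. ((ok z' \<and> window N z' \<in> Q) \<and> (Suc n = 0 \<longrightarrow> z' = s n0)) \<and> b (r z') = z"
      if "(ok z \<and> window N z \<in> Q) \<and> (n = 0 \<longrightarrow> z = s n0)" for z n
      using step[of z] that by auto
  qed
  then obtain d where d: "\<And>n. ok (d n)" "d 0 = s n0" "\<And>n. b (r (d (Suc n))) = d n" by blast
  show ?thesis
  proof (rule that[of d n0])
    fix n
    show "d n \<in> A" "\<forall>(k, l, k', l')\<in>R. bwd k l (d n) = bwd k' l' (d n)"
      using d(1)[of n] unfolding ok_def by blast+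
    show "b (r (d (Suc n))) = d n" by (rule d(3))
    show "d 0 = bwd n0 n0 x" using d(2) by (simp add: s_def)
  qed
qed

text \<open>It is enough to extend the diagonal, since every lattice position lies behind some
  diagonal point. Two generators of the period group are kept valid at all diagonal points, so every
  period of \<open>x\<close> becomes a period of the whole path. Position (0, 0) is
  \<open>bwd n0 n0 x\<close> rather than \<open>x\<close>, because the extension starts at a
  recurrent window.\<close>

lemma ex_bi_infinite_path:
  assumes fin: "finite (UNIV :: 'm set)" "finite (UNIV :: 'n set)" and x: "x \<in> A"
  obtains v :: "int \<Rightarrow> int \<Rightarrow> 'w" and n0 where "\<And>s t. v s t \<in> A"
    "\<And>s t. b (v s t) = v (s - 1) t" "\<And>s t. r (v s t) = v s (t - 1)"
    "\<And>k l. v (- int k) (- int l) = bwd (k + n0) (l + n0) x"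
    "\<And>s t s' t'. v s t = v s' t' \<longleftrightarrow> (s - s', t - t') \<in> periods x"
proof -
  obtain p q w where K: "\<And>s t. (s, t) \<in> periods x \<longleftrightarrow> (\<exists>i j. s = i * p + j * q \<and> t = j * w)"
    using add_subgroup_int_pairs[OF add_subgroup_periods[OF x]] by metis
  have "(p, 0) \<in> periods x" unfolding K by (intro exI[of _ 1] exI[of _ 0]) simp
  then obtain k1 l1 k1' l1' where g1: "p = int k1' - int k1" "0 = int l1' - int l1"
    "bwd k1 l1 x = bwd k1' l1' x" unfolding periods_def by blast
  have "(q, w) \<in> periods x" unfolding K by (intro exI[of _ 0] exI[of _ 1]) simp
  then obtain k2 l2 k2' l2' where g2: "q = int k2' - int k2" "w = int l2' - int l2"
    "bwd k2 l2 x = bwd k2' l2' x" unfolding periods_def by blast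
  let ?R = "{(k1, l1, k1', l1'), (k2, l2, k2', l2')}"
  have "finite ?R" "\<forall>(k, l, k', l')\<in>?R. bwd k l x = bwd k' l' x" using g1(3) g2(3) by auto
  from ex_forward_diagonal[OF fin x this] obtain d n0 where
    d: "\<And>n. d n \<in> A" "\<And>n. b (r (d (Suc n))) = d n" "d 0 = bwd n0 n0 x"
    and RR: "\<And>n. \<forall>(k, l, k', l')\<in>?R. bwd k l (d n) = bwd k' l' (d n)" by blast
  have R: "bwd k1 l1 (d n) = bwd k1' l1' (d n)" "bwd k2 l2 (d n) = bwd k2' l2' (d n)" for n
    using RR[of n] by auto
  have d1: "d n = bwd m m (d (n + m))" for n m
  proof (induction m)
    case (Suc m)
    have "d (n + m) = bwd 1 1 (d (Suc (n + m)))"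
      using d(2) by (simp add: bwd_def)
    then show ?case using Suc d(1) by (simp add: bwd_bwd)
  qed simp
  \<comment> \<open>The fact \<open>v\<close> below shows that every diagonal index above
    \<open>s\<close> and \<open>t\<close> gives the same vertex. For negative \<open>s\<close> and
    \<open>t\<close>, \<open>nat\<close> selects index 0.\<close>
  define v where "v s t = (let n = nat (max s t) in bwd (nat (int n - s)) (nat (int n - t)) (d n))" for s t
  have v: "v s t = bwd (nat (int n - s)) (nat (int n - t)) (d n)" if "s \<le> int n" "t \<le> int n" for s t n
  proof -
    define m where "m = nat (max s t)"
    have "m \<le> n" unfolding m_def using that by linarith
    then obtain j where j: "n = m + j" by (auto simp: le_iff_add)
    have "v s t = bwd (nat (int m - s)) (nat (int m - t)) (bwd j j (d n))"
      unfolding v_def Let_def m_def[symmetric] j d1[of m j, symmetric] ..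
    also have "\<dots> = bwd (nat (int m - s) + j) (nat (int m - t) + j) (d n)" using d(1) by (simp add: bwd_bwd)
    also have "nat (int m - s) + j = nat (int n - s)" using j that unfolding m_def by linarith
    also have "nat (int m - t) + j = nat (int n - t)" using j that unfolding m_def by linarith
    finally show ?thesis .
  qed
  have vd: "v (int n - int k) (int n - int l) = bwd k l (d n)" for n k l
    by (subst v[of _ n]) auto
  have vA: "v s t \<in> A" for s t using d(1) by (simp add: v_def Let_def)
  have ex: "\<exists>n k l. s = int n - int k \<and> t = int n - int l \<and> N \<le> n \<and> M \<le> k \<and> M \<le> l" for s t N M
    by (rule exI[of _ "N + M + nat \<bar>s\<bar> + nat \<bar>t\<bar>"], rule exI[of _ "nat (int (N + M + nat \<bar>s\<bar> + nat \<bar>t\<bar>) - s)"],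
        rule exI[of _ "nat (int (N + M + nat \<bar>s\<bar> + nat \<bar>t\<bar>) - t)"]) auto
  have bv: "bwd k l (v s t) = v (s - int k) (t - int l)" for s t k l
  proof -
    obtain n k' l' where n: "s = int n - int k'" "t = int n - int l'" using ex by blast
    have "bwd k l (v s t) = bwd (k + k') (l + l') (d n)" unfolding n vd using d(1) by (simp add: bwd_bwd)
    also have "\<dots> = v (int n - int (k + k')) (int n - int (l + l'))" by (rule vd[symmetric])
    finally show ?thesis unfolding n by (simp add: algebra_simps)
  qed
  have v_x: "v (- int k) (- int l) = bwd (k + n0) (l + n0) x" for k l
    using vd[of 0 k l] d(3) x by (simp add: bwd_bwd)
  have per: "v s t = v (s + int k' - int k) (t + int l' - int l)"
    if "\<And>n. bwd k l (d n) = bwd k' l' (d n)" for s t k l k' l'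
  proof -
    obtain n m m' where n: "s = int n - int m" "t = int n - int m'" "k' \<le> m" "l' \<le> m'"
      using ex[of s t 0 "k' + l'"] by auto
    have "v s t = bwd (k' + (m - k')) (l' + (m' - l')) (d n)" using n vd by simp
    also have "\<dots> = bwd (k + (m - k')) (l + (m' - l')) (d n)"
      using bwd_shift[OF d(1) that d(1)] by metis
    also have "\<dots> = v (int n - int (k + (m - k'))) (int n - int (l + (m' - l')))" by (rule vd[symmetric])
    also have "int n - int (k + (m - k')) = s + int k' - int k" using n by (simp add: of_nat_diff)
    also have "int n - int (l + (m' - l')) = t + int l' - int l" using n by (simp add: of_nat_diff)
    finally show ?thesis .
  qed
  \<comment> \<open>The global periods of the path form a subgroup, so it suffices that it contains
    the two generators.\<close>
  define P where "P = {(a, c). \<forall>s t. v (s + a) (t + c) = v s t}"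
  have P: "add_subgroup P"
    unfolding add_subgroup_def
  proof (intro conjI ballI)
    show "0 \<in> P" by (simp add: P_def zero_prod_def)
    fix y z assume "y \<in> P" "z \<in> P"
    then obtain a c a' c' where yz: "y = (a, c)" "z = (a', c')"
      "\<And>s t. v (s + a) (t + c) = v s t" "\<And>s t. v (s + a') (t + c') = v s t" by (auto simp: P_def)
    have "v (s + (a - a')) (t + (c - c')) = v s t" for s t
      using yz(3)[of "s - a'" "t - c'"] yz(4)[of "s - a'" "t - c'"] by (simp add: algebra_simps)
    then show "y - z \<in> P" by (simp add: P_def yz)
  qed
  have "v (s + p) (t + 0) = v s t" for s t
  proof -
    have "s + int k1' - int k1 = s + p" "t + int l1' - int l1 = t + 0" using g1 by linarith+
    then show ?thesis using per[OF R(1), of s t] by (simp only:)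
  qed
  then have p0: "(p, 0) \<in> P" by (simp add: P_def)
  have "v (s + q) (t + w) = v s t" for s t
  proof -
    have "s + int k2' - int k2 = s + q" "t + int l2' - int l2 = t + w" using g2 by linarith+
    then show ?thesis using per[OF R(2), of s t] by (simp only:)
  qed
  then have qw: "(q, w) \<in> P" by (simp add: P_def)
  have KP: "(s, t) \<in> P" if st: "(s, t) \<in> periods x" for s t
  proof -
    obtain i j where "s = i * p + j * q" "t = j * w" using st unfolding K by blast
    then show ?thesis
      using add_subgroup_add[OF P add_subgroup_scale[OF P p0, of i] add_subgroup_scale[OF P qw, of j]]
      by simp
  qed
  have "v s t = v s' t' \<longleftrightarrow> (s - s', t - t') \<in> periods x" for s t s' t'
  proof
    assume eq: "v s t = v s' t'"
    \<comment> \<open>Moving back by \<open>m\<close> brings both positions into the negative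
      quadrant, hence into the past of \<open>x\<close>, where a coincidence is a period by
      definition.\<close>
    define m where "m = nat \<bar>s\<bar> + nat \<bar>t\<bar> + nat \<bar>s'\<bar> + nat \<bar>t'\<bar>"
    have m: "s \<le> int m" "t \<le> int m" "s' \<le> int m" "t' \<le> int m"
      unfolding m_def by simp_all
    have "v (s - int m) (t - int m) = v (s' - int m) (t' - int m)"
      using eq bv[of m m s t] bv[of m m s' t'] by simp
    moreover have "s - int m = - int (nat (int m - s))" "t - int m = - int (nat (int m - t))"
      "s' - int m = - int (nat (int m - s'))" "t' - int m = - int (nat (int m - t'))"
      using m by simp_all
    ultimately have "bwd (nat (int m - s) + n0) (nat (int m - t) + n0) x
        = bwd (nat (int m - s') + n0) (nat (int m - t') + n0) x" using v_x by metis
    from periodsI[OF this] have "(int (nat (int m - s') + n0) - int (nat (int m - s) + n0),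
        int (nat (int m - t') + n0) - int (nat (int m - t) + n0)) \<in> periods x" .
    moreover have "int (nat (int m - s') + n0) - int (nat (int m - s) + n0) = s - s'"
      "int (nat (int m - t') + n0) - int (nat (int m - t) + n0) = t - t'"
      using m by simp_all
    ultimately show "(s - s', t - t') \<in> periods x" by simp
  next
    assume "(s - s', t - t') \<in> periods x"
    then have "(s - s', t - t') \<in> P" by (rule KP)
    then have "v (s' + (s - s')) (t' + (t - t')) = v s' t'" unfolding P_def by blast
    then show "v s t = v s' t'" by simp
  qed
  moreover have "b (v s t) = v (s - 1) t" "r (v s t) = v s (t - 1)" for s t
    using bv[of 1 0 s t] bv[of 0 1 s t] by (simp_all add: b_eq_bwd r_eq_bwd)
  ultimately show ?thesis using vA v_x by (intro that[of v n0])
qed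

end

section \<open>Quotients of the group of pairs of integers\<close>

abbreviation int_pairs :: "(int \<times> int) monoid" where
  "int_pairs \<equiv> integer_group \<times>\<times> integer_group"

lemma mult_int_pairs: "x \<otimes>\<^bsub>int_pairs\<^esub> y = x + y"
  by (simp add: mult_DirProd' prod_eq_iff)

lemma one_int_pairs: "\<one>\<^bsub>int_pairs\<^esub> = 0"
  by (simp add: zero_prod_def)

lemma comm_group_int_pairs: "comm_group int_pairs"
  by (rule group.group_comm_groupI[OF DirProd_group])
    (simp_all add: mult_int_pairs add.commute del: mult_DirProd)

lemma inv_int_pairs: "inv\<^bsub>int_pairs\<^esub> x = - x"
proof -
  interpret comm_group int_pairs by (rule comm_group_int_pairs)
  show ?thesis by (rule inv_equality) (simp_all add: mult_int_pairs one_int_pairs del: one_DirProd)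
qed

lemma subgroup_int_pairs:
  assumes "add_subgroup K" shows "subgroup K int_pairs"
proof (rule subgroup.intro)
  show "x \<otimes>\<^bsub>int_pairs\<^esub> y \<in> K" if "x \<in> K" "y \<in> K" for x y
    unfolding mult_int_pairs using assms that by (rule add_subgroup_add)
  show "inv\<^bsub>int_pairs\<^esub> x \<in> K" if "x \<in> K" for x
    unfolding inv_int_pairs using assms that by (rule add_subgroup_minus)
  show "\<one>\<^bsub>int_pairs\<^esub> \<in> K" unfolding one_int_pairs using assms by (rule add_subgroup_0)
qed simp

definition coset :: "(int \<times> int) set \<Rightarrow> int \<Rightarrow> int \<Rightarrow> (int \<times> int) set" where
  "coset K s t = K #>\<^bsub>int_pairs\<^esub> (s, t)"

lemma mem_coset: "x \<in> coset K s t \<longleftrightarrow> x - (s, t) \<in> K"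
proof
  assume "x \<in> coset K s t"
  then obtain k where "k \<in> K" "x = k + (s, t)"
    unfolding coset_def r_coset_def mult_int_pairs by blast
  then show "x - (s, t) \<in> K" by simp
next
  assume "x - (s, t) \<in> K"
  then have "(x - (s, t)) + (s, t) \<in> coset K s t"
    unfolding coset_def r_coset_def mult_int_pairs by blast
  then show "x \<in> coset K s t" by simp
qed

context
  fixes K :: "(int \<times> int) set" assumes K: "add_subgroup K"
begin

lemma coset_eq_iff: "coset K s t = coset K s' t' \<longleftrightarrow> (s - s', t - t') \<in> K"
proof
  have "(s, t) - (s, t) \<in> K" using add_subgroup_0[OF K] by simp
  then have "(s, t) \<in> coset K s t" by (simp only: mem_coset)
  moreover assume "coset K s t = coset K s' t'"
  ultimately have "(s, t) \<in> coset K s' t'" by simp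
  then show "(s - s', t - t') \<in> K" by (simp add: mem_coset)
next
  assume h: "(s - s', t - t') \<in> K"
  have "x - (s, t) \<in> K \<longleftrightarrow> x - (s', t') \<in> K" for x
    using add_subgroup_add[OF K h, of "x - (s, t)"] add_subgroup_diff[OF K _ h, of "x - (s', t')"]
    by (cases x) auto
  then show "coset K s t = coset K s' t'" by (auto simp: mem_coset set_eq_iff)
qed

lemma carrier_quotient: "carrier (int_pairs Mod K) = {coset K s t | s t. True}"
  by (auto simp: carrier_FactGroup coset_def)

lemma coset_in_carrier [simp]: "coset K s t \<in> carrier (int_pairs Mod K)"
  by (auto simp: carrier_quotient)

lemma mult_coset:
  "coset K s t \<otimes>\<^bsub>int_pairs Mod K\<^esub> coset K s' t' = coset K (s + s') (t + t')"
proof -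
  interpret comm_group int_pairs by (rule comm_group_int_pairs)
  interpret normal K int_pairs by (rule subgroup_imp_normal[OF subgroup_int_pairs[OF K]])
  show ?thesis unfolding coset_def mult_FactGroup by (subst rcos_sum) (simp_all add: mult_int_pairs)
qed

lemma comm_group_quotient: "comm_group (int_pairs Mod K)"
  using comm_group.abelian_FactGroup[OF comm_group_int_pairs subgroup_int_pairs[OF K]] .

lemma one_quotient: "\<one>\<^bsub>int_pairs Mod K\<^esub> = coset K 0 0"
proof -
  have "K = coset K 0 0" by (auto simp: mem_coset zero_prod_def[symmetric])
  then show ?thesis by simp
qed

lemma inv_coset: "inv\<^bsub>int_pairs Mod K\<^esub> coset K s t = coset K (- s) (- t)"
proof -
  interpret comm_group "int_pairs Mod K" by (rule comm_group_quotient)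
  show ?thesis by (rule inv_equality) (simp_all add: mult_coset one_quotient del: one_FactGroup mult_FactGroup)
qed

lemma generate_quotient:
  "generate (int_pairs Mod K) {coset K 1 0, coset K 0 1} = carrier (int_pairs Mod K)" (is "?E = _")
proof
  interpret comm_group "int_pairs Mod K" by (rule comm_group_quotient)
  show "?E \<subseteq> carrier (int_pairs Mod K)" by (rule generate_incl) auto
  have mult: "coset K (s + s') (t + t') \<in> ?E" if "coset K s t \<in> ?E" "coset K s' t' \<in> ?E" for s t s' t'
    using generate.eng[OF that] by (simp add: mult_coset del: mult_FactGroup)
  have 0: "coset K 0 0 \<in> ?E"
    using generate.one[of "int_pairs Mod K"] by (simp add: one_quotient del: one_FactGroup)
  have gens: "coset K 1 0 \<in> ?E" "coset K 0 1 \<in> ?E" "coset K (- 1) 0 \<in> ?E" "coset K 0 (- 1) \<in> ?E"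
    using generate.incl[of "coset K 1 0" "{coset K 1 0, coset K 0 1}" "int_pairs Mod K"]
      generate.incl[of "coset K 0 1" "{coset K 1 0, coset K 0 1}" "int_pairs Mod K"]
      generate.inv[of "coset K 1 0" "{coset K 1 0, coset K 0 1}" "int_pairs Mod K"]
      generate.inv[of "coset K 0 1" "{coset K 1 0, coset K 0 1}" "int_pairs Mod K"]
    by (simp_all add: inv_coset)
  have "coset K (int n) 0 \<in> ?E" "coset K 0 (int n) \<in> ?E"
    "coset K (- int n) 0 \<in> ?E" "coset K 0 (- int n) \<in> ?E" for n
  proof (induction n)
    case (Suc n)
    case 1 show ?case using mult[OF gens(1) Suc(1)] by simp
    case 2 show ?case using mult[OF gens(2) Suc(2)] by simp
    case 3 show ?case using mult[OF gens(3) Suc(3)] by simp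
    case 4 show ?case using mult[OF gens(4) Suc(4)] by simp
  qed (use 0 in simp_all)
  then have "coset K s 0 \<in> ?E" "coset K 0 t \<in> ?E" for s t
    by (metis int_cases2)+
  then have "coset K s t \<in> ?E" for s t using mult[of s 0 0 t] by simp
  then show "carrier (int_pairs Mod K) \<subseteq> ?E" by (auto simp: carrier_quotient)
qed

end

section \<open>Group construction from a bi-infinite path\<close>

text \<open>The group is the lattice modulo the periods of one vertex, and a bi-infinite path embeds
  it injectively into the graph. The image is closed under predecessors and contains an ancestor of
  every vertex, as \<open>minimal_star_dilation_rho\<close> requires. The copy on the image is kept
  apart from the representation on the group because the two live on different types.\<close>

lemma ex_group_construction:
  fixes \<theta> :: "'m::finite \<times> 'n::finite \<Rightarrow> 'm \<times> 'n" and A :: "'w set"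
  assumes full: "full_system \<theta> A b r I J" and conn: "pred_system.connected A b r"
    and a: "cmod a = 1" and c: "cmod c = 1"
  obtains G :: "(int \<times> int) set monoid" and g\<^sub>1 g\<^sub>2 i j \<alpha> \<beta> \<sigma> H \<tau> where
    "group_construction_rep \<theta> G g\<^sub>1 g\<^sub>2 i j \<alpha> \<beta> \<sigma>"
    "unitarily_equivalent \<theta> (ell2_on (carrier G)) \<sigma> H \<tau>" "adjointable \<theta> H \<tau>"
    "minimal_star_dilation \<theta> H \<tau> (ell2_on A) (pred_system.rho A b r I J a c)"
    "(\<And>x y. x \<in> A \<Longrightarrow> y \<in> A \<Longrightarrow> pred_system.same_tail b r I J x y \<Longrightarrow> x = y)
      \<Longrightarrow> irreducible_rep \<theta> (ell2_on (carrier G)) \<sigma>"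
proof -
  interpret full_system \<theta> A b r I J by fact
  obtain x0 where x0: "x0 \<in> A" using conn unfolding connected_def by blast
  obtain v n0 where vA: "\<And>s t. v s t \<in> A"
    and bv: "\<And>s t. b (v s t) = v (s - 1) t" and rv: "\<And>s t. r (v s t) = v s (t - 1)"
    and vx: "\<And>k l. v (- int k) (- int l) = bwd (k + n0) (l + n0) x0"
    and v_eq': "\<And>s t s' t'. v s t = v s' t' \<longleftrightarrow> (s - s', t - t') \<in> periods x0"
    using ex_bi_infinite_path[OF finite[of UNIV] finite[of UNIV] x0] by blast
  define K where "K = periods x0"
  have v_eq: "v s t = v s' t' \<longleftrightarrow> (s - s', t - t') \<in> K" for s t s' t'
    unfolding K_def by (rule v_eq')
  have K: "add_subgroup K" unfolding K_def by (rule add_subgroup_periods[OF x0])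
  let ?G = "int_pairs Mod K" and ?C = "coset K"
  \<comment> \<open>By \<open>v_eq\<close>, equality of cosets is the same as equality of vertices;
    this gives well-definedness here and injectivity later.\<close>
  define h where "h g = (THE y. \<exists>s t. g = ?C s t \<and> y = v s t)" for g
  have h: "h (?C s t) = v s t" for s t
    unfolding h_def
  proof (rule the_equality)
    show "\<exists>s' t'. ?C s t = ?C s' t' \<and> v s t = v s' t'" by blast
    show "y = v s t" if "\<exists>s' t'. ?C s t = ?C s' t' \<and> y = v s' t'" for y
      using that by (auto simp: coset_eq_iff[OF K] v_eq[symmetric])
  qed
  define bG where "bG g = g \<otimes>\<^bsub>?G\<^esub> ?C (- 1) 0" for g
  define rG where "rG g = g \<otimes>\<^bsub>?G\<^esub> ?C 0 (- 1)" for g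
  have bG: "bG (?C s t) = ?C (s - 1) t" and rG: "rG (?C s t) = ?C s (t - 1)" for s t
    unfolding bG_def rG_def mult_coset[OF K] by simp_all
  define IG JG where "IG g = I (h g)" and "JG g = J (h g)" for g
  have cases: "\<exists>s t. g = ?C s t" if "g \<in> carrier ?G" for g
    using that unfolding carrier_quotient[OF K] by blast
  have sq: "\<theta> (I (v s t), J (v (s - 1) t)) = (I (v s (t - 1)), J (v s t))" for s t
    using square[OF vA, of s t] by (simp add: bv rv)
  interpret G: pred_system \<theta> "carrier ?G" bG rG IG JG
  proof
    show "bij \<theta>" by (rule bij_theta)
    fix x assume "x \<in> carrier ?G"
    then obtain s t where x: "x = ?C s t" using cases by blast
    show "bG x \<in> carrier ?G" "rG x \<in> carrier ?G" by (simp_all only: x bG rG coset_in_carrier[OF K])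
    show "bG (rG x) = rG (bG x)" by (simp add: x bG rG)
    show "\<theta> (IG x, JG (bG x)) = (IG (rG x), JG x)"
      by (simp add: x bG rG IG_def JG_def h sq)
    fix y assume "y \<in> carrier ?G"
    then obtain s' t' where y: "y = ?C s' t'" using cases by blast
    show "x = y" if "bG x = bG y" using that by (simp add: x y bG coset_eq_iff[OF K])
    show "x = y" if "rG x = rG y" using that by (simp add: x y rG coset_eq_iff[OF K])
  qed
  define A0 where "A0 = {v s t | s t. True}"
  have vA0: "v s t \<in> A0" for s t unfolding A0_def by blast
  have A0: "A0 \<subseteq> A" "b ` A0 \<subseteq> A0" "r ` A0 \<subseteq> A0"
  proof -
    show "A0 \<subseteq> A" using vA by (auto simp: A0_def)
    show "b ` A0 \<subseteq> A0" "r ` A0 \<subseteq> A0"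
    proof (safe)
      fix y assume "y \<in> A0"
      then obtain s t where y: "y = v s t" unfolding A0_def by blast
      show "b y \<in> A0" "r y \<in> A0" unfolding y bv rv by (rule vA0)+
    qed
  qed
  interpret R: pred_system \<theta> A0 b r I J
  proof
    show "bij \<theta>" by (rule bij_theta)
    fix x assume "x \<in> A0"
    then have x: "x \<in> A" using A0 by auto
    show "b x \<in> A0" "r x \<in> A0" using \<open>x \<in> A0\<close> A0 by auto
    show "b (r x) = r (b x)" "\<theta> (I x, J (b x)) = (I (r x), J x)"
      by (rule b_r[OF x], rule square[OF x])
    fix y assume "y \<in> A0"
    then have y: "y \<in> A" using A0 by auto
    show "x = y" if "b x = b y" "I x = I y" by (rule b_inj[OF x y that])
    show "x = y" if "r x = r y" "J x = J y" by (rule r_inj[OF x y that])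
  qed
  have bij: "bij_betw h (carrier ?G) A0"
  proof (rule bij_betw_imageI)
    show "inj_on h (carrier ?G)"
    proof (rule inj_onI)
      fix x y assume "x \<in> carrier ?G" "y \<in> carrier ?G" "h x = h y"
      then obtain s t s' t' where "x = ?C s t" "y = ?C s' t'" using cases by blast
      then show "x = y" using \<open>h x = h y\<close> by (simp add: h coset_eq_iff[OF K] v_eq)
    qed
    show "h ` carrier ?G = A0"
    proof (intro equalityI subsetI)
      fix y assume "y \<in> h ` carrier ?G"
      then obtain s t where "y = h (?C s t)" using cases by blast
      then show "y \<in> A0" using vA0 by (simp add: h)
    next
      fix y assume "y \<in> A0"
      then obtain s t where "y = h (?C s t)" unfolding A0_def h by blast
      then show "y \<in> h ` carrier ?G" using coset_in_carrier[OF K] by blast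
    qed
  qed
  have hom: "h (bG x) = b (h x) \<and> h (rG x) = r (h x) \<and> IG x = I (h x) \<and> JG x = J (h x)"
    if "x \<in> carrier ?G" for x
    using cases[OF that] by (auto simp: bG rG h bv rv IG_def JG_def)
  let ?\<sigma> = "G.rho a c"
  have ue: "unitarily_equivalent \<theta> (ell2_on (carrier ?G)) ?\<sigma> (ell2_on A0) (R.rho a c)"
    by (rule unitarily_equivalent_rho[OF R.pred_system_axioms G.pred_system_axioms bij hom])
  \<comment> \<open>The path follows the past of \<open>x0\<close> only from depth \<open>n0\<close>
    on, so a common ancestor with \<open>x0\<close> is pushed back by \<open>n0\<close> in both
    directions.\<close>
  have "\<exists>k l. bwd k l x \<in> A0" if "x \<in> A" for x
  proof -
    obtain k l k' l' where "bwd k l x = bwd k' l' x0"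
      using conn x0 \<open>x \<in> A\<close> unfolding connected_def by blast
    then have "bwd (k + n0) (l + n0) x = v (- int k') (- int l')"
      unfolding vx by (rule bwd_shift[OF that _ x0])
    then show ?thesis unfolding A0_def by blast
  qed
  then have dil: "minimal_star_dilation \<theta> (ell2_on A0) (R.rho a c) (ell2_on A) (rho a c)"
    by (intro minimal_star_dilation_rho full A0 a c)
  \<comment> \<open>\<open>IG g\<close> labels the edge entering \<open>g\<close>, whereas a group
    construction records the edge leaving it; hence the shift by a generator.\<close>
  define i where "i g = IG (g \<otimes>\<^bsub>?G\<^esub> ?C 1 0)" for g
  define j where "j g = JG (g \<otimes>\<^bsub>?G\<^esub> ?C 0 1)" for g
  have i: "i (?C s t) = I (v (s + 1) t)" and j: "j (?C s t) = J (v s (t + 1))" for s t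
    by (simp_all add: i_def j_def mult_coset[OF K] IG_def JG_def h del: mult_FactGroup)
  have gc: "group_construction_rep \<theta> ?G (?C 1 0) (?C 0 1) i j (\<lambda>_. a) (\<lambda>_. c) ?\<sigma>"
    unfolding group_construction_rep_def
  proof (intro conjI ballI allI)
    show "comm_group ?G" by (rule comm_group_quotient[OF K])
    show "?C 1 0 \<in> carrier ?G" "?C 0 1 \<in> carrier ?G" by (rule coset_in_carrier[OF K])+
    show "generate ?G {?C 1 0, ?C 0 1} = carrier ?G" by (rule generate_quotient[OF K])
    show "cmod a = 1" "cmod c = 1" by (fact a c)+
    show "a * c = c * a" by simp
    show "representation \<theta> (ell2_on (carrier ?G)) ?\<sigma>" by (rule G.representation_rho[OF a c])
    fix g assume "g \<in> carrier ?G"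
    then obtain s t where g: "g = ?C s t" using cases by blast
    show "gen_e \<theta> (i (g \<otimes>\<^bsub>?G\<^esub> ?C 0 1)) \<otimes>\<^bsub>F_theta \<theta>\<^esub> gen_f \<theta> (j g)
        = gen_f \<theta> (j (g \<otimes>\<^bsub>?G\<^esub> ?C 1 0)) \<otimes>\<^bsub>F_theta \<theta>\<^esub> gen_e \<theta> (i g)"
      unfolding g mult_coset[OF K] i j
      by (rule gen_e_gen_f) (use sq[of "s + 1" "t + 1"] in simp)
    fix k
    show "?\<sigma> (gen_e \<theta> k) (ket g) = (if k = i g then a *\<^sub>C ket (g \<otimes>\<^bsub>?G\<^esub> ?C 1 0) else 0)"
    proof -
      have inj: "inj_on (G.bwd (Suc 0) 0) {x \<in> carrier ?G. G.matches [Inl k] x}"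
        using G.inj_on_bwd[of "[Inl k]"] by simp
      have b1: "G.bwd (Suc 0) 0 x = bG x" for x unfolding G.bwd_def by simp
      have g': "g = G.bwd (Suc 0) 0 (?C (s + 1) t)" unfolding b1 by (simp add: bG g)
      have \<sigma>: "?\<sigma> (gen_e \<theta> k) = pullop {x \<in> carrier ?G. G.matches [Inl k] x} (G.bwd (Suc 0) 0) a"
        unfolding gen_e_def G.rho_word by simp
      show ?thesis
      proof (cases "k = i g")
        case True
        then have "?C (s + 1) t \<in> {x \<in> carrier ?G. G.matches [Inl k] x}"
          by (simp add: g i IG_def h coset_in_carrier[OF K])
        from pullop_ket[OF inj this, of a] True show ?thesis
          unfolding \<sigma> g'[symmetric] by (simp add: g mult_coset[OF K] del: mult_FactGroup)
      next
        case False
        have "g \<notin> G.bwd (Suc 0) 0 ` {x \<in> carrier ?G. G.matches [Inl k] x}"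
        proof
          assume "g \<in> G.bwd (Suc 0) 0 ` {x \<in> carrier ?G. G.matches [Inl k] x}"
          then obtain x where x: "x \<in> carrier ?G" "IG x = k" "g = bG x" by (auto simp: b1)
          then obtain s' t' where x': "x = ?C s' t'" using cases by blast
          then have "x = ?C (s + 1) t" using x(3)[symmetric] by (simp add: g bG coset_eq_iff[OF K] algebra_simps)
          then show False using x(2) False by (simp add: g i IG_def h)
        qed
        then show ?thesis unfolding \<sigma> pullop_ket_0[OF inj \<open>g \<notin> _\<close>] using False by simp
      qed
    qed
  next
    fix g k assume "g \<in> carrier ?G"
    then obtain s t where g: "g = ?C s t" using cases by blast
    show "?\<sigma> (gen_f \<theta> k) (ket g) = (if k = j g then c *\<^sub>C ket (g \<otimes>\<^bsub>?G\<^esub> ?C 0 1) else 0)"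
    proof -
      have inj: "inj_on (G.bwd 0 (Suc 0)) {x \<in> carrier ?G. G.matches [Inr k] x}"
        using G.inj_on_bwd[of "[Inr k]"] by simp
      have b1: "G.bwd 0 (Suc 0) x = rG x" for x unfolding G.bwd_def by simp
      have g': "g = G.bwd 0 (Suc 0) (?C s (t + 1))" unfolding b1 by (simp add: rG g)
      have \<sigma>: "?\<sigma> (gen_f \<theta> k) = pullop {x \<in> carrier ?G. G.matches [Inr k] x} (G.bwd 0 (Suc 0)) c"
        unfolding gen_f_def G.rho_word by simp
      show ?thesis
      proof (cases "k = j g")
        case True
        then have "?C s (t + 1) \<in> {x \<in> carrier ?G. G.matches [Inr k] x}"
          by (simp add: g j JG_def h coset_in_carrier[OF K])
        from pullop_ket[OF inj this, of c] True show ?thesis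
          unfolding \<sigma> g'[symmetric] by (simp add: g mult_coset[OF K] del: mult_FactGroup)
      next
        case False
        have "g \<notin> G.bwd 0 (Suc 0) ` {x \<in> carrier ?G. G.matches [Inr k] x}"
        proof
          assume "g \<in> G.bwd 0 (Suc 0) ` {x \<in> carrier ?G. G.matches [Inr k] x}"
          then obtain x where x: "x \<in> carrier ?G" "JG x = k" "g = rG x" by (auto simp: b1)
          then obtain s' t' where x': "x = ?C s' t'" using cases by blast
          then have "x = ?C s (t + 1)" using x(3)[symmetric] by (simp add: g rG coset_eq_iff[OF K] algebra_simps)
          then show False using x(2) False by (simp add: g j JG_def h)
        qed
        then show ?thesis unfolding \<sigma> pullop_ket_0[OF inj \<open>g \<notin> _\<close>] using False by simp
      qed
    qed
  qed
  \<comment> \<open>Tails in the group graph are tails of the path vertices, so separation of tails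
    passes from \<open>A\<close> to the group; any two lattice positions have a common
    ancestor.\<close>
  have irr: "irreducible_rep \<theta> (ell2_on (carrier ?G)) ?\<sigma>"
    if sep: "\<And>x y. x \<in> A \<Longrightarrow> y \<in> A \<Longrightarrow> same_tail x y \<Longrightarrow> x = y"
  proof (rule G.irreducible_rho[OF a c])
    have bwdG: "G.bwd k l (?C s t) = ?C (s - int k) (t - int l)" for k l s t
    proof -
      have "(rG ^^ l) (?C s t) = ?C s (t - int l)" by (induction l) (auto simp: rG algebra_simps)
      moreover have "(bG ^^ k) (?C s t) = ?C (s - int k) t" for t
        by (induction k) (auto simp: bG algebra_simps)
      ultimately show ?thesis by (simp add: G.bwd_def)
    qed
    have bwdv: "bwd k l (v s t) = v (s - int k) (t - int l)" for k l s t
    proof -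
      have "(r ^^ l) (v s t) = v s (t - int l)" by (induction l) (auto simp: rv algebra_simps)
      moreover have "(b ^^ k) (v s t) = v (s - int k) t" for t
        by (induction k) (auto simp: bv algebra_simps)
      ultimately show ?thesis by (simp add: bwd_def)
    qed
    show "G.connected"
      unfolding G.connected_def
    proof (intro conjI ballI)
      show "carrier ?G \<noteq> {}" using coset_in_carrier[OF K] by blast
      fix x y assume "x \<in> carrier ?G" "y \<in> carrier ?G"
      then obtain s t s' t' where xy: "x = ?C s t" "y = ?C s' t'" using cases by blast
      have "G.bwd (nat (s - s')) (nat (t - t')) x = G.bwd (nat (s' - s)) (nat (t' - t)) y"
        unfolding xy bwdG by simp
      then show "\<exists>k l k' l'. G.bwd k l x = G.bwd k' l' y" by blast
    qed
    fix x y assume "x \<in> carrier ?G" "y \<in> carrier ?G" and st: "G.same_tail x y"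
    then obtain s t s' t' where xy: "x = ?C s t" "y = ?C s' t'" using cases by blast
    have "same_tail (v s t) (v s' t')"
      using st unfolding G.same_tail_def same_tail_def xy bwdG bwdv IG_def JG_def h .
    then have "v s t = v s' t'" using sep vA by blast
    then show "x = y" unfolding xy coset_eq_iff[OF K] by (simp add: v_eq)
  qed
  show ?thesis by (rule that[OF gc ue R.adjointable_rho dil irr])
qed

section \<open>Uniqueness of Fourier coefficients\<close>

definition char2 :: "int \<Rightarrow> int \<Rightarrow> real \<times> real \<Rightarrow> complex" where
  "char2 u v p = cis (2 * pi * (of_int u * fst p + of_int v * snd p))"

lemma norm_char2 [simp]: "cmod (char2 u v p) = 1"
  by (simp add: char2_def)

lemma char2_mult: "char2 u v p * char2 u' v' p = char2 (u + u') (v + v') p"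
  by (simp add: char2_def cis_mult algebra_simps)

lemma char2_0 [simp]: "char2 0 0 p = 1"
  by (simp add: char2_def)

lemma measurable_char2 [measurable]: "char2 u v \<in> borel_measurable borel"
  unfolding char2_def by (intro borel_measurable_continuous_onI continuous_intros)

lemma integrable_bounded_mult:
  fixes f h :: "'a \<Rightarrow> complex"
  assumes h: "integrable M h" and [measurable]: "f \<in> borel_measurable M" and f: "\<And>x. cmod (f x) \<le> B"
  shows "integrable M (\<lambda>x. f x * h x)"
proof (rule Bochner_Integration.integrable_bound)
  show "integrable M (\<lambda>x. B * norm (h x))" using h by (intro integrable_mult_right integrable_norm)
  show "(\<lambda>x. f x * h x) \<in> borel_measurable M" using h by measurable
  have "norm (f x * h x) \<le> norm (B * norm (h x))" for x
  proof -
    have "norm (f x * h x) \<le> B * norm (h x)"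
      using mult_right_mono[OF f, of "norm (h x)" x] by (simp add: norm_mult)
    also have "\<dots> \<le> norm (B * norm (h x))" by simp
    finally show ?thesis .
  qed
  then show "AE x in M. norm (f x * h x) \<le> norm (B * norm (h x))" by simp
qed

text \<open>The functions to be proved null. Stability under multiplication by characters lets the
  argument pass from characters to continuous functions and then to indicators.\<close>

definition null_fourier :: "(real \<times> real) measure \<Rightarrow> (real \<times> real \<Rightarrow> complex) \<Rightarrow> bool" where
  "null_fourier M h \<longleftrightarrow> integrable M h \<and> (\<forall>u v. (\<integral>p. char2 u v p * h p \<partial>M) = 0)"

context
  fixes M :: "(real \<times> real) measure"
  assumes sets_M [measurable_cong]: "sets M = sets borel"
begin

lemma integrable_char2_mult: "integrable M h \<Longrightarrow> integrable M (\<lambda>p. char2 u v p * h p)"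
  by (rule integrable_bounded_mult[where B=1]) auto

lemma null_fourier_add:
  assumes "null_fourier M h" "null_fourier M h'" shows "null_fourier M (\<lambda>p. h p + h' p)"
  using assms unfolding null_fourier_def
  by (simp add: distrib_left integrable_char2_mult)

lemma null_fourier_cmult:
  assumes "null_fourier M h" shows "null_fourier M (\<lambda>p. c * h p)"
  using assms unfolding null_fourier_def by (simp add: mult.left_commute[of _ c])

lemma null_fourier_char2:
  assumes "null_fourier M h" shows "null_fourier M (\<lambda>p. char2 u v p * h p)"
  using assms unfolding null_fourier_def
  by (simp add: integrable_char2_mult mult.assoc[symmetric] char2_mult)

lemma null_fourier_integral:
  assumes "null_fourier M h" shows "(\<integral>p. h p \<partial>M) = 0"
  using assms unfolding null_fourier_def by (metis (no_types, lifting) Bochner_Integration.integral_cong char2_0 mult_1)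

definition torus :: "(complex \<times> complex) set" where
  "torus = sphere 0 1 \<times> sphere 0 1"

definition torus_map :: "real \<times> real \<Rightarrow> complex \<times> complex" where
  "torus_map p = (char2 1 0 p, char2 0 1 p)"

lemma continuous_torus_map: "continuous_on S torus_map"
  unfolding torus_map_def char2_def by (intro continuous_intros)

lemma torus_map_in [simp]: "torus_map p \<in> torus"
  by (simp add: torus_def torus_map_def)

lemma continuous_comp_torus_map: "continuous_on torus f \<Longrightarrow> continuous_on UNIV (\<lambda>p. f (torus_map p))"
  by (rule continuous_on_compose2[OF _ continuous_torus_map]) auto

lemma measurable_continuous: "continuous_on UNIV f \<Longrightarrow> f \<in> borel_measurable M"
  for f :: "real \<times> real \<Rightarrow> complex"
  using borel_measurable_continuous_onI measurable_cong_sets[OF sets_M HOL.refl] by blast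

text \<open>Trigonometric polynomials are never written down. Instead, the continuous real functions
  whose multiplication preserves \<open>null_fourier\<close> form an algebra containing the real and
  imaginary parts of both coordinates, and \<open>Stone_Weierstrass_basic\<close> applies to
  it.\<close>

definition multipliers :: "(complex \<times> complex \<Rightarrow> real) set" where
  "multipliers = {f. continuous_on torus f \<and>
    (\<forall>h. null_fourier M h \<longrightarrow> null_fourier M (\<lambda>p. complex_of_real (f (torus_map p)) * h p))}"

lemma char2_Re_Im:
  "complex_of_real (Re (char2 u v p)) = (char2 u v p + char2 (- u) (- v) p) / 2"
  "complex_of_real (Im (char2 u v p)) = (char2 u v p - char2 (- u) (- v) p) / (2 * \<i>)"
proof -
  have "char2 (- u) (- v) p = cnj (char2 u v p)" by (simp add: char2_def cis_cnj algebra_simps)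
  then show "complex_of_real (Re (char2 u v p)) = (char2 u v p + char2 (- u) (- v) p) / 2"
    "complex_of_real (Im (char2 u v p)) = (char2 u v p - char2 (- u) (- v) p) / (2 * \<i>)"
    by (simp_all add: complex_eq_iff)
qed

lemma null_fourier_Re_Im:
  assumes "null_fourier M h"
  shows "null_fourier M (\<lambda>p. complex_of_real (Re (char2 u v p)) * h p)"
    "null_fourier M (\<lambda>p. complex_of_real (Im (char2 u v p)) * h p)"
proof -
  note c = null_fourier_char2[OF assms]
  have "null_fourier M (\<lambda>p. (1/2) * (char2 u v p * h p + char2 (- u) (- v) p * h p))"
    by (intro null_fourier_cmult null_fourier_add c)
  then show "null_fourier M (\<lambda>p. complex_of_real (Re (char2 u v p)) * h p)"
    unfolding char2_Re_Im by (simp add: algebra_simps add_divide_distrib)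
  have "null_fourier M (\<lambda>p. (1/(2*\<i>)) * (char2 u v p * h p + (-1) * (char2 (- u) (- v) p * h p)))"
    by (intro null_fourier_cmult null_fourier_add c)
  then show "null_fourier M (\<lambda>p. complex_of_real (Im (char2 u v p)) * h p)"
    unfolding char2_Re_Im by (simp add: algebra_simps diff_divide_distrib)
qed

lemma function_ring_multipliers: "function_ring_on multipliers torus"
proof
  show "compact torus" unfolding torus_def by (intro compact_Times compact_sphere)
  show "continuous_on torus f" if "f \<in> multipliers" for f using that by (simp add: multipliers_def)
  show "(\<lambda>x. f x + g x) \<in> multipliers" if "f \<in> multipliers" "g \<in> multipliers" for f g
    using that unfolding multipliers_def
    by (auto simp: distrib_right intro!: continuous_intros null_fourier_add)
  show "(\<lambda>x. f x * g x) \<in> multipliers" if "f \<in> multipliers" "g \<in> multipliers" for f g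
    using that unfolding multipliers_def
    by (auto simp: mult.assoc intro!: continuous_intros)
  show "(\<lambda>_. c) \<in> multipliers" for c
    unfolding multipliers_def by (auto intro!: continuous_intros null_fourier_cmult)
  have "(\<lambda>z. Re (fst z)) \<in> multipliers" "(\<lambda>z. Im (fst z)) \<in> multipliers"
    "(\<lambda>z. Re (snd z)) \<in> multipliers" "(\<lambda>z. Im (snd z)) \<in> multipliers"
    unfolding multipliers_def torus_map_def
    by (auto intro!: continuous_intros null_fourier_Re_Im)
  then show "\<exists>f\<in>multipliers. f x \<noteq> f y" if "x \<noteq> y" for x y
    using that by (metis complex_eq_iff prod_eq_iff)
qed

text \<open>Approximating \<open>f\<close> uniformly by a multiplier changes the integral by at most
  \<open>e\<close> times the integral of \<open>cmod (h p)\<close>; for the multiplier itself the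
  integral is a zeroth Fourier coefficient.\<close>

lemma null_fourier_continuous:
  assumes h: "null_fourier M h" and f: "continuous_on torus f"
  shows "(\<integral>p. complex_of_real (f (torus_map p)) * h p \<partial>M) = 0"
proof -
  interpret function_ring_on multipliers torus by (rule function_ring_multipliers)
  have int: "integrable M h" using h by (simp add: null_fourier_def)
  have meas: "(\<lambda>p. complex_of_real (g (torus_map p))) \<in> borel_measurable M" if "continuous_on torus g" for g
    by (intro measurable_continuous continuous_on_of_real continuous_comp_torus_map that)
  have int': "integrable M (\<lambda>p. complex_of_real (g (torus_map p)) * h p)" if g: "continuous_on torus g" for g
  proof -
    have "bounded (g ` torus)" using compact compact_continuous_image[OF g] compact_imp_bounded by blast
    then obtain B where "\<And>z. z \<in> torus \<Longrightarrow> \<bar>g z\<bar> \<le> B" unfolding bounded_iff by auto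
    then show ?thesis using int meas[OF g] by (intro integrable_bounded_mult[where B=B]) auto
  qed
  let ?I = "\<integral>p. complex_of_real (f (torus_map p)) * h p \<partial>M"
  have "cmod ?I \<le> e * (\<integral>p. cmod (h p) \<partial>M)" if e: "e > 0" for e
  proof -
    obtain g where g: "g \<in> multipliers" "\<And>z. z \<in> torus \<Longrightarrow> \<bar>f z - g z\<bar> < e"
      using Stone_Weierstrass_basic[OF f e] by blast
    then have gc: "continuous_on torus g" by (simp add: multipliers_def)
    have "(\<integral>p. complex_of_real (g (torus_map p)) * h p \<partial>M) = 0"
      using g(1) h by (intro null_fourier_integral) (simp add: multipliers_def)
    then have "?I = (\<integral>p. complex_of_real (f (torus_map p)) * h p - complex_of_real (g (torus_map p)) * h p \<partial>M)"
      using int'[OF f] int'[OF gc] by simp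
    also have "cmod \<dots> \<le> (\<integral>p. cmod (complex_of_real (f (torus_map p)) * h p - complex_of_real (g (torus_map p)) * h p) \<partial>M)"
      by (rule integral_norm_bound)
    also have "\<dots> \<le> (\<integral>p. e * cmod (h p) \<partial>M)"
    proof (rule integral_mono)
      show "integrable M (\<lambda>p. cmod (complex_of_real (f (torus_map p)) * h p - complex_of_real (g (torus_map p)) * h p))"
        using int'[OF f] int'[OF gc] by (intro integrable_norm Bochner_Integration.integrable_diff)
      show "integrable M (\<lambda>p. e * cmod (h p))" using int by (intro integrable_mult_right integrable_norm)
      fix p
      have "cmod (complex_of_real (f (torus_map p)) * h p - complex_of_real (g (torus_map p)) * h p)
          = \<bar>f (torus_map p) - g (torus_map p)\<bar> * cmod (h p)"
        by (simp add: left_diff_distrib[symmetric] norm_mult del: of_real_diff flip: of_real_diff)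
      also have "\<dots> \<le> e * cmod (h p)" using g(2)[of "torus_map p"] by (intro mult_right_mono) auto
      finally show "cmod (complex_of_real (f (torus_map p)) * h p - complex_of_real (g (torus_map p)) * h p) \<le> e * cmod (h p)" .
    qed
    finally show ?thesis by simp
  qed
  then have *: "cmod ?I \<le> e * (\<integral>p. cmod (h p) \<partial>M)" if "e > 0" for e using that by blast
  have "(\<lambda>n. inverse (real (Suc n)) * (\<integral>p. cmod (h p) \<partial>M)) \<longlonglongrightarrow> 0 * (\<integral>p. cmod (h p) \<partial>M)"
    by (intro tendsto_intros LIMSEQ_inverse_real_of_nat)
  then have "cmod ?I \<le> 0"
    by (intro LIMSEQ_le_const) (auto intro!: * simp del: of_nat_Suc)
  then show ?thesis by simp
qed

lemma torus_map_inj: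
  assumes "p \<in> {0..<1} \<times> {0..<1}" "q \<in> {0..<1} \<times> {0..<1}" "torus_map p = torus_map q"
  shows "p = q"
proof -
  have *: "x = y" if "x \<in> {0..<1}" "y \<in> {0..<1}" "cis (2 * pi * x) = cis (2 * pi * y)" for x y :: real
  proof -
    have "exp (\<i> * of_real (2 * pi * x)) = exp (\<i> * of_real (2 * pi * y))"
      using that(3) by (simp add: cis_conv_exp)
    then obtain n :: int where n: "\<i> * of_real (2 * pi * x) = \<i> * of_real (2 * pi * y) + (of_int (2 * n) * pi) * \<i>"
      unfolding exp_eq by blast
    then have "Im (\<i> * of_real (2 * pi * x)) = Im (\<i> * of_real (2 * pi * y) + (of_int (2 * n) * pi) * \<i>)" by simp
    then have "2 * pi * x = 2 * pi * (y + of_int n)" by (simp add: algebra_simps)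
    then have "x = y + of_int n" by simp
    moreover from this that have "n = 0" by auto
    ultimately show ?thesis by simp
  qed
  show ?thesis
    using assms *[of "fst p" "fst q"] *[of "snd p" "snd q"]
    by (auto simp: torus_map_def char2_def prod_eq_iff mem_Times_iff)
qed

text \<open>The indicator of a compact set is a limit of continuous functions of the distance
  measured on the torus, not in the plane. This works because \<open>torus_map\<close> is injective
  on the half-open square, which carries the measure.\<close>

lemma null_fourier_compact:
  assumes h: "null_fourier M h" and supp: "AE p in M. p \<in> {0..<1} \<times> {0..<1}"
    and C: "compact C" "C \<subseteq> {0..<1} \<times> {0..<1}"
  shows "(\<integral>p. indicat_real C p *\<^sub>R h p \<partial>M) = 0"
proof (cases "C = {}")
  case False
  define D where "D = torus_map ` C"
  have D: "compact D" "D \<noteq> {}"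
    using False compact_continuous_image[OF continuous_torus_map C(1)] by (auto simp: D_def)
  define f where "f n z = max 0 (1 - real n * infdist z D)" for n z
  have int: "integrable M h" using h by (simp add: null_fourier_def)
  have fc: "continuous_on S (f n)" for n S unfolding f_def by (intro continuous_intros)
  have "(\<lambda>n. \<integral>p. complex_of_real (f n (torus_map p)) * h p \<partial>M) \<longlonglongrightarrow> (\<integral>p. indicat_real C p *\<^sub>R h p \<partial>M)"
  proof (rule integral_dominated_convergence[where w="\<lambda>p. norm (h p)"])
    have "closed C" using C(1) compact_imp_closed by blast
    then have "C \<in> sets borel" by simp
    then show "(\<lambda>p. indicat_real C p *\<^sub>R h p) \<in> borel_measurable M"
      using int sets_M by (intro borel_measurable_scaleR borel_measurable_indicator borel_measurable_integrable) auto
    show "(\<lambda>p. complex_of_real (f n (torus_map p)) * h p) \<in> borel_measurable M" for n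
      using int by (intro borel_measurable_times borel_measurable_integrable[of M h]
          measurable_continuous continuous_on_of_real continuous_comp_torus_map fc)
    show "integrable M (\<lambda>p. norm (h p))" using int by (rule integrable_norm)
    have f1: "\<bar>f n z\<bar> \<le> 1" for n z by (auto simp: f_def infdist_nonneg)
    show "AE p in M. norm (complex_of_real (f n (torus_map p)) * h p) \<le> norm (h p)" for n
      by (intro AE_I2) (simp add: norm_mult f1 mult_left_le_one_le)
    show "AE p in M. (\<lambda>n. complex_of_real (f n (torus_map p)) * h p) \<longlonglongrightarrow> indicat_real C p *\<^sub>R h p"
      using supp
    proof eventually_elim
      case (elim p)
      show ?case
      proof (cases "p \<in> C")
        case True
        then have "f n (torus_map p) = 1" for n by (simp add: f_def D_def)
        then show ?thesis using True by simp
      next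
        case False
        then have "torus_map p \<notin> D" using torus_map_inj[OF elim] C(2) by (auto simp: D_def)
        then have pos: "infdist (torus_map p) D > 0"
          using D compact_imp_closed in_closed_iff_infdist_zero infdist_nonneg
          by (metis order_less_le)
        then obtain N where N: "real N * infdist (torus_map p) D > 1"
          using reals_Archimedean3 by blast
        have "f n (torus_map p) = 0" if "n \<ge> N" for n
        proof -
          have "real N * infdist (torus_map p) D \<le> real n * infdist (torus_map p) D"
            using that pos by (intro mult_right_mono) auto
          then show ?thesis using N by (simp add: f_def)
        qed
        then have "\<forall>\<^sub>F n in sequentially. complex_of_real (f n (torus_map p)) * h p = indicat_real C p *\<^sub>R h p"
          using False by (intro eventually_sequentiallyI[of N]) simp
        then show ?thesis by (rule tendsto_eventually)
      qed
    qed
  qed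
  moreover have "(\<integral>p. complex_of_real (f n (torus_map p)) * h p \<partial>M) = 0" for n
    by (rule null_fourier_continuous[OF h fc])
  ultimately show ?thesis by (simp add: LIMSEQ_const_iff)
qed simp

text \<open>The part of a closed set in the half-open square need not be compact, so it is exhausted
  by slightly smaller closed squares.\<close>

lemma null_fourier_closed:
  assumes h: "null_fourier M h" and supp: "AE p in M. p \<in> {0..<1} \<times> {0..<1}" and F: "closed F"
  shows "(\<integral>p. indicat_real F p *\<^sub>R h p \<partial>M) = 0"
proof -
  define S where "S n = F \<inter> ({0..1 - inverse (real (Suc n))} \<times> {0..1 - inverse (real (Suc n))})" for n
  have S: "compact (S n)" "S n \<subseteq> {0..<1} \<times> {0..<1}" for n
  proof -
    show "compact (S n)" unfolding S_def using F
      by (intro closed_Int_compact compact_Times compact_Icc)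
    have "x < 1" if "x \<le> 1 - inverse (real (Suc n))" for x :: real
    proof -
      have "1 - inverse (real (Suc n)) < 1" by simp
      with that show ?thesis by linarith
    qed
    then show "S n \<subseteq> {0..<1} \<times> {0..<1}" unfolding S_def by (auto simp del: of_nat_Suc)
  qed
  have int: "integrable M h" using h by (simp add: null_fourier_def)
  have meas: "(\<lambda>p. indicat_real C p *\<^sub>R h p) \<in> borel_measurable M" if "closed C" for C
    using int sets_M that by (intro borel_measurable_scaleR borel_measurable_indicator borel_measurable_integrable) auto
  have "(\<lambda>n. \<integral>p. indicat_real (S n) p *\<^sub>R h p \<partial>M) \<longlonglongrightarrow> (\<integral>p. indicat_real F p *\<^sub>R h p \<partial>M)"
  proof (rule integral_dominated_convergence[where w="\<lambda>p. norm (h p)"])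
    show "(\<lambda>p. indicat_real F p *\<^sub>R h p) \<in> borel_measurable M" by (rule meas[OF F])
    show "(\<lambda>p. indicat_real (S n) p *\<^sub>R h p) \<in> borel_measurable M" for n
      by (rule meas[OF compact_imp_closed[OF S(1)]])
    show "integrable M (\<lambda>p. norm (h p))" using int by (rule integrable_norm)
    show "AE p in M. norm (indicat_real (S n) p *\<^sub>R h p) \<le> norm (h p)" for n
      by (auto simp: indicator_def)
    show "AE p in M. (\<lambda>n. indicat_real (S n) p *\<^sub>R h p) \<longlonglongrightarrow> indicat_real F p *\<^sub>R h p"
      using supp
    proof eventually_elim
      case (elim p)
      then have m: "0 < 1 - max (fst p) (snd p)" by (auto simp: mem_Times_iff)
      obtain N where N: "inverse (real (Suc N)) < 1 - max (fst p) (snd p)"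
        using reals_Archimedean[OF m] by blast
      have "p \<in> S n \<longleftrightarrow> p \<in> F" if "n \<ge> N" for n
      proof -
        have "inverse (real (Suc n)) \<le> inverse (real (Suc N))" using that by (intro le_imp_inverse_le) auto
        then have "fst p \<le> 1 - inverse (real (Suc n))" "snd p \<le> 1 - inverse (real (Suc n))"
          using N by linarith+
        then show ?thesis using elim unfolding S_def by (auto simp: mem_Times_iff simp del: of_nat_Suc)
      qed
      then have "\<forall>\<^sub>F n in sequentially. indicat_real (S n) p *\<^sub>R h p = indicat_real F p *\<^sub>R h p"
        by (intro eventually_sequentiallyI[of N]) (simp add: indicator_def)
      then show ?case by (rule tendsto_eventually)
    qed
  qed
  then show ?thesis by (simp add: null_fourier_compact[OF h supp S] LIMSEQ_const_iff)
qed

text \<open>Closed sets generate the Borel sets and are stable under intersection, so vanishing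
  integrals spread to all Borel sets by Dynkin's argument; a density with vanishing integral over
  every set is null.\<close>

theorem null_fourier_AE_zero:
  assumes fin: "finite_measure M" and h: "null_fourier M h" and supp: "AE p in M. p \<in> {0..<1} \<times> {0..<1}"
  shows "AE p in M. h p = 0"
proof (rule sigma_finite_measure.density_unique_banach)
  show "sigma_finite_measure M" using fin unfolding finite_measure_def by blast
  show int: "integrable M h" using h by (simp add: null_fourier_def)
  show "integrable M (\<lambda>_. 0 :: complex)" by simp
  fix A assume "A \<in> sets M"
  then have A: "A \<in> sigma_sets UNIV (Collect closed)"
    unfolding sets_M borel_eq_closed by (simp add: sets_measure_of)
  have meas: "B \<in> sets M" if "B \<in> sigma_sets UNIV (Collect closed)" for B
    using that unfolding sets_M borel_eq_closed by (simp add: sets_measure_of)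
  have intB: "integrable M (\<lambda>p. indicat_real B p *\<^sub>R h p)" if "B \<in> sets M" for B
    using that int by (rule integrable_mult_indicator)
  have "(\<integral>p. indicat_real A p *\<^sub>R h p \<partial>M) = 0"
  proof -
    have "Int_stable (Collect closed :: (real \<times> real) set set)" by (auto simp: Int_stable_def)
    then show ?thesis using subset_UNIV[of "Collect closed", folded Pow_UNIV] A
  proof (induction rule: sigma_sets_induct_disjoint)
    case (basic B)
    then show ?case using null_fourier_closed[OF h supp] by simp
  next
    case (compl B)
    have "(\<integral>p. indicat_real (UNIV - B) p *\<^sub>R h p \<partial>M) = (\<integral>p. h p - indicat_real B p *\<^sub>R h p \<partial>M)"
      by (intro Bochner_Integration.integral_cong) (auto simp: indicator_def)
    also have "\<dots> = 0"
      using int intB[OF meas[OF compl.hyps]] compl null_fourier_integral[OF h] by simp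
    finally show ?case .
  next
    case (union B)
    have B: "B i \<in> sets M" for i using union meas by blast
    then have "set_integrable M (\<Union>i. B i) h"
      unfolding set_integrable_def by (intro intB sets.countable_UN) auto
    from lebesgue_integral_countable_add[OF B _ this]
    have "set_lebesgue_integral M (\<Union>i. B i) h = (\<Sum>i. set_lebesgue_integral M (B i) h)"
      using union(1) by (auto simp: disjoint_family_on_def)
    then show ?case using union by (simp add: set_lebesgue_integral_def)
  qed auto
  qed
  then show "set_lebesgue_integral M A h = set_lebesgue_integral M A (\<lambda>_. 0)"
    by (simp add: set_lebesgue_integral_def)
qed

end

section \<open>Measures with prescribed Fourier coefficients\<close>

lemma cis_eq_1_imp:
  assumes "cis (2 * pi * x) = 1" shows "x \<in> \<int>"
proof -
  have "exp (\<i> * complex_of_real (2 * pi * x)) = 1" using assms by (simp add: cis_conv_exp)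
  then obtain n :: int where "Im (\<i> * complex_of_real (2 * pi * x)) = of_int (2 * n) * pi"
    unfolding exp_eq_1 by blast
  then have "x = of_int n" by simp
  then show ?thesis by simp
qed

text \<open>These are the Haar measures of closed subgroups of the circle, cut open to [0, 1):
  Lebesgue measure for \<open>d = 0\<close>, and otherwise the uniform distribution on the multiples
  of \<open>1 / d\<close>, whose coefficients are geometric sums.\<close>

lemma ex_circle_measure:
  fixes d :: int
  assumes "d \<ge> 0"
  obtains \<nu> :: "real measure" where "sets \<nu> = sets borel" "emeasure \<nu> (space \<nu>) = 1"
    "AE x in \<nu>. x \<in> {0..<1}"
    "\<And>k :: int. (\<integral>x. cis (2 * pi * (of_int k * x)) \<partial>\<nu>) = (if d dvd k then 1 else 0)"
proof (cases "d = 0")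
  case True
  define \<nu> :: "real measure" where "\<nu> = density lborel (\<lambda>x. ennreal (indicat_real {0..1} x))"
  have sets: "sets \<nu> = sets borel" by (simp add: \<nu>_def)
  have space: "emeasure \<nu> (space \<nu>) = 1"
    unfolding \<nu>_def by (subst emeasure_density) (simp_all add: ennreal_indicator)
  have "AE x in (lborel :: real measure). x \<noteq> 1" by (rule AE_lborel_singleton)
  then have "AE x in (lborel :: real measure). 0 < ennreal (indicat_real {0..1} x) \<longrightarrow> x \<in> {0..<1}"
    by eventually_elim (auto simp: indicator_def)
  then have supp: "AE x in \<nu>. x \<in> {0..<1}" unfolding \<nu>_def by (subst AE_density) auto
  have int: "(\<integral>x. cis (2 * pi * (of_int k * x)) \<partial>\<nu>) = (\<integral>x. indicat_real {0..1} x *\<^sub>R cis (2 * pi * (of_int k * x)) \<partial>lborel)" for k :: int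
    unfolding \<nu>_def
    by (rule integral_density)
      (auto intro!: borel_measurable_continuous_onI continuous_intros)
  have "(\<integral>x. cis (2 * pi * (of_int k * x)) \<partial>\<nu>) = 0" if "k \<noteq> 0" for k
  proof -
    let ?w = "\<i> * (2 * pi * of_int k) :: complex"
    have w: "?w \<noteq> 0" using that by simp
    have "((\<lambda>z. exp (?w * z) / ?w) has_field_derivative exp (?w * z)) (at z)" for z
      using w by (auto intro!: derivative_eq_intros)
    then have "((\<lambda>x. exp (?w * of_real x) / ?w) has_vector_derivative exp (?w * of_real x)) (at x within {0..1})" for x
      by (rule has_vector_derivative_real_field)
    then have "has_bochner_integral lborel (\<lambda>x. indicat_real {0..1} x *\<^sub>R exp (?w * of_real x))
        (exp (?w * of_real 1) / ?w - exp (?w * of_real 0) / ?w)"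
      by (intro has_bochner_integral_FTC_Icc) (auto intro!: continuous_intros)
    moreover have e: "exp (?w * of_real x) = cis (2 * pi * (of_int k * x))" for x
      by (simp add: cis_conv_exp mult_ac)
    moreover have "exp (?w * of_real 1) = 1" unfolding e by (simp add: cis_multiple_2pi)
    ultimately have "has_bochner_integral lborel (\<lambda>x. indicat_real {0..1} x *\<^sub>R cis (2 * pi * (of_int k * x))) 0"
      by (simp only:) simp
    then show ?thesis unfolding int by (rule has_bochner_integral_integral_eq)
  qed
  moreover have "(\<integral>x. cis (2 * pi * (of_int 0 * x)) \<partial>\<nu>) = 1"
    unfolding int by simp
  ultimately show ?thesis using that[of \<nu>] sets space supp True by (metis dvd_0_left dvd_0_right)
next
  case False
  define n where "n = nat d"
  have n: "n > 0" "d = int n" using False assms by (auto simp: n_def)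
  define P where "P = point_measure {..<n} (\<lambda>_. ennreal (1 / n))"
  define \<nu> where "\<nu> = distr P borel (\<lambda>i. real i / real n)"
  have meas [measurable]: "(\<lambda>i. real i / real n) \<in> P \<rightarrow>\<^sub>M borel"
    by (simp add: P_def measurable_def sets_point_measure space_point_measure)
  have sets: "sets \<nu> = sets borel" by (simp add: \<nu>_def)
  have "emeasure P {..<n} = 1"
    using n by (simp add: P_def emeasure_point_measure_finite ennreal_of_nat_eq_real_of_nat
        flip: ennreal_mult)
  then have space: "emeasure \<nu> (space \<nu>) = 1"
    unfolding \<nu>_def by (subst emeasure_distr) (auto simp: P_def space_point_measure)
  have "AE i in P. real i / real n \<in> {0..<1}"
    using n by (intro AE_I2) (auto simp: P_def space_point_measure)
  then have supp: "AE x in \<nu>. x \<in> {0..<1}" unfolding \<nu>_def by (subst AE_distr_iff) auto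
  have "(\<integral>x. cis (2 * pi * (of_int k * x)) \<partial>\<nu>) = (if d dvd k then 1 else 0)" for k :: int
  proof -
    let ?z = "cis (2 * pi * (of_int k / real n))"
    have "(\<integral>x. cis (2 * pi * (of_int k * x)) \<partial>\<nu>) = (\<integral>i. cis (2 * pi * (of_int k * (real i / real n))) \<partial>P)"
      unfolding \<nu>_def
      by (rule integral_distr[OF meas]) (auto intro!: borel_measurable_continuous_onI continuous_intros)
    also have "\<dots> = (\<Sum>i<n. (1 / real n) *\<^sub>R cis (2 * pi * (of_int k * (real i / real n))))"
      unfolding P_def using n by (subst lebesgue_integral_point_measure_finite) auto
    also have "\<dots> = (1 / real n) *\<^sub>R (\<Sum>i<n. ?z ^ i)"
      unfolding scaleR_sum_right by (intro sum.cong) (auto simp: Complex.DeMoivre mult_ac)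
    also have "\<dots> = (if d dvd k then 1 else 0)"
    proof (cases "d dvd k")
      case True
      then obtain j where "k = int n * j" using n by (auto simp: dvd_def)
      then have "?z = 1" using n by (simp add: cis_multiple_2pi)
      then show ?thesis using True n by (simp add: scaleR_conv_of_real)
    next
      case False
      have "?z \<noteq> 1"
      proof
        assume "?z = 1"
        then obtain j :: int where "of_int k / real n = of_int j"
          using cis_eq_1_imp Ints_cases by blast
        then have "real_of_int k = of_int (int n * j)" using n by (simp add: field_simps)
        then have "k = int n * j" by (simp only: of_int_eq_iff)
        then show False using False n by simp
      qed
      moreover have "?z ^ n = 1" using n by (simp add: Complex.DeMoivre cis_multiple_2pi)
      ultimately show ?thesis using False by (simp add: geometric_sum)
    qed
    finally show ?thesis .
  qed
  then show ?thesis using that[of \<nu>] sets space supp by blast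
qed

text \<open>The Haar measure of the annihilator of \<open>K\<close> in the torus. In Hermite form, a
  point (x, y) annihilates \<open>K\<close> if \<open>p x\<close> and \<open>q x + r y\<close> are
  integers, so \<open>x\<close> and \<open>y + (q / r) x\<close> are taken independent, with the
  circle measures for \<open>p\<close> and \<open>r\<close>.\<close>

lemma ex_torus_measure:
  assumes K: "add_subgroup K"
  obtains M :: "(real \<times> real) measure" where "sets M = sets borel" "emeasure M UNIV = 1"
    "AE p in M. p \<in> {0..<1} \<times> {0..<1}"
    "\<And>u v. (\<integral>p. char2 u v p \<partial>M) = (if (u, v) \<in> K then 1 else 0)"
proof -
  obtain p q r where pr: "p \<ge> 0" "r \<ge> 0" "r = 0 \<Longrightarrow> q = 0"
    and mem: "\<And>s t. (s, t) \<in> K \<longleftrightarrow> (\<exists>i j. s = i * p + j * q \<and> t = j * r)"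
    using add_subgroup_int_pairs[OF K] by metis
  obtain \<mu> where \<mu>: "sets \<mu> = sets borel" "emeasure \<mu> (space \<mu>) = 1" "AE x in \<mu>. x \<in> {0..<1}"
    "\<And>k :: int. (\<integral>x. cis (2 * pi * (of_int k * x)) \<partial>\<mu>) = (if p dvd k then 1 else 0)"
    using ex_circle_measure[OF pr(1)] by blast
  obtain \<nu> where \<nu>: "sets \<nu> = sets borel" "emeasure \<nu> (space \<nu>) = 1" "AE x in \<nu>. x \<in> {0..<1}"
    "\<And>k :: int. (\<integral>x. cis (2 * pi * (of_int k * x)) \<partial>\<nu>) = (if r dvd k then 1 else 0)"
    using ex_circle_measure[OF pr(2)] by blast
  interpret \<mu>: finite_measure \<mu> by (rule finite_measureI) (simp add: \<mu>(2))
  interpret \<nu>: finite_measure \<nu> by (rule finite_measureI) (simp add: \<nu>(2))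
  interpret pair_sigma_finite \<mu> \<nu> ..
  note [measurable_cong] = \<mu>(1) \<nu>(1)
  \<comment> \<open>The fractional part keeps the point in the unit square and changes no character,
    as frequencies are integers. For \<open>r = 0\<close> the shear is trivial, division by zero
    giving 0.\<close>
  define f where "f = (\<lambda>(x, y). (x, frac (y - real_of_int q / real_of_int r * x)))"
  have f [measurable]: "f \<in> \<mu> \<Otimes>\<^sub>M \<nu> \<rightarrow>\<^sub>M borel"
    unfolding f_def frac_def borel_prod[symmetric] by measurable
  define M where "M = distr (\<mu> \<Otimes>\<^sub>M \<nu>) borel f"
  have sp: "space \<mu> = UNIV" "space \<nu> = UNIV"
    using sets_eq_imp_space_eq[OF \<mu>(1)] sets_eq_imp_space_eq[OF \<nu>(1)] by simp_all
  have one: "emeasure (\<mu> \<Otimes>\<^sub>M \<nu>) (space (\<mu> \<Otimes>\<^sub>M \<nu>)) = 1"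
    unfolding space_pair_measure
    using \<mu>(2) \<nu>(2) by (subst \<nu>.emeasure_pair_measure_Times) auto
  interpret P: finite_measure "\<mu> \<Otimes>\<^sub>M \<nu>" by (rule finite_measureI) (simp add: one)
  have M1: "emeasure M UNIV = 1"
    unfolding M_def using one by (subst emeasure_distr) auto
  have "AE z in \<mu> \<Otimes>\<^sub>M \<nu>. fst z \<in> {0..<1}"
  proof (rule AE_pair_measure)
    show "{z \<in> space (\<mu> \<Otimes>\<^sub>M \<nu>). fst z \<in> {0..<1}} \<in> sets (\<mu> \<Otimes>\<^sub>M \<nu>)" by measurable
    show "AE x in \<mu>. AE y in \<nu>. fst (x, y) \<in> {0..<1}" using \<mu>(3) by auto
  qed
  then have "AE z in \<mu> \<Otimes>\<^sub>M \<nu>. f z \<in> {0..<1} \<times> {0..<1}"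
    by eventually_elim (auto simp: f_def frac_lt_1)
  then have supp: "AE z in M. z \<in> {0..<1} \<times> {0..<1}"
    unfolding M_def by (subst AE_distr_iff) (auto intro!: borel_Times)
  have "(\<integral>z. char2 u v z \<partial>M) = (if (u, v) \<in> K then 1 else 0)" for u v
  proof -
    let ?c = "of_int u - of_int v * (of_int q / of_int r) :: real"
    have char: "char2 u v (f (x, y)) = cis (2 * pi * (?c * x)) * cis (2 * pi * (of_int v * y))" for x y
    proof -
      let ?z = "y - real_of_int q / real_of_int r * x"
      have "2 * pi * (of_int u * x + of_int v * frac ?z)
        = 2 * pi * (?c * x) + 2 * pi * (of_int v * y) + 2 * pi * of_int (- v * \<lfloor>?z\<rfloor>)"
        unfolding frac_def by (simp add: algebra_simps)
      then have "char2 u v (f (x, y)) = cis (2 * pi * (?c * x)) * cis (2 * pi * (of_int v * y))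
          * cis (2 * pi * of_int (- v * \<lfloor>?z\<rfloor>))"
        by (simp only: char2_def f_def prod.case fst_conv snd_conv cis_mult)
      also have "cis (2 * pi * of_int (- v * \<lfloor>?z\<rfloor>)) = 1"
        by (rule cis_multiple_2pi) simp
      finally show ?thesis by simp
    qed
    have "(\<integral>z. char2 u v z \<partial>M) = (\<integral>z. char2 u v (f z) \<partial>(\<mu> \<Otimes>\<^sub>M \<nu>))"
      unfolding M_def by (rule integral_distr) auto
    also have "\<dots> = (\<integral>x. (\<integral>y. char2 u v (f (x, y)) \<partial>\<nu>) \<partial>\<mu>)"
      by (rule integral_fst'[symmetric], rule P.integrable_const_bound[where B=1]) auto
    also have "\<dots> = (\<integral>x. cis (2 * pi * (?c * x)) * (if r dvd v then 1 else 0) \<partial>\<mu>)"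
      unfolding char by (simp add: \<nu>(4))
    also have "\<dots> = (if (u, v) \<in> K then 1 else 0)"
    proof (cases "r dvd v")
      case True
      then obtain j where j: "v = r * j" by (auto simp: dvd_def)
      have c: "?c = of_int (u - j * q)" using pr(3) by (cases "r = 0") (auto simp: j)
      have "p dvd u - j * q \<longleftrightarrow> (u, v) \<in> K"
      proof
        assume "p dvd u - j * q"
        then obtain i where "u - j * q = p * i" by (auto simp: dvd_def)
        then show "(u, v) \<in> K" unfolding mem j by (intro exI[of _ i] exI[of _ j]) (auto simp: algebra_simps)
      next
        assume "(u, v) \<in> K"
        then obtain i j' where ij: "u = i * p + j' * q" "v = j' * r" unfolding mem by blast
        have "j' * q = j * q" using ij(2) pr(3) by (cases "r = 0") (auto simp: j)
        then have "u - j * q = p * i" using ij(1) by (simp add: mult.commute)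
        then show "p dvd u - j * q" by simp
      qed
      then show ?thesis using True unfolding c by (simp add: \<mu>(4) del: of_int_diff of_int_mult)
    next
      case False
      then have "(u, v) \<notin> K" unfolding mem by auto
      then show ?thesis using False by simp
    qed
    finally show ?thesis .
  qed
  then show ?thesis using that[of M] M1 supp by (simp add: M_def)
qed

text \<open>An equality case: \<open>1 - Re (g x)\<close> is nonnegative with integral 0.\<close>

lemma AE_eq_1_if_integral_1:
  fixes g :: "'x \<Rightarrow> complex"
  assumes M: "emeasure M (space M) = 1" and [measurable]: "g \<in> borel_measurable M"
    and g: "\<And>x. cmod (g x) = 1" and int: "(\<integral>x. g x \<partial>M) = 1"
  shows "AE x in M. g x = 1"
proof -
  interpret finite_measure M by (rule finite_measureI) (simp add: M)
  have i: "integrable M g" by (rule integrable_const_bound[where B=1]) (auto simp: g)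
  then have iR: "integrable M (\<lambda>x. 1 - Re (g x))" by simp
  have "(\<integral>x. 1 - Re (g x) \<partial>M) = 0"
    using i int M by (simp add: integral_Re measure_def)
  then have "AE x in M. 1 - Re (g x) = 0"
    using complex_Re_le_cmod[of "g _"] g
    by (subst (asm) integral_nonneg_eq_0_iff_AE[OF iR]) auto
  then show ?thesis
  proof eventually_elim
    case (elim x)
    then have "Re (g x) = 1" by simp
    moreover from this have "Im (g x) = 0" using g[of x] by (simp add: cmod_def)
    ultimately show ?case by (simp add: complex_eq_iff)
  qed
qed

text \<open>
  Characters of \<open>L\<close> that are trivial on \<open>K\<close>, extended to all pairs of integers as
  \<open>(s, t) \<mapsto> z\<^sub>1\<^sup>s z\<^sub>2\<^sup>t\<close>: the measure is the Haar measure of the dual group of \<open>L / K\<close>.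
\<close>

lemma ex_character_measure:
  assumes K: "add_subgroup K" and L: "add_subgroup L" and KL: "K \<subseteq> L"
  obtains M :: "(real \<times> real) measure" and z\<^sub>1 z\<^sub>2 :: "real \<times> real \<Rightarrow> complex" where
    "sets M = sets borel" "emeasure M UNIV = 1"
    "z\<^sub>1 \<in> borel_measurable borel" "z\<^sub>2 \<in> borel_measurable borel"
    "\<And>p. cmod (z\<^sub>1 p) = 1" "\<And>p. cmod (z\<^sub>2 p) = 1"
    "\<And>s t. (s, t) \<in> L \<Longrightarrow> (\<integral>p. z\<^sub>1 p powi s * z\<^sub>2 p powi t \<partial>M) = (if (s, t) \<in> K then 1 else 0)"
    "\<And>h. integrable M h \<Longrightarrow> (\<And>s t. (s, t) \<in> L \<Longrightarrow> (\<integral>p. (z\<^sub>1 p powi s * z\<^sub>2 p powi t) * h p \<partial>M) = 0)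
      \<Longrightarrow> AE p in M. h p = 0"
proof -
  obtain p q r where pr: "p \<ge> 0" "r \<ge> 0" "r = 0 \<Longrightarrow> q = 0"
    and mem: "\<And>s t. (s, t) \<in> L \<longleftrightarrow> (\<exists>i j. s = i * p + j * q \<and> t = j * r)"
    using add_subgroup_int_pairs[OF L] by metis
  \<comment> \<open>This is \<open>K\<close> in the coordinates \<open>(i, j)\<close> from the
    Hermite form of \<open>L\<close>. When \<open>p = 0\<close> or \<open>r = 0\<close> a coordinate
    is redundant, and its direction then belongs to \<open>K'\<close>.\<close>
  define K' where "K' = {(i, j). (i * p + j * q, j * r) \<in> K}"
  have "add_subgroup K'"
    unfolding add_subgroup_def
  proof (intro conjI ballI)
    show "0 \<in> K'" using add_subgroup_0[OF K] by (simp add: K'_def zero_prod_def)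
    fix x y assume "x \<in> K'" "y \<in> K'"
    then show "x - y \<in> K'"
      using add_subgroup_diff[OF K] unfolding K'_def by (fastforce simp: algebra_simps)
  qed
  then obtain M :: "(real \<times> real) measure" where M: "sets M = sets borel" "emeasure M UNIV = 1"
    and supp: "AE p in M. p \<in> {0..<1} \<times> {0..<1}"
    and ft: "\<And>u v. (\<integral>p. char2 u v p \<partial>M) = (if (u, v) \<in> K' then 1 else 0)"
    by (rule ex_torus_measure) blast
  have sp: "space M = UNIV" using sets_eq_imp_space_eq[OF M(1)] by simp
  interpret finite_measure M by (rule finite_measureI) (simp add: sp M(2))
  note [measurable_cong] = M(1)
  have AE_char: "AE x in M. char2 u v x = 1" if "(u, v) \<in> K'" for u v
    by (rule AE_eq_1_if_integral_1) (use ft[of u v] that M(2) sp in auto)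
  have zero: "x = 0" if "cis (2 * pi * x) = 1" "x \<in> {0..<1}" for x
    using cis_eq_1_imp[OF that(1)] that(2) by (auto elim!: Ints_cases)
  \<comment> \<open>A redundant coordinate is 0 almost everywhere because its character is trivial.
    This matches the formulas below, where dividing by \<open>p = 0\<close> or \<open>r = 0\<close>
    gives 0.\<close>
  have p0: "AE x in M. p = 0 \<longrightarrow> fst x = 0"
  proof (cases "p = 0")
    case True
    then have "(1, 0) \<in> K'" using add_subgroup_0[OF K] by (simp add: K'_def zero_prod_def)
    from AE_char[OF this] supp show ?thesis
      by eventually_elim (auto simp: char2_def intro!: zero)
  qed simp
  have r0: "AE x in M. r = 0 \<longrightarrow> snd x = 0"
  proof (cases "r = 0")
    case True
    then have "(0, 1) \<in> K'" using add_subgroup_0[OF K] pr(3) by (simp add: K'_def zero_prod_def)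
    from AE_char[OF this] supp show ?thesis
      by eventually_elim (auto simp: char2_def intro!: zero)
  qed simp
  \<comment> \<open>Dividing angles solves \<open>z1 ^ p = cis (2 pi x)\<close> and
    \<open>z1 ^ q z2 ^ r = cis (2 pi y)\<close>, that is, extends a character of \<open>L\<close> to
    all pairs of integers.\<close>
  define z1 where "z1 x = cis (2 * pi * (fst x / real_of_int p))" for x :: "real \<times> real"
  define z2 where "z2 x = cis (2 * pi * (snd x / real_of_int r - fst x * real_of_int q / (real_of_int p * real_of_int r)))" for x :: "real \<times> real"
  have meas: "z1 \<in> borel_measurable borel" "z2 \<in> borel_measurable borel"
    unfolding z1_def z2_def by (auto intro!: borel_measurable_continuous_onI continuous_intros simp: divide_inverse)
  have [measurable]: "(\<lambda>x. z1 x powi s) \<in> borel_measurable borel"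
    "(\<lambda>x. z2 x powi s) \<in> borel_measurable borel" for s
    unfolding z1_def z2_def cis_power_int
    by (auto intro!: borel_measurable_continuous_onI continuous_intros simp: divide_inverse)
  have z: "AE x in M. \<forall>i j. z1 x powi (i * p + j * q) * z2 x powi (j * r) = char2 i j x"
    using p0 r0
  proof eventually_elim
    case (elim x)
    have "z1 x powi (i * p + j * q) * z2 x powi (j * r) = char2 i j x" for i j
    proof -
      have "of_int (i * p + j * q) * (2 * pi * (fst x / real_of_int p))
          + of_int (j * r) * (2 * pi * (snd x / real_of_int r - fst x * real_of_int q / (real_of_int p * real_of_int r)))
        = 2 * pi * (of_int i * fst x + of_int j * snd x)"
        using elim pr(3) by (cases "p = 0"; cases "r = 0") (auto simp: field_simps)
      then show ?thesis
        unfolding z1_def z2_def cis_power_int cis_mult char2_def by presburger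
    qed
    then show ?case by blast
  qed
  show ?thesis
  proof (rule that[of M z1 z2])
    show "cmod (z1 x) = 1" "cmod (z2 x) = 1" for x by (simp_all add: z1_def z2_def)
    show "(\<integral>x. z1 x powi s * z2 x powi t \<partial>M) = (if (s, t) \<in> K then 1 else 0)" if st: "(s, t) \<in> L" for s t
    proof -
      obtain i j where ij: "s = i * p + j * q" "t = j * r" using st unfolding mem by blast
      have "(\<integral>x. z1 x powi s * z2 x powi t \<partial>M) = (\<integral>x. char2 i j x \<partial>M)"
        unfolding ij using z by (intro integral_cong_AE) (auto elim!: eventually_mono)
      then show ?thesis by (simp add: ft K'_def ij)
    qed
    fix h assume h: "integrable M h"
      and orth: "\<And>s t. (s, t) \<in> L \<Longrightarrow> (\<integral>x. (z1 x powi s * z2 x powi t) * h x \<partial>M) = 0"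
    have "(\<integral>x. char2 i j x * h x \<partial>M) = 0" for i j
    proof -
      have "(\<integral>x. char2 i j x * h x \<partial>M) = (\<integral>x. (z1 x powi (i * p + j * q) * z2 x powi (j * r)) * h x \<partial>M)"
        using z borel_measurable_integrable[OF h] by (intro integral_cong_AE) (auto elim!: eventually_mono)
      then show ?thesis using orth[of "i * p + j * q" "j * r"] mem by auto
    qed
    then have "null_fourier M h" using h by (simp add: null_fourier_def)
    then show "AE x in M. h x = 0"
      by (rule null_fourier_AE_zero[OF M(1) finite_measure_axioms _ supp])
  qed (fact M meas)+
qed

section \<open>Orthonormal bases of spaces of square integrable sections\<close>

definition sq_int :: "'x measure \<Rightarrow> nat set \<Rightarrow> ('x \<Rightarrow> nat ell2) \<Rightarrow> bool" where
  "sq_int M W f \<longleftrightarrow> (\<forall>x. f x \<in> ell2_on W) \<and> (\<forall>n. (\<lambda>x. ell2_fun (f x) n) \<in> borel_measurable M) \<and>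
    integrable M (\<lambda>x. (norm (f x))\<^sup>2)"

lemma measurable_cinner:
  fixes f g :: "'x \<Rightarrow> nat ell2"
  assumes [measurable]: "\<And>n. (\<lambda>x. ell2_fun (f x) n) \<in> borel_measurable M"
    "\<And>n. (\<lambda>x. ell2_fun (g x) n) \<in> borel_measurable M"
  shows "(\<lambda>x. cinner (f x) (g x)) \<in> borel_measurable M"
proof (rule borel_measurable_LIMSEQ_metric)
  show "(\<lambda>x. \<Sum>n<k. cnj (ell2_fun (f x) n) * ell2_fun (g x) n) \<in> borel_measurable M" for k
    by (intro borel_measurable_sum borel_measurable_times assms
        borel_measurable_continuous_on[of cnj] continuous_on_cnj continuous_on_id)
  show "(\<lambda>k. \<Sum>n<k. cnj (ell2_fun (f x) n) * ell2_fun (g x) n) \<longlonglongrightarrow> cinner (f x) (g x)" for x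
    using has_sum_imp_sums[OF has_sum_infsum[OF ell2_cinner_summable[OF square_summable_ell2_fun square_summable_ell2_fun]]]
    unfolding cinner_ell2_def sums_def by blast
qed

lemma measurable_norm_ell2:
  fixes f :: "'x \<Rightarrow> nat ell2"
  assumes [measurable]: "\<And>n. (\<lambda>x. ell2_fun (f x) n) \<in> borel_measurable M"
  shows "(\<lambda>x. norm (f x)) \<in> borel_measurable M"
proof -
  have [measurable]: "(\<lambda>x. cinner (f x) (f x)) \<in> borel_measurable M" by (rule measurable_cinner) fact+
  have "norm v = sqrt (Re (cinner v v))" for v :: "nat ell2" by (simp add: cinner_self)
  then have "(\<lambda>x. norm (f x)) = (\<lambda>x. sqrt (Re (cinner (f x) (f x))))" by blast
  also have "\<dots> \<in> borel_measurable M" by measurable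
  finally show ?thesis .
qed

lemma ell2_on_add: "f \<in> ell2_on W \<Longrightarrow> g \<in> ell2_on W \<Longrightarrow> f + g \<in> ell2_on W"
  and ell2_on_scaleC: "f \<in> ell2_on W \<Longrightarrow> c *\<^sub>C f \<in> ell2_on W"
  and ell2_on_0 [simp]: "0 \<in> ell2_on W"
  by (auto simp: ell2_on_def ell2_fun_simps ell2_fun_scaleC)

lemma norm_add_square_le: "(norm (x + y))\<^sup>2 \<le> 2 * (norm x)\<^sup>2 + 2 * (norm y)\<^sup>2"
  for x :: "'a::real_normed_vector"
proof -
  have "(norm (x + y))\<^sup>2 \<le> (norm x + norm y)\<^sup>2" by (intro power_mono norm_triangle_ineq norm_ge_zero)
  also have "\<dots> \<le> 2 * (norm x)\<^sup>2 + 2 * (norm y)\<^sup>2"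
    using sum_squares_bound[of "norm x" "norm y"] by (simp add: power2_sum)
  finally show ?thesis .
qed

lemma sq_int_add:
  assumes "sq_int M W f" "sq_int M W g" shows "sq_int M W (\<lambda>x. f x + g x)"
proof -
  have [measurable]: "(\<lambda>x. ell2_fun (f x) n) \<in> borel_measurable M" "(\<lambda>x. ell2_fun (g x) n) \<in> borel_measurable M" for n
    using assms unfolding sq_int_def by blast+
  have coord: "(\<lambda>x. ell2_fun (f x + g x) n) \<in> borel_measurable M" for n
    unfolding ell2_fun_add by measurable
  have [measurable]: "(\<lambda>x. norm (f x + g x)) \<in> borel_measurable M"
    by (rule measurable_norm_ell2[OF coord])
  have "integrable M (\<lambda>x. (norm (f x + g x))\<^sup>2)"
  proof (rule Bochner_Integration.integrable_bound)
    show "integrable M (\<lambda>x. 2 * (norm (f x))\<^sup>2 + 2 * (norm (g x))\<^sup>2)"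
      using assms unfolding sq_int_def by (intro Bochner_Integration.integrable_add integrable_mult_right) auto
    show "AE x in M. norm ((norm (f x + g x))\<^sup>2) \<le> norm (2 * (norm (f x))\<^sup>2 + 2 * (norm (g x))\<^sup>2)"
      by (intro AE_I2) (simp add: norm_add_square_le)
  qed measurable
  then show ?thesis using assms coord unfolding sq_int_def by (simp add: ell2_on_add)
qed

lemma sq_int_scaleC:
  assumes "sq_int M W f" shows "sq_int M W (\<lambda>x. c *\<^sub>C f x)"
  using assms unfolding sq_int_def
  by (auto simp: ell2_on_scaleC ell2_fun_scaleC norm_scaleC power_mult_distrib
      intro: borel_measurable_times)

lemma sq_int_diff:
  assumes "sq_int M W f" "sq_int M W g" shows "sq_int M W (\<lambda>x. f x - g x)"
  using sq_int_add[OF assms(1) sq_int_scaleC[OF assms(2), of "-1"]] by simp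

lemma sq_int_zero: "sq_int M W (\<lambda>_. 0)"
  by (simp add: sq_int_def ell2_fun_zero)

lemma sq_int_sum: "(\<And>i. i \<in> S \<Longrightarrow> sq_int M W (f i)) \<Longrightarrow> sq_int M W (\<lambda>x. \<Sum>i\<in>S. f i x)"
  by (induction S rule: infinite_finite_induct) (auto intro: sq_int_add sq_int_zero)

lemma integrable_cinner_sections:
  assumes "sq_int M W f" "sq_int M W g" shows "integrable M (\<lambda>x. cinner (f x) (g x))"
proof (rule Bochner_Integration.integrable_bound)
  show "integrable M (\<lambda>x. (norm (f x))\<^sup>2 + (norm (g x))\<^sup>2)"
    using assms unfolding sq_int_def by (intro Bochner_Integration.integrable_add) auto
  show "(\<lambda>x. cinner (f x) (g x)) \<in> borel_measurable M"
    using assms unfolding sq_int_def by (intro measurable_cinner) auto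
  have "norm (cinner (f x) (g x)) \<le> norm ((norm (f x))\<^sup>2 + (norm (g x))\<^sup>2)" for x
  proof -
    have "cmod (cinner (f x) (g x)) \<le> norm (f x) * norm (g x)" by (rule cinner_Cauchy_Schwarz)
    also have "\<dots> \<le> (norm (f x))\<^sup>2 + (norm (g x))\<^sup>2"
      using sum_squares_bound[of "norm (f x)" "norm (g x)"]
        mult_nonneg_nonneg[OF norm_ge_zero[of "f x"] norm_ge_zero[of "g x"]] by linarith
    finally show ?thesis by simp
  qed
  then show "AE x in M. norm (cinner (f x) (g x)) \<le> norm ((norm (f x))\<^sup>2 + (norm (g x))\<^sup>2)" by blast
qed

text \<open>An orthonormal basis of square integrable sections without passing to classes modulo
  null sets: coefficients and combinations use representatives, and equality almost everywhere
  enters through \<open>complete\<close>.\<close>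

locale l2_basis =
  fixes M :: "'x measure" and W :: "nat set" and F :: "'y \<Rightarrow> 'x \<Rightarrow> nat ell2" and A :: "'y set"
  assumes prob: "emeasure M (space M) = 1"
    and F: "y \<in> A \<Longrightarrow> sq_int M W (F y)"
    and orth: "y \<in> A \<Longrightarrow> y' \<in> A \<Longrightarrow> (\<integral>x. cinner (F y x) (F y' x) \<partial>M) = (if y = y' then 1 else 0)"
    and complete: "sq_int M W f \<Longrightarrow> (\<And>y. y \<in> A \<Longrightarrow> (\<integral>x. cinner (F y x) (f x) \<partial>M) = 0) \<Longrightarrow> AE x in M. f x = 0"
    and count: "countable A"
begin

lemma finite_measure_M: "finite_measure M"
  by (rule finite_measureI) (simp add: prob)

lemma measure_space_M: "measure M (space M) = 1"
  by (simp add: measure_def prob)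

definition coef :: "('x \<Rightarrow> nat ell2) \<Rightarrow> 'y \<Rightarrow> complex" where
  "coef f y = (\<integral>x. cinner (F y x) (f x) \<partial>M)"

definition comb :: "('y \<Rightarrow> complex) \<Rightarrow> 'y set \<Rightarrow> 'x \<Rightarrow> nat ell2" where
  "comb c S x = (\<Sum>y\<in>S. c y *\<^sub>C F y x)"

lemma sq_int_comb: "S \<subseteq> A \<Longrightarrow> sq_int M W (comb c S)"
  unfolding comb_def by (intro sq_int_sum sq_int_scaleC F) auto

lemma coef_add: "y \<in> A \<Longrightarrow> sq_int M W f \<Longrightarrow> sq_int M W g \<Longrightarrow> coef (\<lambda>x. f x + g x) y = coef f y + coef g y"
  unfolding coef_def by (simp add: cinner_add_right integrable_cinner_sections[OF F])

lemma coef_scaleC: "coef (\<lambda>x. c *\<^sub>C f x) y = c * coef f y"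
  unfolding coef_def by (simp add: cinner_scaleC_right)

lemma coef_diff: "y \<in> A \<Longrightarrow> sq_int M W f \<Longrightarrow> sq_int M W g \<Longrightarrow> coef (\<lambda>x. f x - g x) y = coef f y - coef g y"
  unfolding coef_def by (simp add: cinner_diff_right integrable_cinner_sections[OF F])

lemma integral_cinner_comb:
  assumes "finite S" "S \<subseteq> A" "sq_int M W f"
  shows "(\<integral>x. cinner (comb c S x) (f x) \<partial>M) = (\<Sum>y\<in>S. cnj (c y) * coef f y)"
proof -
  have "integrable M (\<lambda>x. cnj (c y) * cinner (F y x) (f x))" if "y \<in> S" for y
    using that assms by (intro integrable_mult_right integrable_cinner_sections[of M W] F) auto
  then show ?thesis
    unfolding comb_def cinner_sum_left cinner_scaleC_left coef_def by simp
qed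

lemma coef_comb:
  assumes "finite S" "S \<subseteq> A" "y \<in> A"
  shows "coef (comb c S) y = (if y \<in> S then c y else 0)"
proof -
  have "integrable M (\<lambda>x. c z * cinner (F y x) (F z x))" if "z \<in> S" for z
    using that assms by (intro integrable_mult_right integrable_cinner_sections[of M W] F) auto
  then have "coef (comb c S) y = (\<Sum>z\<in>S. c z * (\<integral>x. cinner (F y x) (F z x) \<partial>M))"
    unfolding comb_def coef_def cinner_sum_right cinner_scaleC_right by simp
  also have "\<dots> = (\<Sum>z\<in>S. if y = z then c z else 0)"
    by (intro sum.cong) (use assms orth in auto)
  finally show ?thesis using assms by simp
qed

lemma norm_square_comb:
  assumes "finite S" "S \<subseteq> A"
  shows "(\<integral>x. (norm (comb c S x))\<^sup>2 \<partial>M) = (\<Sum>y\<in>S. (cmod (c y))\<^sup>2)"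
proof -
  have "complex_of_real (\<integral>x. (norm (comb c S x))\<^sup>2 \<partial>M) = (\<integral>x. cinner (comb c S x) (comb c S x) \<partial>M)"
    unfolding cinner_self by (rule integral_complex_of_real[symmetric])
  also have "\<dots> = (\<Sum>y\<in>S. cnj (c y) * c y)"
    using assms by (subst integral_cinner_comb)
      (auto simp: sq_int_comb subsetD coef_comb[OF assms] intro!: sum.cong)
  also have "\<dots> = complex_of_real (\<Sum>y\<in>S. (cmod (c y))\<^sup>2)"
    unfolding of_real_sum complex_norm_square by (intro sum.cong) (auto simp: mult.commute)
  finally show ?thesis by (simp only: of_real_eq_iff)
qed

lemma Bessel:
  assumes "finite S" "S \<subseteq> A" and f: "sq_int M W f"
  shows "(\<Sum>y\<in>S. (cmod (coef f y))\<^sup>2) \<le> (\<integral>x. (norm (f x))\<^sup>2 \<partial>M)"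
proof -
  let ?g = "comb (coef f) S"
  have g: "sq_int M W ?g" using assms sq_int_comb by blast
  have i: "integrable M (\<lambda>x. (norm (f x))\<^sup>2)" "integrable M (\<lambda>x. (norm (?g x))\<^sup>2)"
    using f g by (auto simp: sq_int_def)
  have ic: "integrable M (\<lambda>x. cinner (?g x) (f x))" by (rule integrable_cinner_sections[OF g f])
  have "0 \<le> (\<integral>x. (norm (?g x - f x))\<^sup>2 \<partial>M)" by simp
  also have "\<dots> = (\<integral>x. (norm (?g x))\<^sup>2 \<partial>M) + (\<integral>x. (norm (f x))\<^sup>2 \<partial>M) - 2 * Re (\<integral>x. cinner (?g x) (f x) \<partial>M)"
    unfolding norm_diff_square using i ic by (simp add: integral_Re)
  also have "(\<integral>x. cinner (?g x) (f x) \<partial>M) = complex_of_real (\<Sum>y\<in>S. (cmod (coef f y))\<^sup>2)"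
    unfolding integral_cinner_comb[OF assms] of_real_sum complex_norm_square
    by (intro sum.cong) (auto simp: mult.commute)
  finally show ?thesis by (simp add: norm_square_comb[OF assms(1,2)])
qed

lemma coef_summable:
  assumes f: "sq_int M W f"
  shows "(\<lambda>y. (cmod (coef f y))\<^sup>2) summable_on A"
    and "(\<Sum>\<^sub>\<infinity>y\<in>A. (cmod (coef f y))\<^sup>2) \<le> (\<integral>x. (norm (f x))\<^sup>2 \<partial>M)"
proof -
  show s: "(\<lambda>y. (cmod (coef f y))\<^sup>2) summable_on A"
    by (rule nonneg_bdd_above_summable_on) (use Bessel[OF _ _ f] in \<open>auto intro!: bdd_aboveI\<close>)
  show "(\<Sum>\<^sub>\<infinity>y\<in>A. (cmod (coef f y))\<^sup>2) \<le> (\<integral>x. (norm (f x))\<^sup>2 \<partial>M)"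
    by (rule infsum_le_finite_sums[OF s]) (rule Bessel[OF _ _ f])
qed

text \<open>The bound \<open>t <= d / 2 + t^2 / (2 d)\<close> is integrated against a probability
  measure, in place of a Cauchy-Schwarz inequality for integrals.\<close>

lemma integral_norm_le:
  assumes f: "sq_int M W f" and d: "d > 0" and le: "(\<integral>x. (norm (f x))\<^sup>2 \<partial>M) \<le> d\<^sup>2"
  shows "integrable M (\<lambda>x. norm (f x))" "(\<integral>x. norm (f x) \<partial>M) \<le> d"
proof -
  interpret finite_measure M by (rule finite_measure_M)
  have [measurable]: "(\<lambda>x. norm (f x)) \<in> borel_measurable M"
    using f unfolding sq_int_def by (intro measurable_norm_ell2) auto
  have i: "integrable M (\<lambda>x. (norm (f x))\<^sup>2)" using f by (simp add: sq_int_def)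
  have bound: "norm (f x) \<le> d / 2 + (norm (f x))\<^sup>2 / (2 * d)" for x
  proof -
    have "2 * d * norm (f x) \<le> d\<^sup>2 + (norm (f x))\<^sup>2" using sum_squares_bound[of d "norm (f x)"] by simp
    then show ?thesis using d by (simp add: field_simps power2_eq_square)
  qed
  have ib: "integrable M (\<lambda>x. d / 2 + (norm (f x))\<^sup>2 / (2 * d))"
    using i by (intro Bochner_Integration.integrable_add integrable_divide) auto
  show int: "integrable M (\<lambda>x. norm (f x))"
    by (rule Bochner_Integration.integrable_bound[OF ib]) (use bound d in \<open>auto intro!: AE_I2 order_trans[OF bound]\<close>)
  have "(\<integral>x. norm (f x) \<partial>M) \<le> (\<integral>x. d / 2 + (norm (f x))\<^sup>2 / (2 * d) \<partial>M)"
    by (rule integral_mono[OF int ib bound])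
  also have "\<dots> = d / 2 + (\<integral>x. (norm (f x))\<^sup>2 \<partial>M) / (2 * d)"
    using i by (simp add: measure_space_M)
  also have "\<dots> \<le> d / 2 + d\<^sup>2 / (2 * d)"
    using le d by (intro add_left_mono divide_right_mono) auto
  finally show "(\<integral>x. norm (f x) \<partial>M) \<le> d" using d by (simp add: power2_eq_square)
qed

text \<open>Partial sums over finite sets whose tails are at most \<open>4^(-k)\<close> have
  increments with integrated norm at most \<open>2^(-k)\<close>, so they converge almost everywhere;
  Fatou's lemma then controls the limit in the square norm.\<close>

lemma Riesz_Fischer:
  assumes c: "(\<lambda>y. (cmod (c y))\<^sup>2) summable_on A"
  obtains f where "sq_int M W f" "\<And>y. y \<in> A \<Longrightarrow> coef f y = c y"
    "(\<integral>x. (norm (f x))\<^sup>2 \<partial>M) \<le> (\<Sum>\<^sub>\<infinity>y\<in>A. (cmod (c y))\<^sup>2)"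
proof -
  let ?c2 = "\<lambda>y. (cmod (c y))\<^sup>2"
  have sum_on: "?c2 summable_on B" if "B \<subseteq> A" for B
    using summable_on_subset_banach[OF c that] .
  have tail: "\<exists>T. finite T \<and> T \<subseteq> A \<and> infsum ?c2 (A - T) \<le> (1 / 2 ^ k)\<^sup>2" for k :: nat
  proof -
    have "(1 / 2 ^ k :: real)\<^sup>2 > 0" by simp
    from infsum_finite_approximation[OF c this] obtain T where
      T: "finite T" "T \<subseteq> A" "dist (sum ?c2 T) (infsum ?c2 A) \<le> (1 / 2 ^ k)\<^sup>2" by blast
    have "infsum ?c2 (A - T) = infsum ?c2 A - sum ?c2 T"
      using T by (subst infsum_Diff) (auto intro: sum_on)
    also have "\<dots> \<le> (1 / 2 ^ k)\<^sup>2" using T(3) unfolding dist_real_def by linarith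
    finally show ?thesis using T by blast
  qed
  then obtain T where T: "\<And>k. finite (T k)" "\<And>k. T k \<subseteq> A" "\<And>k. infsum ?c2 (A - T k) \<le> (1 / 2 ^ k)\<^sup>2"
    by metis
  \<comment> \<open>Unions make the finite sets increasing, so that differences of partial sums are
    combinations over set differences.\<close>
  define S where "S k = (\<Union>j\<le>k. T j)" for k
  have S: "finite (S k)" "S k \<subseteq> A" for k using T by (auto simp: S_def)
  have S_mono: "S k \<subseteq> S j" if "k \<le> j" for k j unfolding S_def using that by (intro UN_mono) auto
  have tailS: "infsum ?c2 B \<le> (1 / 2 ^ k)\<^sup>2" if "B \<subseteq> A - S k" for k B
  proof -
    have "infsum ?c2 B \<le> infsum ?c2 (A - T k)"
      by (rule infsum_mono2) (use that sum_on in \<open>auto simp: S_def\<close>)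
    then show ?thesis using T(3)[of k] by linarith
  qed
  define G where "G k = comb c (S k)" for k
  have G: "sq_int M W (G k)" for k unfolding G_def using S(2) by (rule sq_int_comb)
  have Gd: "G j x - G k x = comb c (S j - S k) x" if "k \<le> j" for j k x
    unfolding G_def comb_def using S_mono[OF that] S(1) by (simp add: sum_diff)
  have d2: "(\<integral>x. (norm (comb c (S j - S k) x))\<^sup>2 \<partial>M) \<le> (1 / 2 ^ k)\<^sup>2" for j k
  proof -
    have "(\<integral>x. (norm (comb c (S j - S k) x))\<^sup>2 \<partial>M) = infsum ?c2 (S j - S k)"
      using S[of j] by (subst norm_square_comb) auto
    also have "\<dots> \<le> (1 / 2 ^ k)\<^sup>2" using S[of j] by (intro tailS) auto
    finally show ?thesis .
  qed
  let ?D = "\<lambda>k. comb c (S (Suc k) - S k)"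
  have D: "sq_int M W (comb c (S j - S k))" for j k using S by (intro sq_int_comb) auto
  have coordD: "(\<lambda>x. ell2_fun (comb c (S j - S k) x) n) \<in> borel_measurable M" for j k n
    using D unfolding sq_int_def by blast
  have coordG: "(\<lambda>x. ell2_fun (G k x) n) \<in> borel_measurable M" for k n
    using G unfolding sq_int_def by blast
  have [measurable]: "(\<lambda>x. norm (comb c (S j - S k) x)) \<in> borel_measurable M" for j k
    by (rule measurable_norm_ell2[OF coordD])
  have Dint: "integrable M (\<lambda>x. norm (?D k x))" "(\<integral>x. norm (?D k x) \<partial>M) \<le> 1 / 2 ^ k" for k
    using integral_norm_le[OF D _ d2, of k] by auto
  \<comment> \<open>Off the conull set \<open>Z\<close> the limit is set to 0, so the section has
    values in the fibre everywhere.\<close>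
  define Z where "Z = {x \<in> space M. (\<Sum>k. ennreal (norm (?D k x))) \<noteq> \<infinity>}"
  have [measurable]: "Z \<in> sets M" unfolding Z_def by measurable
  have "(\<integral>\<^sup>+x. (\<Sum>k. ennreal (norm (?D k x))) \<partial>M) = (\<Sum>k. \<integral>\<^sup>+x. ennreal (norm (?D k x)) \<partial>M)"
    by (rule nn_integral_suminf) measurable
  also have "\<dots> = (\<Sum>k. ennreal (\<integral>x. norm (?D k x) \<partial>M))"
    by (intro suminf_cong nn_integral_eq_integral Dint) auto
  also have "\<dots> \<le> (\<Sum>k. ennreal (1 / 2 ^ k))"
    by (intro suminf_le ennreal_leI Dint) auto
  also have "\<dots> = ennreal (\<Sum>k. (1 / 2) ^ k)"
  proof -
    have "summable (\<lambda>k. (1 / 2 :: real) ^ k)" by (rule summable_geometric) simp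
    then have "(\<Sum>k. ennreal ((1 / 2) ^ k)) = ennreal (\<Sum>k. (1 / 2) ^ k)"
      by (intro suminf_ennreal2) auto
    then show ?thesis by (simp only: power_one_over)
  qed
  also have "\<dots> < \<infinity>" by simp
  finally have "AE x in M. (\<Sum>k. ennreal (norm (?D k x))) \<noteq> \<infinity>"
    by (intro nn_integral_PInf_AE) auto
  then have AE_Z: "AE x in M. x \<in> Z" by (auto simp: Z_def)
  have conv: "convergent (\<lambda>k. G k x)" if "x \<in> Z" for x
  proof -
    have "summable (\<lambda>k. norm (?D k x))"
      by (rule summable_suminf_not_top) (use that in \<open>auto simp: Z_def\<close>)
    then have "summable (\<lambda>k. ?D k x)" by (rule summable_norm_cancel)
    then have "convergent (\<lambda>k. G 0 x + (\<Sum>i<k. ?D i x))"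
      by (intro convergent_add convergent_const) (simp add: summable_iff_convergent)
    moreover have "G 0 x + (\<Sum>i<k. ?D i x) = G k x" for k
    proof (induction k)
      case (Suc k)
      then show ?case using Gd[of k "Suc k" x] by (simp add: algebra_simps)
    qed simp
    ultimately show ?thesis by simp
  qed
  define f where "f x = (if x \<in> Z then lim (\<lambda>k. G k x) else 0)" for x
  have lim: "(\<lambda>k. G k x) \<longlonglongrightarrow> f x" if "x \<in> Z" for x
    using conv[OF that] that by (simp add: f_def convergent_LIMSEQ_iff)
  have fW: "f x \<in> ell2_on W" for x
  proof (cases "x \<in> Z")
    case True
    have "closed (ell2_on W)" using hilbert_subspace_ell2_on[of W] by (simp add: hilbert_subspace_def)
    then show ?thesis
      by (rule Lim_in_closed_set[OF _ _ _ lim[OF True]])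
        (use G in \<open>auto simp: sq_int_def\<close>)
  qed (simp add: f_def)
  have coordf: "(\<lambda>x. ell2_fun (f x) n) \<in> borel_measurable M" for n
  proof (rule borel_measurable_LIMSEQ_metric)
    show "(\<lambda>x. if x \<in> Z then ell2_fun (G k x) n else 0) \<in> borel_measurable M" for k
      using coordG[of k n] by measurable
    show "(\<lambda>k. if x \<in> Z then ell2_fun (G k x) n else 0) \<longlonglongrightarrow> ell2_fun (f x) n" for x
    proof (cases "x \<in> Z")
      case True
      have "(\<lambda>k. cinner (ket n) (G k x)) \<longlonglongrightarrow> cinner (ket n) (f x)"
        by (rule bounded_linear.tendsto[OF bounded_linear_cinner_right lim[OF True]])
      then show ?thesis using True by (simp add: cinner_ket)
    qed (simp add: f_def ell2_fun_zero)
  qed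
  \<comment> \<open>Used twice: \<open>g = 0\<close> bounds the norm of the limit, and
    \<open>g = G k\<close> bounds its distance to a partial sum.\<close>
  have Fatou: "integrable M (\<lambda>x. (norm (f x - g x))\<^sup>2) \<and> (\<integral>x. (norm (f x - g x))\<^sup>2 \<partial>M) \<le> C"
    if g: "sq_int M W g" and C: "C \<ge> 0"
      and bound: "\<And>j. j \<ge> k \<Longrightarrow> (\<integral>x. (norm (G j x - g x))\<^sup>2 \<partial>M) \<le> C" for g C k
  proof -
    have coordg: "(\<lambda>x. ell2_fun (g x) n) \<in> borel_measurable M" for n
      using g unfolding sq_int_def by blast
    have "(\<lambda>x. ell2_fun (G j x - g x) n) \<in> borel_measurable M" for j n
      unfolding ell2_fun_diff using coordG coordg by (intro borel_measurable_diff)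
    then have [measurable]: "(\<lambda>x. norm (G j x - g x)) \<in> borel_measurable M" for j
      by (rule measurable_norm_ell2)
    have "(\<lambda>x. ell2_fun (f x - g x) n) \<in> borel_measurable M" for n
      unfolding ell2_fun_diff using coordf coordg by (intro borel_measurable_diff)
    then have [measurable]: "(\<lambda>x. norm (f x - g x)) \<in> borel_measurable M"
      by (rule measurable_norm_ell2)
    have "(\<integral>\<^sup>+x. ennreal ((norm (f x - g x))\<^sup>2) \<partial>M)
        = (\<integral>\<^sup>+x. liminf (\<lambda>j. ennreal ((norm (G j x - g x))\<^sup>2)) \<partial>M)"
    proof (rule nn_integral_cong_AE, use AE_Z in eventually_elim)
      case (elim x)
      have "(\<lambda>j. ennreal ((norm (G j x - g x))\<^sup>2)) \<longlonglongrightarrow> ennreal ((norm (f x - g x))\<^sup>2)"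
        by (intro tendsto_ennrealI tendsto_power tendsto_norm tendsto_diff lim elim tendsto_const)
      from lim_imp_Liminf[OF _ this] show ?case by simp
    qed
    also have "\<dots> \<le> liminf (\<lambda>j. \<integral>\<^sup>+x. ennreal ((norm (G j x - g x))\<^sup>2) \<partial>M)"
      by (rule nn_integral_liminf) measurable
    also have "\<dots> \<le> liminf (\<lambda>j. ennreal C)"
    proof (rule Liminf_mono, rule eventually_sequentiallyI[of k])
      fix j assume "k \<le> j"
      have "integrable M (\<lambda>x. (norm (G j x - g x))\<^sup>2)"
        using sq_int_diff[OF G g, of j] by (simp add: sq_int_def)
      then have "(\<integral>\<^sup>+x. ennreal ((norm (G j x - g x))\<^sup>2) \<partial>M) = ennreal (\<integral>x. (norm (G j x - g x))\<^sup>2 \<partial>M)"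
        by (rule nn_integral_eq_integral) simp
      also have "\<dots> \<le> ennreal C" using bound[OF \<open>k \<le> j\<close>] by (rule ennreal_leI)
      finally show "(\<integral>\<^sup>+x. ennreal ((norm (G j x - g x))\<^sup>2) \<partial>M) \<le> ennreal C" .
    qed
    also have "\<dots> = ennreal C" by (simp add: Liminf_const)
    finally have le: "(\<integral>\<^sup>+x. ennreal ((norm (f x - g x))\<^sup>2) \<partial>M) \<le> ennreal C" .
    have int: "integrable M (\<lambda>x. (norm (f x - g x))\<^sup>2)"
      by (rule integrableI_bounded) (use le in \<open>auto simp: order_le_less_trans\<close>)
    from le have "ennreal (\<integral>x. (norm (f x - g x))\<^sup>2 \<partial>M) \<le> ennreal C"
      by (subst (asm) nn_integral_eq_integral[OF int]) auto
    then show ?thesis using int C by (simp add: ennreal_le_iff)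
  qed
  have normG: "(\<integral>x. (norm (G j x - 0))\<^sup>2 \<partial>M) \<le> infsum ?c2 A" for j
    unfolding G_def diff_zero using S[of j]
    by (subst norm_square_comb) (auto intro!: finite_sum_le_infsum c)
  have f0: "integrable M (\<lambda>x. (norm (f x))\<^sup>2)" "(\<integral>x. (norm (f x))\<^sup>2 \<partial>M) \<le> infsum ?c2 A"
    using Fatou[OF sq_int_zero, of "infsum ?c2 A" 0] normG by (auto simp: infsum_nonneg)
  have f: "sq_int M W f" unfolding sq_int_def using fW coordf f0 by blast
  have "coef f y = c y" if y: "y \<in> A" for y
  proof -
    \<comment> \<open>The comparison passes through \<open>G k\<close>: Bessel's inequality bounds
      the first error by the distance in square norm, and the second error is either 0 or a
      coefficient in the tail.\<close>
    have *: "cmod (coef f y - c y) \<le> 2 * (1 / 2) ^ k" for k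
    proof -
      have "(\<integral>x. (norm (G j x - G k x))\<^sup>2 \<partial>M) \<le> (1 / 2 ^ k)\<^sup>2" if "j \<ge> k" for j
        unfolding Gd[OF that] by (rule d2)
      then have "(\<integral>x. (norm (f x - G k x))\<^sup>2 \<partial>M) \<le> (1 / 2 ^ k)\<^sup>2"
        using Fatou[OF G, of "(1 / 2 ^ k)\<^sup>2" k k] by auto
      then have "(cmod (coef (\<lambda>x. f x - G k x) y))\<^sup>2 \<le> (1 / 2 ^ k)\<^sup>2"
        using order_trans[OF Bessel[of "{y}", OF _ _ sq_int_diff[OF f G[of k]]]] y
        by (simp del: power2_le_iff_abs_le power_mono_iff)
      then have 1: "cmod (coef f y - coef (G k) y) \<le> 1 / 2 ^ k"
        unfolding coef_diff[OF y f G] by (rule power2_le_imp_le) simp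
      have 2: "cmod (coef (G k) y - c y) \<le> 1 / 2 ^ k"
      proof (cases "y \<in> S k")
        case False
        then have "(cmod (c y))\<^sup>2 \<le> (1 / 2 ^ k)\<^sup>2" using tailS[of "{y}" k] y by simp
        then have "cmod (c y) \<le> 1 / 2 ^ k" by (rule power2_le_imp_le) simp
        then show ?thesis using False by (simp add: G_def coef_comb[OF S y])
      qed (simp add: G_def coef_comb[OF S y])
      have "coef f y - c y = (coef f y - coef (G k) y) + (coef (G k) y - c y)" by simp
      then have "cmod (coef f y - c y) \<le> 1 / 2 ^ k + 1 / 2 ^ k"
        using norm_triangle_mono[OF 1 2] by metis
      then show ?thesis by (simp add: power_one_over)
    qed
    have "(\<lambda>k. 2 * (1 / 2) ^ k :: real) \<longlonglongrightarrow> 2 * 0"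
      by (intro tendsto_mult tendsto_const LIMSEQ_realpow_zero) auto
    then have "cmod (coef f y - c y) \<le> 2 * 0"
      by (rule LIMSEQ_le_const) (use * in blast)
    then show ?thesis by simp
  qed
  then show ?thesis using that[OF f] f0(2) by blast
qed

text \<open>Bessel's inequality is one half. For the other, the section rebuilt from the
  coefficients by \<open>Riesz_Fischer\<close> has no larger norm than they allow, and
  \<open>complete\<close> identifies it with \<open>f\<close>.\<close>

lemma Parseval:
  assumes f: "sq_int M W f"
  shows "(\<Sum>\<^sub>\<infinity>y\<in>A. (cmod (coef f y))\<^sup>2) = (\<integral>x. (norm (f x))\<^sup>2 \<partial>M)"
proof -
  obtain g where g: "sq_int M W g" "\<And>y. y \<in> A \<Longrightarrow> coef g y = coef f y"
    "(\<integral>x. (norm (g x))\<^sup>2 \<partial>M) \<le> (\<Sum>\<^sub>\<infinity>y\<in>A. (cmod (coef f y))\<^sup>2)"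
    by (rule Riesz_Fischer[OF coef_summable(1)[OF f]]) blast
  have "AE x in M. f x - g x = 0"
  proof (rule complete[OF sq_int_diff[OF f g(1)]])
    show "(\<integral>x. cinner (F y x) (f x - g x) \<partial>M) = 0" if "y \<in> A" for y
      using coef_diff[OF that f g(1)] g(2)[OF that] by (simp add: coef_def)
  qed
  then have "(\<integral>x. (norm (f x))\<^sup>2 \<partial>M) = (\<integral>x. (norm (g x))\<^sup>2 \<partial>M)"
    using f g(1) unfolding sq_int_def
    by (intro integral_cong_AE borel_measurable_integrable) (auto elim!: eventually_mono)
  then show ?thesis using g(3) coef_summable(2)[OF f] by linarith
qed

end

section \<open>Degrees and label tails\<close>

context pred_system
begin

lemma matches_same_tail:
  "same_tail x y \<Longrightarrow> x \<in> A \<Longrightarrow> y \<in> A \<Longrightarrow> matches u x \<longleftrightarrow> matches u y"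
proof (induction u arbitrary: x y rule: sum_list_induct)
  case (Blue i u)
  have "I (bwd 0 0 x) = I (bwd 0 0 y)" using Blue.prems(1) unfolding same_tail_def by blast
  moreover have "same_tail (b x) (b y)"
    using same_tail_bwd[OF Blue.prems(2,3,1), of 1 0] by (simp add: b_eq_bwd)
  ultimately show ?case using Blue by simp
next
  case (Red j u)
  have "J (bwd 0 0 x) = J (bwd 0 0 y)" using Red.prems(1) unfolding same_tail_def by blast
  moreover have "same_tail (r x) (r y)"
    using same_tail_bwd[OF Red.prems(2,3,1), of 0 1] by (simp add: r_eq_bwd)
  ultimately show ?case using Red by simp
qed simp

text \<open>Equal tails mean that the same word leads to both vertices, so a common ancestor at the
  same degree forces them to coincide.\<close>

lemma same_tail_bwd_eq:
  assumes "same_tail x y" "x \<in> A" "y \<in> A" "bwd k l x = bwd k l y" shows "x = y"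
proof -
  obtain u where u: "matches u x" "nblue u = k" "nred u = l" using ex_word assms(2) by blast
  then have "matches u y" using matches_same_tail assms(1-3) by blast
  then show ?thesis using matches_bwd_inj[of u x y] u assms by simp
qed

lemma same_tail_if_bwd:
  assumes "matches u x" "matches u y" "x \<in> A" "y \<in> A"
    "same_tail (bwd (nblue u) (nred u) x) (bwd (nblue u) (nred u) y)"
  shows "same_tail x y"
  using assms
proof (induction u arbitrary: x y rule: sum_list_induct)
  case (Blue i u)
  have "same_tail (b x) (b y)" using Blue.IH[of "b x" "b y"] Blue.prems by (simp add: bwd_b)
  moreover have "I x = I y" using Blue.prems(1,2) by simp
  ultimately show ?case by (rule same_tail_b_cancel[OF Blue.prems(3,4)])
next
  case (Red i u)
  have "same_tail (r x) (r y)" using Red.IH[of "r x" "r y"] Red.prems by (simp add: bwd_r)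
  moreover have "J x = J y" using Red.prems(1,2) by simp
  ultimately show ?case by (rule same_tail_r_cancel[OF Red.prems(3,4)])
qed simp

text \<open>The coordinates of \<open>y\<close> when \<open>x\<close> is the origin: back from
  \<open>x\<close> to a common ancestor, then forward to \<open>y\<close>. By
  \<open>degs_diff_periods\<close> they are unique modulo \<open>periods x\<close>.\<close>

definition degs :: "'w \<Rightarrow> 'w \<Rightarrow> (int \<times> int) set" where
  "degs x y = {(int k - int k', int l - int l') | k l k' l'. bwd k l y = bwd k' l' x}"

lemma degsI: "bwd k l y = bwd k' l' x \<Longrightarrow> (int k - int k', int l - int l') \<in> degs x y"
  unfolding degs_def by blast

text \<open>Together with \<open>degs_surj\<close> this makes each tail class a copy of
  \<open>L / K\<close>: coordinates inside a class differ by label periods, and modulo periods they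
  determine the vertex.\<close>

lemma degs_diff_label_periods:
  assumes x: "x \<in> A" "y \<in> A" "y' \<in> A" and st: "same_tail y y'"
    and s: "(s, t) \<in> degs x y" "(s', t') \<in> degs x y'"
  shows "(s - s', t - t') \<in> label_periods x"
    and "(s - s', t - t') \<in> periods x \<Longrightarrow> y = y'"
proof -
  obtain k l k' l' where 1: "s = int k - int k'" "t = int l - int l'" "bwd k l y = bwd k' l' x"
    using s(1) unfolding degs_def by blast
  obtain m n m' n' where 2: "s' = int m - int m'" "t' = int n - int n'" "bwd m n y' = bwd m' n' x"
    using s(2) unfolding degs_def by blast
  have e1: "bwd (k + m) (l + n) y = bwd (k' + m) (l' + n) x" by (rule bwd_shift[OF x(2) 1(3) x(1)])
  have e2: "bwd (k + m) (l + n) y' = bwd (m' + k) (n' + l) x"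
    using bwd_shift[OF x(3) 2(3) x(1), of k l] by (simp add: add.commute)
  have "same_tail (bwd (k' + m) (l' + n) x) (bwd (m' + k) (n' + l) x)"
    unfolding e1[symmetric] e2[symmetric] by (rule same_tail_bwd[OF x(2,3) st])
  then have "(int (m' + k) - int (k' + m), int (n' + l) - int (l' + n)) \<in> label_periods x"
    unfolding label_periods_def by blast
  then show "(s - s', t - t') \<in> label_periods x" by (simp add: 1 2 algebra_simps)
  assume "(s - s', t - t') \<in> periods x"
  then obtain N where N: "\<And>k l k' l'. N \<le> k \<Longrightarrow> N \<le> l \<Longrightarrow> N \<le> k' \<Longrightarrow> N \<le> l'
    \<Longrightarrow> int k' - int k = s - s' \<Longrightarrow> int l' - int l = t - t' \<Longrightarrow> bwd k l x = bwd k' l' x"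
    by (rule periods_far[OF x(1)]) blast
  have "bwd (k' + m + N) (l' + n + N) x = bwd (m' + k + N) (n' + l + N) x"
    by (rule N) (auto simp: 1 2)
  moreover have "bwd (k + m + N) (l + n + N) y = bwd (k' + m + N) (l' + n + N) x"
    by (rule bwd_shift[OF x(2) e1 x(1)])
  moreover have "bwd (k + m + N) (l + n + N) y' = bwd (m' + k + N) (n' + l + N) x"
    by (rule bwd_shift[OF x(3) e2 x(1)])
  ultimately have "bwd (k + m + N) (l + n + N) y = bwd (k + m + N) (l + n + N) y'" by simp
  then show "y = y'" by (rule same_tail_bwd_eq[OF st x(2,3)])
qed

lemma degs_bwd:
  assumes "x \<in> A" "y \<in> A" "(s, t) \<in> degs x y"
  shows "(s - int m, t - int n) \<in> degs x (bwd m n y)"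
proof -
  obtain k l k' l' where 1: "s = int k - int k'" "t = int l - int l'" "bwd k l y = bwd k' l' x"
    using assms(3) unfolding degs_def by blast
  have "bwd k l (bwd m n y) = bwd (k' + m) (l' + n) x"
    using bwd_shift[OF assms(2) 1(3) assms(1), of m n] assms(2) by (simp add: bwd_bwd)
  from degsI[OF this] show ?thesis by (simp add: 1 algebra_simps)
qed

lemma degs_diff_periods:
  assumes "x \<in> A" "y \<in> A" "(s, t) \<in> degs x y" "(s', t') \<in> degs x y"
  shows "(s - s', t - t') \<in> periods x"
proof -
  obtain k l k' l' where 1: "s = int k - int k'" "t = int l - int l'" "bwd k l y = bwd k' l' x"
    using assms(3) unfolding degs_def by blast
  obtain m n m' n' where 2: "s' = int m - int m'" "t' = int n - int n'" "bwd m n y = bwd m' n' x"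
    using assms(4) unfolding degs_def by blast
  have "bwd (k + m) (l + n) y = bwd (k' + m) (l' + n) x" by (rule bwd_shift[OF assms(2) 1(3) assms(1)])
  moreover have "bwd (k + m) (l + n) y = bwd (m' + k) (n' + l) x"
    using bwd_shift[OF assms(2) 2(3) assms(1), of k l] by (simp add: add.commute)
  ultimately have "bwd (k' + m) (l' + n) x = bwd (m' + k) (n' + l) x" by simp
  from periodsI[OF this] show ?thesis by (simp add: 1 2 algebra_simps)
qed

text \<open>A vertex is determined by an ancestor in the past of a base vertex and a word leading
  from there to it; there are countably many such data.\<close>

lemma countable_vertices:
  assumes "finite (UNIV :: 'm set)" "finite (UNIV :: 'n set)" and conn: connected
  shows "countable A"
proof -
  obtain x where x: "x \<in> A" using conn unfolding connected_def by blast
  let ?P = "\<lambda>(k, l, u) y. y \<in> A \<and> matches u y \<and> bwd (nblue u) (nred u) y = bwd k l x"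
  have "A \<subseteq> (\<lambda>p. SOME y. ?P p y) ` (UNIV \<times> UNIV \<times> lists UNIV)"
  proof
    fix y assume y: "y \<in> A"
    obtain k l k' l' where e: "bwd k l y = bwd k' l' x" using conn x y unfolding connected_def by blast
    obtain u where u: "matches u y" "nblue u = k" "nred u = l" using ex_word y by blast
    have P: "?P (k', l', u) y" using y u e by simp
    then have "?P (k', l', u) (SOME y. ?P (k', l', u) y)" by (rule someI)
    then have "y = (SOME y. ?P (k', l', u) y)"
      using matches_bwd_inj[of u y "SOME y. ?P (k', l', u) y"] P by auto
    then show "y \<in> (\<lambda>p. SOME y. ?P p y) ` (UNIV \<times> UNIV \<times> lists UNIV)"
      by (intro image_eqI[of _ _ "(k', l', u)"]) auto
  qed
  moreover have "finite (UNIV :: ('m + 'n) set)"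
    using assms(1,2) by (simp add: UNIV_Plus_UNIV[symmetric] del: UNIV_Plus_UNIV)
  then have "countable (lists (UNIV :: ('m + 'n) set))" by (intro countable_lists countable_finite)
  then have "countable ((\<lambda>p. SOME y. ?P p y) ` (UNIV \<times> UNIV \<times> lists UNIV))"
    by (intro countable_image countable_SIGMA) auto
  ultimately show ?thesis by (rule countable_subset)
qed

end

text \<open>Go back from \<open>y\<close> into the past of \<open>x\<close>, jump by the label
  period to a position with the same tail, and come forward along the same word. The forward edges
  exist because the system is full.\<close>

lemma (in full_system) degs_surj:
  assumes x: "x \<in> A" "y \<in> A" and s: "(s, t) \<in> degs x y" and p: "(p, q) \<in> label_periods x"
  shows "\<exists>y'\<in>A. same_tail y y' \<and> (s + p, t + q) \<in> degs x y'"
proof -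
  obtain k l k' l' where 1: "s = int k - int k'" "t = int l - int l'" "bwd k l y = bwd k' l' x"
    using s unfolding degs_def by blast
  obtain N where N: "\<And>k l k' l'. N \<le> k \<Longrightarrow> N \<le> l \<Longrightarrow> N \<le> k' \<Longrightarrow> N \<le> l'
    \<Longrightarrow> int k' - int k = p \<Longrightarrow> int l' - int l = q \<Longrightarrow> same_tail (bwd k l x) (bwd k' l' x)"
    using label_periods_far[OF x(1) p] by blast
  \<comment> \<open>Large enough for the positions before and after the jump to lie beyond
    \<open>N\<close>; in backward counts the jump subtracts \<open>(p, q)\<close>.\<close>
  define m where "m = N + nat \<bar>p\<bar> + nat \<bar>q\<bar>"
  have m: "int N + p \<le> int m" "int N + q \<le> int m" "N \<le> m" by (auto simp: m_def)
  define k2 where "k2 = nat (int (k' + m) - p)"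
  define l2 where "l2 = nat (int (l' + m) - q)"
  have k2: "int k2 = int (k' + m) - p" "int l2 = int (l' + m) - q" "N \<le> k2" "N \<le> l2"
    using m by (auto simp: k2_def l2_def)
  have e: "bwd (k + m) (l + m) y = bwd (k' + m) (l' + m) x" by (rule bwd_shift[OF x(2) 1(3) x(1)])
  have st: "same_tail (bwd k2 l2 x) (bwd (k' + m) (l' + m) x)"
    using k2 m by (intro N) auto
  obtain u where u: "matches u y" "nblue u = k + m" "nred u = l + m" using ex_word x(2) by blast
  obtain y' where y': "y' \<in> A" "matches u y'" "bwd (k + m) (l + m) y' = bwd k2 l2 x"
    using matches_bwd_ex[of "bwd k2 l2 x" u] x u by auto
  have "same_tail y y'"
    by (rule same_tail_if_bwd[OF u(1) y'(2) x(2) y'(1)])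
      (use u y'(3) e st same_tail_sym in simp)
  moreover have "(int (k + m) - int k2, int (l + m) - int l2) \<in> degs x y'" by (rule degsI[OF y'(3)])
  ultimately show ?thesis using y'(1) by (intro bexI[of _ y']) (simp_all add: k2 1 algebra_simps)
qed

section \<open>Decomposition over the characters of the symmetry group\<close>

lemma measurable_power_int [measurable]:
  fixes z :: "'x \<Rightarrow> complex"
  assumes [measurable]: "z \<in> borel_measurable M" shows "(\<lambda>x. z x powi s) \<in> borel_measurable M"
  unfolding power_int_def by (cases "s \<ge> 0") simp_all

lemma cnj_power_int_unit: "cmod z = 1 \<Longrightarrow> cnj (z powi s) = z powi (- s)"
proof -
  assume z: "cmod z = 1"
  then have "cmod (z powi s) = 1" by (simp add: norm_power_int)
  then have "z powi s * cnj (z powi s) = 1"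
    unfolding complex_norm_square[symmetric] by simp
  then have "cnj (z powi s) = inverse (z powi s)" by (simp add: inverse_unique)
  then show ?thesis by (simp add: power_int_minus)
qed

text \<open>Functions on a tail class correspond to functions on the dual of \<open>L / K\<close>;
  collecting the classes gives sections of a constant field over the quotient graph. A word of
  degree \<open>(k, l)\<close> shifts coordinates by that degree, which becomes multiplication by
  \<open>z\<^sub>1 ^ k\<close> and \<open>z\<^sub>2 ^ l\<close>; hence the fibre constants
  \<open>a z\<^sub>1\<close> and \<open>c z\<^sub>2\<close>. The last two conclusions serve the
  reducibility argument.\<close>

lemma ex_direct_integral:
  fixes \<theta> :: "'m::finite \<times> 'n::finite \<Rightarrow> 'm \<times> 'n" and A :: "'w set"
  assumes full: "full_system \<theta> A b r I J" and conn: "pred_system.connected A b r"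
    and a: "cmod a = 1" and c: "cmod c = 1" and x0: "x0 \<in> A"
  obtains M :: "(real \<times> real) measure" and H :: "real \<times> real \<Rightarrow> nat ell2 set" and \<epsilon> \<rho> where
    "sets M = sets borel" "emeasure M UNIV = 1"
    "is_direct_integral \<theta> (ell2_on A) (pred_system.rho A b r I J a c) M H \<epsilon> \<rho>"
    "\<And>x. irreducible_group_construction_dilation \<theta> (H x) (\<rho> x)"
    "\<exists>e\<in>square_integrable_sections M H \<epsilon>. \<forall>x. norm (e x) = 1"
    "\<not> pred_system.label_periods b r I J x0 \<subseteq> pred_system.periods b r x0 \<Longrightarrow>
      \<exists>Z\<in>sets M. emeasure M Z \<noteq> 0 \<and> emeasure M (UNIV - Z) \<noteq> 0"
proof -
  interpret full_system \<theta> A b r I J by fact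

  \<comment> \<open>Characters of the symmetry group\<close>
  define K where "K = periods x0"
  define L where "L = label_periods x0"
  have K: "add_subgroup K" and L: "add_subgroup L" and KL: "K \<subseteq> L"
    unfolding K_def L_def
    by (rule add_subgroup_periods[OF x0] add_subgroup_label_periods[OF x0] periods_subset)+
  obtain M :: "(real \<times> real) measure" and z\<^sub>1 z\<^sub>2 :: "real \<times> real \<Rightarrow> complex" where
    M: "sets M = sets borel" "emeasure M UNIV = 1"
    and zm: "z\<^sub>1 \<in> borel_measurable borel" "z\<^sub>2 \<in> borel_measurable borel"
    and z: "\<And>p. cmod (z\<^sub>1 p) = 1" "\<And>p. cmod (z\<^sub>2 p) = 1"
    and orth: "\<And>s t. (s, t) \<in> L \<Longrightarrow> (\<integral>p. z\<^sub>1 p powi s * z\<^sub>2 p powi t \<partial>M) = (if (s, t) \<in> K then 1 else 0)"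
    and total: "\<And>h. integrable M h \<Longrightarrow> (\<And>s t. (s, t) \<in> L \<Longrightarrow> (\<integral>p. (z\<^sub>1 p powi s * z\<^sub>2 p powi t) * h p \<partial>M) = 0)
      \<Longrightarrow> AE p in M. h p = 0"
    using ex_character_measure[OF K L KL] by blast
  have sp: "space M = UNIV" using sets_eq_imp_space_eq[OF M(1)] by simp
  have M1: "emeasure M (space M) = 1" using M(2) sp by simp
  interpret finite_measure M by (rule finite_measureI) (simp add: M1)
  note [measurable_cong] = M(1)
  have zM [measurable]: "z\<^sub>1 \<in> borel_measurable M" "z\<^sub>2 \<in> borel_measurable M"
    using zm measurable_cong_sets[OF M(1) HOL.refl] by blast+
  define chi where "chi s t p = z\<^sub>1 p powi s * z\<^sub>2 p powi t" for s t p
  have [measurable]: "chi s t \<in> borel_measurable M" for s t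
    unfolding chi_def by (intro borel_measurable_times measurable_power_int zM)
  have z0: "z\<^sub>1 p \<noteq> 0" "z\<^sub>2 p \<noteq> 0" for p using z[of p] by auto
  have norm_chi [simp]: "cmod (chi s t p) = 1" for s t p
    by (simp add: chi_def norm_mult norm_power_int z)
  have chi_add: "chi (s + s') (t + t') p = chi s t p * chi s' t' p" for s t s' t' p
    by (simp add: chi_def power_int_add z0)
  have chi_nat: "chi (int k) (int l) p = z\<^sub>1 p ^ k * z\<^sub>2 p ^ l" for k l p by (simp add: chi_def)
  have chi_cnj: "cnj (chi s t p) = chi (- s) (- t) p" for s t p
    unfolding chi_def complex_cnj_mult by (simp only: cnj_power_int_unit z)
  have chi_K: "AE p in M. chi s t p = 1" if "(s, t) \<in> K" for s t
    by (rule AE_eq_1_if_integral_1[OF M1]) (use orth[of s t] that KL in \<open>auto simp: chi_def[symmetric]\<close>)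
  have chi_cong: "AE p in M. chi s t p = chi s' t' p" if "(s - s', t - t') \<in> K" for s t s' t'
    using chi_K[OF that]
  proof eventually_elim
    case (elim p)
    then show ?case using chi_add[of "s - s'" s' "t - t'" t' p] by simp
  qed

  \<comment> \<open>The quotient graph of label tails\<close>
  have ctbl: "countable A" using countable_vertices[OF finite[of UNIV] finite[of UNIV] conn] .
  \<comment> \<open>Coordinates are determined only modulo \<open>K\<close>; by
    \<open>chi_cong\<close>, another choice would change the characters below on a null set at
    most.\<close>
  define d where "d y = (SOME u. u \<in> degs x0 y)" for y
  have d: "d y \<in> degs x0 y" if y: "y \<in> A" for y
  proof -
    obtain k l k' l' where "bwd k l y = bwd k' l' x0" using conn x0 y unfolding connected_def by blast
    from degsI[OF this] show ?thesis unfolding d_def by (rule someI)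
  qed
  define tail where "tail y = {y' \<in> A. same_tail y y'}" for y
  \<comment> \<open>Classes are numbered by naturals, so that all fibres lie in the one type
    \<open>nat ell2\<close>.\<close>
  define idx where "idx y = to_nat_on (tail ` A) (tail y)" for y
  define W where "W = idx ` A"
  have idx_eq: "idx y = idx y' \<longleftrightarrow> same_tail y y'" if "y \<in> A" "y' \<in> A" for y y'
  proof -
    have "idx y = idx y' \<longleftrightarrow> tail y = tail y'"
      unfolding idx_def using ctbl that by (intro to_nat_on_inj) auto
    also have "\<dots> \<longleftrightarrow> same_tail y y'"
    proof
      assume "tail y = tail y'"
      moreover have "y' \<in> tail y'" using that by (simp add: tail_def)
      ultimately show "same_tail y y'" unfolding tail_def by blast
    next
      assume "same_tail y y'"
      then show "tail y = tail y'"
        unfolding tail_def using same_tail_trans same_tail_sym by blast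
    qed
    finally show ?thesis .
  qed
  define rep where "rep i = inv_into A idx i" for i
  have rep: "rep i \<in> A" "idx (rep i) = i" if "i \<in> W" for i
    using that unfolding rep_def W_def by (auto intro: inv_into_into f_inv_into_f)
  have idxW: "idx y \<in> W" if "y \<in> A" for y using that by (simp add: W_def)
  have rep_idx: "same_tail (rep (idx y)) y" if "y \<in> A" for y
    using rep[OF idxW[OF that]] idx_eq[of "rep (idx y)" y] that by simp
  define bW where "bW i = idx (b (rep i))" for i
  define rW where "rW i = idx (r (rep i))" for i
  define IW where "IW i = I (rep i)" for i
  define JW where "JW i = J (rep i)" for i
  have bW: "bW (idx y) = idx (b y)" if "y \<in> A" for y
    unfolding bW_def
    using same_tail_bwd[OF rep(1)[OF idxW[OF that]] that rep_idx[OF that], of 1 0] that rep(1)[OF idxW[OF that]]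
    by (subst idx_eq) (auto simp: b_eq_bwd)
  have rW: "rW (idx y) = idx (r y)" if "y \<in> A" for y
    unfolding rW_def
    using same_tail_bwd[OF rep(1)[OF idxW[OF that]] that rep_idx[OF that], of 0 1] that rep(1)[OF idxW[OF that]]
    by (subst idx_eq) (auto simp: r_eq_bwd)
  have IJ0: "I x = I y \<and> J x = J y" if "same_tail x y" for x y
    using that[unfolded same_tail_def, rule_format, of 0 0] by simp
  have IW: "IW (idx y) = I y" and JW: "JW (idx y) = J y" if "y \<in> A" for y
    using IJ0[OF rep_idx[OF that]] by (simp_all add: IW_def JW_def)
  have W_cases: "\<exists>y\<in>A. i = idx y" if "i \<in> W" for i using that unfolding W_def by blast
  interpret Q: full_system \<theta> W bW rW IW JW
  proof
    show "bij \<theta>" by (rule bij_theta)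
    fix i assume "i \<in> W"
    then obtain x where x: "x \<in> A" "i = idx x" using W_cases by blast
    show "bW i \<in> W" "rW i \<in> W" using x by (simp_all add: bW rW idxW)
    show "bW (rW i) = rW (bW i)" using x by (simp add: bW rW b_r)
    show "\<theta> (IW i, JW (bW i)) = (IW (rW i), JW i)" using x by (simp add: bW rW IW JW square)
    show "\<exists>j\<in>W. bW j = i \<and> IW j = l" for l
    proof -
      obtain y where "y \<in> A" "b y = x" "I y = l" using b_ex[OF x(1), of l] by blast
      then show ?thesis using x by (intro bexI[of _ "idx y"]) (auto simp: bW IW idxW)
    qed
    show "\<exists>j\<in>W. rW j = i \<and> JW j = l" for l
    proof -
      obtain y where "y \<in> A" "r y = x" "J y = l" using r_ex[OF x(1), of l] by blast
      then show ?thesis using x by (intro bexI[of _ "idx y"]) (auto simp: rW JW idxW)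
    qed
    fix j assume "j \<in> W"
    then obtain y where y: "y \<in> A" "j = idx y" using W_cases by blast
    show "i = j" if "bW i = bW j" "IW i = IW j"
    proof -
      have "same_tail (b x) (b y)" using that(1) x y idx_eq[of "b x" "b y"] by (simp add: bW)
      moreover have "I x = I y" using that(2) x y by (simp add: IW)
      ultimately have "same_tail x y" by (rule same_tail_b_cancel[OF x(1) y(1)])
      then show ?thesis using x y by (simp add: idx_eq)
    qed
    show "i = j" if "rW i = rW j" "JW i = JW j"
    proof -
      have "same_tail (r x) (r y)" using that(1) x y idx_eq[of "r x" "r y"] by (simp add: rW)
      moreover have "J x = J y" using that(2) x y by (simp add: JW)
      ultimately have "same_tail x y" by (rule same_tail_r_cancel[OF x(1) y(1)])
      then show ?thesis using x y by (simp add: idx_eq)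
    qed
  qed
  have bwdW: "Q.bwd k l (idx y) = idx (bwd k l y)" if "y \<in> A" for y k l
  proof -
    have "(rW ^^ l) (idx y) = idx ((r ^^ l) y)" using that by (induction l) (auto simp: rW)
    moreover have "(bW ^^ k) (idx z) = idx ((b ^^ k) z)" if "z \<in> A" for z
      using that by (induction k) (auto simp: bW)
    ultimately show ?thesis using that by (simp add: Q.bwd_def bwd_def)
  qed
  have matchesW: "Q.matches u (idx y) \<longleftrightarrow> matches u y" if "y \<in> A" for u y
    using that by (induction u arbitrary: y rule: sum_list_induct) (auto simp: IW JW bW rW)
  have connW: "Q.connected"
    unfolding Q.connected_def
  proof (intro conjI ballI)
    show "W \<noteq> {}" using x0 idxW by blast
    fix i j assume "i \<in> W" "j \<in> W"
    then obtain x y where xy: "x \<in> A" "i = idx x" "y \<in> A" "j = idx y" using W_cases by blast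
    then obtain k l k' l' where "bwd k l x = bwd k' l' y" using conn unfolding connected_def by blast
    then show "\<exists>k l k' l'. Q.bwd k l i = Q.bwd k' l' j" using xy by (metis bwdW)
  qed
  have sepW: "i = j" if ij: "i \<in> W" "j \<in> W" "Q.same_tail i j" for i j
  proof -
    obtain x y where xy: "x \<in> A" "i = idx x" "y \<in> A" "j = idx y" using ij W_cases by blast
    have "same_tail x y"
      using ij(3) xy unfolding Q.same_tail_def same_tail_def by (simp add: bwdW IW JW)
    then show ?thesis using xy by (simp add: idx_eq)
  qed

  \<comment> \<open>The Fourier basis of sections indexed by vertices\<close>
  define F where "F y p = chi (fst (d y)) (snd (d y)) p *\<^sub>C ket (idx y)" for y p
  have cinnerF: "cinner (F y p) v = chi (- fst (d y)) (- snd (d y)) p * ell2_fun v (idx y)" for y p v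
    by (simp add: F_def cinner_scaleC_left chi_cnj cinner_ket)
  have coordF: "(\<lambda>p. ell2_fun (F y p) n) \<in> borel_measurable M" for y n
    unfolding F_def ell2_fun_scaleC ell2_fun_ket by measurable
  have F: "sq_int M W (F y)" if "y \<in> A" for y
  proof -
    have "norm (F y p) = 1" for p by (simp add: F_def norm_scaleC)
    moreover have "F y p \<in> ell2_on W" for p
      using that by (simp add: F_def ell2_on_scaleC ket_in_ell2_on idxW)
    ultimately show ?thesis using coordF by (simp add: sq_int_def)
  qed
  have int_coord: "integrable M (\<lambda>p. ell2_fun (f p) n)" if "sq_int M W f" for f n
  proof (rule Bochner_Integration.integrable_bound)
    show "integrable M (\<lambda>p. 1 + (norm (f p))\<^sup>2)" using that by (auto simp: sq_int_def)
    show "(\<lambda>p. ell2_fun (f p) n) \<in> borel_measurable M" using that by (auto simp: sq_int_def)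
    have "norm (ell2_fun (f p) n) \<le> norm (1 + (norm (f p))\<^sup>2)" for p
    proof -
      have "norm (f p) \<le> 1 + (norm (f p))\<^sup>2"
        using sum_squares_bound[of 1 "norm (f p)"] norm_ge_zero[of "f p"]
        unfolding power_one mult_1_right by linarith
      then show ?thesis using cmod_le_ell2_norm[of "f p" n] by simp
    qed
    then show "AE p in M. norm (ell2_fun (f p) n) \<le> norm (1 + (norm (f p))\<^sup>2)" by blast
  qed
  interpret B: l2_basis M W F A
  proof
    show "emeasure M (space M) = 1" by (rule M1)
    show "countable A" by (rule ctbl)
    show "sq_int M W (F y)" if "y \<in> A" for y by (rule F[OF that])
    show "(\<integral>p. cinner (F y p) (F y' p) \<partial>M) = (if y = y' then 1 else 0)" if y: "y \<in> A" "y' \<in> A" for y y'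
    proof (cases "idx y = idx y'")
      case False
      then show ?thesis unfolding cinnerF by (auto simp: F_def ell2_fun_scaleC ell2_fun_ket)
    next
      case True
      let ?s = "fst (d y') - fst (d y)" and ?t = "snd (d y') - snd (d y)"
      have st: "same_tail y' y" using True y idx_eq[of y' y] by simp
      have dd: "(fst (d y'), snd (d y')) \<in> degs x0 y'" "(fst (d y), snd (d y)) \<in> degs x0 y"
        using d y by simp_all
      have inL: "(?s, ?t) \<in> L"
        unfolding L_def by (rule degs_diff_label_periods(1)[OF x0 y(2,1) st dd])
      have "(?s, ?t) \<in> K \<longleftrightarrow> y = y'"
        using degs_diff_label_periods(2)[OF x0 y(2,1) st dd] add_subgroup_0[OF K]
        by (auto simp: K_def zero_prod_def)
      moreover have "cinner (F y p) (F y' p) = chi ?s ?t p" for p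
        using True chi_add[of "- fst (d y)" "fst (d y')" "- snd (d y)" "snd (d y')" p]
        unfolding cinnerF by (simp add: F_def ell2_fun_scaleC ell2_fun_ket)
      ultimately show ?thesis using orth[OF inL] by (simp add: chi_def)
    qed
    fix f assume f: "sq_int M W f" and zero: "\<And>y. y \<in> A \<Longrightarrow> (\<integral>p. cinner (F y p) (f p) \<partial>M) = 0"
    \<comment> \<open>The coefficients of \<open>f\<close> at the vertices of class \<open>n\<close>
      are, up to a shift, all Fourier coefficients over \<open>L\<close> of the coordinate
      \<open>n\<close>, since \<open>degs_surj\<close> supplies a vertex for every frequency. So
      \<open>total\<close> gives completeness.\<close>
    have "AE p in M. ell2_fun (f p) n = 0" for n
    proof (cases "n \<in> W")
      case False
      then show ?thesis using f by (auto simp: sq_int_def ell2_on_def)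
    next
      case True
      then obtain y where y: "y \<in> A" "n = idx y" using W_cases by blast
      let ?s = "- fst (d y)" and ?t = "- snd (d y)"
      let ?h = "\<lambda>p. chi ?s ?t p * ell2_fun (f p) n"
      have "AE p in M. ?h p = 0"
      proof (rule total)
        show "integrable M ?h"
          by (rule integrable_bounded_mult[OF int_coord[OF f], where B=1]) auto
        fix s t assume st: "(s, t) \<in> L"
        have "(- s, - t) \<in> label_periods x0"
          using add_subgroup_minus[OF L st] by (simp add: L_def)
        from degs_surj[OF x0 y(1) _ this, of "fst (d y)" "snd (d y)"] d[OF y(1)]
        obtain y' where y': "y' \<in> A" "same_tail y y'" "(fst (d y) + - s, snd (d y) + - t) \<in> degs x0 y'"
          by auto
        have "(fst (d y) - s - fst (d y'), snd (d y) - t - snd (d y')) \<in> K"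
          unfolding K_def using degs_diff_periods[OF x0 y'(1) y'(3), of "fst (d y')" "snd (d y')"] d[OF y'(1)]
          by simp
        then have "AE p in M. chi (- fst (d y')) (- snd (d y')) p = chi (s + ?s) (t + ?t) p"
          by (intro chi_cong) (simp add: algebra_simps)
        then have "(\<integral>p. chi (s + ?s) (t + ?t) p * ell2_fun (f p) n \<partial>M) = (\<integral>p. cinner (F y' p) (f p) \<partial>M)"
          unfolding cinnerF
          using f y idx_eq[OF y(1) y'(1)] y'(2)
          by (intro integral_cong_AE borel_measurable_times) (auto simp: sq_int_def elim!: eventually_mono)
        moreover have "z\<^sub>1 p powi s * z\<^sub>2 p powi t * ?h p = chi (s + ?s) (t + ?t) p * ell2_fun (f p) n" for p
          by (simp only: chi_add chi_def[of s t, symmetric] mult.assoc)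
        ultimately show "(\<integral>p. z\<^sub>1 p powi s * z\<^sub>2 p powi t * ?h p \<partial>M) = 0"
          using zero[OF y'(1)] by (simp only:)
      qed
      then show ?thesis
      proof eventually_elim
        case (elim p)
        moreover have "chi ?s ?t p \<noteq> 0" using norm_chi[of ?s ?t p] by fastforce
        ultimately show ?case by simp
      qed
    qed
    then have "AE p in M. \<forall>n. ell2_fun (f p) n = 0" unfolding AE_all_countable by blast
    then show "AE p in M. f p = 0"
      by eventually_elim (auto intro!: ell2_eqI simp: ell2_fun_zero)
  qed

  \<comment> \<open>The direct integral of the twisted models\<close>
  define H :: "real \<times> real \<Rightarrow> nat ell2 set" where "H = (\<lambda>_. ell2_on W)"
  define \<epsilon> :: "nat \<Rightarrow> real \<times> real \<Rightarrow> nat ell2" where "\<epsilon> = (\<lambda>n _. if n \<in> W then ket n else 0)"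
  define \<rho> where "\<rho> p = Q.rho (a * z\<^sub>1 p) (c * z\<^sub>2 p)" for p
  have az: "cmod (a * z\<^sub>1 p) = 1" "cmod (c * z\<^sub>2 p) = 1" for p by (simp_all add: norm_mult a c z)
  have sec: "measurable_section M H \<epsilon> f \<longleftrightarrow>
      (\<forall>p. f p \<in> ell2_on W) \<and> (\<forall>n. (\<lambda>p. ell2_fun (f p) n) \<in> borel_measurable M)" for f
  proof -
    have "(\<lambda>p. cinner (\<epsilon> n p) (f p)) = (\<lambda>p. ell2_fun (f p) n)" if f: "\<forall>p. f p \<in> ell2_on W" for n
    proof
      fix p
      have "f p \<in> ell2_on W" using f by blast
      then show "cinner (\<epsilon> n p) (f p) = ell2_fun (f p) n"
        by (simp add: \<epsilon>_def cinner_ket ell2_on_def)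
    qed
    then show ?thesis unfolding measurable_section_def H_def sp
      by (simp cong: conj_cong del: split_paired_All)
  qed
  have sqs: "square_integrable_sections M H \<epsilon> = {f. sq_int M W f}"
    unfolding square_integrable_sections_def sq_int_def sec by auto
  define U where "U f = Abs_ell2 (\<lambda>y. if y \<in> A then B.coef f y else 0)" for f
  have U: "ell2_fun (U f) = (\<lambda>y. if y \<in> A then B.coef f y else 0)" if "sq_int M W f" for f
  proof -
    have "(\<lambda>y. (cmod (if y \<in> A then B.coef f y else 0))\<^sup>2) summable_on UNIV"
      by (rule summable_on_cong_neutral[THEN iffD1, OF _ _ _ B.coef_summable(1)[OF that]]) auto
    then show ?thesis unfolding U_def by (intro Abs_ell2_inverse) (simp add: square_summable_def)
  qed
  have field: "measurable_field M H \<epsilon>"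
    unfolding measurable_field_def
  proof (intro conjI ballI allI)
    fix p
    show "hilbert_subspace (H p)" by (simp add: H_def hilbert_subspace_ell2_on)
    have "closed_span (range (\<lambda>n. \<epsilon> n p)) \<subseteq> ell2_on W"
      by (rule closed_span_minimal[OF hilbert_subspace_ell2_on]) (auto simp: \<epsilon>_def ket_in_ell2_on)
    moreover have "ket ` W \<subseteq> range (\<lambda>n. \<epsilon> n p)" by (force simp: \<epsilon>_def)
    then have "ell2_on W \<subseteq> closed_span (range (\<lambda>n. \<epsilon> n p))"
      unfolding closed_span_ket[symmetric] by (rule closed_span_mono)
    ultimately show "closed_span (range (\<lambda>n. \<epsilon> n p)) = H p" by (simp add: H_def)
  qed (simp add: \<epsilon>_def)
  have rho_word: "ell2_fun (\<rho> p (word_class \<theta> u) v) = (\<lambda>n. if n \<in> W \<and> Q.matches u n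
      then (a * z\<^sub>1 p) ^ nblue u * (c * z\<^sub>2 p) ^ nred u * ell2_fun v (Q.bwd (nblue u) (nred u) n) else 0)" for p u v
    unfolding \<rho>_def by (rule Q.ell2_fun_rho_word)
  have rho_sec: "measurable_section M H \<epsilon> (\<lambda>p. \<rho> p w (f p))"
    if w: "w \<in> carrier (F_theta \<theta>)" and f: "measurable_section M H \<epsilon> f" for w f
  proof -
    from w obtain u where u: "w = word_class \<theta> u" unfolding carrier_F_theta by blast
    have [measurable]: "(\<lambda>p. ell2_fun (f p) n) \<in> borel_measurable M" for n using f unfolding sec by blast
    show ?thesis unfolding sec u
    proof (intro conjI allI)
      show "\<rho> p (word_class \<theta> u) (f p) \<in> ell2_on W" for p
        by (simp add: ell2_on_def rho_word)
      show "(\<lambda>p. ell2_fun (\<rho> p (word_class \<theta> u) (f p)) n) \<in> borel_measurable M" for n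
        unfolding rho_word by measurable
    qed
  qed
  have sq_rho: "sq_int M W (\<lambda>p. \<rho> p w (f p))" if w: "w \<in> carrier (F_theta \<theta>)" and f: "sq_int M W f" for w f
  proof -
    have isom: "norm (\<rho> p w v) = norm v" if "v \<in> ell2_on W" for p v
      using Q.isometric_rho[OF az, of p p] w that
      unfolding \<rho>_def isometric_representation_def isometry_on_def by blast
    have "measurable_section M H \<epsilon> f" using f unfolding sec sq_int_def by blast
    from rho_sec[OF w this] show ?thesis
      using f isom unfolding sq_int_def sec by (simp del: split_paired_All)
  qed
  have inter: "U (\<lambda>p. \<rho> p w (f p)) = rho a c w (U f)"
    if w: "w \<in> carrier (F_theta \<theta>)" and f: "sq_int M W f" for w f
  proof (rule ell2_eqI)
    from w obtain u where u: "w = word_class \<theta> u" unfolding carrier_F_theta by blast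
    let ?k = "nblue u" and ?l = "nred u"
    fix y
    show "ell2_fun (U (\<lambda>p. \<rho> p w (f p))) y = ell2_fun (rho a c w (U f)) y"
    proof (cases "y \<in> A \<and> matches u y")
      case True
      let ?y = "bwd ?k ?l y" and ?s = "- fst (d y)" and ?t = "- snd (d y)"
      have y: "y \<in> A" "?y \<in> A" using True by auto
      \<comment> \<open>Modulo \<open>K\<close>, the coordinates of the ancestor \<open>?y\<close>
        are those of \<open>y\<close> minus the degree of the word. The characters therefore differ
        almost everywhere by exactly the factor that the fibre constants contribute.\<close>
      have "(fst (d y) - int ?k - fst (d ?y), snd (d y) - int ?l - snd (d ?y)) \<in> K"
        unfolding K_def
        using degs_diff_periods[OF x0 y(2) degs_bwd[OF x0 y(1), of "fst (d y)" "snd (d y)" ?k ?l],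
            of "fst (d ?y)" "snd (d ?y)"] d[OF y(1)] d[OF y(2)] by simp
      then have "AE p in M. chi (- fst (d ?y)) (- snd (d ?y)) p = chi (?s + int ?k) (?t + int ?l) p"
        by (intro chi_cong) (simp add: algebra_simps)
      then have *: "AE p in M. chi (- fst (d ?y)) (- snd (d ?y)) p = chi ?s ?t p * (z\<^sub>1 p ^ ?k * z\<^sub>2 p ^ ?l)"
        by eventually_elim (simp only: chi_add chi_nat)
      have "B.coef (\<lambda>p. \<rho> p w (f p)) y
        = (\<integral>p. (a ^ ?k * c ^ ?l) * ((chi ?s ?t p * (z\<^sub>1 p ^ ?k * z\<^sub>2 p ^ ?l)) * ell2_fun (f p) (idx ?y)) \<partial>M)"
        unfolding B.coef_def cinnerF u rho_word using True
        by (intro Bochner_Integration.integral_cong HOL.refl)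
          (simp add: idxW matchesW bwdW power_mult_distrib mult_ac)
      also have "\<dots> = (a ^ ?k * c ^ ?l) * (\<integral>p. (chi ?s ?t p * (z\<^sub>1 p ^ ?k * z\<^sub>2 p ^ ?l)) * ell2_fun (f p) (idx ?y) \<partial>M)"
        by (rule integral_mult_right_zero)
      also have "(\<integral>p. (chi ?s ?t p * (z\<^sub>1 p ^ ?k * z\<^sub>2 p ^ ?l)) * ell2_fun (f p) (idx ?y) \<partial>M) = B.coef f ?y"
        unfolding B.coef_def cinnerF
        using * f
        by (intro integral_cong_AE borel_measurable_times borel_measurable_power)
          (auto simp: sq_int_def elim!: eventually_mono)
      finally show ?thesis
        using True y unfolding U[OF sq_rho[OF w f]] by (simp add: U[OF f] u ell2_fun_rho_word)
    next
      case False
      have "B.coef (\<lambda>p. \<rho> p w (f p)) y = 0" if "y \<in> A" "\<not> matches u y"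
        unfolding B.coef_def cinnerF u rho_word using that by (simp add: matchesW)
      then show ?thesis
        using False unfolding U[OF sq_rho[OF w f]] by (auto simp: u ell2_fun_rho_word)
    qed
  qed
  have di: "is_direct_integral \<theta> (ell2_on A) (rho a c) M H \<epsilon> \<rho>"
    unfolding is_direct_integral_def sqs
  proof (intro conjI exI[of _ U] ballI allI impI)
    show "measurable_field M H \<epsilon>" by (rule field)
    show "representation \<theta> (H p) (\<rho> p)" for p
      unfolding H_def \<rho>_def by (rule Q.representation_rho[OF az])
    show "measurable_section M H \<epsilon> (\<lambda>p. \<rho> p w (f p))"
      if "w \<in> carrier (F_theta \<theta>)" "measurable_section M H \<epsilon> f" for w f using that by (rule rho_sec)
    show "U (\<lambda>p. f p + g p) = U f + U g" if "f \<in> {f. sq_int M W f}" "g \<in> {f. sq_int M W f}" for f g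
      using that by (intro ell2_eqI) (simp add: U sq_int_add B.coef_add ell2_fun_add)
    show "U (\<lambda>p. s *\<^sub>C f p) = s *\<^sub>C U f" if "f \<in> {f. sq_int M W f}" for s f
      using that by (intro ell2_eqI) (simp add: U sq_int_scaleC B.coef_scaleC ell2_fun_scaleC)
    show "(norm (U f))\<^sup>2 = (\<integral>p. (norm (f p))\<^sup>2 \<partial>M)" if "f \<in> {f. sq_int M W f}" for f
    proof -
      have "(norm (U f))\<^sup>2 = (\<Sum>\<^sub>\<infinity>y\<in>A. (cmod (B.coef f y))\<^sup>2)"
        unfolding norm_ell2_square using that by (intro infsum_cong_neutral) (auto simp: U)
      then show ?thesis using B.Parseval that by simp
    qed
    show "U ` {f. sq_int M W f} = ell2_on A"
    proof (intro equalityI subsetI)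
      fix g assume "g \<in> U ` {f. sq_int M W f}"
      then show "g \<in> ell2_on A" by (auto simp: U ell2_on_def)
    next
      fix g assume g: "g \<in> ell2_on A"
      obtain f where f: "sq_int M W f" "\<And>y. y \<in> A \<Longrightarrow> B.coef f y = ell2_fun g y"
        by (rule B.Riesz_Fischer[OF ell2_summable[of g A]]) blast
      have "U f = g" by (rule ell2_eqI) (use f g in \<open>auto simp: U ell2_on_def\<close>)
      then show "g \<in> U ` {f. sq_int M W f}" using f(1) by blast
    qed
    show "U (\<lambda>p. \<rho> p w (f p)) = rho a c w (U f)"
      if "w \<in> carrier (F_theta \<theta>)" "f \<in> {f. sq_int M W f}" for w f
      using that inter by blast
  qed
  have irr: "irreducible_group_construction_dilation \<theta> (H p) (\<rho> p)" for p
  proof -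
    obtain G :: "(int \<times> int) set monoid" and g\<^sub>1 g\<^sub>2 i j \<alpha> \<beta> \<sigma> H' \<tau> where
      "group_construction_rep \<theta> G g\<^sub>1 g\<^sub>2 i j \<alpha> \<beta> \<sigma>"
      "unitarily_equivalent \<theta> (ell2_on (carrier G)) \<sigma> H' \<tau>" "adjointable \<theta> H' \<tau>"
      "minimal_star_dilation \<theta> H' \<tau> (ell2_on W) (Q.rho (a * z\<^sub>1 p) (c * z\<^sub>2 p))"
      "irreducible_rep \<theta> (ell2_on (carrier G)) \<sigma>"
      by (rule ex_group_construction[OF Q.full_system_axioms connW az[of p]]) (use sepW in blast)
    then have "group_construction_rep \<theta> G g\<^sub>1 g\<^sub>2 i j \<alpha> \<beta> \<sigma>"
      "is_minimal_star_dilation_of \<theta> (ell2_on W) (Q.rho (a * z\<^sub>1 p) (c * z\<^sub>2 p)) (ell2_on (carrier G)) \<sigma>"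
      "irreducible_rep \<theta> (ell2_on (carrier G)) \<sigma>"
      unfolding is_minimal_star_dilation_of_def by blast+
    moreover have "irreducible_rep \<theta> (ell2_on W) (Q.rho (a * z\<^sub>1 p) (c * z\<^sub>2 p))"
      by (rule Q.irreducible_rho[OF az connW sepW])
    ultimately show ?thesis
      unfolding irreducible_group_construction_dilation_def H_def \<rho>_def by blast
  qed
  have unit: "\<exists>e\<in>square_integrable_sections M H \<epsilon>. \<forall>p. norm (e p) = 1"
    unfolding sqs using F[OF x0] by (intro bexI[of _ "F x0"]) (auto simp: F_def norm_scaleC)
  \<comment> \<open>Otherwise every measurable set is null or conull, and every real function with
    integral 0 vanishes almost everywhere. For a pair in \<open>L\<close> outside \<open>K\<close>
    this applies to both parts of \<open>chi s t\<close>, which contradicts its modulus one.\<close>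
  have split: "\<exists>Z\<in>sets M. emeasure M Z \<noteq> 0 \<and> emeasure M (UNIV - Z) \<noteq> 0" if LK: "\<not> L \<subseteq> K"
  proof (rule ccontr)
    assume no: "\<not> ?thesis"
    obtain w where "w \<in> L" "w \<notin> K" using LK by blast
    moreover obtain s t where "w = (s, t)" by (cases w)
    ultimately have st: "(s, t) \<in> L" "(s, t) \<notin> K" by simp_all
    have int: "integrable M (chi s t)" by (rule integrable_const_bound[where B=1]) auto
    have int0: "(\<integral>p. chi s t p \<partial>M) = 0" using orth[OF st(1)] st(2) by (simp add: chi_def)
    have part: "AE p in M. g p = 0" if g: "integrable M g" "(\<integral>p. g p \<partial>M) = 0" for g :: "real \<times> real \<Rightarrow> real"
    proof -
      have [measurable]: "g \<in> borel_measurable M" using g(1) by (rule borel_measurable_integrable)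
      have half: "AE p in M. \<not> h p > 0" if h: "integrable M h" "(\<integral>p. h p \<partial>M) = 0" for h :: "real \<times> real \<Rightarrow> real"
      proof -
        have [measurable]: "h \<in> borel_measurable M" using h(1) by (rule borel_measurable_integrable)
        have Z: "{p \<in> space M. h p > 0} \<in> sets M" by measurable
        then have "{p. h p > 0} \<in> sets M" by (simp add: sp)
        then consider "emeasure M {p. h p > 0} = 0" | "emeasure M (UNIV - {p. h p > 0}) = 0"
          using no by blast
        then show ?thesis
        proof cases
          case 1
          then show ?thesis using Z by (subst AE_iff_measurable[of "{p. h p > 0}"]) (auto simp: sp)
        next
          case 2
          then have pos: "AE p in M. h p > 0"
            using Z by (subst AE_iff_measurable[of "UNIV - {p. h p > 0}"]) (auto simp: sp sets.compl_sets[of "{p. h p > 0}" M, unfolded sp])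
          then have "AE p in M. 0 \<le> h p" by eventually_elim simp
          then have "AE p in M. h p = 0" using integral_nonneg_eq_0_iff_AE[OF h(1)] h(2) by blast
          then show ?thesis by eventually_elim simp
        qed
      qed
      have "AE p in M. \<not> g p > 0" by (rule half[OF g])
      moreover have "AE p in M. \<not> - g p > 0" by (rule half) (use g in auto)
      ultimately show ?thesis by eventually_elim auto
    qed
    have "AE p in M. Re (chi s t p) = 0" "AE p in M. Im (chi s t p) = 0"
      using int int0 by (auto intro!: part simp: integral_Re integral_Im)
    then have "AE p in M. False"
    proof eventually_elim
      case (elim p)
      then have "chi s t p = 0" by (simp add: complex_eq_iff)
      then show ?case using norm_chi[of s t p] by simp
    qed
    then have "emeasure M (space M) = 0" by (simp add: AE_iff_measurable[of "space M"])
    then show False using M1 by simp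
  qed
  show ?thesis
    by (rule that[OF M di irr unit split]) (auto simp: K_def L_def)
qed

section \<open>Transport along unitaries\<close>

text \<open>The nearest point: the parallelogram identity makes a minimising sequence Cauchy.
  Existence has to be shown because \<open>orth_proj\<close> is a definite description.\<close>

lemma ex_orth_proj:
  assumes S: "hilbert_subspace S"
  shows "\<exists>y\<in>S. \<forall>z\<in>S. cinner z (x - y) = 0"
proof -
  have sub: "complex_vector.subspace S" and cl: "closed S" using S by (auto simp: hilbert_subspace_def)
  have S0: "0 \<in> S" using sub complex_vector.subspace_0 by blast
  define d where "d = (INF y\<in>S. (norm (x - y))\<^sup>2)"
  have bdd: "bdd_below ((\<lambda>y. (norm (x - y))\<^sup>2) ` S)" by (intro bdd_belowI[of _ 0]) auto
  have d: "d \<le> (norm (x - y))\<^sup>2" if "y \<in> S" for y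
    unfolding d_def using bdd that by (rule cINF_lower)
  have "\<exists>y\<in>S. (norm (x - y))\<^sup>2 < d + 1 / real (Suc n)" for n
  proof -
    have "(INF y\<in>S. (norm (x - y))\<^sup>2) < d + 1 / real (Suc n)" unfolding d_def by simp
    then show ?thesis using S0 bdd by (subst (asm) cINF_less_iff) auto
  qed
  then obtain f where f: "\<And>n. f n \<in> S" "\<And>n. (norm (x - f n))\<^sup>2 < d + 1 / real (Suc n)" by metis
  have par: "(norm (f n - f m))\<^sup>2 \<le> 2 * (1 / real (Suc n)) + 2 * (1 / real (Suc m))" for n m
  proof -
    have h: "(1/2) *\<^sub>C (f n + f m) \<in> S"
      using f(1) sub by (intro complex_vector.subspace_scale complex_vector.subspace_add)
    let ?a = "x - f n" and ?b = "x - f m"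
    have half: "(1/2) *\<^sub>C (?a + ?b) = x - (1/2) *\<^sub>C (f n + f m)"
    proof -
      have "(1/2) *\<^sub>C (x + x) = x"
        using scaleC_add_left[of "1/2" "1/2" x] by (simp add: scaleC_add_right scaleC_one)
      moreover have "?a + ?b = (x + x) - (f n + f m)" by simp
      ultimately show ?thesis by (simp only: complex_vector.scale_right_diff_distrib)
    qed
    have "4 * d \<le> 4 * (norm ((1/2) *\<^sub>C (?a + ?b)))\<^sup>2" using d[OF h] unfolding half by simp
    also have "\<dots> = (norm (?a + ?b))\<^sup>2" by (simp add: norm_scaleC power_mult_distrib power_divide)
    finally have "4 * d \<le> (norm ?a)\<^sup>2 + (norm ?b)\<^sup>2 + 2 * Re (cinner ?a ?b)" unfolding norm_add_square .
    moreover have "f n - f m = ?b - ?a" by simp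
    then have "(norm (f n - f m))\<^sup>2 = (norm ?b)\<^sup>2 + (norm ?a)\<^sup>2 - 2 * Re (cinner ?b ?a)"
      by (simp only: norm_diff_square)
    moreover have "Re (cinner ?b ?a) = Re (cinner ?a ?b)" by (subst cinner_commute) simp
    ultimately show ?thesis using f(2)[of n] f(2)[of m] by linarith
  qed
  have "Cauchy f"
  proof (rule metric_CauchyI)
    fix e :: real assume e: "e > 0"
    obtain N where N: "1 / real (Suc N) < e\<^sup>2 / 4"
      using nat_approx_posE[of "e\<^sup>2 / 4"] e by auto
    have "dist (f m) (f n) < e" if "m \<ge> N" "n \<ge> N" for m n
    proof -
      have "1 / real (Suc m) \<le> 1 / real (Suc N)" "1 / real (Suc n) \<le> 1 / real (Suc N)"
        using that by (auto intro!: divide_left_mono)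
      then have "(norm (f m - f n))\<^sup>2 < e\<^sup>2" using par[of m n] N by linarith
      then show ?thesis using e by (simp add: dist_norm power_less_imp_less_base)
    qed
    then show "\<exists>M. \<forall>m\<ge>M. \<forall>n\<ge>M. dist (f m) (f n) < e" by blast
  qed
  then obtain y where lim: "f \<longlonglongrightarrow> y" using Cauchy_convergent convergent_def by blast
  have y: "y \<in> S" using cl f(1) lim closed_sequentially by blast
  have "(norm (x - y))\<^sup>2 \<le> d"
  proof (rule LIMSEQ_le)
    show "(\<lambda>n. (norm (x - f n))\<^sup>2) \<longlonglongrightarrow> (norm (x - y))\<^sup>2" by (intro tendsto_intros lim)
    have "(\<lambda>n. d + inverse (real (Suc n))) \<longlonglongrightarrow> d + 0"
      by (intro tendsto_add tendsto_const LIMSEQ_inverse_real_of_nat)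
    then show "(\<lambda>n. d + 1 / real (Suc n)) \<longlonglongrightarrow> d" by (simp add: inverse_eq_divide del: of_nat_Suc)
    show "\<exists>N. \<forall>n\<ge>N. (norm (x - f n))\<^sup>2 \<le> d + 1 / real (Suc n)" using f(2) less_imp_le by blast
  qed
  have "cinner z (x - y) = 0" if z: "z \<in> S" for z
  proof (cases "z = 0")
    case False
    \<comment> \<open>The coefficient of \<open>x - y\<close> along \<open>z\<close>; moving
      \<open>y\<close> by \<open>t\<close> times \<open>z\<close> would come closer to
      \<open>x\<close> unless it is 0.\<close>
    define t where "t = cinner z (x - y) / (norm z)\<^sup>2"
    have "y + t *\<^sub>C z \<in> S"
      using y z sub by (intro complex_vector.subspace_add complex_vector.subspace_scale)
    from d[OF this] \<open>(norm (x - y))\<^sup>2 \<le> d\<close>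
    have "(norm (x - y))\<^sup>2 \<le> (norm ((x - y) - t *\<^sub>C z))\<^sup>2" unfolding diff_diff_eq by linarith
    then have le: "2 * Re (t * cinner (x - y) z) \<le> (cmod t * norm z)\<^sup>2"
      by (simp add: norm_diff_square norm_scaleC cinner_scaleC_right)
    have "t * cinner (x - y) z = complex_of_real ((cmod (cinner z (x - y)))\<^sup>2 / (norm z)\<^sup>2)"
      unfolding t_def cinner_commute[of "x - y" z] times_divide_eq_left complex_norm_square[symmetric] by simp
    moreover have "cmod t = cmod (cinner z (x - y)) / (norm z)\<^sup>2" by (simp add: t_def norm_divide norm_power)
    then have "(cmod t * norm z)\<^sup>2 = (cmod (cinner z (x - y)))\<^sup>2 / (norm z)\<^sup>2"
      using False by (simp add: power2_eq_square)
    ultimately have "2 * ((cmod (cinner z (x - y)))\<^sup>2 / (norm z)\<^sup>2) \<le> (cmod (cinner z (x - y)))\<^sup>2 / (norm z)\<^sup>2"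
      using le by simp
    then have "(cmod (cinner z (x - y)))\<^sup>2 / (norm z)\<^sup>2 \<le> 0" by linarith
    then show ?thesis using False by (simp add: divide_le_0_iff)
  qed simp
  then show ?thesis using y by blast
qed

lemma orth_proj_works:
  assumes "hilbert_subspace S"
  shows "orth_proj S x \<in> S" "z \<in> S \<Longrightarrow> cinner z (x - orth_proj S x) = 0"
proof -
  obtain y where y: "y \<in> S" "\<forall>z\<in>S. cinner z (x - y) = 0" using ex_orth_proj[OF assms] by blast
  have "orth_proj S x = y" by (rule orth_proj_eqI[OF assms y])
  then show "orth_proj S x \<in> S" "z \<in> S \<Longrightarrow> cinner z (x - orth_proj S x) = 0" using y by auto
qed

locale unitary_map =
  fixes S :: "'h::chilbert_space set" and S' :: "'k::chilbert_space set" and U :: "'h \<Rightarrow> 'k"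
  assumes S: "hilbert_subspace S" and lin: "linear_on_subspace S U"
    and iso: "\<forall>x\<in>S. norm (U x) = norm x" and onto: "U ` S = S'"
begin

abbreviation V :: "'k \<Rightarrow> 'h" where "V \<equiv> inv_into S U"

lemma sub: "complex_vector.subspace S" and clS: "closed S"
  using S by (auto simp: hilbert_subspace_def)

lemma U_add: "x \<in> S \<Longrightarrow> y \<in> S \<Longrightarrow> U (x + y) = U x + U y"
  and U_scale: "x \<in> S \<Longrightarrow> U (c *\<^sub>C x) = c *\<^sub>C U x"
  using lin by (auto simp: linear_on_subspace_def)

lemma U_diff: "x \<in> S \<Longrightarrow> y \<in> S \<Longrightarrow> U (x - y) = U x - U y"
  by (rule linear_on_subspace_diff[OF sub lin])

lemma U_zero: "U 0 = 0"
  by (rule linear_on_subspace_zero[OF sub lin])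

lemma U_sum: "(\<And>i. i \<in> F \<Longrightarrow> f i \<in> S) \<Longrightarrow> U (\<Sum>i\<in>F. f i) = (\<Sum>i\<in>F. U (f i))"
proof (induction F rule: infinite_finite_induct)
  case (insert i F)
  then have "(\<Sum>i\<in>F. f i) \<in> S" using sub by (intro complex_vector.subspace_sum) auto
  then show ?case using insert by (simp add: U_add)
qed (simp_all add: U_zero)

lemma cinner_U: "x \<in> S \<Longrightarrow> y \<in> S \<Longrightarrow> cinner (U x) (U y) = cinner x y"
  by (rule isometry_preserves_cinner[OF sub lin iso])

lemma inj: "inj_on U S"
  by (rule linear_isometry_inj_on[OF sub lin iso])

lemma V_U: "x \<in> S \<Longrightarrow> V (U x) = x"
  using inj by (rule inv_into_f_f)

lemma U_V: "y \<in> S' \<Longrightarrow> U (V y) = y" and V_in: "y \<in> S' \<Longrightarrow> V y \<in> S"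
  using onto by (auto intro: f_inv_into_f inv_into_into)

lemma U_in: "x \<in> S \<Longrightarrow> U x \<in> S'" using onto by blast

text \<open>If images under an isometry form a Cauchy sequence, so do their preimages; hence
  closedness is inherited.\<close>

lemma hilbert_subspace_image:
  assumes H: "hilbert_subspace H" "H \<subseteq> S" shows "hilbert_subspace (U ` H)"
proof -
  have subH: "complex_vector.subspace H" and clH: "closed H" using H by (auto simp: hilbert_subspace_def)
  have "complex_vector.subspace (U ` H)"
  proof (rule complex_vector.subspaceI)
    show "0 \<in> U ` H" using U_zero complex_vector.subspace_0[OF subH] by (metis imageI)
    fix x y c assume "x \<in> U ` H"
    then obtain x' where x: "x' \<in> H" "x = U x'" by blast
    show "c *\<^sub>C x \<in> U ` H"
      using x complex_vector.subspace_scale[OF subH x(1), of c] U_scale[OF subsetD[OF H(2) x(1)], of c]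
      by (metis imageI)
    assume "y \<in> U ` H"
    then obtain y' where y: "y' \<in> H" "y = U y'" by blast
    have "x + y = U (x' + y')"
      using x(2) y(2) U_add[OF subsetD[OF H(2) x(1)] subsetD[OF H(2) y(1)]] by simp
    then show "x + y \<in> U ` H" using complex_vector.subspace_add[OF subH x(1) y(1)] by blast
  qed
  moreover have "closed (U ` H)"
    unfolding closed_sequential_limits
  proof (intro allI impI)
    fix g l assume g: "(\<forall>n. g n \<in> U ` H) \<and> g \<longlonglongrightarrow> l"
    then have "\<forall>n. \<exists>h. h \<in> H \<and> g n = U h" by blast
    then obtain h where h: "\<And>n. h n \<in> H" "\<And>n. g n = U (h n)" by metis
    have dist: "dist (h m) x = dist (g m) (U x)" if "x \<in> H" for m x
    proof -
      have m: "h m \<in> S" and x: "x \<in> S" using h(1)[of m] that H(2) by auto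
      then have "h m - x \<in> S" using sub complex_vector.subspace_diff by blast
      then have "norm (U (h m - x)) = norm (h m - x)" using iso by blast
      then show ?thesis unfolding dist_norm h(2) U_diff[OF m x] by simp
    qed
    have gg: "dist (h m) (h n) = dist (g m) (g n)" for m n
      unfolding h(2)[of n] by (rule dist[OF h(1)])
    have "Cauchy g" by (rule LIMSEQ_imp_Cauchy[OF conjunct2[OF g]])
    then have "Cauchy h" unfolding Cauchy_def gg .
    then obtain x where x: "h \<longlonglongrightarrow> x" using Cauchy_convergent convergent_def by blast
    have xH: "x \<in> H" by (rule closed_sequentially[OF clH h(1) x])
    have "(\<lambda>n. dist (g n) (U x)) \<longlonglongrightarrow> 0"
      using tendsto_dist_iff[THEN iffD1, OF x] unfolding dist[OF xH] .
    then have "g \<longlonglongrightarrow> U x" by (rule tendsto_dist_iff[THEN iffD2])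
    then have "l = U x" by (rule LIMSEQ_unique[OF conjunct2[OF g]])
    then show "l \<in> U ` H" using xH by blast
  qed
  ultimately show ?thesis by (simp add: hilbert_subspace_def)
qed

lemma hilbert_subspace_S': "hilbert_subspace S'"
  using hilbert_subspace_image[OF S order_refl] onto by simp

lemma unitary_map_V: "unitary_map S' S V"
proof
  show "hilbert_subspace S'" by (rule hilbert_subspace_S')
  have sub': "complex_vector.subspace S'" using hilbert_subspace_S' by (simp add: hilbert_subspace_def)
  show "linear_on_subspace S' V"
    unfolding linear_on_subspace_def
  proof (intro conjI ballI allI)
    fix x y c assume x: "x \<in> S'"
    have "V (c *\<^sub>C U (V x)) = V (U (c *\<^sub>C V x))" using V_in[OF x] by (simp add: U_scale)
    also have "\<dots> = c *\<^sub>C V x" using V_in[OF x] sub by (intro V_U complex_vector.subspace_scale)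
    finally show "V (c *\<^sub>C x) = c *\<^sub>C V x" using U_V[OF x] by simp
    assume y: "y \<in> S'"
    have "V (U (V x) + U (V y)) = V (U (V x + V y))" using V_in x y by (simp add: U_add)
    also have "\<dots> = V x + V y" using V_in x y sub by (intro V_U complex_vector.subspace_add)
    finally show "V (x + y) = V x + V y" using U_V x y by simp
  qed
  show "\<forall>y\<in>S'. norm (V y) = norm y" using iso U_V V_in by metis
  show "V ` S' = S"
  proof (intro equalityI subsetI)
    fix x assume "x \<in> S"
    then show "x \<in> V ` S'" using V_U U_in by (metis imageI)
  qed (use V_in in blast)
qed

lemma closed_span_image:
  assumes "X \<subseteq> S" shows "U ` closed_span X \<subseteq> closed_span (U ` X)"
proof -
  interpret V: unitary_map S' S V by (rule unitary_map_V)
  have XS': "closed_span (U ` X) \<subseteq> S'"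
    by (rule closed_span_minimal[OF hilbert_subspace_S']) (use assms U_in in blast)
  have "hilbert_subspace (V ` closed_span (U ` X))"
    by (rule V.hilbert_subspace_image[OF hilbert_subspace_closed_span XS'])
  moreover have "X \<subseteq> V ` closed_span (U ` X)"
  proof
    fix x assume "x \<in> X"
    then have "U x \<in> closed_span (U ` X)" "x = V (U x)"
      using closed_span_superset[of "U ` X"] assms V_U by auto
    then show "x \<in> V ` closed_span (U ` X)" by blast
  qed
  ultimately have "closed_span X \<subseteq> V ` closed_span (U ` X)" by (rule closed_span_minimal)
  then have sub: "\<exists>z\<in>closed_span (U ` X). y = V z" if "y \<in> closed_span X" for y using that by blast
  show ?thesis
  proof (rule image_subsetI)
    fix y assume "y \<in> closed_span X"
    then obtain z where z: "z \<in> closed_span (U ` X)" "y = V z" using sub by blast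
    then have "U y = z" using U_V[of z] XS' by auto
    then show "U y \<in> closed_span (U ` X)" using z(1) by simp
  qed
qed

lemma adjoint_image:
  assumes H: "hilbert_subspace H" "H \<subseteq> S" and T: "\<And>x. x \<in> H \<Longrightarrow> T x \<in> H" "\<And>x. x \<in> H \<Longrightarrow> T' (U x) = U (T x)"
    and y: "y \<in> H" and ex: "\<exists>z\<in>H. \<forall>x\<in>H. cinner (T x) y = cinner x z"
  shows "adjoint_on (U ` H) T' (U y) = U (adjoint_on H T y)" "adjoint_on H T y \<in> H"
proof -
  obtain z where z: "z \<in> H" "\<forall>x\<in>H. cinner (T x) y = cinner x z" using ex by blast
  have a: "adjoint_on H T y = z" by (rule adjoint_on_eqI[OF H(1) z])
  then show "adjoint_on H T y \<in> H" using z by simp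
  show "adjoint_on (U ` H) T' (U y) = U (adjoint_on H T y)"
    unfolding a
  proof (rule adjoint_on_eqI[OF hilbert_subspace_image[OF H]])
    show "\<forall>x\<in>U ` H. cinner (T' x) (U y) = cinner x (U z)"
    proof
      fix x assume "x \<in> U ` H"
      then obtain h where h: "h \<in> H" "x = U h" by blast
      have "T h \<in> S" "y \<in> S" "h \<in> S" "z \<in> S" using h T(1) y z H(2) by auto
      then show "cinner (T' x) (U y) = cinner x (U z)" using h T(2) z(2) by (simp add: cinner_U)
    qed
  qed (use z in blast)
qed

end

text \<open>The dilated representation is conjugated onto the image of \<open>H\<close> in the
  target space, which may be of another type. Adjoints are given by descriptions, so defect freeness
  moves along \<open>U\<close> only once their existence is known; this is the purpose of
  \<open>adjointable\<close>.\<close>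

lemma minimal_star_dilation_transport:
  fixes \<theta> :: "'m::finite \<times> 'n::finite \<Rightarrow> 'm \<times> 'n"
  assumes U: "unitary_map S S' U"
    and inter: "\<And>w x. w \<in> carrier (F_theta \<theta>) \<Longrightarrow> x \<in> S \<Longrightarrow> U (\<sigma> w x) = \<sigma>' w (U x)"
    and star: "star_representation \<theta> S' \<sigma>'"
    and dil: "minimal_star_dilation \<theta> H \<tau> S \<sigma>" and adj: "adjointable \<theta> H \<tau>"
    and ue: "unitarily_equivalent \<theta> X \<tau>\<^sub>0 H \<tau>"
  shows "is_minimal_star_dilation_of \<theta> S' \<sigma>' X \<tau>\<^sub>0"
proof -
  interpret unitary_map S S' U by fact
  interpret V: unitary_map S' S V by (rule unitary_map_V)
  have repH: "representation \<theta> H \<tau>" and repS: "representation \<theta> S \<sigma>" and HS: "H \<subseteq> S"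
    and proj: "\<And>w x. w \<in> carrier (F_theta \<theta>) \<Longrightarrow> x \<in> H \<Longrightarrow> \<tau> w x = orth_proj H (\<sigma> w x)"
    and df: "defect_free \<theta> H \<tau>"
    and span: "S = closed_span (\<Union>w\<in>carrier (F_theta \<theta>). \<sigma> w ` H)"
    using dil unfolding minimal_star_dilation_def dilation_def by blast+
  have repS': "representation \<theta> S' \<sigma>'"
    using star unfolding star_representation_def isometric_representation_def by blast
  have H: "hilbert_subspace H" and pi: "\<And>w. w \<in> carrier (F_theta \<theta>) \<Longrightarrow> partial_isometry_on H (\<tau> w)"
    using repH unfolding representation_def by blast+
  have \<tau>H: "\<tau> w x \<in> H" if "w \<in> carrier (F_theta \<theta>)" "x \<in> H" for w x
    using pi[OF that(1)] that(2) unfolding partial_isometry_on_def bounded_operator_on_def by blast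
  define \<tau>' where "\<tau>' w y = U (\<tau> w (V y))" for w y
  have \<tau>': "\<tau>' w (U x) = U (\<tau> w x)" if "x \<in> H" for w x
    using that HS V_U by (auto simp: \<tau>'_def)
  have H': "hilbert_subspace (U ` H)" by (rule hilbert_subspace_image[OF H HS])
  have HS': "x \<in> S" if "x \<in> H" for x using that HS by blast
  have pi': "partial_isometry_on (U ` H) (\<tau>' w)" if w: "w \<in> carrier (F_theta \<theta>)" for w
    unfolding partial_isometry_on_def bounded_operator_on_def linear_on_subspace_def
  proof (intro conjI ballI allI impI)
    have lin\<tau>: "linear_on_subspace H (\<tau> w)" and bd: "\<exists>C. \<forall>x\<in>H. norm (\<tau> w x) \<le> C * norm x"
      and iso\<tau>: "\<And>x. x \<in> H \<Longrightarrow> \<forall>y\<in>H. \<tau> w y = 0 \<longrightarrow> cinner y x = 0 \<Longrightarrow> norm (\<tau> w x) = norm x"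
      using pi[OF w] unfolding partial_isometry_on_def bounded_operator_on_def by blast+
    have subH: "complex_vector.subspace H" using H by (simp add: hilbert_subspace_def)
    show "\<tau>' w ` U ` H \<subseteq> U ` H" using \<tau>H[OF w] \<tau>' by auto
    fix x assume "x \<in> U ` H"
    then obtain x' where x: "x' \<in> H" "x = U x'" by blast
    show "\<tau>' w (c *\<^sub>C x) = c *\<^sub>C \<tau>' w x" for c
    proof -
      have "c *\<^sub>C x' \<in> H" using subH x(1) complex_vector.subspace_scale by blast
      then have "\<tau>' w (U (c *\<^sub>C x')) = U (\<tau> w (c *\<^sub>C x'))" by (rule \<tau>')
      also have "\<tau> w (c *\<^sub>C x') = c *\<^sub>C \<tau> w x'" using lin\<tau> x(1) by (simp add: linear_on_subspace_def)
      finally show ?thesis unfolding x(2) \<tau>'[OF x(1)] U_scale[OF HS'[OF x(1)]] U_scale[OF HS'[OF \<tau>H[OF w x(1)]]] .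
    qed
    show "\<tau>' w (x + y) = \<tau>' w x + \<tau>' w y" if "y \<in> U ` H" for y
    proof -
      from that obtain y' where y: "y' \<in> H" "y = U y'" by blast
      have "x' + y' \<in> H" using subH x(1) y(1) complex_vector.subspace_add by blast
      then have "\<tau>' w (U (x' + y')) = U (\<tau> w (x' + y'))" by (rule \<tau>')
      also have "\<tau> w (x' + y') = \<tau> w x' + \<tau> w y'" using lin\<tau> x(1) y(1) by (simp add: linear_on_subspace_def)
      finally show ?thesis
        unfolding x(2) y(2) \<tau>'[OF x(1)] \<tau>'[OF y(1)] U_add[OF HS'[OF x(1)] HS'[OF y(1)]]
          U_add[OF HS'[OF \<tau>H[OF w x(1)]] HS'[OF \<tau>H[OF w y(1)]]] .
    qed
    show "norm (\<tau>' w x) = norm x" if k: "\<forall>y\<in>U ` H. \<tau>' w y = 0 \<longrightarrow> cinner y x = 0"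
    proof -
      have "norm (\<tau> w x') = norm x'"
      proof (rule iso\<tau>[OF x(1)], intro ballI impI)
        fix y assume y: "y \<in> H" "\<tau> w y = 0"
        then have "cinner (U y) x = 0" using k \<tau>'[OF y(1), of w] U_zero by auto
        then show "cinner y x' = 0" using x y HS' by (simp add: cinner_U)
      qed
      then show ?thesis using x \<tau>' HS' \<tau>H[OF w x(1)] iso by simp
    qed
  next
    obtain C where C: "\<forall>x\<in>H. norm (\<tau> w x) \<le> C * norm x"
      using pi[OF w] unfolding partial_isometry_on_def bounded_operator_on_def by blast
    show "\<exists>C. \<forall>x\<in>U ` H. norm (\<tau>' w x) \<le> C * norm x"
      by (rule exI[of _ C]) (use C \<tau>' HS' \<tau>H[OF w] iso in auto)
  qed
  have rep': "representation \<theta> (U ` H) \<tau>'"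
    unfolding representation_def
  proof (intro conjI ballI)
    show "hilbert_subspace (U ` H)" by (rule H')
    show "partial_isometry_on (U ` H) (\<tau>' w)" if "w \<in> carrier (F_theta \<theta>)" for w by (rule pi'[OF that])
    fix x assume "x \<in> U ` H"
    then obtain x' where x: "x' \<in> H" "x = U x'" by blast
    show "\<tau>' \<one>\<^bsub>F_theta \<theta>\<^esub> x = x"
      using repH x unfolding representation_def by (simp add: \<tau>')
    show "\<tau>' (v \<otimes>\<^bsub>F_theta \<theta>\<^esub> w) x = \<tau>' v (\<tau>' w x)"
      if "v \<in> carrier (F_theta \<theta>)" "w \<in> carrier (F_theta \<theta>)" for v w
      using repH x that unfolding representation_def by (simp add: \<tau>' \<tau>H)
  qed
  have dil': "dilation \<theta> (U ` H) \<tau>' S' \<sigma>'"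
    unfolding dilation_def
  proof (intro conjI ballI rep' repS')
    show "U ` H \<subseteq> S'" using HS onto by blast
    fix w x assume w: "w \<in> carrier (F_theta \<theta>)" and "x \<in> U ` H"
    then obtain x' where x: "x' \<in> H" "x = U x'" by blast
    have \<sigma>S: "\<sigma> w x' \<in> S"
      using repS w HS'[OF x(1)] unfolding representation_def partial_isometry_on_def bounded_operator_on_def by blast
    have "orth_proj (U ` H) (\<sigma>' w x) = U (\<tau> w x')"
    proof (rule orth_proj_eqI[OF H'])
      show "U (\<tau> w x') \<in> U ` H" using \<tau>H[OF w x(1)] by blast
      show "\<forall>z\<in>U ` H. cinner z (\<sigma>' w x - U (\<tau> w x')) = 0"
      proof
        fix z assume "z \<in> U ` H"
        then obtain z' where z: "z' \<in> H" "z = U z'" by blast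
        have "\<sigma>' w x - U (\<tau> w x') = U (\<sigma> w x' - \<tau> w x')"
          using x inter[OF w HS'[OF x(1)]] \<sigma>S HS'[OF \<tau>H[OF w x(1)]] by (simp add: U_diff)
        moreover have "\<sigma> w x' - \<tau> w x' \<in> S"
          using \<sigma>S HS'[OF \<tau>H[OF w x(1)]] sub complex_vector.subspace_diff by blast
        ultimately show "cinner z (\<sigma>' w x - U (\<tau> w x')) = 0"
          using z HS'[OF z(1)] orth_proj_works(2)[OF H z(1)] proj[OF w x(1)] by (simp add: cinner_U)
      qed
    qed
    then show "\<tau>' w x = orth_proj (U ` H) (\<sigma>' w x)" using x \<tau>' by simp
  qed
  have df': "defect_free \<theta> (U ` H) \<tau>'"
    unfolding defect_free_def
  proof (intro ballI)
    fix x assume "x \<in> U ` H"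
    then obtain x' where x: "x' \<in> H" "x = U x'" by blast
    have *: "adjoint_on (U ` H) (\<tau>' w) (U x') = U (adjoint_on H (\<tau> w) x')" "adjoint_on H (\<tau> w) x' \<in> H"
      if "w \<in> carrier (F_theta \<theta>)" for w
      using adjoint_image[of H "\<tau> w" "\<tau>' w", OF H HS \<tau>H[OF that] \<tau>' x(1)] adj that x(1)
      unfolding adjointable_def by blast+
    have **: "\<tau>' w (adjoint_on (U ` H) (\<tau>' w) x) = U (\<tau> w (adjoint_on H (\<tau> w) x'))"
      "\<tau> w (adjoint_on H (\<tau> w) x') \<in> S" if "w \<in> carrier (F_theta \<theta>)" for w
      using *[OF that] x \<tau>' \<tau>H[OF that] HS' by auto
    show "(\<Sum>i\<in>UNIV. \<tau>' (gen_e \<theta> i) (adjoint_on (U ` H) (\<tau>' (gen_e \<theta> i)) x)) = x \<and>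
      (\<Sum>j\<in>UNIV. \<tau>' (gen_f \<theta> j) (adjoint_on (U ` H) (\<tau>' (gen_f \<theta> j)) x)) = x"
      using df x unfolding defect_free_def by (simp add: **[unfolded x(2)] U_sum[symmetric])
  qed
  have "S' = closed_span (\<Union>w\<in>carrier (F_theta \<theta>). \<sigma>' w ` U ` H)" (is "_ = closed_span ?Y")
  proof
    let ?X = "\<Union>w\<in>carrier (F_theta \<theta>). \<sigma> w ` H"
    have XS: "?X \<subseteq> S" using closed_span_superset[of ?X] span by blast
    have "U ` ?X = ?Y" using inter HS' by (auto simp: image_UN image_image)
    then show "S' \<subseteq> closed_span ?Y" using closed_span_image[OF XS] onto span by metis
    have "?Y \<subseteq> S'"
    proof (intro UN_least image_subsetI)
      fix w x assume w: "w \<in> carrier (F_theta \<theta>)" and "x \<in> U ` H"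
      then have "x \<in> S'" using HS onto by blast
      moreover have "\<sigma>' w ` S' \<subseteq> S'"
        using repS' w unfolding representation_def partial_isometry_on_def bounded_operator_on_def by simp
      ultimately show "\<sigma>' w x \<in> S'" by blast
    qed
    then show "closed_span ?Y \<subseteq> S'" by (rule closed_span_minimal[OF hilbert_subspace_S'])
  qed
  then have "minimal_star_dilation \<theta> (U ` H) \<tau>' S' \<sigma>'"
    unfolding minimal_star_dilation_def using dil' df' star by blast
  moreover have "unitarily_equivalent \<theta> X \<tau>\<^sub>0 (U ` H) \<tau>'"
  proof -
    obtain W where W: "linear_on_subspace X W" "\<forall>x\<in>X. norm (W x) = norm x" "W ` X = H"
      "\<forall>w\<in>carrier (F_theta \<theta>). \<forall>x\<in>X. W (\<tau>\<^sub>0 w x) = \<tau> w (W x)"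
      using ue unfolding unitarily_equivalent_def by blast
    have WH: "W x \<in> H" if "x \<in> X" for x using W(3) that by blast
    show ?thesis
      unfolding unitarily_equivalent_def
    proof (intro exI[of _ "U \<circ> W"] conjI ballI)
      show "linear_on_subspace X (U \<circ> W)"
        using W(1) WH HS' unfolding linear_on_subspace_def by (simp add: U_add U_scale)
      show "norm ((U \<circ> W) x) = norm x" if "x \<in> X" for x using that W(2) WH HS' iso by simp
      show "(U \<circ> W) ` X = U ` H" unfolding image_comp[symmetric] W(3) ..
      show "(U \<circ> W) (\<tau>\<^sub>0 w x) = \<tau>' w ((U \<circ> W) x)" if "w \<in> carrier (F_theta \<theta>)" "x \<in> X" for w x
        using that W(4) WH \<tau>' by simp
    qed
  qed
  ultimately show ?thesis unfolding is_minimal_star_dilation_of_def by blast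
qed

text \<open>The image of a reducing subspace is reducing. Adjoints exist on the source by
  \<open>adjointable\<close>, and uniqueness fixes them on the target.\<close>

lemma irreducible_transport:
  assumes U: "unitary_map S S' U"
    and inter: "\<And>w x. w \<in> carrier (F_theta \<theta>) \<Longrightarrow> x \<in> S \<Longrightarrow> U (\<sigma> w x) = \<sigma>' w (U x)"
    and \<sigma>S: "\<And>w x. w \<in> carrier (F_theta \<theta>) \<Longrightarrow> x \<in> S \<Longrightarrow> \<sigma> w x \<in> S"
    and adj: "adjointable \<theta> S \<sigma>" and irr: "irreducible_rep \<theta> S' \<sigma>'"
  shows "irreducible_rep \<theta> S \<sigma>"
  unfolding irreducible_rep_def
proof (intro allI impI)
  interpret unitary_map S S' U by fact
  fix N assume red: "reducing \<theta> S \<sigma> N"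
  then have N: "hilbert_subspace N" "N \<subseteq> S"
    and inv: "\<And>w x. w \<in> carrier (F_theta \<theta>) \<Longrightarrow> x \<in> N \<Longrightarrow> \<sigma> w x \<in> N"
      "\<And>w x. w \<in> carrier (F_theta \<theta>) \<Longrightarrow> x \<in> N \<Longrightarrow> adjoint_on S (\<sigma> w) x \<in> N"
    unfolding reducing_def by blast+
  have "reducing \<theta> S' \<sigma>' (U ` N)"
    unfolding reducing_def
  proof (intro conjI ballI)
    show "hilbert_subspace (U ` N)" by (rule hilbert_subspace_image[OF N])
    show "U ` N \<subseteq> S'" using N onto by blast
    fix w assume w: "w \<in> carrier (F_theta \<theta>)"
    show "\<sigma>' w ` U ` N \<subseteq> U ` N"
    proof (intro image_subsetI)
      fix y assume "y \<in> U ` N"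
      then obtain x where "x \<in> N" "y = U x" by blast
      then show "\<sigma>' w y \<in> U ` N" using inter[OF w, of x] inv(1)[OF w] N by force
    qed
    show "adjoint_on S' (\<sigma>' w) ` U ` N \<subseteq> U ` N"
    proof (intro image_subsetI)
      fix y assume "y \<in> U ` N"
      then obtain x where x: "x \<in> N" "y = U x" by blast
      have "adjoint_on (U ` S) (\<sigma>' w) (U x) = U (adjoint_on S (\<sigma> w) x)"
        using x N w adj unfolding adjointable_def
        by (intro adjoint_image(1)[of S "\<sigma> w" "\<sigma>' w", OF S order_refl \<sigma>S[OF w] inter[OF w, symmetric]]) auto
      then show "adjoint_on S' (\<sigma>' w) y \<in> U ` N" using x inv(2)[OF w x(1)] onto by auto
    qed
  qed
  then have "U ` N = {0} \<or> U ` N = S'" using irr unfolding irreducible_rep_def by blast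
  then show "N = {0} \<or> N = S"
  proof
    assume "U ` N = {0}"
    then have "x = 0" if "x \<in> N" for x
      using that iso[rule_format, OF subsetD[OF N(2) that]] imageI[OF that, of U] by simp
    moreover have "0 \<in> N" using N complex_vector.subspace_0 unfolding hilbert_subspace_def by blast
    ultimately show ?thesis by blast
  next
    assume "U ` N = S'"
    then show ?thesis using inj_on_image_eq_iff[OF inj N(2) order_refl] onto by simp
  qed
qed

lemma adjointable_transport:
  assumes U: "unitary_map S S' U"
    and inter: "\<And>w x. w \<in> carrier (F_theta \<theta>) \<Longrightarrow> x \<in> S \<Longrightarrow> U (\<sigma> w x) = \<sigma>' w (U x)"
    and \<sigma>S: "\<And>w x. w \<in> carrier (F_theta \<theta>) \<Longrightarrow> x \<in> S \<Longrightarrow> \<sigma> w x \<in> S"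
    and adj: "adjointable \<theta> S' \<sigma>'"
  shows "adjointable \<theta> S \<sigma>"
  unfolding adjointable_def
proof (intro ballI)
  interpret unitary_map S S' U by fact
  fix w y assume w: "w \<in> carrier (F_theta \<theta>)" and y: "y \<in> S"
  obtain z where z: "z \<in> S'" "\<forall>x\<in>S'. cinner (\<sigma>' w x) (U y) = cinner x z"
    using adj w U_in[OF y] unfolding adjointable_def by blast
  have "cinner (\<sigma> w x) y = cinner x (V z)" if x: "x \<in> S" for x
  proof -
    have "cinner (\<sigma> w x) y = cinner (\<sigma>' w (U x)) (U y)"
      using cinner_U[OF \<sigma>S[OF w x] y] inter[OF w x] by simp
    also have "\<dots> = cinner (U x) (U (V z))" using z U_in[OF x] U_V[OF z(1)] by simp
    also have "\<dots> = cinner x (V z)" by (rule cinner_U[OF x V_in[OF z(1)]])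
    finally show ?thesis .
  qed
  then show "\<exists>z\<in>S. \<forall>x\<in>S. cinner (\<sigma> w x) y = cinner x z" using V_in[OF z(1)] by blast
qed

lemma representation_closed:
  "representation \<theta> S \<sigma> \<Longrightarrow> w \<in> carrier (F_theta \<theta>) \<Longrightarrow> x \<in> S \<Longrightarrow> \<sigma> w x \<in> S"
  unfolding representation_def partial_isometry_on_def bounded_operator_on_def by blast

section \<open>Removing the scalars\<close>

lemma ex_unit_root:
  assumes "cmod u = 1" "n > 0"
  obtains z where "cmod z = 1" "z ^ n = u"
proof
  have "u \<noteq> 0" using assms(1) by auto
  have "cis (Arg u / n) ^ n = cis (real n * (Arg u / n))" by (rule Complex.DeMoivre)
  also have "real n * (Arg u / n) = Arg u" using assms(2) by simp
  also have "cis (Arg u) = u" using cis_Arg[OF \<open>u \<noteq> 0\<close>] assms(1) by (simp add: sgn_eq)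
  finally show "cis (Arg u / n) ^ n = u" .
qed simp

lemma skew_pow:
  fixes a :: complex
  shows "((\<lambda>(y, z). (f y, z * a / \<alpha> y)) ^^ k) (y, z) = ((f ^^ k) y, z * a ^ k / (\<Prod>i<k. \<alpha> ((f ^^ i) y)))"
  by (induction k) (simp_all add: mult_ac)

context pred_system
begin

text \<open>The product of the scalars on the path from \<open>bwd k l y\<close> to
  \<open>y\<close>, in the order of \<open>bwd\<close>: the red steps back from \<open>y\<close>,
  then the blue ones. \<open>\<alpha> x\<close> and \<open>\<beta> x\<close> belong to the edges
  entering \<open>x\<close>.\<close>

definition weight :: "('w \<Rightarrow> complex) \<Rightarrow> ('w \<Rightarrow> complex) \<Rightarrow> nat \<Rightarrow> nat \<Rightarrow> 'w \<Rightarrow> complex" where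
  "weight \<alpha> \<beta> k l y = (\<Prod>i<l. \<beta> ((r ^^ i) y)) * (\<Prod>i<k. \<alpha> ((b ^^ i) ((r ^^ l) y)))"

context
  fixes \<alpha> \<beta> :: "'w \<Rightarrow> complex"
  assumes \<alpha>: "\<And>x. x \<in> A \<Longrightarrow> cmod (\<alpha> x) = 1" and \<beta>: "\<And>x. x \<in> A \<Longrightarrow> cmod (\<beta> x) = 1"
    and comm: "\<And>x. x \<in> A \<Longrightarrow> \<alpha> x * \<beta> (b x) = \<beta> x * \<alpha> (r x)"
begin

lemma cmod_weight: "y \<in> A \<Longrightarrow> cmod (weight \<alpha> \<beta> k l y) = 1"
  unfolding weight_def norm_mult prod_norm[symmetric] by (simp add: \<alpha> \<beta>)

text \<open>
  The skew product with the circle turns the scalars into part of the graph, so that the results on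
  periods apply to them.
\<close>

lemma pred_system_skew:
  assumes a: "cmod a = 1" and c: "cmod c = 1"
  shows "pred_system \<theta> (A \<times> {z. cmod z = 1}) (\<lambda>(y, z). (b y, z * a / \<alpha> y))
    (\<lambda>(y, z). (r y, z * c / \<beta> y)) (I \<circ> fst) (J \<circ> fst)"
proof
  have a0: "a \<noteq> 0" "c \<noteq> 0" using a c by auto
  have n0: "\<alpha> y \<noteq> 0" "\<beta> y \<noteq> 0" if "y \<in> A" for y using \<alpha>[OF that] \<beta>[OF that] by auto
  show "bij \<theta>" by (rule bij_theta)
  fix x assume "x \<in> A \<times> {z. cmod z = 1}"
  then obtain y z where x: "x = (y, z)" "y \<in> A" "cmod z = 1" by blast
  show "(case x of (y, z) \<Rightarrow> (b y, z * a / \<alpha> y)) \<in> A \<times> {z. cmod z = 1}"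
    "(case x of (y, z) \<Rightarrow> (r y, z * c / \<beta> y)) \<in> A \<times> {z. cmod z = 1}"
    using x a c by (simp_all add: norm_mult norm_divide \<alpha> \<beta>)
  show "(case case x of (y, z) \<Rightarrow> (r y, z * c / \<beta> y) of (y, z) \<Rightarrow> (b y, z * a / \<alpha> y))
      = (case case x of (y, z) \<Rightarrow> (b y, z * a / \<alpha> y) of (y, z) \<Rightarrow> (r y, z * c / \<beta> y))"
    using x comm[of y] n0[of y] n0[of "b y"] n0[of "r y"] by (simp add: b_r field_simps)
  show "\<theta> ((I \<circ> fst) x, (J \<circ> fst) (case x of (y, z) \<Rightarrow> (b y, z * a / \<alpha> y)))
      = ((I \<circ> fst) (case x of (y, z) \<Rightarrow> (r y, z * c / \<beta> y)), (J \<circ> fst) x)"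
    using x square[of y] by simp
  fix x' assume "x' \<in> A \<times> {z. cmod z = 1}"
  then obtain y' z' where x': "x' = (y', z')" "y' \<in> A" "cmod z' = 1" by blast
  show "x = x'" if "(case x of (y, z) \<Rightarrow> (b y, z * a / \<alpha> y)) = (case x' of (y, z) \<Rightarrow> (b y, z * a / \<alpha> y))"
    "(I \<circ> fst) x = (I \<circ> fst) x'"
  proof -
    have e: "b y = b y'" "I y = I y'" "z * a / \<alpha> y = z' * a / \<alpha> y'" using that x x' by simp_all
    have "y = y'" using b_inj[OF x(2) x'(2) e(1,2)] .
    then show ?thesis using e(3) x(1) x'(1) a0 n0[OF x'(2)] by simp
  qed
  show "x = x'" if "(case x of (y, z) \<Rightarrow> (r y, z * c / \<beta> y)) = (case x' of (y, z) \<Rightarrow> (r y, z * c / \<beta> y))"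
    "(J \<circ> fst) x = (J \<circ> fst) x'"
  proof -
    have e: "r y = r y'" "J y = J y'" "z * c / \<beta> y = z' * c / \<beta> y'" using that x x' by simp_all
    have "y = y'" using r_inj[OF x(2) x'(2) e(1,2)] .
    then show ?thesis using e(3) x(1) x'(1) a0 n0[OF x'(2)] by simp
  qed
qed

lemma bwd_skew:
  assumes "cmod a = 1" "cmod c = 1"
  shows "pred_system.bwd (\<lambda>(y, z). (b y, z * a / \<alpha> y)) (\<lambda>(y, z). (r y, z * c / \<beta> y)) k l (y, z)
    = (bwd k l y, z * (a ^ k * c ^ l / weight \<alpha> \<beta> k l y))"
proof -
  interpret S: pred_system \<theta> "A \<times> {z. cmod z = 1}" "\<lambda>(y, z). (b y, z * a / \<alpha> y)"
    "\<lambda>(y, z). (r y, z * c / \<beta> y)" "I \<circ> fst" "J \<circ> fst" by (rule pred_system_skew[OF assms])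
  show ?thesis by (simp add: S.bwd_def bwd_def skew_pow weight_def mult_ac)
qed

text \<open>A period lifts to the skew product when the corresponding ratio of weights is the
  matching product of powers of \<open>a\<close> and \<open>c\<close>. Two generators suffice, and
  the triangular Hermite form lets \<open>a\<close> be found first and \<open>c\<close> afterwards,
  as roots of unimodular numbers.\<close>

lemma ex_gauge_constants:
  assumes x: "x \<in> A"
  obtains a c where "cmod a = 1" "cmod c = 1"
    "periods x \<subseteq> pred_system.periods (\<lambda>(y, z). (b y, z * a / \<alpha> y)) (\<lambda>(y, z). (r y, z * c / \<beta> y)) (x, 1)"
proof -
  have w0: "weight \<alpha> \<beta> k l x \<noteq> 0" for k l using cmod_weight[OF x, of k l] by auto
  obtain p q s where p0: "p \<ge> 0" and s0: "s \<ge> 0" and sq: "s = 0 \<Longrightarrow> q = 0"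
    and hnf: "\<And>t t'. (t, t') \<in> periods x \<longleftrightarrow> (\<exists>i j. t = i * p + j * q \<and> t' = j * s)"
    by (rule add_subgroup_int_pairs[OF add_subgroup_periods[OF x]], rule that) simp_all
  have "(p, 0) \<in> periods x" unfolding hnf by (rule exI[of _ 1], rule exI[of _ 0]) simp
  then obtain k l k' l' where k: "bwd k l x = bwd k' l' x" "int k' - int k = p" "int l' - int l = 0"
    unfolding periods_def by auto
  have "(q, s) \<in> periods x" unfolding hnf by (rule exI[of _ 0], rule exI[of _ 1]) simp
  then obtain m n m' n' where m: "bwd m n x = bwd m' n' x" "int m' - int m = q" "int n' - int n = s"
    unfolding periods_def by auto
  have kk: "k' = k + nat p" "l' = l" "n' = n + nat s" using k m p0 s0 by auto
  obtain a where a: "cmod a = 1" "p > 0 \<Longrightarrow> a ^ nat p = weight \<alpha> \<beta> k' l' x / weight \<alpha> \<beta> k l x"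
  proof (cases "p > 0")
    case True
    then show thesis
      using ex_unit_root[of "weight \<alpha> \<beta> k' l' x / weight \<alpha> \<beta> k l x" "nat p"] that cmod_weight[OF x]
      by (auto simp: norm_divide)
  qed (use that[of 1] in simp)
  \<comment> \<open>The constant \<open>a\<close> is already fixed. Since \<open>q\<close> may be
    negative, its power is split into \<open>a ^ m\<close> and \<open>a ^ m'\<close>.\<close>
  obtain c where c: "cmod c = 1"
    "s > 0 \<Longrightarrow> c ^ nat s = a ^ m * weight \<alpha> \<beta> m' n' x / (a ^ m' * weight \<alpha> \<beta> m n x)"
  proof (cases "s > 0")
    case True
    then show thesis
      using ex_unit_root[of "a ^ m * weight \<alpha> \<beta> m' n' x / (a ^ m' * weight \<alpha> \<beta> m n x)" "nat s"]
        that cmod_weight[OF x] a(1)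
      by (auto simp: norm_divide norm_mult norm_power)
  qed (use that[of 1] in simp)
  have a0: "a \<noteq> 0" "c \<noteq> 0" using a c by auto
  interpret S: pred_system \<theta> "A \<times> {z. cmod z = 1}" "\<lambda>(y, z). (b y, z * a / \<alpha> y)"
    "\<lambda>(y, z). (r y, z * c / \<beta> y)" "I \<circ> fst" "J \<circ> fst" by (rule pred_system_skew[OF a(1) c(1)])
  have P: "add_subgroup (S.periods (x, 1))" by (rule S.add_subgroup_periods) (simp add: x)
  have p: "(p, 0) \<in> S.periods (x, 1)"
  proof (cases "p > 0")
    case True
    have "S.bwd k l (x, 1) = S.bwd k' l' (x, 1)"
      unfolding bwd_skew[OF a(1) c(1)] using k(1) a(2)[OF True] w0[of k l] w0[of k' l'] a0
      by (simp add: kk power_add field_simps)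
    from S.periodsI[OF this] show ?thesis using k by simp
  next
    case False
    then have "p = 0" using p0 by simp
    then show ?thesis using add_subgroup_0[OF P] by (simp add: zero_prod_def)
  qed
  have q: "(q, s) \<in> S.periods (x, 1)"
  proof (cases "s > 0")
    case True
    have "S.bwd m n (x, 1) = S.bwd m' n' (x, 1)"
      unfolding bwd_skew[OF a(1) c(1)] using m(1) c(2)[OF True] w0[of m n] w0[of m' n'] a0
      by (simp add: kk power_add field_simps)
    from S.periodsI[OF this] show ?thesis using m by simp
  next
    case False
    then have "s = 0" "q = 0" using s0 sq by auto
    then show ?thesis using add_subgroup_0[OF P] by (simp add: zero_prod_def)
  qed
  have "periods x \<subseteq> S.periods (x, 1)"
  proof
    fix v assume "v \<in> periods x"
    moreover obtain t t' where v: "v = (t, t')" by fastforce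
    ultimately obtain i j where ij: "t = i * p + j * q" "t' = j * s" unfolding v hnf by blast
    have "(i * p, i * 0) + (j * q, j * s) \<in> S.periods (x, 1)"
      by (rule add_subgroup_add[OF P add_subgroup_scale[OF P p] add_subgroup_scale[OF P q]])
    then show "v \<in> S.periods (x, 1)" by (simp add: v ij)
  qed
  then show thesis using that a(1) c(1) by blast
qed

text \<open>The component of \<open>(x0, 1)\<close> in the skew product meets the fibre over each
  vertex in exactly one point: at least one by connectedness, at most one because the periods of
  \<open>x0\<close> lift. These points define \<open>\<psi>\<close>, and invariance of the component
  under backward steps is the gauge equation.\<close>

lemma ex_gauge:
  assumes conn: connected
  obtains a c \<psi> where "cmod a = 1" "cmod c = 1" "\<And>x. x \<in> A \<Longrightarrow> cmod (\<psi> x) = 1"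
    "\<And>x. x \<in> A \<Longrightarrow> \<alpha> x * \<psi> (b x) = a * \<psi> x" "\<And>x. x \<in> A \<Longrightarrow> \<beta> x * \<psi> (r x) = c * \<psi> x"
proof -
  obtain x0 where x0: "x0 \<in> A" using conn unfolding connected_def by blast
  obtain a c where a: "cmod a = 1" and c: "cmod c = 1" and per:
    "periods x0 \<subseteq> pred_system.periods (\<lambda>(y, z). (b y, z * a / \<alpha> y)) (\<lambda>(y, z). (r y, z * c / \<beta> y)) (x0, 1)"
    by (rule ex_gauge_constants[OF x0])
  interpret S: pred_system \<theta> "A \<times> {z. cmod z = 1}" "\<lambda>(y, z). (b y, z * a / \<alpha> y)"
    "\<lambda>(y, z). (r y, z * c / \<beta> y)" "I \<circ> fst" "J \<circ> fst" by (rule pred_system_skew[OF a c])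
  note Sbwd = bwd_skew[OF a c]
  have a0: "a \<noteq> 0" "c \<noteq> 0" using a c by auto
  have w0: "weight \<alpha> \<beta> k l y \<noteq> 0" if "y \<in> A" for k l y using cmod_weight[OF that, of k l] by auto
  let ?X = "(x0, 1 :: complex)"
  have X: "?X \<in> A \<times> {z. cmod z = 1}" using x0 by simp
  define R where "R y z \<longleftrightarrow> (\<exists>k l k' l'. S.bwd k l (y, z) = S.bwd k' l' ?X)" for y z
  have ex: "\<exists>z. cmod z = 1 \<and> R y z" if y: "y \<in> A" for y
  proof -
    obtain k l k' l' where k: "bwd k l y = bwd k' l' x0" using conn y x0 unfolding connected_def by blast
    let ?t = "a ^ k * c ^ l / weight \<alpha> \<beta> k l y" and ?t' = "a ^ k' * c ^ l' / weight \<alpha> \<beta> k' l' x0"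
    have "?t \<noteq> 0" using w0[OF y] a0 by simp
    then have "S.bwd k l (y, ?t' / ?t) = S.bwd k' l' ?X" unfolding Sbwd k by simp
    then have "R y (?t' / ?t)" unfolding R_def by blast
    moreover have "cmod (?t' / ?t) = 1"
      using a c by (simp add: norm_divide norm_mult norm_power cmod_weight[OF y] cmod_weight[OF x0])
    ultimately show ?thesis by blast
  qed
  \<comment> \<open>Two points over \<open>y\<close> produce a period of \<open>x0\<close>. As it
    lifts, the points have a common ancestor at the same degree, and on the way there both circle
    coordinates are multiplied by the same nonzero factor.\<close>
  have uniq: "z = z'" if y: "y \<in> A" and z: "cmod z = 1" "cmod z' = 1" and R: "R y z" "R y z'" for y z z'
  proof -
    have yz: "(y, z) \<in> A \<times> {z. cmod z = 1}" "(y, z') \<in> A \<times> {z. cmod z = 1}" using y z by auto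
    obtain k l k' l' where k: "S.bwd k l (y, z) = S.bwd k' l' ?X" using R(1) unfolding R_def by blast
    obtain m n m' n' where m: "S.bwd m n (y, z') = S.bwd m' n' ?X" using R(2) unfolding R_def by blast
    have 1: "S.bwd (k + m) (l + n) (y, z) = S.bwd (k' + m) (l' + n) ?X"
      by (rule S.bwd_shift[OF yz(1) k X])
    have 2: "S.bwd (m + k) (n + l) (y, z') = S.bwd (m' + k) (n' + l) ?X"
      by (rule S.bwd_shift[OF yz(2) m X])
    have "bwd (k' + m) (l' + n) x0 = bwd (m' + k) (n' + l) x0"
      using 1 2 unfolding Sbwd by (simp add: add.commute)
    from periodsI[OF this] have "(int (m' + k) - int (k' + m), int (n' + l) - int (l' + n)) \<in> S.periods ?X"
      using per by blast
    then obtain N where N: "\<And>i j i' j'. N \<le> i \<Longrightarrow> N \<le> j \<Longrightarrow> N \<le> i' \<Longrightarrow> N \<le> j'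
        \<Longrightarrow> int i' - int i = int (m' + k) - int (k' + m) \<Longrightarrow> int j' - int j = int (n' + l) - int (l' + n)
        \<Longrightarrow> S.bwd i j ?X = S.bwd i' j' ?X"
      by (rule S.periods_far[OF X]) (rule that, blast)
    have "S.bwd (k' + m + N) (l' + n + N) ?X = S.bwd (m' + k + N) (n' + l + N) ?X"
      by (rule N) auto
    moreover have "S.bwd (k + m + N) (l + n + N) (y, z) = S.bwd (k' + m + N) (l' + n + N) ?X"
      by (rule S.bwd_shift[OF yz(1) 1 X])
    moreover have "S.bwd (m + k + N) (n + l + N) (y, z') = S.bwd (m' + k + N) (n' + l + N) ?X"
      by (rule S.bwd_shift[OF yz(2) 2 X])
    ultimately have "S.bwd (k + m + N) (l + n + N) (y, z) = S.bwd (k + m + N) (l + n + N) (y, z')"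
      by (simp add: add.commute[of m k] add.commute[of n l])
    then show "z = z'" unfolding Sbwd using w0[OF y] a0 by simp
  qed
  define \<psi> where "\<psi> y = (SOME z. cmod z = 1 \<and> R y z)" for y
  have \<psi>: "cmod (\<psi> y) = 1" "R y (\<psi> y)" if "y \<in> A" for y
    using someI_ex[OF ex[OF that]] unfolding \<psi>_def by auto
  have \<psi>_eq: "\<psi> y = z" if "y \<in> A" "cmod z = 1" "R y z" for y z
    using uniq[OF that(1) \<psi>(1)[OF that(1)] that(2) \<psi>(2)[OF that(1)] that(3)] .
  show thesis
  proof
    show "cmod a = 1" "cmod c = 1" by fact+
    fix y assume y: "y \<in> A"
    show "cmod (\<psi> y) = 1" by (rule \<psi>(1)[OF y])
    have yz: "(y, \<psi> y) \<in> A \<times> {z. cmod z = 1}" using \<psi>[OF y] y by simp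
    obtain k l k' l' where k: "S.bwd k l (y, \<psi> y) = S.bwd k' l' ?X" using \<psi>(2)[OF y] unfolding R_def by blast
    have n0: "\<alpha> y \<noteq> 0" "\<beta> y \<noteq> 0" using \<alpha>[OF y] \<beta>[OF y] by auto
    have "S.bwd k l (b y, \<psi> y * a / \<alpha> y) = S.bwd (k' + 1) (l' + 0) ?X"
      using S.bwd_b[OF yz, of k l] S.bwd_shift[OF yz k X, of 1 0] by simp
    then have "R (b y) (\<psi> y * a / \<alpha> y)" unfolding R_def by blast
    then have "\<psi> (b y) = \<psi> y * a / \<alpha> y"
      by (intro \<psi>_eq) (simp_all add: y norm_divide norm_mult \<alpha> \<psi>(1) a)
    then show "\<alpha> y * \<psi> (b y) = a * \<psi> y" using n0 by simp
    have "S.bwd k l (r y, \<psi> y * c / \<beta> y) = S.bwd (k' + 0) (l' + 1) ?X"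
      using S.bwd_r[OF yz, of k l] S.bwd_shift[OF yz k X, of 0 1] by simp
    then have "R (r y) (\<psi> y * c / \<beta> y)" unfolding R_def by blast
    then have "\<psi> (r y) = \<psi> y * c / \<beta> y"
      by (intro \<psi>_eq) (simp_all add: y norm_divide norm_mult \<beta> \<psi>(1) c)
    then show "\<beta> y * \<psi> (r y) = c * \<psi> y" using n0 by simp
  qed
qed

end

end

section \<open>Direct integrals\<close>

lemma is_direct_integral_transport:
  assumes U: "unitary_map S S' U"
    and inter: "\<And>w x. w \<in> carrier (F_theta \<theta>) \<Longrightarrow> x \<in> S \<Longrightarrow> U (\<sigma> w x) = \<sigma>' w (U x)"
    and di: "is_direct_integral \<theta> S \<sigma> M H \<epsilon> \<rho>"
  shows "is_direct_integral \<theta> S' \<sigma>' M H \<epsilon> \<rho>"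
proof -
  interpret unitary_map S S' U by fact
  let ?Q = "square_integrable_sections M H \<epsilon>"
  have m: "measurable_field M H \<epsilon>" "\<forall>x\<in>space M. representation \<theta> (H x) (\<rho> x)"
    "\<forall>w\<in>carrier (F_theta \<theta>). \<forall>f. measurable_section M H \<epsilon> f \<longrightarrow> measurable_section M H \<epsilon> (\<lambda>x. \<rho> x w (f x))"
    using di[unfolded is_direct_integral_def, THEN conjunct1]
      di[unfolded is_direct_integral_def, THEN conjunct2, THEN conjunct1]
      di[unfolded is_direct_integral_def, THEN conjunct2, THEN conjunct2, THEN conjunct1] .
  obtain W where W: "\<forall>f\<in>?Q. \<forall>g\<in>?Q. W (\<lambda>x. f x + g x) = W f + W g"
    "\<forall>c. \<forall>f\<in>?Q. W (\<lambda>x. c *\<^sub>C f x) = c *\<^sub>C W f"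
    "\<forall>f\<in>?Q. (norm (W f))\<^sup>2 = (\<integral>x. (norm (f x))\<^sup>2 \<partial>M)" "W ` ?Q = S"
    "\<forall>w\<in>carrier (F_theta \<theta>). \<forall>f\<in>?Q. W (\<lambda>x. \<rho> x w (f x)) = \<sigma> w (W f)"
    using di unfolding is_direct_integral_def by (elim conjE exE) (rule that)
  have WS: "W f \<in> S" if "f \<in> ?Q" for f using W(4) that by blast
  show ?thesis
    unfolding is_direct_integral_def
  proof (intro conjI m exI[of _ "U \<circ> W"])
    show "\<forall>f\<in>?Q. \<forall>g\<in>?Q. (U \<circ> W) (\<lambda>x. f x + g x) = (U \<circ> W) f + (U \<circ> W) g"
      using W(1) WS by (simp add: U_add)
    show "\<forall>c. \<forall>f\<in>?Q. (U \<circ> W) (\<lambda>x. c *\<^sub>C f x) = c *\<^sub>C (U \<circ> W) f"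
      using W(2) WS by (simp add: U_scale)
    show "\<forall>f\<in>?Q. (norm ((U \<circ> W) f))\<^sup>2 = (\<integral>x. (norm (f x))\<^sup>2 \<partial>M)"
      using W(3) WS iso by simp
    show "(U \<circ> W) ` ?Q = S'" unfolding image_comp[symmetric] W(4) onto ..
    show "\<forall>w\<in>carrier (F_theta \<theta>). \<forall>f\<in>?Q. (U \<circ> W) (\<lambda>x. \<rho> x w (f x)) = \<sigma>' w ((U \<circ> W) f)"
      using W(5) WS inter by simp
  qed
qed

text \<open>Sections vanishing off \<open>Z\<close> give a reducing subspace. Cutting the section
  \<open>e\<close> of norm one to \<open>Z\<close> and to its complement yields nonzero vectors
  inside and outside this subspace.\<close>

lemma direct_integral_reducible:
  assumes di: "is_direct_integral \<theta> S \<sigma> M H \<epsilon> \<rho>" and S: "hilbert_subspace S"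
    and \<sigma>S: "\<And>w x. w \<in> carrier (F_theta \<theta>) \<Longrightarrow> x \<in> S \<Longrightarrow> \<sigma> w x \<in> S" and adj: "adjointable \<theta> S \<sigma>"
    and iso: "\<And>x w h. x \<in> space M \<Longrightarrow> w \<in> carrier (F_theta \<theta>) \<Longrightarrow> h \<in> H x \<Longrightarrow> norm (\<rho> x w h) = norm h"
    and e: "e \<in> square_integrable_sections M H \<epsilon>" "\<And>x. x \<in> space M \<Longrightarrow> norm (e x) = 1"
    and M: "emeasure M (space M) < \<infinity>" and UNIV: "space M = UNIV"
    and Z: "Z \<in> sets M" "emeasure M Z \<noteq> 0" "emeasure M (space M - Z) \<noteq> 0"
  shows "\<not> irreducible_rep \<theta> S \<sigma>"
proof
  let ?Q = "square_integrable_sections M H \<epsilon>"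
  have field: "measurable_field M H \<epsilon>"
    and meas: "\<And>w f. w \<in> carrier (F_theta \<theta>) \<Longrightarrow> measurable_section M H \<epsilon> f \<Longrightarrow> measurable_section M H \<epsilon> (\<lambda>x. \<rho> x w (f x))"
    and rep: "\<And>x. x \<in> space M \<Longrightarrow> representation \<theta> (H x) (\<rho> x)"
    using di unfolding is_direct_integral_def by blast+
  have Hx: "hilbert_subspace (H x)" if "x \<in> space M" for x using field that unfolding measurable_field_def by blast
  obtain W where W: "\<And>f g. f \<in> ?Q \<Longrightarrow> g \<in> ?Q \<Longrightarrow> W (\<lambda>x. f x + g x) = W f + W g"
    "\<And>c f. f \<in> ?Q \<Longrightarrow> W (\<lambda>x. c *\<^sub>C f x) = c *\<^sub>C W f"
    "\<And>f. f \<in> ?Q \<Longrightarrow> (norm (W f))\<^sup>2 = (\<integral>x. (norm (f x))\<^sup>2 \<partial>M)" "W ` ?Q = S"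
    "\<And>w f. w \<in> carrier (F_theta \<theta>) \<Longrightarrow> f \<in> ?Q \<Longrightarrow> W (\<lambda>x. \<rho> x w (f x)) = \<sigma> w (W f)"
    using di unfolding is_direct_integral_def by blast
  have WS: "W f \<in> S" if "f \<in> ?Q" for f using W(4) that by blast
  have cut: "(\<lambda>x. if x \<in> C then f x else 0) \<in> ?Q" if f: "f \<in> ?Q" and C[measurable]: "C \<in> sets M" for f C
    unfolding square_integrable_sections_def measurable_section_def
  proof (intro CollectI conjI ballI allI)
    have fm: "\<And>x. x \<in> space M \<Longrightarrow> f x \<in> H x" and [measurable]: "\<And>n. (\<lambda>x. cinner (\<epsilon> n x) (f x)) \<in> borel_measurable M"
      and int: "integrable M (\<lambda>x. (norm (f x))\<^sup>2)"
      using f unfolding square_integrable_sections_def measurable_section_def by auto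
    show "(if x \<in> C then f x else 0) \<in> H x" if "x \<in> space M" for x
      using fm[OF that] Hx[OF that] complex_vector.subspace_0 unfolding hilbert_subspace_def by auto
    show "(\<lambda>x. cinner (\<epsilon> n x) (if x \<in> C then f x else 0)) \<in> borel_measurable M" for n
      by (simp add: if_distrib[of "cinner _"] cong: if_cong)
    have "integrable M (\<lambda>x. indicator C x *\<^sub>R (norm (f x))\<^sup>2)"
      by (rule integrable_mult_indicator[OF C int])
    then show "integrable M (\<lambda>x. (norm (if x \<in> C then f x else 0))\<^sup>2)"
      by (rule back_subst[of "integrable M"]) (auto simp: indicator_def)
  qed
  have scale: "(\<lambda>x. c *\<^sub>C f x) \<in> ?Q" if f: "f \<in> ?Q" for c f
    using f hilbert_subspace_scale[OF Hx]
    unfolding square_integrable_sections_def measurable_section_def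
    by (auto simp: cinner_scaleC_right norm_scaleC power_mult_distrib intro!: borel_measurable_times)
  have rho: "(\<lambda>x. \<rho> x w (f x)) \<in> ?Q" if f: "f \<in> ?Q" and w: "w \<in> carrier (F_theta \<theta>)" for f w
  proof -
    have ms: "measurable_section M H \<epsilon> f" and int: "integrable M (\<lambda>x. (norm (f x))\<^sup>2)"
      using f unfolding square_integrable_sections_def by auto
    have fH: "\<And>x. x \<in> space M \<Longrightarrow> f x \<in> H x" using ms unfolding measurable_section_def by blast
    have "integrable M (\<lambda>x. (norm (\<rho> x w (f x)))\<^sup>2)"
      using int by (subst Bochner_Integration.integrable_cong[OF HOL.refl, of _ _ "\<lambda>x. (norm (f x))\<^sup>2"])
        (simp_all add: iso[OF _ w fH])
    then show ?thesis using meas[OF w ms] unfolding square_integrable_sections_def by blast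
  qed
  have orth: "cinner (W f) (W g) = 0"
    if f: "f \<in> ?Q" "\<And>x. x \<in> space M - Z \<Longrightarrow> f x = 0" and g: "g \<in> ?Q" "\<And>x. x \<in> Z \<Longrightarrow> g x = 0" for f g
  proof -
    \<comment> \<open>Disjoint supports make the squared norm of the sum additive, so the mixed term
      vanishes for every \<open>c\<close>; the values 1 and \<i> give both parts of the inner
      product.\<close>
    have "Re (cinner (W f) (c *\<^sub>C W g)) = 0" for c
    proof -
      have cg: "(\<lambda>x. c *\<^sub>C g x) \<in> ?Q" by (rule scale[OF g(1)])
      have sq: "(norm (f x + c *\<^sub>C g x))\<^sup>2 = (norm (f x))\<^sup>2 + (norm (c *\<^sub>C g x))\<^sup>2" if "x \<in> space M" for x
        using f(2)[of x] g(2)[of x] that by (cases "x \<in> Z") auto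
      have "(\<lambda>x. f x + c *\<^sub>C g x) \<in> ?Q"
      proof -
        have "(\<lambda>x. f x + c *\<^sub>C g x) = (\<lambda>x. f x + (\<lambda>x. c *\<^sub>C g x) x)" by simp
        have i: "integrable M (\<lambda>x. (norm (f x + c *\<^sub>C g x))\<^sup>2)"
          using f(1) cg unfolding square_integrable_sections_def
          by (subst Bochner_Integration.integrable_cong[OF HOL.refl sq]) auto
        have s: "f x + c *\<^sub>C g x \<in> H x" if "x \<in> space M" for x
          using f(1) cg Hx[OF that] that complex_vector.subspace_add
          unfolding square_integrable_sections_def measurable_section_def hilbert_subspace_def by blast
        have "(\<lambda>x. cinner (\<epsilon> n x) (f x + c *\<^sub>C g x)) \<in> borel_measurable M" for n
          using f(1) cg unfolding square_integrable_sections_def measurable_section_def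
          by (auto simp: cinner_add_right intro!: borel_measurable_add)
        then show ?thesis using i s unfolding square_integrable_sections_def measurable_section_def by auto
      qed
      then have "(norm (W f + c *\<^sub>C W g))\<^sup>2 = (\<integral>x. (norm (f x + c *\<^sub>C g x))\<^sup>2 \<partial>M)"
        using W(1)[OF f(1) cg] W(2)[OF g(1)] W(3) by metis
      also have "\<dots> = (\<integral>x. (norm (f x))\<^sup>2 + (norm (c *\<^sub>C g x))\<^sup>2 \<partial>M)"
        by (rule Bochner_Integration.integral_cong[OF HOL.refl sq])
      also have "\<dots> = (norm (W f))\<^sup>2 + (norm (W (\<lambda>x. c *\<^sub>C g x)))\<^sup>2"
        unfolding W(3)[OF f(1)] W(3)[OF cg]
        by (rule Bochner_Integration.integral_add) (use f(1) cg in \<open>simp_all add: square_integrable_sections_def\<close>)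
      finally show ?thesis unfolding W(2)[OF g(1)] norm_add_square by simp
    qed
    from this[of 1] this[of "\<i>"] show ?thesis
      by (simp add: cinner_scaleC_right complex_eq_iff)
  qed
  \<comment> \<open>Described as an orthogonal complement, so that closedness and invariance under
    adjoints are direct; \<open>N_rep\<close> recovers the description by supports.\<close>
  define N where "N = {v \<in> S. \<forall>g\<in>?Q. (\<forall>x\<in>Z. g x = 0) \<longrightarrow> cinner (W g) v = 0}"
  have sub: "complex_vector.subspace S" and cl: "closed S" using S by (auto simp: hilbert_subspace_def)
  have "complex_vector.subspace N"
    using sub by (intro complex_vector.subspaceI)
      (auto simp: N_def cinner_add_right cinner_scaleC_right complex_vector.subspace_0
        complex_vector.subspace_add complex_vector.subspace_scale)
  moreover have "closed N"
  proof -
    have "N = S \<inter> (\<Inter>g\<in>{g \<in> ?Q. \<forall>x\<in>Z. g x = 0}. {v. cinner (W g) v = 0})" by (auto simp: N_def)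
    moreover have "closed {v. cinner (W g) v = 0}" for g
      using continuous_closed_vimage[of "{0}" "cinner (W g)"]
        linear_continuous_at[OF bounded_linear_cinner_right[of "W g"]] by (simp add: vimage_def)
    ultimately show ?thesis using cl by auto
  qed
  ultimately have N: "hilbert_subspace N" by (simp add: hilbert_subspace_def)
  have N_rep: "\<exists>f\<in>?Q. v = W f \<and> (\<forall>x\<in>space M - Z. f x = 0)" if v: "v \<in> N" for v
  proof -
    obtain f where f: "f \<in> ?Q" "v = W f" using v W(4) unfolding N_def by blast
    let ?f = "\<lambda>x. if x \<in> Z then f x else 0" and ?g = "\<lambda>x. if x \<in> space M - Z then f x else 0"
    have Q: "?f \<in> ?Q" "?g \<in> ?Q"
      by (rule cut[OF f(1) Z(1)], rule cut[OF f(1) sets.compl_sets[OF Z(1)]])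
    \<comment> \<open>\<open>W\<close> is applied to functions, not to classes modulo null sets, so
      the two pieces must add up to \<open>f\<close> at every point of the type; hence the
      assumption \<open>UNIV\<close>.\<close>
    have "(\<lambda>x. ?f x + ?g x) = f" using UNIV by auto
    then have fg: "W (\<lambda>x. ?f x + ?g x) = W f" by (rule arg_cong)
    have "cinner (W ?g) (W ?f + W ?g) = 0" using v Q(2) fg W(1)[OF Q] f(2) unfolding N_def by auto
    moreover have "cinner (W ?g) (W ?f) = 0"
      using orth[OF Q(1) _ Q(2)] cinner_commute[of "W ?g" "W ?f"] by simp
    ultimately have "W ?g = 0" by (simp add: cinner_add_right)
    then show ?thesis using Q(1) fg W(1)[OF Q] f(2) by (intro bexI[of _ ?f]) auto
  qed
  have red: "reducing \<theta> S \<sigma> N"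
    unfolding reducing_def
  proof (intro conjI ballI N image_subsetI)
    show "N \<subseteq> S" by (auto simp: N_def)
    fix w v assume w: "w \<in> carrier (F_theta \<theta>)" and v: "v \<in> N"
    have rho0: "\<rho> x w 0 = 0" if "x \<in> space M" for x
      using iso[OF that w, of 0] Hx[OF that] complex_vector.subspace_0 unfolding hilbert_subspace_def by auto
    have vS: "v \<in> S" using v by (auto simp: N_def)
    obtain f where f: "f \<in> ?Q" "v = W f" "\<forall>x\<in>space M - Z. f x = 0" using N_rep[OF v] by blast
    have "cinner (W (\<lambda>x. \<rho> x w (f x))) (W g) = 0" if "g \<in> ?Q" "\<forall>x\<in>Z. g x = 0" for g
      by (rule orth[OF rho[OF f(1) w] _ that(1)]) (use f(3) rho0 that(2) in auto)
    then have "cinner (W g) (\<sigma> w v) = 0" if "g \<in> ?Q" "\<forall>x\<in>Z. g x = 0" for g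
      using that W(5)[OF w f(1)] f(2) cinner_commute[of "W g" "\<sigma> w v"] by simp
    then show "\<sigma> w v \<in> N" using \<sigma>S[OF w vS] by (simp add: N_def)
    obtain z where z: "z \<in> S" "\<forall>x\<in>S. cinner (\<sigma> w x) v = cinner x z"
      using adj w vS unfolding adjointable_def by blast
    have "cinner (W g) z = 0" if g: "g \<in> ?Q" "\<forall>x\<in>Z. g x = 0" for g
    proof -
      have "cinner (W g) z = cinner (W (\<lambda>x. \<rho> x w (g x))) v" using z(2) WS[OF g(1)] W(5)[OF w g(1)] by simp
      also have "\<dots> = 0"
      proof -
        have "\<forall>x\<in>Z. \<rho> x w (g x) = 0" using g(2) rho0 UNIV by simp
        moreover have "\<forall>g\<in>?Q. (\<forall>x\<in>Z. g x = 0) \<longrightarrow> cinner (W g) v = 0"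
          using v unfolding N_def by simp
        ultimately show ?thesis using rho[OF g(1) w] by (metis (no_types, lifting))
      qed
      finally show ?thesis .
    qed
    then have "z \<in> N" using z(1) by (simp add: N_def)
    then show "adjoint_on S (\<sigma> w) v \<in> N" using adjoint_on_eqI[OF S z] by simp
  qed
  have normcut: "(norm (W (\<lambda>x. if x \<in> C then e x else 0)))\<^sup>2 = measure M C" if C: "C \<in> sets M" for C
  proof -
    have "(norm (W (\<lambda>x. if x \<in> C then e x else 0)))\<^sup>2 = (\<integral>x. (norm (if x \<in> C then e x else 0))\<^sup>2 \<partial>M)"
      by (rule W(3)[OF cut[OF e(1) C]])
    also have "\<dots> = (\<integral>x. indicator C x \<partial>M)"
      by (rule Bochner_Integration.integral_cong) (auto simp: e(2) indicator_def)
    also have "\<dots> = measure M C" using sets.sets_into_space[OF C] by (simp add: Int_absorb2)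
    finally show ?thesis .
  qed
  have fin: "emeasure M C < \<infinity>" if "C \<in> sets M" for C
    using M emeasure_space[of M C] by (rule order_le_less_trans[rotated])
  have pos: "W (\<lambda>x. if x \<in> C then e x else 0) \<noteq> 0" if "C \<in> sets M" "emeasure M C \<noteq> 0" for C
  proof
    assume "W (\<lambda>x. if x \<in> C then e x else 0) = 0"
    then have "measure M C = 0" using normcut[OF that(1)] by simp
    then show False using that(2) fin[OF that(1)] by (simp add: measure_def enn2real_eq_0_iff)
  qed
  have ZC: "space M - Z \<in> sets M" using Z(1) by auto
  assume "irreducible_rep \<theta> S \<sigma>"
  then have "N = {0} \<or> N = S" using red unfolding irreducible_rep_def by blast
  moreover have "W (\<lambda>x. if x \<in> Z then e x else 0) \<in> N"
  proof -
    have "cinner (W (\<lambda>x. if x \<in> Z then e x else 0)) (W g) = 0" if "g \<in> ?Q" "\<forall>x\<in>Z. g x = 0" for g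
      by (rule orth[OF cut[OF e(1) Z(1)] _ that(1)]) (use that in auto)
    then have "cinner (W g) (W (\<lambda>x. if x \<in> Z then e x else 0)) = 0" if "g \<in> ?Q" "\<forall>x\<in>Z. g x = 0" for g
      using that cinner_commute[of "W g" "W (\<lambda>x. if x \<in> Z then e x else 0)"] by simp
    then show ?thesis using WS[OF cut[OF e(1) Z(1)]] by (simp add: N_def)
  qed
  moreover have "W (\<lambda>x. if x \<in> space M - Z then e x else 0) \<notin> N"
  proof
    assume "W (\<lambda>x. if x \<in> space M - Z then e x else 0) \<in> N"
    then have N: "\<forall>g\<in>?Q. (\<forall>x\<in>Z. g x = 0) \<longrightarrow> cinner (W g) (W (\<lambda>x. if x \<in> space M - Z then e x else 0)) = 0"
      unfolding N_def by simp
    have "cinner (W (\<lambda>x. if x \<in> space M - Z then e x else 0)) (W (\<lambda>x. if x \<in> space M - Z then e x else 0)) = 0"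
      by (rule N[rule_format, OF cut[OF e(1) ZC]]) simp
    then show False using pos[OF ZC Z(3)] by simp
  qed
  ultimately show False using pos[OF Z(1,2)] WS[OF cut[OF e(1) ZC]] by auto
qed

lemma dilation_isometric:
  "irreducible_group_construction_dilation \<theta> K \<rho> \<Longrightarrow> w \<in> carrier (F_theta \<theta>) \<Longrightarrow> x \<in> K \<Longrightarrow> norm (\<rho> w x) = norm x"
  unfolding irreducible_group_construction_dilation_def is_minimal_star_dilation_of_def
    minimal_star_dilation_def star_representation_def isometric_representation_def isometry_on_def by blast

section \<open>Atomic representations\<close>

lemma bessel:
  assumes F: "finite F" and on: "\<And>y z. y \<in> F \<Longrightarrow> z \<in> F \<Longrightarrow> cinner (e y) (e z) = (if y = z then 1 else 0)"
  shows "(\<Sum>y\<in>F. (cmod (cinner (e y) x))\<^sup>2) \<le> (norm (x :: 'h::chilbert_space))\<^sup>2"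
proof -
  define s where "s = (\<Sum>y\<in>F. cinner (e y) x *\<^sub>C e y)"
  have ys: "cinner (e y) s = cinner (e y) x" if y: "y \<in> F" for y
  proof -
    have "cinner (e y) s = (\<Sum>z\<in>F. if y = z then cinner (e z) x else 0)"
      unfolding s_def cinner_sum_right by (rule sum.cong) (use on y in \<open>simp_all add: cinner_scaleC_right\<close>)
    then show ?thesis using F y by simp
  qed
  have sq: "cnj (cinner (e y) x) * cinner (e y) x = complex_of_real ((cmod (cinner (e y) x))\<^sup>2)" for y
    by (simp only: complex_norm_square mult.commute)
  have ss: "cinner s v = (\<Sum>y\<in>F. cnj (cinner (e y) x) * cinner (e y) v)" for v
    unfolding s_def cinner_sum_left by (simp add: cinner_scaleC_left)
  have 1: "cinner s x = complex_of_real (\<Sum>y\<in>F. (cmod (cinner (e y) x))\<^sup>2)"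
    unfolding ss of_real_sum by (intro sum.cong HOL.refl sq)
  have 2: "cinner s s = cinner s x" unfolding ss by (intro sum.cong HOL.refl) (simp add: ys)
  have "(norm s)\<^sup>2 = (\<Sum>y\<in>F. (cmod (cinner (e y) x))\<^sup>2)"
    using 2 unfolding 1 cinner_self of_real_eq_iff .
  moreover have "0 \<le> (norm (s - x))\<^sup>2" by simp
  ultimately show ?thesis unfolding norm_diff_square 1 by simp
qed

locale atomic_star =
  fixes \<theta> :: "'m::finite \<times> 'n::finite \<Rightarrow> 'm \<times> 'n"
    and \<pi> :: "('m, 'n, 'h::chilbert_space) rep" and B :: "'h set"
  assumes bij: "bij \<theta>" and star: "star_representation \<theta> UNIV \<pi>" and atomic: "atomic_wrt \<theta> UNIV B \<pi>"
begin

lemma rep: "representation \<theta> UNIV \<pi>"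
  using star unfolding star_representation_def isometric_representation_def by blast

lemma isometry: "w \<in> carrier (F_theta \<theta>) \<Longrightarrow> isometry_on UNIV (\<pi> w)"
  using star unfolding star_representation_def isometric_representation_def by blast

lemma norm_\<pi>: "w \<in> carrier (F_theta \<theta>) \<Longrightarrow> norm (\<pi> w x) = norm x"
  using isometry unfolding isometry_on_def by blast

lemma linear_\<pi>: "w \<in> carrier (F_theta \<theta>) \<Longrightarrow> linear_on_subspace UNIV (\<pi> w)"
  using isometry unfolding isometry_on_def bounded_operator_on_def by blast

lemma \<pi>_add: "w \<in> carrier (F_theta \<theta>) \<Longrightarrow> \<pi> w (x + y) = \<pi> w x + \<pi> w y"
  and \<pi>_scale: "w \<in> carrier (F_theta \<theta>) \<Longrightarrow> \<pi> w (c *\<^sub>C x) = c *\<^sub>C \<pi> w x"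
  using linear_\<pi> unfolding linear_on_subspace_def by blast+

lemma \<pi>_mult: "v \<in> carrier (F_theta \<theta>) \<Longrightarrow> w \<in> carrier (F_theta \<theta>) \<Longrightarrow> \<pi> (v \<otimes>\<^bsub>F_theta \<theta>\<^esub> w) x = \<pi> v (\<pi> w x)"
  using rep unfolding representation_def by blast

lemma \<pi>_one: "\<pi> (word_class \<theta> []) x = x"
  using rep unfolding representation_def one_F_theta by blast

lemma cinner_\<pi>: "w \<in> carrier (F_theta \<theta>) \<Longrightarrow> cinner (\<pi> w x) (\<pi> w y) = cinner x y"
  by (rule isometry_preserves_cinner[of UNIV]) (simp_all add: linear_\<pi> norm_\<pi>)

lemma bounded_linear_\<pi>: "w \<in> carrier (F_theta \<theta>) \<Longrightarrow> bounded_linear (\<pi> w)"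
  by (rule bounded_linear_intro[of _ 1]) (simp_all add: \<pi>_add scaleR_scaleC \<pi>_scale norm_\<pi>)

lemma cinner_B: "x \<in> B \<Longrightarrow> y \<in> B \<Longrightarrow> cinner x y = (if x = y then 1 else 0)"
  and span_B: "closed_span B = UNIV"
  using atomic unfolding atomic_wrt_def orthonormal_basis_def by blast+

lemma norm_B: "x \<in> B \<Longrightarrow> norm x = 1"
proof -
  assume "x \<in> B"
  then have "complex_of_real ((norm x)\<^sup>2) = of_real 1" using cinner_B[of x x] by (simp add: cinner_self)
  then have "(norm x)\<^sup>2 = 1" unfolding of_real_eq_iff .
  then show ?thesis by (simp add: power2_eq_1_iff) (use norm_ge_zero[of x] in linarith)
qed

lemma scaled_B_eq:
  assumes "x \<in> B" "y \<in> B" "\<alpha> *\<^sub>C x = \<beta> *\<^sub>C y" "\<alpha> \<noteq> 0"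
  shows "x = y" "\<alpha> = \<beta>"
proof -
  have "cinner x (\<alpha> *\<^sub>C x) = cinner x (\<beta> *\<^sub>C y)" using assms(3) by simp
  then have e: "\<alpha> = \<beta> * (if x = y then 1 else 0)" using assms(1,2) by (simp add: cinner_scaleC_right cinner_B)
  then show "x = y" using assms(4) by (metis mult_zero_right)
  with e show "\<alpha> = \<beta>" by simp
qed

text \<open>A graph edge in terms of basis vectors; the scalar cannot be 0 because
  \<open>\<pi>\<close> is isometric.\<close>

definition edge :: "('m + 'n) list set \<Rightarrow> 'h \<Rightarrow> 'h \<Rightarrow> bool" where
  "edge w x y \<longleftrightarrow> x \<in> B \<and> y \<in> B \<and> (\<exists>\<alpha>. cmod \<alpha> = 1 \<and> \<pi> w x = \<alpha> *\<^sub>C y)"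

lemma edge_B: "edge w x y \<Longrightarrow> x \<in> B \<and> y \<in> B" by (simp add: edge_def)

lemma ex_edge: assumes w: "w \<in> carrier (F_theta \<theta>)" and x: "x \<in> B" shows "\<exists>y. edge w x y"
proof -
  obtain y \<alpha> where y: "y \<in> B" "\<pi> w x = \<alpha> *\<^sub>C y"
    using atomic w x unfolding atomic_wrt_def by meson
  have "cmod \<alpha> = 1" using norm_\<pi>[OF w, of x] y norm_B x by (simp add: norm_scaleC)
  then show ?thesis using x y unfolding edge_def by blast
qed

lemma edge_target_unique: assumes "edge w x y" "edge w x y'" shows "y = y'"
proof -
  obtain \<alpha> where a: "y \<in> B" "cmod \<alpha> = 1" "\<pi> w x = \<alpha> *\<^sub>C y" using assms(1) unfolding edge_def by blast
  obtain \<alpha>' where a': "y' \<in> B" "\<pi> w x = \<alpha>' *\<^sub>C y'" using assms(2) unfolding edge_def by blast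
  have "\<alpha> \<noteq> 0" using a(2) by auto
  then show ?thesis using scaled_B_eq(1)[OF a(1) a'(1)] a(3) a'(2) by metis
qed

lemma edge_source_unique:
  assumes w: "w \<in> carrier (F_theta \<theta>)" and e: "edge w x y" "edge w x' y" shows "x = x'"
proof -
  obtain \<alpha> \<beta> where a: "cmod \<alpha> = 1" "\<pi> w x = \<alpha> *\<^sub>C y" and b: "cmod \<beta> = 1" "\<pi> w x' = \<beta> *\<^sub>C y"
    using e unfolding edge_def by auto
  have "\<pi> w (\<beta> *\<^sub>C x + (- \<alpha>) *\<^sub>C x') = (\<beta> * \<alpha> + - (\<alpha> * \<beta>)) *\<^sub>C y"
    unfolding \<pi>_add[OF w] \<pi>_scale[OF w] a b by (simp only: scaleC_scaleC scaleC_add_left mult_minus_left)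
  then have "norm (\<beta> *\<^sub>C x + (- \<alpha>) *\<^sub>C x') = 0" using norm_\<pi>[OF w] by (metis norm_zero mult.commute add.right_inverse scaleC_zero_left)
  then have "\<beta> *\<^sub>C x = \<alpha> *\<^sub>C x'" by (simp add: add_eq_0_iff)
  moreover have "\<beta> \<noteq> 0" using b by auto
  ultimately show ?thesis using scaled_B_eq(1) e edge_B by blast
qed

lemma edge_comp:
  assumes v: "v \<in> carrier (F_theta \<theta>)" and w: "w \<in> carrier (F_theta \<theta>)" and e: "edge w x y" "edge v y z"
  shows "edge (v \<otimes>\<^bsub>F_theta \<theta>\<^esub> w) x z"
proof -
  obtain \<alpha> \<beta> where a: "cmod \<alpha> = 1" "\<pi> w x = \<alpha> *\<^sub>C y" and b: "cmod \<beta> = 1" "\<pi> v y = \<beta> *\<^sub>C z"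
    using e unfolding edge_def by auto
  have "\<pi> (v \<otimes>\<^bsub>F_theta \<theta>\<^esub> w) x = (\<alpha> * \<beta>) *\<^sub>C z" using a b v w by (simp add: \<pi>_mult \<pi>_scale scaleC_scaleC)
  moreover have "cmod (\<alpha> * \<beta>) = 1" using a b by (simp add: norm_mult)
  ultimately show ?thesis using e unfolding edge_def by blast
qed

lemma edge_decomp:
  assumes v: "v \<in> carrier (F_theta \<theta>)" and w: "w \<in> carrier (F_theta \<theta>)" and e: "edge (v \<otimes>\<^bsub>F_theta \<theta>\<^esub> w) x z"
  obtains y where "edge w x y" "edge v y z"
proof -
  obtain y where y: "edge w x y" using ex_edge[OF w] e edge_B by blast
  obtain z' where z': "edge v y z'" using ex_edge[OF v] y edge_B by blast
  have "z' = z" by (rule edge_target_unique[OF edge_comp[OF v w y z'] e])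
  then show thesis using that y z' by blast
qed

lemma leads_to_iff:
  assumes w: "w \<in> carrier (F_theta \<theta>)" and x: "x \<in> B" and y: "y \<in> B"
  shows "leads_to \<pi> w x y \<longleftrightarrow> edge w x y"
proof
  assume "leads_to \<pi> w x y"
  moreover have "x \<in> line x" unfolding line_def by (rule range_eqI[of _ _ 1]) (simp add: scaleC_one)
  then have "\<pi> w x \<in> \<pi> w ` line x" by (rule imageI)
  ultimately have "\<pi> w x \<in> line y" unfolding leads_to_def by simp
  then obtain c where c: "\<pi> w x = c *\<^sub>C y" unfolding line_def by blast
  then have "cmod c = 1" using norm_\<pi>[OF w, of x] norm_B x y by (simp add: norm_scaleC)
  then show "edge w x y" using c x y unfolding edge_def by blast
next
  assume "edge w x y"
  then obtain \<alpha> where a: "cmod \<alpha> = 1" "\<pi> w x = \<alpha> *\<^sub>C y" unfolding edge_def by blast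
  have a0: "\<alpha> \<noteq> 0" using a by auto
  have im: "\<pi> w ` line x = range (\<lambda>c. (c * \<alpha>) *\<^sub>C y)"
    unfolding line_def by (simp add: image_image \<pi>_scale[OF w] a scaleC_scaleC)
  have "line y \<subseteq> range (\<lambda>c. (c * \<alpha>) *\<^sub>C y)"
  proof
    fix v assume "v \<in> line y"
    then obtain c where "v = c *\<^sub>C y" unfolding line_def by blast
    then have "v = (c / \<alpha> * \<alpha>) *\<^sub>C y" using a0 by simp
    then show "v \<in> range (\<lambda>c. (c * \<alpha>) *\<^sub>C y)" by blast
  qed
  moreover have "range (\<lambda>c. (c * \<alpha>) *\<^sub>C y) \<subseteq> line y" unfolding line_def by blast
  ultimately show "leads_to \<pi> w x y" unfolding leads_to_def im by (rule equalityI[rotated])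
qed

text \<open>If no edge enters \<open>x\<close>, then \<open>x\<close> is orthogonal to the image of
  every basis vector, hence to the range of \<open>\<pi> w\<close>; otherwise it lies in that range.
  So the range projection kills or fixes \<open>x\<close>.\<close>

lemma \<pi>_adjoint:
  assumes w: "w \<in> carrier (F_theta \<theta>)" and x: "x \<in> B"
  shows "\<pi> w (adjoint_on UNIV (\<pi> w) x) = (if \<exists>z. edge w z x then x else 0)"
proof -
  have U: "hilbert_subspace (UNIV :: 'h set)" using rep unfolding representation_def by blast
  show ?thesis
  proof (cases "\<exists>z. edge w z x")
    case True
    then obtain z \<alpha> where a: "cmod \<alpha> = 1" "\<pi> w z = \<alpha> *\<^sub>C x" unfolding edge_def by blast
    have one: "cnj \<alpha> * \<alpha> = 1" using a(1) complex_norm_square[of \<alpha>] by (simp add: mult.commute)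
    have \<pi>z: "\<pi> w (cnj \<alpha> *\<^sub>C z) = x" by (simp add: \<pi>_scale[OF w] a scaleC_scaleC one scaleC_one)
    have "adjoint_on UNIV (\<pi> w) x = cnj \<alpha> *\<^sub>C z"
    proof (rule adjoint_on_eqI[OF U])
      show "\<forall>y\<in>UNIV. cinner (\<pi> w y) x = cinner y (cnj \<alpha> *\<^sub>C z)" using cinner_\<pi>[OF w, of _ "cnj \<alpha> *\<^sub>C z"] \<pi>z by simp
    qed simp
    then show ?thesis using True \<pi>z by simp
  next
    case False
    have "cinner x (\<pi> w y) = 0" for y
    proof (rule cinner_eq_on_closed_span[of B "\<lambda>y. cinner x (\<pi> w y)" "\<lambda>_. 0"])
      show "cinner x (\<pi> w y) = 0" if y: "y \<in> B" for y
      proof -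
        obtain z where "edge w y z" using ex_edge[OF w y] by blast
        moreover from this have "z \<noteq> x" using False by blast
        ultimately show ?thesis using cinner_B[OF x] unfolding edge_def by (auto simp: cinner_scaleC_right)
      qed
      show "bounded_linear (\<lambda>y. cinner x (\<pi> w y))"
        by (rule bounded_linear_compose[OF bounded_linear_cinner_right bounded_linear_\<pi>[OF w]])
      show "bounded_linear (\<lambda>_::'h. 0 :: complex)" by (rule bounded_linear_zero)
      show "y \<in> closed_span B" by (simp add: span_B)
    qed (simp_all add: \<pi>_scale[OF w] cinner_scaleC_right)
    then have "cinner (\<pi> w y) x = 0" for y using cinner_commute[of "\<pi> w y" x] by simp
    then have "adjoint_on UNIV (\<pi> w) x = 0" by (intro adjoint_on_eqI[OF U]) simp_all
    moreover have "\<pi> w 0 = 0" using norm_\<pi>[OF w, of 0] by simp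
    ultimately show ?thesis using False by simp
  qed
qed

text \<open>Pairing the defect free identity with \<open>x\<close> turns it into a count: a summand
  contributes 1 if an edge enters and 0 otherwise, and the total is 1.\<close>

lemma ex1_incoming:
  fixes g :: "'k::finite \<Rightarrow> ('m + 'n) list set"
  assumes g: "\<And>i. g i \<in> carrier (F_theta \<theta>)" and x: "x \<in> B"
    and sum: "(\<Sum>i\<in>UNIV. \<pi> (g i) (adjoint_on UNIV (\<pi> (g i)) x)) = x"
  shows "\<exists>!i. \<exists>z. edge (g i) z x"
proof -
  define P where "P = {i. \<exists>z. edge (g i) z x}"
  have "cinner x x = (\<Sum>i\<in>UNIV. cinner x (if i \<in> P then x else 0))"
    using sum \<pi>_adjoint[OF g x] unfolding cinner_sum_right[symmetric] by (simp add: P_def)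
  also have "\<dots> = (\<Sum>i\<in>UNIV. if i \<in> P then 1 else 0)"
    by (rule sum.cong) (use cinner_B[OF x x] in auto)
  also have "\<dots> = of_nat (card P)" by (simp add: sum.If_cases)
  finally have "complex_of_nat (card P) = of_nat 1" using cinner_B[OF x x] by simp
  then have "card P = 1" unfolding of_nat_eq_iff .
  then obtain i where "P = {i}" by (rule card_1_singletonE)
  then show ?thesis unfolding P_def by (intro ex1I[of _ i]) auto
qed

lemma ex1_blue: "x \<in> B \<Longrightarrow> \<exists>!i. \<exists>z. edge (gen_e \<theta> i) z x"
  and ex1_red: "x \<in> B \<Longrightarrow> \<exists>!j. \<exists>z. edge (gen_f \<theta> j) z x"
  using star unfolding star_representation_def defect_free_def by (intro ex1_incoming; simp)+

abbreviation lb where "lb \<equiv> blue_label \<theta> B \<pi>"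
abbreviation lr where "lr \<equiv> red_label \<theta> B \<pi>"

definition pb where "pb x = (THE z. edge (gen_e \<theta> (lb x)) z x)"
definition pr where "pr x = (THE z. edge (gen_f \<theta> (lr x)) z x)"

lemma lb_eq: "x \<in> B \<Longrightarrow> lb x = (THE i. \<exists>z. edge (gen_e \<theta> i) z x)"
  unfolding blue_label_def
  by (rule arg_cong[of _ _ The], rule ext) (use leads_to_iff[OF gen_in_carrier(1)] edge_B in blast)

lemma lr_eq: "x \<in> B \<Longrightarrow> lr x = (THE j. \<exists>z. edge (gen_f \<theta> j) z x)"
  unfolding red_label_def
  by (rule arg_cong[of _ _ The], rule ext) (use leads_to_iff[OF gen_in_carrier(2)] edge_B in blast)

lemma blue_eqI:
  assumes e: "edge (gen_e \<theta> i) z x" shows "lb x = i" "pb x = z"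
proof -
  have x: "x \<in> B" using e edge_B by blast
  show l: "lb x = i" unfolding lb_eq[OF x] by (rule the1_equality[OF ex1_blue[OF x]]) (use e in blast)
  show "pb x = z" unfolding pb_def l
    by (rule the_equality, rule e, rule edge_source_unique[OF gen_in_carrier(1) _ e])
qed

lemma red_eqI:
  assumes e: "edge (gen_f \<theta> j) z x" shows "lr x = j" "pr x = z"
proof -
  have x: "x \<in> B" using e edge_B by blast
  show l: "lr x = j" unfolding lr_eq[OF x] by (rule the1_equality[OF ex1_red[OF x]]) (use e in blast)
  show "pr x = z" unfolding pr_def l
    by (rule the_equality, rule e, rule edge_source_unique[OF gen_in_carrier(2) _ e])
qed

lemma edge_pb: "x \<in> B \<Longrightarrow> edge (gen_e \<theta> (lb x)) (pb x) x"
  using ex1_implies_ex[OF ex1_blue[of x]] blue_eqI by blast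

lemma edge_pr: "x \<in> B \<Longrightarrow> edge (gen_f \<theta> (lr x)) (pr x) x"
  using ex1_implies_ex[OF ex1_red[of x]] red_eqI by blast

text \<open>The two-edge path into \<open>x\<close> through \<open>pb x\<close> is rewritten by the
  commutation relation and decomposed at its new middle vertex, which must be \<open>pr x\<close> by
  uniqueness of incoming edges.\<close>

lemma square_vertices:
  assumes x: "x \<in> B"
  shows "\<theta> (lb x, lr (pb x)) = (lb (pr x), lr x)" "pb (pr x) = pr (pb x)"
proof -
  obtain i' j' where t: "\<theta> (lb x, lr (pb x)) = (i', j')" by fastforce
  have pbB: "pb x \<in> B" using edge_pb[OF x] edge_B by blast
  have "edge (gen_e \<theta> (lb x) \<otimes>\<^bsub>F_theta \<theta>\<^esub> gen_f \<theta> (lr (pb x))) (pr (pb x)) x"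
    by (rule edge_comp[OF gen_in_carrier edge_pr[OF pbB] edge_pb[OF x]])
  then have "edge (gen_f \<theta> j' \<otimes>\<^bsub>F_theta \<theta>\<^esub> gen_e \<theta> i') (pr (pb x)) x" unfolding gen_e_gen_f[of \<theta> "lb x" "lr (pb x)" i' j', OF t] .
  then obtain y where y: "edge (gen_e \<theta> i') (pr (pb x)) y" "edge (gen_f \<theta> j') y x"
    by (rule edge_decomp[OF gen_in_carrier(2,1)])
  show "\<theta> (lb x, lr (pb x)) = (lb (pr x), lr x)" "pb (pr x) = pr (pb x)"
    unfolding t red_eqI[OF y(2)] blue_eqI[OF y(1)] by (rule HOL.refl)+
qed

sublocale G: full_system \<theta> B pb pr lb lr
proof
  show "bij \<theta>" by (rule bij)
  fix x assume x: "x \<in> B"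
  show "pb x \<in> B" "pr x \<in> B" using edge_pb[OF x] edge_pr[OF x] edge_B by blast+
  show "pb (pr x) = pr (pb x)" "\<theta> (lb x, lr (pb x)) = (lb (pr x), lr x)" using square_vertices[OF x] by auto
  show "x = y" if y: "y \<in> B" and e: "pb x = pb y" "lb x = lb y" for y
    using edge_pb[OF x] edge_pb[OF y] unfolding e by (rule edge_target_unique)
  show "x = y" if y: "y \<in> B" and e: "pr x = pr y" "lr x = lr y" for y
    using edge_pr[OF x] edge_pr[OF y] unfolding e by (rule edge_target_unique)
  show "\<exists>y\<in>B. pb y = x \<and> lb y = i" for i
    using ex_edge[OF gen_in_carrier(1) x, of i] edge_B blue_eqI by blast
  show "\<exists>y\<in>B. pr y = x \<and> lr y = j" for j
    using ex_edge[OF gen_in_carrier(2) x, of j] edge_B red_eqI by blast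
qed

lemma word_class_Cons:
  "word_class \<theta> (Inl i # u) = gen_e \<theta> i \<otimes>\<^bsub>F_theta \<theta>\<^esub> word_class \<theta> u"
  "word_class \<theta> (Inr j # u) = gen_f \<theta> j \<otimes>\<^bsub>F_theta \<theta>\<^esub> word_class \<theta> u"
  by (simp_all add: gen_e_def gen_f_def F_theta_mult_word_class)

lemma edge_word: "x \<in> B \<Longrightarrow> G.matches u x \<Longrightarrow> edge (word_class \<theta> u) (G.bwd (nblue u) (nred u) x) x"
proof (induction u arbitrary: x rule: sum_list_induct)
  case Nil
  then show ?case by (auto simp: edge_def \<pi>_one scaleC_one intro: exI[of _ 1])
next
  case (Blue i u)
  have "edge (word_class \<theta> u) (G.bwd (nblue u) (nred u) (pb x)) (pb x)" using Blue by simp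
  then show ?case
    using edge_comp[OF gen_in_carrier(1) word_class_in_carrier _ edge_pb[OF Blue.prems(1)]] Blue.prems
    by (simp add: word_class_Cons G.bwd_b)
next
  case (Red j u)
  have "edge (word_class \<theta> u) (G.bwd (nblue u) (nred u) (pr x)) (pr x)" using Red by simp
  then show ?case
    using edge_comp[OF gen_in_carrier(2) word_class_in_carrier _ edge_pr[OF Red.prems(1)]] Red.prems
    by (simp add: word_class_Cons G.bwd_r)
qed

lemma edge_wordD: "edge (word_class \<theta> u) y x \<Longrightarrow> G.bwd (nblue u) (nred u) x = y"
proof (induction u arbitrary: x rule: sum_list_induct)
  case Nil
  then obtain \<alpha> where "cmod \<alpha> = 1" "1 *\<^sub>C y = \<alpha> *\<^sub>C x" "x \<in> B" "y \<in> B"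
    unfolding edge_def \<pi>_one scaleC_one by blast
  then show ?case using scaled_B_eq(1)[of y x 1 \<alpha>] by simp
next
  case (Blue i u)
  obtain z where z: "edge (word_class \<theta> u) y z" "edge (gen_e \<theta> i) z x"
    using Blue.prems unfolding word_class_Cons by (rule edge_decomp[OF gen_in_carrier(1) word_class_in_carrier])
  have "G.bwd (nblue u) (nred u) (pb x) = y" using Blue.IH[OF z(1)] blue_eqI[OF z(2)] by simp
  then show ?case using edge_B[OF Blue.prems] by (simp add: G.bwd_b)
next
  case (Red j u)
  obtain z where z: "edge (word_class \<theta> u) y z" "edge (gen_f \<theta> j) z x"
    using Red.prems unfolding word_class_Cons by (rule edge_decomp[OF gen_in_carrier(2) word_class_in_carrier])
  have "G.bwd (nblue u) (nred u) (pr x) = y" using Red.IH[OF z(1)] red_eqI[OF z(2)] by simp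
  then show ?case using edge_B[OF Red.prems] by (simp add: G.bwd_r)
qed

lemma back_vertex_eq:
  assumes x: "x \<in> B"
  shows "back_vertex \<theta> B \<pi> x s t = G.bwd (nat \<bar>s\<bar>) (nat \<bar>t\<bar>) x"
  unfolding back_vertex_def
proof (rule the_equality)
  obtain "is" js where u: "length is = nat \<bar>s\<bar>" "length js = nat \<bar>t\<bar>" "G.matches (map Inl is @ map Inr js) x"
    using G.ex_matching_word[OF x] by blast
  let ?u = "map Inl is @ map Inr js"
  have n: "nblue ?u = nat \<bar>s\<bar>" "nred ?u = nat \<bar>t\<bar>" using u by (simp_all add: nblue_append nred_append)
  have "has_degree \<theta> (word_class \<theta> ?u) (nat \<bar>s\<bar>) (nat \<bar>t\<bar>)" unfolding has_degree_def using u by blast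
  moreover have "leads_to \<pi> (word_class \<theta> ?u) (G.bwd (nat \<bar>s\<bar>) (nat \<bar>t\<bar>) x) x"
    using edge_word[OF x u(3)] x unfolding n by (simp add: leads_to_iff)
  ultimately show "G.bwd (nat \<bar>s\<bar>) (nat \<bar>t\<bar>) x \<in> B \<and> (\<exists>w. has_degree \<theta> w (nat \<bar>s\<bar>) (nat \<bar>t\<bar>)
      \<and> leads_to \<pi> w (G.bwd (nat \<bar>s\<bar>) (nat \<bar>t\<bar>) x) x)" using x by auto
next
  fix y assume y: "y \<in> B \<and> (\<exists>w. has_degree \<theta> w (nat \<bar>s\<bar>) (nat \<bar>t\<bar>) \<and> leads_to \<pi> w y x)"
  then obtain "is" js where u: "length is = nat \<bar>s\<bar>" "length js = nat \<bar>t\<bar>"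
    "leads_to \<pi> (word_class \<theta> (map Inl is @ map Inr js)) y x"
    unfolding has_degree_def by blast
  then have "edge (word_class \<theta> (map Inl is @ map Inr js)) y x" using x y by (simp add: leads_to_iff)
  from edge_wordD[OF this] show "y = G.bwd (nat \<bar>s\<bar>) (nat \<bar>t\<bar>) x"
    using u by (simp add: nblue_append nred_append)
qed

text \<open>Having a common ancestor with \<open>x\<close> is preserved along edges: against an edge
  the path from the ancestor gets longer, and along an edge the ancestor is kept or moved one step
  further back.\<close>

lemma connectedI:
  assumes "connected_graph \<theta> B \<pi>" shows "G.connected"
proof -
  let ?E = "graph_edges \<theta> B \<pi>"
  have E: "x \<in> B \<and> y \<in> B \<and> (x = pb y \<or> x = pr y)" if "(x, y) \<in> ?E" for x y
  proof -
    have xy: "x \<in> B" "y \<in> B" and "(\<exists>i. edge (gen_e \<theta> i) x y) \<or> (\<exists>j. edge (gen_f \<theta> j) x y)"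
      using that leads_to_iff[OF gen_in_carrier(1)] leads_to_iff[OF gen_in_carrier(2)]
      unfolding graph_edges_def by auto
    then show ?thesis using blue_eqI red_eqI by metis
  qed
  have ext_path: "\<exists>k l k' l'. G.bwd k l x = G.bwd k' l' z"
    if ex: "\<exists>k l k' l'. G.bwd k l x = G.bwd k' l' y" and x: "x \<in> B" and yz: "(y, z) \<in> ?E \<union> ?E\<inverse>" for x y z
  proof -
    obtain k l k' l' where k: "G.bwd k l x = G.bwd k' l' y" using ex by blast
    consider "y = pb z" "z \<in> B" | "y = pr z" "z \<in> B" | "z = pb y" "y \<in> B" | "z = pr y" "y \<in> B"
      using yz E by fastforce
    then show ?thesis
    proof cases
      case 1
      then show ?thesis using k G.bwd_b[of z k' l'] by metis
    next
      case 2
      then show ?thesis using k G.bwd_r[of z k' l'] by metis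
    next
      case 3
      then have "G.bwd (k + 1) (l + 0) x = G.bwd k' l' z"
        using G.bwd_shift[OF x k 3(2), of 1 0] G.bwd_b[of y k' l'] by simp
      then show ?thesis by blast
    next
      case 4
      then have "G.bwd (k + 0) (l + 1) x = G.bwd k' l' z"
        using G.bwd_shift[OF x k 4(2), of 0 1] G.bwd_r[of y k' l'] by simp
      then show ?thesis by blast
    qed
  qed
  have "\<exists>k l k' l'. G.bwd k l x = G.bwd k' l' y" if x: "x \<in> B" and "(x, y) \<in> (?E \<union> ?E\<inverse>)\<^sup>*" for x y
    using that(2)
  proof (induction rule: rtrancl_induct)
    case base
    show ?case by blast
  next
    case (step y z)
    show ?case by (rule ext_path[OF step.IH x step.hyps(2)])
  qed
  then show ?thesis using assms unfolding connected_graph_def G.connected_def by blast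
qed

subsection \<open>The symmetry group\<close>

text \<open>One notion asks for coincidence at all far positions, the other for a single
  coincidence: the corner \<open>s = t = T\<close> gives one inclusion, \<open>periods_far\<close>
  the other.\<close>

lemma K_sub_eq:
  assumes x: "x \<in> B" shows "K_sub \<theta> B \<pi> x = G.periods x"
proof (intro equalityI subsetI)
  fix v assume v: "v \<in> K_sub \<theta> B \<pi> x"
  obtain p q where pq: "v = (p, q)" by fastforce
  obtain T where T: "T \<le> 0" "T + p \<le> 0" "T + q \<le> 0"
    "G.bwd (nat \<bar>T + p\<bar>) (nat \<bar>T + q\<bar>) x = G.bwd (nat \<bar>T\<bar>) (nat \<bar>T\<bar>) x"
    using v unfolding pq K_sub_def back_vertex_eq[OF x] by blast
  have "(int (nat \<bar>T\<bar>) - int (nat \<bar>T + p\<bar>), int (nat \<bar>T\<bar>) - int (nat \<bar>T + q\<bar>)) = (p, q)" using T(1-3) by simp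
  then show "v \<in> G.periods x" using G.periodsI[OF T(4)] unfolding pq by simp
next
  fix v assume v: "v \<in> G.periods x"
  obtain p q where pq: "v = (p, q)" by fastforce
  obtain N where N: "\<And>k l k' l'. N \<le> k \<Longrightarrow> N \<le> l \<Longrightarrow> N \<le> k' \<Longrightarrow> N \<le> l'
    \<Longrightarrow> int k' - int k = p \<Longrightarrow> int l' - int l = q \<Longrightarrow> G.bwd k l x = G.bwd k' l' x"
    by (rule G.periods_far[OF x v[unfolded pq]], rule that) blast
  show "v \<in> K_sub \<theta> B \<pi> x"
    unfolding pq K_sub_def back_vertex_eq[OF x]
  proof (intro CollectI case_prodI exI conjI allI impI)
    let ?T = "- (int N + \<bar>p\<bar> + \<bar>q\<bar>)"
    show "?T \<le> 0" "?T + p \<le> 0" "?T + q \<le> 0" by auto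
    fix s t assume st: "s \<le> ?T" "t \<le> ?T"
    then have "s \<le> 0" "t \<le> 0" "s + p \<le> - int N" "t + q \<le> - int N" "s \<le> - int N" "t \<le> - int N" by auto
    then show "G.bwd (nat \<bar>s + p\<bar>) (nat \<bar>t + q\<bar>) x = G.bwd (nat \<bar>s\<bar>) (nat \<bar>t\<bar>) x"
      by (intro N) auto
  qed
qed

text \<open>Agreement of labels at all positions behind the corner \<open>(T, T)\<close> is equality
  of tails at that corner; the converse is \<open>label_periods_far\<close>.\<close>

lemma L_sub_eq:
  assumes x: "x \<in> B" shows "L_sub \<theta> B \<pi> x = G.label_periods x"
proof (intro equalityI subsetI)
  fix v assume v: "v \<in> L_sub \<theta> B \<pi> x"
  obtain p q where pq: "v = (p, q)" by fastforce
  obtain T where T: "T \<le> 0" "T + p \<le> 0" "T + q \<le> 0" and L: "\<forall>s\<le>T. \<forall>t\<le>T.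
      lb (G.bwd (nat \<bar>s + p\<bar>) (nat \<bar>t + q\<bar>) x) = lb (G.bwd (nat \<bar>s\<bar>) (nat \<bar>t\<bar>) x) \<and>
      lr (G.bwd (nat \<bar>s + p\<bar>) (nat \<bar>t + q\<bar>) x) = lr (G.bwd (nat \<bar>s\<bar>) (nat \<bar>t\<bar>) x)"
    using v unfolding pq L_sub_def back_vertex_eq[OF x] by blast
  have "G.same_tail (G.bwd (nat \<bar>T + p\<bar>) (nat \<bar>T + q\<bar>) x) (G.bwd (nat \<bar>T\<bar>) (nat \<bar>T\<bar>) x)"
    unfolding G.same_tail_def G.bwd_bwd[OF x]
  proof (intro allI)
    fix k l
    have "k + nat \<bar>T + p\<bar> = nat \<bar>T - int k + p\<bar>" "l + nat \<bar>T + q\<bar> = nat \<bar>T - int l + q\<bar>"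
      "k + nat \<bar>T\<bar> = nat \<bar>T - int k\<bar>" "l + nat \<bar>T\<bar> = nat \<bar>T - int l\<bar>" using T by auto
    then show "lb (G.bwd (k + nat \<bar>T + p\<bar>) (l + nat \<bar>T + q\<bar>) x) = lb (G.bwd (k + nat \<bar>T\<bar>) (l + nat \<bar>T\<bar>) x) \<and>
      lr (G.bwd (k + nat \<bar>T + p\<bar>) (l + nat \<bar>T + q\<bar>) x) = lr (G.bwd (k + nat \<bar>T\<bar>) (l + nat \<bar>T\<bar>) x)"
      using L[rule_format, of "T - int k" "T - int l"] by simp
  qed
  then have "(int (nat \<bar>T\<bar>) - int (nat \<bar>T + p\<bar>), int (nat \<bar>T\<bar>) - int (nat \<bar>T + q\<bar>)) \<in> G.label_periods x"
    unfolding G.label_periods_def by blast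
  moreover have "(int (nat \<bar>T\<bar>) - int (nat \<bar>T + p\<bar>), int (nat \<bar>T\<bar>) - int (nat \<bar>T + q\<bar>)) = (p, q)" using T(1-3) by simp
  ultimately show "v \<in> G.label_periods x" unfolding pq by simp
next
  fix v assume v: "v \<in> G.label_periods x"
  obtain p q where pq: "v = (p, q)" by fastforce
  obtain N where N: "\<And>k l k' l'. N \<le> k \<Longrightarrow> N \<le> l \<Longrightarrow> N \<le> k' \<Longrightarrow> N \<le> l'
    \<Longrightarrow> int k' - int k = p \<Longrightarrow> int l' - int l = q \<Longrightarrow> G.same_tail (G.bwd k l x) (G.bwd k' l' x)"
    by (rule G.label_periods_far[OF x v[unfolded pq]], rule that) blast
  show "v \<in> L_sub \<theta> B \<pi> x"
    unfolding pq L_sub_def back_vertex_eq[OF x]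
  proof (intro CollectI case_prodI exI conjI allI impI)
    let ?T = "- (int N + \<bar>p\<bar> + \<bar>q\<bar>)"
    show "?T \<le> 0" "?T + p \<le> 0" "?T + q \<le> 0" by auto
    fix s t assume st: "s \<le> ?T" "t \<le> ?T"
    then have "s \<le> 0" "t \<le> 0" "s + p \<le> - int N" "t + q \<le> - int N" "s \<le> - int N" "t \<le> - int N" by auto
    then have "G.same_tail (G.bwd (nat \<bar>s + p\<bar>) (nat \<bar>t + q\<bar>) x) (G.bwd (nat \<bar>s\<bar>) (nat \<bar>t\<bar>) x)"
      by (intro N) auto
    then show "lb (G.bwd (nat \<bar>s + p\<bar>) (nat \<bar>t + q\<bar>) x) = lb (G.bwd (nat \<bar>s\<bar>) (nat \<bar>t\<bar>) x)"
      "lr (G.bwd (nat \<bar>s + p\<bar>) (nat \<bar>t + q\<bar>) x) = lr (G.bwd (nat \<bar>s\<bar>) (nat \<bar>t\<bar>) x)"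
      unfolding G.same_tail_def by (metis G.bwd_0)+
  qed
qed

lemma trivial_symmetry_group:
  assumes x: "x \<in> B"
  shows "trivial_group (symmetry_group \<theta> B \<pi> x) \<longleftrightarrow> G.label_periods x \<subseteq> G.periods x"
proof -
  let ?K = "G.periods x" and ?L = "G.label_periods x"
  let ?S = "symmetry_group \<theta> B \<pi> x"
  note K = G.add_subgroup_periods[OF x]
  have coset: "?K #>\<^bsub>int_pairs\<lparr>carrier := ?L\<rparr>\<^esub> v = coset ?K (fst v) (snd v)" for v
    by (simp add: r_coset_def coset_def)
  have coset': "?K #>\<^bsub>int_pairs\<^esub> v = coset ?K (fst v) (snd v)" for v by (simp add: coset_def)
  have car: "carrier ?S = (\<lambda>v. coset ?K (fst v) (snd v)) ` ?L"
    unfolding symmetry_group_def K_sub_eq[OF x] L_sub_eq[OF x] FactGroup_def RCOSETS_def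
    by (simp add: coset coset' UNION_singleton_eq_range)
  have one: "\<one>\<^bsub>?S\<^esub> = ?K" by (simp add: symmetry_group_def K_sub_eq[OF x] FactGroup_def)
  have K0: "coset ?K 0 0 = ?K" by (auto simp: mem_coset zero_prod_def[symmetric])
  have eq: "coset ?K p q = ?K \<longleftrightarrow> (p, q) \<in> ?K" for p q
    using coset_eq_iff[OF K, of p q 0 0] unfolding K0 by simp
  show ?thesis
  proof
    assume "trivial_group ?S"
    then have "(\<lambda>v. coset ?K (fst v) (snd v)) ` ?L = {?K}" unfolding trivial_group_def car one by blast
    then have "coset ?K (fst v) (snd v) = ?K" if "v \<in> ?L" for v using that by blast
    then show "?L \<subseteq> ?K" unfolding eq by auto
  next
    assume sub: "?L \<subseteq> ?K"
    have L0: "0 \<in> ?L" by (rule add_subgroup_0[OF G.add_subgroup_label_periods[OF x]])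
    have "coset ?K (fst v) (snd v) = ?K" if "v \<in> ?L" for v using that sub unfolding eq by auto
    then have c: "carrier ?S = {?K}" unfolding car using L0 by blast
    have "?K \<otimes>\<^bsub>?S\<^esub> ?K = ?K"
    proof -
      have "?K \<otimes>\<^bsub>?S\<^esub> ?K = (\<Union>a\<in>?K. \<Union>b\<in>?K. {a + b})"
        by (simp add: symmetry_group_def K_sub_eq[OF x] FactGroup_def set_mult_def mult_int_pairs)
      also have "\<dots> = ?K"
      proof (intro equalityI subsetI)
        fix v assume "v \<in> ?K"
        then have "v = v + 0 \<and> v \<in> ?K \<and> 0 \<in> ?K" using add_subgroup_0[OF K] by simp
        then show "v \<in> (\<Union>a\<in>?K. \<Union>b\<in>?K. {a + b})" by blast
      qed (use add_subgroup_add[OF K] in blast)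
      finally show ?thesis .
    qed
    then have "group ?S" by (intro groupI) (simp_all add: c one)
    then show "trivial_group ?S" unfolding trivial_group_def c one by simp
  qed
qed

subsection \<open>The unitary model\<close>

text \<open>Rescaling the basis vectors by the gauge function makes every blue edge carry
  \<open>a\<close> and every red edge \<open>c\<close>. Coordinates in the rescaled basis then
  intertwine \<open>\<pi>\<close> with \<open>G.rho a c\<close>.\<close>

lemma ex_model:
  assumes conn: "connected_graph \<theta> B \<pi>"
  obtains a c \<Phi> where "cmod a = 1" "cmod c = 1" "unitary_map UNIV (ell2_on B) \<Phi>"
    "\<And>w x. w \<in> carrier (F_theta \<theta>) \<Longrightarrow> \<Phi> (\<pi> w x) = G.rho a c w (\<Phi> x)"
proof -
  define \<alpha> where "\<alpha> x = cinner x (\<pi> (gen_e \<theta> (lb x)) (pb x))" for x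
  define \<beta> where "\<beta> x = cinner x (\<pi> (gen_f \<theta> (lr x)) (pr x))" for x
  have \<alpha>: "\<pi> (gen_e \<theta> (lb x)) (pb x) = \<alpha> x *\<^sub>C x" "cmod (\<alpha> x) = 1" if x: "x \<in> B" for x
    using edge_pb[OF x] cinner_B[OF x x] unfolding edge_def by (auto simp: \<alpha>_def cinner_scaleC_right)
  have \<beta>: "\<pi> (gen_f \<theta> (lr x)) (pr x) = \<beta> x *\<^sub>C x" "cmod (\<beta> x) = 1" if x: "x \<in> B" for x
    using edge_pr[OF x] cinner_B[OF x x] unfolding edge_def by (auto simp: \<beta>_def cinner_scaleC_right)
  have comm: "\<alpha> x * \<beta> (pb x) = \<beta> x * \<alpha> (pr x)" if x: "x \<in> B" for x
  proof -
    have B: "pb x \<in> B" "pr x \<in> B" using x by simp_all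
    have "(\<beta> (pb x) * \<alpha> x) *\<^sub>C x = \<pi> (gen_e \<theta> (lb x)) (\<pi> (gen_f \<theta> (lr (pb x))) (pr (pb x)))"
      using x B by (simp add: \<beta> \<pi>_scale \<alpha> scaleC_scaleC)
    also have "\<dots> = \<pi> (gen_e \<theta> (lb x) \<otimes>\<^bsub>F_theta \<theta>\<^esub> gen_f \<theta> (lr (pb x))) (pr (pb x))" by (simp add: \<pi>_mult)
    also have "\<dots> = \<pi> (gen_f \<theta> (lr x) \<otimes>\<^bsub>F_theta \<theta>\<^esub> gen_e \<theta> (lb (pr x))) (pb (pr x))"
      using gen_e_gen_f[of \<theta> "lb x" "lr (pb x)" "lb (pr x)" "lr x", OF square_vertices(1)[OF x]]
        square_vertices(2)[OF x] by simp
    also have "\<dots> = \<pi> (gen_f \<theta> (lr x)) (\<pi> (gen_e \<theta> (lb (pr x))) (pb (pr x)))" by (simp add: \<pi>_mult)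
    also have "\<dots> = (\<alpha> (pr x) * \<beta> x) *\<^sub>C x"
      using \<alpha>(1)[OF B(2)] \<beta>(1)[OF x] by (simp add: \<pi>_scale scaleC_scaleC)
    finally have "\<beta> (pb x) * \<alpha> x = \<alpha> (pr x) * \<beta> x"
      using scaled_B_eq(2)[OF x x] \<alpha>(2)[OF x] \<beta>(2)[OF B(1)] by (metis mult_eq_0_iff norm_zero zero_neq_one)
    then show ?thesis by (simp add: mult.commute)
  qed
  obtain a c \<psi> where a: "cmod a = 1" and c: "cmod c = 1" and \<psi>: "\<And>x. x \<in> B \<Longrightarrow> cmod (\<psi> x) = 1"
    and \<psi>b: "\<And>x. x \<in> B \<Longrightarrow> \<alpha> x * \<psi> (pb x) = a * \<psi> x" and \<psi>r: "\<And>x. x \<in> B \<Longrightarrow> \<beta> x * \<psi> (pr x) = c * \<psi> x"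
    using G.ex_gauge[OF \<alpha>(2) \<beta>(2) comm connectedI[OF conn]] by blast
  define e where "e x = \<psi> x *\<^sub>C x" for x
  have eb: "\<pi> (gen_e \<theta> (lb x)) (e (pb x)) = a *\<^sub>C e x" and er: "\<pi> (gen_f \<theta> (lr x)) (e (pr x)) = c *\<^sub>C e x"
    if x: "x \<in> B" for x
    using \<psi>b[OF x] \<psi>r[OF x] by (simp_all add: e_def \<pi>_scale \<alpha>(1)[OF x] \<beta>(1)[OF x] scaleC_scaleC mult.commute)
  have word: "\<pi> (word_class \<theta> u) (e (G.bwd (nblue u) (nred u) x)) = (a ^ nblue u * c ^ nred u) *\<^sub>C e x"
    if "x \<in> B" "G.matches u x" for u x
    using that
  proof (induction u arbitrary: x rule: sum_list_induct)
    case Nil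
    then show ?case by (simp add: \<pi>_one scaleC_one)
  next
    case (Blue i u)
    have "\<pi> (word_class \<theta> u) (e (G.bwd (nblue u) (nred u) (pb x))) = (a ^ nblue u * c ^ nred u) *\<^sub>C e (pb x)"
      using Blue by simp
    then show ?case using Blue.prems eb[of x]
      by (simp add: word_class_Cons \<pi>_mult G.bwd_b \<pi>_scale scaleC_scaleC mult_ac)
  next
    case (Red j u)
    have "\<pi> (word_class \<theta> u) (e (G.bwd (nblue u) (nred u) (pr x))) = (a ^ nblue u * c ^ nred u) *\<^sub>C e (pr x)"
      using Red by simp
    then show ?case using Red.prems er[of x]
      by (simp add: word_class_Cons \<pi>_mult G.bwd_r \<pi>_scale scaleC_scaleC mult_ac)
  qed
  have one: "cnj (\<psi> x) * \<psi> x = 1" if "x \<in> B" for x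
    using \<psi>[OF that] complex_norm_square[of "\<psi> x"] by (simp add: mult.commute)
  have one': "\<psi> x * cnj (\<psi> x) = 1" if "x \<in> B" for x using one[OF that] by (simp only: mult.commute)
  have on: "cinner (e x) (e y) = (if x = y then 1 else 0)" if "x \<in> B" "y \<in> B" for x y
    using that by (simp add: e_def cinner_scaleC_left cinner_scaleC_right cinner_B one one')
  have span: "closed_span (e ` B) = UNIV"
  proof -
    have "B \<subseteq> closed_span (e ` B)"
    proof
      fix x assume x: "x \<in> B"
      have "cnj (\<psi> x) *\<^sub>C e x \<in> closed_span (e ` B)"
        using closed_span_superset[of "e ` B"] x by (intro hilbert_subspace_scale[OF hilbert_subspace_closed_span]) auto
      then show "x \<in> closed_span (e ` B)" by (simp add: e_def scaleC_scaleC one[OF x] scaleC_one)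
    qed
    from closed_span_minimal[OF hilbert_subspace_closed_span this] show ?thesis unfolding span_B by blast
  qed
  define g where "g x y = (if y \<in> B then cinner (e y) x else 0)" for x y
  have bes: "(\<Sum>y\<in>F. (cmod (g x y))\<^sup>2) \<le> (norm x)\<^sup>2" if F: "finite F" for F x
  proof -
    have "(\<Sum>y\<in>F. (cmod (g x y))\<^sup>2) = (\<Sum>y\<in>F \<inter> B. (cmod (cinner (e y) x))\<^sup>2)"
      by (rule sum.mono_neutral_cong_right) (use F in \<open>auto simp: g_def\<close>)
    also have "\<dots> \<le> (norm x)\<^sup>2" by (rule bessel) (use F on in auto)
    finally show ?thesis .
  qed
  have sq: "square_summable (g x)" for x
    unfolding square_summable_def
    by (rule nonneg_bdd_above_summable_on) (use bes in \<open>auto intro!: bdd_aboveI[of _ "(norm x)\<^sup>2"]\<close>)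
  define \<Phi> where "\<Phi> x = Abs_ell2 (g x)" for x
  have \<Phi>: "ell2_fun (\<Phi> x) = g x" for x unfolding \<Phi>_def by (rule Abs_ell2_inverse) (simp add: sq)
  have \<Phi>_add: "\<Phi> (x + y) = \<Phi> x + \<Phi> y" for x y
    by (rule ell2_eqI) (simp add: \<Phi> ell2_fun_simps g_def cinner_add_right)
  have \<Phi>_scale: "\<Phi> (d *\<^sub>C x) = d *\<^sub>C \<Phi> x" for d x
    by (rule ell2_eqI) (simp add: \<Phi> ell2_fun_scaleC g_def cinner_scaleC_right)
  have \<Phi>_le: "norm (\<Phi> x) \<le> norm x" for x
  proof (rule power2_le_imp_le)
    have "(\<lambda>y. (cmod (g x y))\<^sup>2) summable_on UNIV" using sq unfolding square_summable_def .
    then show "(norm (\<Phi> x))\<^sup>2 \<le> (norm x)\<^sup>2"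
      unfolding norm_ell2_square \<Phi> by (rule infsum_le_finite_sums) (rule bes)
  qed simp
  have bl: "bounded_linear \<Phi>"
    by (rule bounded_linear_intro[of _ 1]) (simp_all add: \<Phi>_add scaleR_scaleC \<Phi>_scale \<Phi>_le)
  have \<Phi>_e: "\<Phi> (e y) = ket y" if "y \<in> B" for y
    by (rule ell2_eqI) (use on that in \<open>auto simp: \<Phi> g_def ell2_fun_ket\<close>)
  have cin: "cinner (\<Phi> x) (\<Phi> y) = cinner x y" for x y
  proof (rule cinner_eq_on_closed_span[of "e ` B" "\<lambda>y. cinner (\<Phi> x) (\<Phi> y)" "cinner x"])
    show "cinner (\<Phi> x) (\<Phi> v) = cinner x v" if v: "v \<in> e ` B" for v
    proof -
      obtain y where y: "y \<in> B" "v = e y" using v by blast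
      have "cinner (\<Phi> x) (\<Phi> v) = cnj (cinner (ket y) (\<Phi> x))"
        unfolding y(2) \<Phi>_e[OF y(1)] by (rule cinner_commute)
      also have "\<dots> = cnj (cinner (e y) x)" unfolding cinner_ket \<Phi> using y by (simp add: g_def)
      also have "\<dots> = cinner x v" unfolding y(2) by (rule cinner_commute[symmetric])
      finally show ?thesis .
    qed
    show "bounded_linear (\<lambda>y. cinner (\<Phi> x) (\<Phi> y))"
      by (rule bounded_linear_compose[OF bounded_linear_cinner_right bl])
    show "bounded_linear (cinner x)" by (rule bounded_linear_cinner_right)
    show "y \<in> closed_span (e ` B)" by (simp add: span)
  qed (simp_all add: \<Phi>_scale cinner_scaleC_right)
  have norm: "norm (\<Phi> x) = norm x" for x
  proof -
    have "(norm (\<Phi> x))\<^sup>2 = (norm x)\<^sup>2" using cin[of x x] unfolding cinner_self of_real_eq_iff .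
    then show ?thesis by simp
  qed
  have U: "unitary_map UNIV (range \<Phi>) \<Phi>"
  proof
    show "hilbert_subspace (UNIV :: 'h set)" using rep unfolding representation_def by blast
    show "linear_on_subspace UNIV \<Phi>" unfolding linear_on_subspace_def by (simp add: \<Phi>_add \<Phi>_scale)
  qed (simp_all add: norm)
  have range: "range \<Phi> = ell2_on B"
  proof
    show "range \<Phi> \<subseteq> ell2_on B" by (auto simp: ell2_on_def \<Phi> g_def)
    have "ket ` B \<subseteq> range \<Phi>" using \<Phi>_e by (metis image_subsetI rangeI)
    then have "closed_span (ket ` B) \<subseteq> range \<Phi>" by (rule closed_span_minimal[OF unitary_map.hilbert_subspace_S'[OF U]])
    then show "ell2_on B \<subseteq> range \<Phi>" unfolding closed_span_ket .
  qed
  show thesis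
  proof
    show "cmod a = 1" "cmod c = 1" by fact+
    show "unitary_map UNIV (ell2_on B) \<Phi>" using U unfolding range .
    fix w x assume w: "w \<in> carrier (F_theta \<theta>)"
    then obtain u where u: "w = word_class \<theta> u" unfolding carrier_F_theta by blast
    show "\<Phi> (\<pi> w x) = G.rho a c w (\<Phi> x)"
    proof (rule ell2_eqI)
      fix y
      show "ell2_fun (\<Phi> (\<pi> w x)) y = ell2_fun (G.rho a c w (\<Phi> x)) y"
      proof (cases "y \<in> B")
        case False
        then show ?thesis unfolding u G.ell2_fun_rho_word \<Phi> by (simp add: g_def)
      next
        case y: True
        show ?thesis
        proof (cases "G.matches u y")
          case True
          let ?z = "G.bwd (nblue u) (nred u) y" and ?d = "a ^ nblue u * c ^ nred u"
          have d: "cnj ?d * ?d = 1"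
            using complex_norm_square[of ?d] a c by (simp add: norm_mult norm_power mult.commute)
          have "cnj ?d * cinner (e y) (\<pi> w x) = cinner (\<pi> w (e ?z)) (\<pi> w x)"
            using word[OF y True] unfolding u by (simp only: cinner_scaleC_left)
          also have "\<dots> = cinner (e ?z) x" by (rule cinner_\<pi>[OF w])
          finally have "?d * (cnj ?d * cinner (e y) (\<pi> w x)) = ?d * cinner (e ?z) x" by simp
          then have "cinner (e y) (\<pi> w x) = ?d * cinner (e ?z) x"
            using d by (metis mult.assoc mult.commute mult_1)
          then show ?thesis unfolding u G.ell2_fun_rho_word \<Phi> using y True by (simp add: g_def)
        next
          case False
          \<comment> \<open>The word sends rescaled basis vectors to multiples of those at vertices
            it matches, so \<open>e y\<close> is orthogonal to its range.\<close>
          have "cinner (e y) (\<pi> w x) = 0"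
          proof (rule cinner_eq_on_closed_span[of "e ` B" "\<lambda>x. cinner (e y) (\<pi> w x)" "\<lambda>_. 0"])
            show "cinner (e y) (\<pi> w v) = 0" if v: "v \<in> e ` B" for v
            proof -
              obtain z where z: "z \<in> B" "v = e z" using v by blast
              obtain x' where x': "x' \<in> B" "G.matches u x'" "G.bwd (nblue u) (nred u) x' = z"
                using G.matches_bwd_ex[OF z(1)] by blast
              have "y \<noteq> x'" using False x' by blast
              then show ?thesis using word[OF x'(1,2)] on[OF y x'(1)] unfolding x'(3) z(2) u
                by (simp add: cinner_scaleC_right)
            qed
            show "bounded_linear (\<lambda>x. cinner (e y) (\<pi> w x))"
              by (rule bounded_linear_compose[OF bounded_linear_cinner_right bounded_linear_\<pi>[OF w]])
            show "bounded_linear (\<lambda>_::'h. 0 :: complex)" by (rule bounded_linear_zero)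
            show "x \<in> closed_span (e ` B)" by (simp add: span)
          qed (simp_all add: \<pi>_scale[OF w] cinner_scaleC_right)
          then show ?thesis unfolding u G.ell2_fun_rho_word \<Phi> using y False by (simp add: g_def)
        qed
      qed
    qed
  qed
qed

end

theorem theorem5p7:
  fixes \<theta> :: "'m::finite \<times> 'n::finite \<Rightarrow> 'm \<times> 'n"
    and \<pi> :: "('m, 'n, 'h::chilbert_space) rep"
    and B :: "'h set"
  assumes "bij \<theta>"
    and "star_representation \<theta> UNIV \<pi>"
    and "atomic_wrt \<theta> UNIV B \<pi>"
    and "connected_graph \<theta> B \<pi>"
  shows
    "(\<exists>(G :: (int \<times> int) set monoid) g\<^sub>1 g\<^sub>2 i j \<alpha> \<beta> \<sigma>.
        group_construction_rep \<theta> G g\<^sub>1 g\<^sub>2 i j \<alpha> \<beta> \<sigma> \<and>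
        is_minimal_star_dilation_of \<theta> UNIV \<pi> (ell2_on (carrier G)) \<sigma>) \<and>
     (\<forall>\<xi>\<in>B. irreducible_rep \<theta> UNIV \<pi> \<longleftrightarrow> trivial_group (symmetry_group \<theta> B \<pi> \<xi>)) \<and>
     ((\<exists>\<N>. direct_sum_decomposition \<theta> UNIV \<pi> \<N> \<and>
         (\<forall>N\<in>\<N>. irreducible_group_construction_dilation \<theta> N \<pi>)) \<or>
      (\<exists>(M :: (real \<times> real) measure) (H :: real \<times> real \<Rightarrow> nat ell2 set) \<epsilon> \<rho>.
         sets M = sets borel \<and> sigma_finite_measure M \<and>
         is_direct_integral \<theta> UNIV \<pi> M H \<epsilon> \<rho> \<and>
         (AE x in M. irreducible_group_construction_dilation \<theta> (H x) (\<rho> x))))"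
proof -
  interpret atomic_star \<theta> \<pi> B using assms(1-3) by unfold_locales
  note full = G.full_system_axioms
  have conn: "G.connected" by (rule connectedI[OF assms(4)])
  obtain a c \<Phi> where a: "cmod a = 1" and c: "cmod c = 1" and U: "unitary_map UNIV (ell2_on B) \<Phi>"
    and inter: "\<And>w x. w \<in> carrier (F_theta \<theta>) \<Longrightarrow> \<Phi> (\<pi> w x) = G.rho a c w (\<Phi> x)"
    using ex_model[OF assms(4)] by blast
  interpret U: unitary_map UNIV "ell2_on B" \<Phi> by (rule U)
  have V: "unitary_map (ell2_on B) UNIV U.V" by (rule U.unitary_map_V)
  have rep_rho: "representation \<theta> (ell2_on B) (G.rho a c)" by (rule G.representation_rho[OF a c])
  have interV: "U.V (G.rho a c w x) = \<pi> w (U.V x)" if w: "w \<in> carrier (F_theta \<theta>)" and x: "x \<in> ell2_on B" for w x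
    using arg_cong[OF inter[OF w, of "U.V x"], of U.V] U.U_V[OF x] U.V_U[of "\<pi> w (U.V x)"] by simp
  note adj = G.adjointable_rho[of a c]
  have adj_\<pi>: "adjointable \<theta> UNIV \<pi>" by (rule adjointable_transport[OF U inter _ adj]) simp_all
  obtain x0 where x0: "x0 \<in> B" using conn unfolding G.connected_def by blast

  have i: "\<exists>(G :: (int \<times> int) set monoid) g\<^sub>1 g\<^sub>2 i j \<alpha> \<beta> \<sigma>.
        group_construction_rep \<theta> G g\<^sub>1 g\<^sub>2 i j \<alpha> \<beta> \<sigma> \<and>
        is_minimal_star_dilation_of \<theta> UNIV \<pi> (ell2_on (carrier G)) \<sigma>"
  proof (rule ex_group_construction[OF full conn a c])
    fix G :: "(int \<times> int) set monoid" and g\<^sub>1 g\<^sub>2 i j \<alpha> \<beta> \<sigma> H \<tau>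
    assume gc: "group_construction_rep \<theta> G g\<^sub>1 g\<^sub>2 i j \<alpha> \<beta> \<sigma>"
      and ue: "unitarily_equivalent \<theta> (ell2_on (carrier G)) \<sigma> H \<tau>" and ad: "adjointable \<theta> H \<tau>"
      and dil: "minimal_star_dilation \<theta> H \<tau> (ell2_on B) (G.rho a c)"
    have "is_minimal_star_dilation_of \<theta> UNIV \<pi> (ell2_on (carrier G)) \<sigma>"
      by (rule minimal_star_dilation_transport[OF V interV star dil ad ue])
    with gc show ?thesis by blast
  qed

  have ii: "irreducible_rep \<theta> UNIV \<pi> \<longleftrightarrow> trivial_group (symmetry_group \<theta> B \<pi> \<xi>)" if \<xi>: "\<xi> \<in> B" for \<xi>
    unfolding trivial_symmetry_group[OF \<xi>]
  proof
    assume irr: "irreducible_rep \<theta> UNIV \<pi>"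
    have irr_rho: "irreducible_rep \<theta> (ell2_on B) (G.rho a c)"
      by (rule irreducible_transport[OF V interV representation_closed[OF rep_rho] adj irr])
    show "G.label_periods \<xi> \<subseteq> G.periods \<xi>"
    proof (rule ccontr)
      assume n: "\<not> G.label_periods \<xi> \<subseteq> G.periods \<xi>"
      \<comment> \<open>A label period that is not a period makes the measure split, and cutting the
        direct integral along such a set contradicts irreducibility of the model.\<close>
      show False
      proof (rule ex_direct_integral[OF full conn a c \<xi>])
        fix M :: "(real \<times> real) measure" and H :: "real \<times> real \<Rightarrow> nat ell2 set" and \<epsilon> \<rho>
        assume M: "sets M = sets borel" "emeasure M UNIV = 1"
          and di: "is_direct_integral \<theta> (ell2_on B) (G.rho a c) M H \<epsilon> \<rho>"
          and irr: "\<And>x. irreducible_group_construction_dilation \<theta> (H x) (\<rho> x)"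
          and e: "\<exists>e\<in>square_integrable_sections M H \<epsilon>. \<forall>x. norm (e x) = 1"
          and Z: "\<not> G.label_periods \<xi> \<subseteq> G.periods \<xi> \<Longrightarrow>
            \<exists>Z\<in>sets M. emeasure M Z \<noteq> 0 \<and> emeasure M (UNIV - Z) \<noteq> 0"
        have space: "space M = UNIV" using sets_eq_imp_space_eq[OF M(1)] by simp
        obtain e where e: "e \<in> square_integrable_sections M H \<epsilon>" "\<And>x. norm (e x) = 1" using e by blast
        obtain Z where Z: "Z \<in> sets M" "emeasure M Z \<noteq> 0" "emeasure M (space M - Z) \<noteq> 0"
          using Z[OF n] unfolding space by blast
        have "\<not> irreducible_rep \<theta> (ell2_on B) (G.rho a c)"
          by (rule direct_integral_reducible[OF di hilbert_subspace_ell2_on representation_closed[OF rep_rho]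
                adj dilation_isometric[OF irr] e _ space Z]) (simp_all add: space M(2))
        then show False using irr_rho by contradiction
      qed
    qed
  next
    assume sub: "G.label_periods \<xi> \<subseteq> G.periods \<xi>"
    have irr: "irreducible_rep \<theta> (ell2_on B) (G.rho a c)"
    proof (rule G.irreducible_rho[OF a c conn])
      \<comment> \<open>Relative to \<open>\<xi>\<close>, vertices with the same tail have
        coordinates differing by a label period, hence by a period, so they coincide: tails separate
        vertices.\<close>
      fix x y assume x: "x \<in> B" and y: "y \<in> B" and st: "G.same_tail x y"
      obtain k l k' l' where k: "G.bwd k l x = G.bwd k' l' \<xi>" using conn x \<xi> unfolding G.connected_def by blast
      obtain m n m' n' where m: "G.bwd m n y = G.bwd m' n' \<xi>" using conn y \<xi> unfolding G.connected_def by blast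
      note d = G.degs_diff_label_periods[OF \<xi> x y st G.degsI[OF k] G.degsI[OF m]]
      show "x = y" by (rule d(2)) (rule subsetD[OF sub d(1)])
    qed
    show "irreducible_rep \<theta> UNIV \<pi>"
      by (rule irreducible_transport[OF U inter _ adj_\<pi> irr]) simp_all
  qed

  have iii: "\<exists>(M :: (real \<times> real) measure) (H :: real \<times> real \<Rightarrow> nat ell2 set) \<epsilon> \<rho>.
         sets M = sets borel \<and> sigma_finite_measure M \<and>
         is_direct_integral \<theta> UNIV \<pi> M H \<epsilon> \<rho> \<and>
         (AE x in M. irreducible_group_construction_dilation \<theta> (H x) (\<rho> x))"
  proof (rule ex_direct_integral[OF full conn a c x0])
    fix M :: "(real \<times> real) measure" and H :: "real \<times> real \<Rightarrow> nat ell2 set" and \<epsilon> \<rho>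
    assume M: "sets M = sets borel" "emeasure M UNIV = 1"
      and di: "is_direct_integral \<theta> (ell2_on B) (G.rho a c) M H \<epsilon> \<rho>"
      and irr: "\<And>x. irreducible_group_construction_dilation \<theta> (H x) (\<rho> x)"
    have space: "space M = UNIV" using sets_eq_imp_space_eq[OF M(1)] by simp
    have "finite_measure M" by (rule finite_measureI) (simp add: space M(2))
    then have "sigma_finite_measure M" by (rule finite_measure.axioms(1))
    moreover have "is_direct_integral \<theta> UNIV \<pi> M H \<epsilon> \<rho>"
      by (rule is_direct_integral_transport[OF V interV di])
    ultimately show ?thesis using M(1) irr by blast
  qed
  show ?thesis using i ii iii by blast
qed

end
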